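(* Let $X$ be an operator system which, as an operator space, is the dual of an operator space. Then there exist a Hilbert space $\mathcal{H}$ and a completely isometric weak* homeomorphism $\Phi$ from $X$ onto a weak* closed operator subsystem of $B(\mathcal{H})$, which maps the identity of $X$ to the identity of $B(\mathcal{H})$; hence $\Phi$ is also a complete order isomorphism onto its range.
   Context: An operator system is a selfadjoint vector space of operators on a Hilbert space $H$ containing the identity operator $I_H$, considered with its inherited matrix norms, matrix order, involution and unit. A subsystem of an operator system $X$ is a selfadjoint subspace containing the identity of $X$. That $X$ is a dual as an operator space means that $X$ is completely isometrically isomorphic to the operator space dual $V^{\sharp}$ of some operator space $V$; the weak* topology on $X$ is the one coming from this identification. $B(\mathcal{H})$ carries its usual weak* topology as dual of the trace class operators, and subspaces of it carry the relative weak* topology. A complete order isomorphism is a linear isomorphism $T$ between operator systems such that $T$ and $T^{-1}$ are completely positive. *)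

theory Defs
  imports "HOL-Analysis.Analysis" "HOL-Library.Function_Algebras"
begin

section \<open>Complex vector spaces\<close>

class complex_vector = ab_group_add +
  fixes scaleC :: "complex \<Rightarrow> 'a \<Rightarrow> 'a"  (infixr \<open>*\<^sub>C\<close> 75)
  assumes scaleC_add_right: "a *\<^sub>C (x + y) = a *\<^sub>C x + a *\<^sub>C y"
    and scaleC_add_left: "(a + b) *\<^sub>C x = a *\<^sub>C x + b *\<^sub>C x"
    and scaleC_scaleC: "a *\<^sub>C b *\<^sub>C x = (a * b) *\<^sub>C x"
    and scaleC_one: "1 *\<^sub>C x = x"

interpretation complex_vec: vector_space "scaleC :: complex \<Rightarrow> 'a \<Rightarrow> 'a::complex_vector"
  by standard (rule scaleC_add_right scaleC_add_left scaleC_scaleC scaleC_one)+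

instantiation complex :: complex_vector
begin
definition scaleC_complex :: "complex \<Rightarrow> complex \<Rightarrow> complex"
  where "scaleC_complex a z = a * z"
instance
  by standard (simp_all add: scaleC_complex_def algebra_simps)
end

instantiation "fun" :: (type, complex_vector) complex_vector
begin
definition scaleC_fun :: "complex \<Rightarrow> ('a \<Rightarrow> 'b) \<Rightarrow> 'a \<Rightarrow> 'b"
  where "scaleC_fun a f = (\<lambda>x. a *\<^sub>C f x)"
instance
  by standard
    (simp_all add: fun_eq_iff scaleC_fun_def scaleC_add_right scaleC_add_left scaleC_scaleC scaleC_one)
end

definition linear_on :: "'a::complex_vector set \<Rightarrow> ('a \<Rightarrow> 'b::complex_vector) \<Rightarrow> bool" where
  "linear_on X f \<longleftrightarrow>
     (\<forall>x\<in>X. \<forall>y\<in>X. f (x + y) = f x + f y) \<and> (\<forall>c. \<forall>x\<in>X. f (c *\<^sub>C x) = c *\<^sub>C f x)"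

section \<open>Hilbert spaces\<close>

text \<open>A Hilbert space is carried by a linear subspace of an ambient complex vector space type.
  (The carrier cannot be a whole type, since the theorem asserts the existence of a Hilbert space,
  which may be zero-dimensional and whose dimension depends on the given data.)
  Inner products are linear in the first argument.\<close>

record 'h hilb =
  hcarrier :: "'h set"
  hinner :: "'h \<Rightarrow> 'h \<Rightarrow> complex"

definition hnorm :: "'h hilb \<Rightarrow> 'h \<Rightarrow> real" where
  "hnorm H x = sqrt (Re (hinner H x x))"

definition hilbert_space :: "'h::complex_vector hilb \<Rightarrow> bool" where
  "hilbert_space H \<longleftrightarrow>
     complex_vec.subspace (hcarrier H) \<and>
     (\<forall>y\<in>hcarrier H. linear_on (hcarrier H) (\<lambda>x. hinner H x y)) \<and>
     (\<forall>x\<in>hcarrier H. \<forall>y\<in>hcarrier H. hinner H y x = cnj (hinner H x y)) \<and>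
     (\<forall>x\<in>hcarrier H. hinner H x x \<in> \<real>\<^sub>\<ge>\<^sub>0 \<and> (hinner H x x = 0 \<longrightarrow> x = 0)) \<and>
     (\<forall>s. (\<forall>k::nat. s k \<in> hcarrier H) \<and>
          (\<forall>e>0. \<exists>N. \<forall>k\<ge>N. \<forall>l\<ge>N. hnorm H (s k - s l) < e) \<longrightarrow>
          (\<exists>x\<in>hcarrier H. (\<lambda>k. hnorm H (s k - x)) \<longlonglongrightarrow> 0))"

definition complex_hilb :: "complex hilb" where
  "complex_hilb = \<lparr>hcarrier = UNIV, hinner = (\<lambda>z w. z * cnj w)\<rparr>"

text \<open>The Hilbert space direct sum of \<open>n\<close> copies of \<open>H\<close>: vectors are indexed by \<open>{..<n}\<close> and
  extended by zero.\<close>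

definition hilb_power :: "'h::complex_vector hilb \<Rightarrow> nat \<Rightarrow> (nat \<Rightarrow> 'h) hilb" where
  "hilb_power H n =
     \<lparr>hcarrier = {\<xi>. (\<forall>i<n. \<xi> i \<in> hcarrier H) \<and> (\<forall>i\<ge>n. \<xi> i = 0)},
      hinner = (\<lambda>\<xi> \<eta>. \<Sum>i<n. hinner H (\<xi> i) (\<eta> i))\<rparr>"

definition orthonormal_basis :: "'h::complex_vector hilb \<Rightarrow> 'h set \<Rightarrow> bool" where
  "orthonormal_basis H E \<longleftrightarrow>
     E \<subseteq> hcarrier H \<and>
     (\<forall>e\<in>E. \<forall>f\<in>E. hinner H e f = (if e = f then 1 else 0)) \<and>
     (\<forall>x\<in>hcarrier H. (\<forall>e\<in>E. hinner H x e = 0) \<longrightarrow> x = 0)"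

section \<open>Bounded operators\<close>

text \<open>Operators are set to zero off the carrier, so that equality of operators is equality of
  functions and the vector space operations are the pointwise ones.\<close>

definition bounded_ops :: "'h::complex_vector hilb \<Rightarrow> ('h \<Rightarrow> 'h) set" where
  "bounded_ops H = {T. (\<forall>x\<in>hcarrier H. T x \<in> hcarrier H) \<and> (\<forall>x. x \<notin> hcarrier H \<longrightarrow> T x = 0) \<and>
     linear_on (hcarrier H) T \<and> (\<exists>M. \<forall>x\<in>hcarrier H. hnorm H (T x) \<le> M * hnorm H x)}"

definition id_op :: "'h::complex_vector hilb \<Rightarrow> 'h \<Rightarrow> 'h" where
  "id_op H = (\<lambda>x. if x \<in> hcarrier H then x else 0)"

definition op_norm :: "'h::complex_vector hilb \<Rightarrow> ('h \<Rightarrow> 'h) \<Rightarrow> real" where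
  "op_norm H T = Sup {hnorm H (T x) | x. x \<in> hcarrier H \<and> hnorm H x \<le> 1}"

definition positive_op :: "'h::complex_vector hilb \<Rightarrow> ('h \<Rightarrow> 'h) \<Rightarrow> bool" where
  "positive_op H T \<longleftrightarrow> (\<forall>x\<in>hcarrier H. hinner H (T x) x \<in> \<real>\<^sub>\<ge>\<^sub>0)"

definition is_adjoint :: "'h::complex_vector hilb \<Rightarrow> ('h \<Rightarrow> 'h) \<Rightarrow> ('h \<Rightarrow> 'h) \<Rightarrow> bool" where
  "is_adjoint H T T' \<longleftrightarrow> T' \<in> bounded_ops H \<and>
     (\<forall>x\<in>hcarrier H. \<forall>y\<in>hcarrier H. hinner H (T x) y = hinner H x (T' y))"

text \<open>\<open>is_modulus H S P\<close>: \<open>P\<close> is the modulus \<open>|S|\<close>, i.e. the positive square root of \<open>S\<^sup>* S\<close>.\<close>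

definition is_modulus :: "'h::complex_vector hilb \<Rightarrow> ('h \<Rightarrow> 'h) \<Rightarrow> ('h \<Rightarrow> 'h) \<Rightarrow> bool" where
  "is_modulus H S P \<longleftrightarrow> P \<in> bounded_ops H \<and> positive_op H P \<and>
     (\<exists>S'. is_adjoint H S S' \<and> P \<circ> P = S' \<circ> S)"

definition trace_class :: "'h::complex_vector hilb \<Rightarrow> ('h \<Rightarrow> 'h) set" where
  "trace_class H = {S \<in> bounded_ops H. \<exists>P E. is_modulus H S P \<and> orthonormal_basis H E \<and>
     (\<lambda>e. hinner H (P e) e) summable_on E}"

text \<open>For trace class operators the value does not depend on the orthonormal basis.\<close>

definition trace :: "'h::complex_vector hilb \<Rightarrow> ('h \<Rightarrow> 'h) \<Rightarrow> complex" where
  "trace H S = (\<Sum>\<^sub>\<infinity>e\<in>(SOME E. orthonormal_basis H E). hinner H (S e) e)"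

section \<open>Matrices over spaces of operators\<close>

definition mats :: "nat \<Rightarrow> 'a set \<Rightarrow> (nat \<Rightarrow> nat \<Rightarrow> 'a) set" where
  "mats n X = {x. \<forall>i<n. \<forall>j<n. x i j \<in> X}"

text \<open>The operator on the \<open>n\<close>-fold power of \<open>H\<close> given by an \<open>n \<times> n\<close> matrix of operators on \<open>H\<close>.\<close>

definition mat_op :: "'h::complex_vector hilb \<Rightarrow> nat \<Rightarrow> (nat \<Rightarrow> nat \<Rightarrow> 'h \<Rightarrow> 'h)
    \<Rightarrow> (nat \<Rightarrow> 'h) \<Rightarrow> (nat \<Rightarrow> 'h)" where
  "mat_op H n x = (\<lambda>\<xi>. if \<xi> \<in> hcarrier (hilb_power H n)
     then (\<lambda>i. if i < n then \<Sum>j<n. x i j (\<xi> j) else 0) else 0)"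

definition mat_norm :: "'h::complex_vector hilb \<Rightarrow> nat \<Rightarrow> (nat \<Rightarrow> nat \<Rightarrow> 'h \<Rightarrow> 'h) \<Rightarrow> real" where
  "mat_norm H n x = op_norm (hilb_power H n) (mat_op H n x)"

definition mat_positive :: "'h::complex_vector hilb \<Rightarrow> nat \<Rightarrow> (nat \<Rightarrow> nat \<Rightarrow> 'h \<Rightarrow> 'h) \<Rightarrow> bool" where
  "mat_positive H n x \<longleftrightarrow> positive_op (hilb_power H n) (mat_op H n x)"

section \<open>Operator spaces and operator systems\<close>

text \<open>Operator spaces are taken to be complete, i.e. norm closed in \<open>B(H)\<close>: the weak* topology
  of a dual depends on the predual being complete.\<close>

definition operator_space :: "'h::complex_vector hilb \<Rightarrow> ('h \<Rightarrow> 'h) set \<Rightarrow> bool" where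
  "operator_space H V \<longleftrightarrow> V \<subseteq> bounded_ops H \<and> complex_vec.subspace V \<and>
     (\<forall>v. \<forall>T\<in>bounded_ops H. (\<forall>k::nat. v k \<in> V) \<and> (\<lambda>k. op_norm H (v k - T)) \<longlonglongrightarrow> 0 \<longrightarrow> T \<in> V)"

definition operator_system :: "'h::complex_vector hilb \<Rightarrow> ('h \<Rightarrow> 'h) set \<Rightarrow> bool" where
  "operator_system H X \<longleftrightarrow> X \<subseteq> bounded_ops H \<and> complex_vec.subspace X \<and>
     (\<forall>T\<in>X. \<exists>T'\<in>X. is_adjoint H T T') \<and> id_op H \<in> X"

definition completely_isometric ::
  "'h::complex_vector hilb \<Rightarrow> ('h \<Rightarrow> 'h) set \<Rightarrow> 'k::complex_vector hilb \<Rightarrow>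
    (('h \<Rightarrow> 'h) \<Rightarrow> ('k \<Rightarrow> 'k)) \<Rightarrow> bool" where
  "completely_isometric H X K u \<longleftrightarrow> linear_on X u \<and>
     (\<forall>n. \<forall>x\<in>mats n X. mat_norm K n (\<lambda>i j. u (x i j)) = mat_norm H n x)"

definition completely_positive ::
  "'h::complex_vector hilb \<Rightarrow> ('h \<Rightarrow> 'h) set \<Rightarrow> 'k::complex_vector hilb \<Rightarrow>
    (('h \<Rightarrow> 'h) \<Rightarrow> ('k \<Rightarrow> 'k)) \<Rightarrow> bool" where
  "completely_positive H X K u \<longleftrightarrow> linear_on X u \<and>
     (\<forall>n. \<forall>x\<in>mats n X. mat_positive H n x \<longrightarrow> mat_positive K n (\<lambda>i j. u (x i j)))"

definition complete_order_isomorphism ::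
  "'h::complex_vector hilb \<Rightarrow> ('h \<Rightarrow> 'h) set \<Rightarrow> 'k::complex_vector hilb \<Rightarrow> ('k \<Rightarrow> 'k) set \<Rightarrow>
    (('h \<Rightarrow> 'h) \<Rightarrow> ('k \<Rightarrow> 'k)) \<Rightarrow> bool" where
  "complete_order_isomorphism H X K Y u \<longleftrightarrow> bij_betw u X Y \<and>
     completely_positive H X K u \<and> completely_positive K Y H (inv_into X u)"

definition cb_norm ::
  "'h::complex_vector hilb \<Rightarrow> ('h \<Rightarrow> 'h) set \<Rightarrow> 'k::complex_vector hilb \<Rightarrow>
    (('h \<Rightarrow> 'h) \<Rightarrow> ('k \<Rightarrow> 'k)) \<Rightarrow> real" where
  "cb_norm H V K u =
     Sup {mat_norm K m (\<lambda>k l. u (v k l)) | m v. v \<in> mats m V \<and> mat_norm H m v \<le> 1}"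

section \<open>Operator space duals and weak* topologies\<close>

definition dual_space :: "'h::complex_vector hilb \<Rightarrow> ('h \<Rightarrow> 'h) set \<Rightarrow> (('h \<Rightarrow> 'h) \<Rightarrow> complex) set" where
  "dual_space H V = {f. linear_on V f \<and> (\<exists>M. \<forall>v\<in>V. cmod (f v) \<le> M * op_norm H v) \<and>
     (\<forall>v. v \<notin> V \<longrightarrow> f v = 0)}"

text \<open>The matrix norms of the operator space dual: an \<open>n \<times> n\<close> matrix \<open>f\<close> of functionals is
  normed as the map from \<open>V\<close> to \<open>M\<^sub>n = B(\<complex>\<^sup>n)\<close> sending \<open>v\<close> to the scalar matrix \<open>(f i j v)\<close>.
  This map is always completely bounded if the entries are bounded, so the supremum is finite.\<close>

definition dual_mat_norm :: "'h::complex_vector hilb \<Rightarrow> ('h \<Rightarrow> 'h) set \<Rightarrow> nat \<Rightarrow>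
    (nat \<Rightarrow> nat \<Rightarrow> ('h \<Rightarrow> 'h) \<Rightarrow> complex) \<Rightarrow> real" where
  "dual_mat_norm H V n f =
     cb_norm H V (hilb_power complex_hilb n) (\<lambda>v. mat_op complex_hilb n (\<lambda>i j z. f i j v * z))"

text \<open>\<open>dual_identification H X L V J\<close>: \<open>J\<close> is a completely isometric isomorphism of \<open>X\<close> onto
  the operator space dual of \<open>V\<close>.\<close>

definition dual_identification ::
  "'h::complex_vector hilb \<Rightarrow> ('h \<Rightarrow> 'h) set \<Rightarrow> 'l::complex_vector hilb \<Rightarrow> ('l \<Rightarrow> 'l) set \<Rightarrow>
    (('h \<Rightarrow> 'h) \<Rightarrow> ('l \<Rightarrow> 'l) \<Rightarrow> complex) \<Rightarrow> bool" where
  "dual_identification H X L V J \<longleftrightarrow> linear_on X J \<and> bij_betw J X (dual_space L V) \<and>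
     (\<forall>n. \<forall>x\<in>mats n X. dual_mat_norm L V n (\<lambda>i j. J (x i j)) = mat_norm H n x)"

text \<open>The coarsest topology on \<open>A\<close> making the functions in the nonempty set \<open>F\<close> continuous.\<close>

definition initial_topology :: "'a set \<Rightarrow> ('a \<Rightarrow> complex) set \<Rightarrow> 'a topology" where
  "initial_topology A F = topology_generated_by {{x\<in>A. f x \<in> U} | f U. f \<in> F \<and> open U}"

definition dual_weak_star ::
  "('h \<Rightarrow> 'h) set \<Rightarrow> ('l \<Rightarrow> 'l) set \<Rightarrow> (('h \<Rightarrow> 'h) \<Rightarrow> ('l \<Rightarrow> 'l) \<Rightarrow> complex) \<Rightarrow> ('h \<Rightarrow> 'h) topology" where
  "dual_weak_star X V J = initial_topology X {\<lambda>x. J x v | v. v \<in> V}"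

definition op_weak_star :: "'k::complex_vector hilb \<Rightarrow> ('k \<Rightarrow> 'k) topology" where
  "op_weak_star K = initial_topology (bounded_ops K) {\<lambda>T. trace K (T \<circ> S) | S. S \<in> trace_class K}"

text \<open>HOL cannot quantify existentially over types, so the Hilbert space to be found is sought
  among those carried by subspaces of one fixed vector space, large enough to contain the
  \<open>\<ell>\<^sup>2\<close>-direct sum of the spaces \<open>\<complex>\<^sup>n\<close> over all \<open>n\<close> and all maps from operators on \<open>H\<close> to
  \<open>n \<times> n\<close> matrices.\<close>

type_synonym 'h target =
  "nat \<times> (('h \<Rightarrow> 'h) \<Rightarrow> nat \<Rightarrow> nat \<Rightarrow> complex) \<times> nat \<Rightarrow> complex"

end

theory Submission
  imports Defs
begin

text \<open>
  The Hilbert space is built from the normal states of all matrix levels. A matrix \<open>w\<close> over \<open>V\<close> acts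
  on \<open>M\<^sub>n(X)\<close> by \<open>\<langle>x, w\<rangle> = \<Sum>\<^sub>i\<^sub>j J x\<^sub>i\<^sub>j w\<^sub>i\<^sub>j\<close>. With the norm that this pairing induces, the matrices over \<open>V\<close>
  form a complete predual of \<open>M\<^sub>n(X)\<close> (\<open>predual_norm_rep\<close>). A normal state is an element \<open>w\<close> of its unit
  ball with \<open>\<langle>1, w\<rangle> = 1\<close>.

  There are enough normal states. Let \<open>s(y)\<close> be the maximum of the real part of the numerical range
  of \<open>y\<close>; it is the limit of \<open>\<parallel>t + y\<parallel> - t\<close> as \<open>t\<close> grows. An element of the predual that almost norms
  \<open>t + y\<close> for large \<open>t\<close> almost attains \<open>s(y)\<close> and is almost a state. Conversely, if \<open>v\<close> is in the unit
  ball and \<open>Re \<langle>1, v\<rangle> \<ge> 1 - \<epsilon>\<close>, then \<open>Re \<langle>y, v\<rangle>\<close> exceeds \<open>s(y)\<close> by at most a multiple of \<open>sqrt \<epsilon>\<close> on the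
  unit ball. So the Hahn-Banach theorem, applied in the predual, puts \<open>v\<close> within a multiple of
  \<open>sqrt \<epsilon>\<close> of elements that are as close to being states as desired. Iterating this gives an exact
  normal state near \<open>v\<close> (\<open>near_to_state\<close>), and normal states attain \<open>s(y)\<close> up to any error
  (\<open>state_attains\<close>).

  A normal state of \<open>M\<^sub>n(X)\<close> defines a positive form on \<open>\<complex>\<^sup>n\<close> through the unit. In an orthonormal basis
  of this form it becomes a vector functional of a normal unital completely contractive map from \<open>X\<close>
  to some \<open>M\<^sub>m\<close> (\<open>state_representation\<close>). The representation \<open>Phi\<close> is the direct sum of all these maps.
  It is completely isometric because \<open>\<parallel>x\<parallel>\<close> is at most \<open>s(y)\<close> for the matrix \<open>y\<close> whose only nonzero
  corner is \<open>2 x\<close> (\<open>mat_norm_le_Phi\<close>). A unital complete isometry preserves order and adjoints, since both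
  can be expressed by norms of \<open>t + y\<close> (\<open>unital_cisom\<close>).

  The same corners give the weak* statements. Every \<open>v \<in> V\<close> of norm at most \<open>1\<close> is four times an
  off-diagonal entry of a normal state of \<open>M\<^sub>2(X)\<close> (\<open>corner_exact\<close>). Hence it is
  \<open>x \<mapsto> \<langle>Phi x \<xi>, \<eta>\<rangle>\<close> with bounds on \<open>\<xi>\<close> and \<open>\<eta>\<close> that do not depend on \<open>v\<close> (\<open>vector_functional\<close>), and so it is
  the trace functional of an operator of rank one. Conversely the trace functional of a trace class
  operator is, uniformly on the unit ball, a limit of finite sums of vector functionals
  (\<open>trace_class_approx\<close>), and these come from \<open>V\<close> (\<open>Phi_normal\<close>). So \<open>Phi\<close> matches the two families of
  functionals, which gives the homeomorphism and, by duality of \<open>V\<close> and \<open>X\<close>, the closed range.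
\<close>

section \<open>Semi-inner products\<close>

lemma linear_onD:
  assumes "linear_on X f"
  shows "x \<in> X \<Longrightarrow> y \<in> X \<Longrightarrow> f (x + y) = f x + f y" "x \<in> X \<Longrightarrow> f (c *\<^sub>C x) = c *\<^sub>C f x"
  using assms by (auto simp: linear_on_def)

lemma linear_on_zero:
  assumes "linear_on X f" "complex_vec.subspace X"
  shows "f 0 = 0"
  using linear_onD(2)[OF assms(1), of 0 0] complex_vec.subspace_0[OF assms(2)] by simp

lemma linear_on_minus:
  assumes "linear_on X f" "x \<in> X"
  shows "f (- x) = - f x"
  using linear_onD(2)[OF assms, of "-1"] by simp

lemma linear_on_diff:
  assumes "linear_on X f" "complex_vec.subspace X" "x \<in> X" "y \<in> X"
  shows "f (x - y) = f x - f y"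
  using linear_onD(1)[OF assms(1), of x "- y"] linear_on_minus[OF assms(1), of y]
    complex_vec.subspace_neg[OF assms(2)] assms by simp

lemma linear_on_sum:
  assumes "linear_on X f" "complex_vec.subspace X" "\<And>i. i \<in> I \<Longrightarrow> g i \<in> X"
  shows "f (\<Sum>i\<in>I. g i) = (\<Sum>i\<in>I. f (g i))"
proof (cases "finite I")
  case True
  then show ?thesis using assms(3)
  proof (induction I rule: finite_induct)
    case empty
    then show ?case by (simp add: linear_on_zero[OF assms(1,2)])
  next
    case (insert i I)
    then have "(\<Sum>i\<in>I. g i) \<in> X" "g i \<in> X" by (auto intro: complex_vec.subspace_sum[OF assms(2)])
    then show ?case using insert linear_onD(1)[OF assms(1), of "g i" "\<Sum>i\<in>I. g i"] by simp
  qed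
next
  case False
  then show ?thesis by (simp add: linear_on_zero[OF assms(1,2)])
qed

lemma linear_on_lincomb:
  assumes "linear_on X f" "complex_vec.subspace X" "\<And>i. i \<in> I \<Longrightarrow> g i \<in> X"
  shows "f (\<Sum>i\<in>I. c i *\<^sub>C g i) = (\<Sum>i\<in>I. c i *\<^sub>C f (g i))"
  using linear_on_sum[OF assms(1,2), of I "\<lambda>i. c i *\<^sub>C g i"] assms
    linear_onD(2)[OF assms(1)] by (simp add: complex_vec.subspace_scale[OF assms(2)])

text \<open>Inner products are allowed to be degenerate, because the forms obtained from states and from
  positive operators are: the same Cauchy-Schwarz, Bessel and Gram-Schmidt arguments then serve the
  given Hilbert spaces and all these forms.\<close>

locale pre_hilb =
  fixes H :: "'h::complex_vector hilb"
  assumes subsp: "complex_vec.subspace (hcarrier H)"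
    and linl: "y \<in> hcarrier H \<Longrightarrow> linear_on (hcarrier H) (\<lambda>x. hinner H x y)"
    and herm: "x \<in> hcarrier H \<Longrightarrow> y \<in> hcarrier H \<Longrightarrow> hinner H y x = cnj (hinner H x y)"
    and pos: "x \<in> hcarrier H \<Longrightarrow> hinner H x x \<in> \<real>\<^sub>\<ge>\<^sub>0"
begin

abbreviation "CH \<equiv> hcarrier H"
abbreviation "ip \<equiv> hinner H"
abbreviation "nm \<equiv> hnorm H"

lemma mem_0[simp]: "0 \<in> CH" using complex_vec.subspace_0[OF subsp] .
lemma mem_add[intro]: "x \<in> CH \<Longrightarrow> y \<in> CH \<Longrightarrow> x + y \<in> CH" using complex_vec.subspace_add[OF subsp] .
lemma mem_diff[intro]: "x \<in> CH \<Longrightarrow> y \<in> CH \<Longrightarrow> x - y \<in> CH" using complex_vec.subspace_diff[OF subsp] .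
lemma mem_scale[intro]: "x \<in> CH \<Longrightarrow> c *\<^sub>C x \<in> CH" using complex_vec.subspace_scale[OF subsp] .
lemma mem_sum[intro]: "(\<And>i. i \<in> I \<Longrightarrow> f i \<in> CH) \<Longrightarrow> (\<Sum>i\<in>I. f i) \<in> CH"
  using complex_vec.subspace_sum[OF subsp] .
lemma mem_lincomb[intro]: "(\<And>i. i \<in> I \<Longrightarrow> f i \<in> CH) \<Longrightarrow> (\<Sum>i\<in>I. c i *\<^sub>C f i) \<in> CH"
  by (intro mem_sum mem_scale)

lemma ip_add_left: "x \<in> CH \<Longrightarrow> y \<in> CH \<Longrightarrow> z \<in> CH \<Longrightarrow> ip (x + y) z = ip x z + ip y z"
  using linear_onD(1)[OF linl] .
lemma ip_scale_left: "x \<in> CH \<Longrightarrow> z \<in> CH \<Longrightarrow> ip (c *\<^sub>C x) z = c * ip x z"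
  using linear_onD(2)[OF linl] by (simp add: scaleC_complex_def)
lemma ip_diff_left: "x \<in> CH \<Longrightarrow> y \<in> CH \<Longrightarrow> z \<in> CH \<Longrightarrow> ip (x - y) z = ip x z - ip y z"
  using linear_on_diff[OF linl subsp] .
lemma ip_zero_left[simp]: "z \<in> CH \<Longrightarrow> ip 0 z = 0"
  using linear_on_zero[OF linl subsp] .
lemma ip_sum_left: "(\<And>i. i \<in> I \<Longrightarrow> f i \<in> CH) \<Longrightarrow> z \<in> CH \<Longrightarrow> ip (\<Sum>i\<in>I. f i) z = (\<Sum>i\<in>I. ip (f i) z)"
  by (rule linear_on_sum[OF linl subsp])
lemma ip_lincomb_left: "(\<And>i. i \<in> I \<Longrightarrow> f i \<in> CH) \<Longrightarrow> z \<in> CH \<Longrightarrow>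
    ip (\<Sum>i\<in>I. c i *\<^sub>C f i) z = (\<Sum>i\<in>I. c i * ip (f i) z)"
  using linear_on_lincomb[OF linl subsp, of z I f c] by (simp add: scaleC_complex_def)

lemma ip_add_right: "x \<in> CH \<Longrightarrow> y \<in> CH \<Longrightarrow> z \<in> CH \<Longrightarrow> ip z (x + y) = ip z x + ip z y"
  using ip_add_left[of x y z] herm[of _ z] by (metis complex_cnj_add mem_add herm)
lemma ip_scale_right: "x \<in> CH \<Longrightarrow> z \<in> CH \<Longrightarrow> ip z (c *\<^sub>C x) = cnj c * ip z x"
  using ip_scale_left[of x z c] by (metis complex_cnj_mult mem_scale herm)
lemma ip_diff_right: "x \<in> CH \<Longrightarrow> y \<in> CH \<Longrightarrow> z \<in> CH \<Longrightarrow> ip z (x - y) = ip z x - ip z y"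
  using ip_diff_left[of x y z] by (metis complex_cnj_diff mem_diff herm)
lemma ip_zero_right[simp]: "z \<in> CH \<Longrightarrow> ip z 0 = 0"
  using herm[of 0 z] by simp
lemma ip_sum_right: 
  assumes "\<And>i. i \<in> I \<Longrightarrow> f i \<in> CH" "z \<in> CH"
  shows "ip z (\<Sum>i\<in>I. f i) = (\<Sum>i\<in>I. ip z (f i))"
proof -
  have "ip z (\<Sum>i\<in>I. f i) = cnj (ip (\<Sum>i\<in>I. f i) z)" using assms by (intro herm mem_sum) auto
  also have "\<dots> = (\<Sum>i\<in>I. cnj (ip (f i) z))" using assms by (simp add: ip_sum_left)
  also have "\<dots> = (\<Sum>i\<in>I. ip z (f i))" using assms by (intro sum.cong) (auto simp: herm[symmetric])
  finally show ?thesis .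
qed
lemma ip_lincomb_right:
  assumes "\<And>i. i \<in> I \<Longrightarrow> f i \<in> CH" "z \<in> CH"
  shows "ip z (\<Sum>i\<in>I. c i *\<^sub>C f i) = (\<Sum>i\<in>I. cnj (c i) * ip z (f i))"
  using assms by (subst ip_sum_right) (auto simp: ip_scale_right intro!: sum.cong)

lemma nm_sq: "x \<in> CH \<Longrightarrow> complex_of_real ((nm x)\<^sup>2) = ip x x"
  using pos[of x] by (auto simp: hnorm_def complex_nonneg_Reals_iff complex_eq_iff)
lemma nm_sq_Re: "x \<in> CH \<Longrightarrow> (nm x)\<^sup>2 = Re (ip x x)"
  using nm_sq[of x] by (metis Re_complex_of_real)
lemma nm_ge_0[simp]: "x \<in> CH \<Longrightarrow> 0 \<le> nm x"
  using pos[of x] by (auto simp: hnorm_def complex_nonneg_Reals_iff)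
lemma nm_0[simp]: "nm 0 = 0" by (simp add: hnorm_def)

lemma Cauchy_Schwarz:
  assumes x: "x \<in> CH" and y: "y \<in> CH"
  shows "cmod (ip x y) \<le> nm x * nm y"
proof -
  define c q where "c = ip x y" and "q = (cmod c)\<^sup>2"
  have yx: "ip y x = cnj c" using herm[OF x y] by (simp add: c_def)
  \<comment> \<open>This quadratic in \<open>t\<close> has no term in \<open>nm y\<close> when \<open>y\<close> is degenerate, so both cases follow from it.\<close>
  have main: "0 \<le> (nm x)\<^sup>2 - 2 * t * q + t\<^sup>2 * q * (nm y)\<^sup>2" for t :: real
  proof -
    let ?d = "complex_of_real t * c"
    have z: "x - ?d *\<^sub>C y \<in> CH" using x y by auto
    have sq: "c * cnj c = complex_of_real q"
      unfolding q_def by (rule complex_norm_square[symmetric])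
    have "ip (x - ?d *\<^sub>C y) (x - ?d *\<^sub>C y)
        = ip x x - t * (c * cnj c) - t * (c * cnj c) + t\<^sup>2 * (c * cnj c) * ip y y"
      using x y by (simp add: ip_diff_left ip_diff_right ip_scale_left ip_scale_right mem_diff mem_scale yx c_def[symmetric])
        (simp add: algebra_simps power2_eq_square)
    also have "\<dots> = complex_of_real ((nm x)\<^sup>2 - 2 * t * q + t\<^sup>2 * q * (nm y)\<^sup>2)"
      unfolding sq nm_sq[OF x, symmetric] nm_sq[OF y, symmetric] by simp
    finally have "complex_of_real ((nm (x - ?d *\<^sub>C y))\<^sup>2) = complex_of_real ((nm x)\<^sup>2 - 2 * t * q + t\<^sup>2 * q * (nm y)\<^sup>2)"
      unfolding nm_sq[OF z] .
    then have "(nm (x - ?d *\<^sub>C y))\<^sup>2 = (nm x)\<^sup>2 - 2 * t * q + t\<^sup>2 * q * (nm y)\<^sup>2"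
      unfolding of_real_eq_iff .
    then show ?thesis using zero_le_power2[of "nm (x - ?d *\<^sub>C y)"] by linarith
  qed
  have "q \<le> (nm x)\<^sup>2 * (nm y)\<^sup>2"
  proof (cases "nm y = 0")
    case True
    have "q = 0"
    proof (rule ccontr)
      assume "q \<noteq> 0"
      then have "q > 0" by (simp add: q_def)
      then have "2 * (((nm x)\<^sup>2 + 1) / q) * q = 2 * ((nm x)\<^sup>2 + 1)" by simp
      then show False using main[of "((nm x)\<^sup>2 + 1) / q"] True zero_le_power2[of "nm x"] by simp
    qed
    then show ?thesis by simp
  next
    case False
    then have p: "(nm y)\<^sup>2 > 0" by simp
    have "(1 / (nm y)\<^sup>2)\<^sup>2 * q * (nm y)\<^sup>2 = q / (nm y)\<^sup>2"
      using p by (simp add: power2_eq_square)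
    then have "0 \<le> (nm x)\<^sup>2 - q / (nm y)\<^sup>2" 
      using main[of "1 / (nm y)\<^sup>2"] by simp
    then show ?thesis using p by (simp add: field_simps)
  qed
  then have "(cmod c)\<^sup>2 \<le> (nm x * nm y)\<^sup>2" by (simp add: q_def power_mult_distrib)
  then show ?thesis unfolding c_def by (rule power2_le_imp_le) (use x y in simp)
qed

lemma nm_scale: "x \<in> CH \<Longrightarrow> nm (c *\<^sub>C x) = cmod c * nm x"
proof -
  assume x: "x \<in> CH"
  have "ip (c *\<^sub>C x) (c *\<^sub>C x) = (c * cnj c) * ip x x"
    using x by (simp add: ip_scale_left ip_scale_right mem_scale)
  also have "\<dots> = complex_of_real ((cmod c)\<^sup>2 * (nm x)\<^sup>2)"
    unfolding of_real_mult complex_norm_square nm_sq[OF x] by simp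
  finally have "(nm (c *\<^sub>C x))\<^sup>2 = (cmod c * nm x)\<^sup>2"
    unfolding nm_sq[OF mem_scale[OF x], symmetric] of_real_eq_iff power_mult_distrib .
  then show ?thesis using x mem_scale by (simp add: power2_eq_iff_nonneg)
qed

lemma nm_minus: "x \<in> CH \<Longrightarrow> nm (- x) = nm x"
  using nm_scale[of x "-1"] by simp

lemma nm_add_sq: "x \<in> CH \<Longrightarrow> y \<in> CH \<Longrightarrow> (nm (x + y))\<^sup>2 = (nm x)\<^sup>2 + 2 * Re (ip x y) + (nm y)\<^sup>2"
  using herm[of x y] by (simp add: nm_sq_Re mem_add ip_add_left ip_add_right)

lemma nm_triangle: 
  assumes x: "x \<in> CH" and y: "y \<in> CH"
  shows "nm (x + y) \<le> nm x + nm y"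
proof (rule power2_le_imp_le)
  have "Re (ip x y) \<le> nm x * nm y"
    using Cauchy_Schwarz[OF x y] complex_Re_le_cmod order_trans by blast
  then show "(nm (x + y))\<^sup>2 \<le> (nm x + nm y)\<^sup>2"
    using x y by (simp add: nm_add_sq power2_sum)
qed (use x y in auto)

lemma nm_triangle_diff: "x \<in> CH \<Longrightarrow> y \<in> CH \<Longrightarrow> nm (x - y) \<le> nm x + nm y"
  using nm_triangle[of x "- y"] nm_minus[of y] complex_vec.subspace_neg[OF subsp] by simp

lemma nm_diff_commute: "x \<in> CH \<Longrightarrow> y \<in> CH \<Longrightarrow> nm (x - y) = nm (y - x)"
  using nm_minus[of "x - y"] mem_diff[of x y] by simp

definition onorm_fam :: "'i set \<Rightarrow> ('i \<Rightarrow> 'h) \<Rightarrow> bool" where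
  "onorm_fam S g \<longleftrightarrow> (\<forall>k\<in>S. g k \<in> CH) \<and> (\<forall>k\<in>S. \<forall>l\<in>S. ip (g k) (g l) = (if k = l then 1 else 0))"

lemma ip_lincomb_onorm:
  assumes "finite S" "onorm_fam S g"
  shows "ip (\<Sum>k\<in>S. a k *\<^sub>C g k) (\<Sum>k\<in>S. b k *\<^sub>C g k) = (\<Sum>k\<in>S. a k * cnj (b k))"
proof -
  have g: "\<And>k. k \<in> S \<Longrightarrow> g k \<in> CH" using assms by (auto simp: onorm_fam_def)
  have "ip (\<Sum>k\<in>S. a k *\<^sub>C g k) (\<Sum>k\<in>S. b k *\<^sub>C g k) = (\<Sum>k\<in>S. a k * (\<Sum>l\<in>S. cnj (b l) * ip (g k) (g l)))"
    using g by (subst ip_lincomb_left) (auto simp: ip_lincomb_right)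
  also have "\<dots> = (\<Sum>k\<in>S. a k * (\<Sum>l\<in>S. if k = l then cnj (b l) else 0))"
    using assms by (intro sum.cong refl arg_cong2[where f="(*)"]) (auto simp: onorm_fam_def)
  also have "\<dots> = (\<Sum>k\<in>S. a k * cnj (b k))"
    using assms(1) by (intro sum.cong) (auto simp: sum.delta)
  finally show ?thesis .
qed

lemma nm_lincomb_onorm:
  assumes "finite S" "onorm_fam S g"
  shows "(nm (\<Sum>k\<in>S. a k *\<^sub>C g k))\<^sup>2 = (\<Sum>k\<in>S. (cmod (a k))\<^sup>2)"
proof -
  have "(\<Sum>k\<in>S. a k *\<^sub>C g k) \<in> CH" using assms by (auto simp: onorm_fam_def)
  then show ?thesis using ip_lincomb_onorm[OF assms, of a a]
    by (simp add: nm_sq_Re complex_mult_cnj cmod_power2)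
qed

lemma ip_onorm_lincomb:
  assumes "finite S" "onorm_fam S g" "k \<in> S"
  shows "ip (\<Sum>l\<in>S. a l *\<^sub>C g l) (g k) = a k"
proof -
  have "ip (\<Sum>l\<in>S. a l *\<^sub>C g l) (g k) = (\<Sum>l\<in>S. a l * ip (g l) (g k))"
    using assms by (intro ip_lincomb_left) (auto simp: onorm_fam_def)
  also have "\<dots> = (\<Sum>l\<in>S. if l = k then a l else 0)"
    using assms by (intro sum.cong) (auto simp: onorm_fam_def)
  finally show ?thesis using assms by simp
qed

lemma nm_diff_proj:
  assumes "finite S" "onorm_fam S g" "x \<in> CH"
  shows "(nm (x - (\<Sum>k\<in>S. ip x (g k) *\<^sub>C g k)))\<^sup>2 = (nm x)\<^sup>2 - (\<Sum>k\<in>S. (cmod (ip x (g k)))\<^sup>2)"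
proof -
  let ?p = "\<Sum>k\<in>S. ip x (g k) *\<^sub>C g k"
  have g: "\<And>k. k \<in> S \<Longrightarrow> g k \<in> CH" using assms by (auto simp: onorm_fam_def)
  have p: "?p \<in> CH" using g by auto
  have "ip x ?p = (\<Sum>k\<in>S. cnj (ip x (g k)) * ip x (g k))"
    using g assms(3) by (simp add: ip_lincomb_right)
  also have "\<dots> = complex_of_real (\<Sum>k\<in>S. (cmod (ip x (g k)))\<^sup>2)"
    unfolding of_real_sum by (intro sum.cong refl) (metis complex_norm_square mult.commute)
  finally have xp: "Re (ip x ?p) = (\<Sum>k\<in>S. (cmod (ip x (g k)))\<^sup>2)" by simp
  have "(nm (x - ?p))\<^sup>2 = (nm x)\<^sup>2 - 2 * Re (ip x ?p) + (nm ?p)\<^sup>2"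
    using herm[OF assms(3) p] assms(3) p by (simp add: nm_sq_Re mem_diff ip_diff_left ip_diff_right)
  then show ?thesis using xp nm_lincomb_onorm[OF assms(1,2)] by simp
qed

lemma Bessel:
  assumes "finite S" "onorm_fam S g" "x \<in> CH"
  shows "(\<Sum>k\<in>S. (cmod (ip x (g k)))\<^sup>2) \<le> (nm x)\<^sup>2"
  using nm_diff_proj[OF assms] by (metis diff_ge_0_iff_ge zero_le_power2)

lemma ip_proj_right:
  assumes "finite S" "onorm_fam S g" "x \<in> CH" "k \<in> S"
  shows "ip (x - (\<Sum>l\<in>S. ip x (g l) *\<^sub>C g l)) (g k) = 0"
proof -
  have g: "\<And>k. k \<in> S \<Longrightarrow> g k \<in> CH" using assms by (auto simp: onorm_fam_def)
  then have "(\<Sum>l\<in>S. ip x (g l) *\<^sub>C g l) \<in> CH" by auto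
  then show ?thesis using ip_onorm_lincomb[OF assms(1,2,4), of "\<lambda>l. ip x (g l)"] g assms
    by (simp add: ip_diff_left)
qed

text \<open>A new vector contributes to the orthonormal family only if its remainder has positive norm. In
  a degenerate space a vector is therefore recovered only up to a vector of norm zero.\<close>

lemma Gram_Schmidt:
  fixes n :: nat
  assumes "\<And>j. j < n \<Longrightarrow> f j \<in> CH"
  shows "\<exists>(m::nat) g. onorm_fam {..<m} g \<and>
    (\<forall>j<n. nm (f j - (\<Sum>k<m. ip (f j) (g k) *\<^sub>C g k)) = 0)"
  using assms
proof (induction n)
  case 0
  then show ?case by (intro exI[of _ 0] exI[of _ "\<lambda>_. 0"]) (simp add: onorm_fam_def)
next
  case (Suc n)
  then obtain m :: nat and g where g: "onorm_fam {..<m} g"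
    and *: "\<And>j. j < n \<Longrightarrow> nm (f j - (\<Sum>k<m. ip (f j) (g k) *\<^sub>C g k)) = 0"
    by (meson less_Suc_eq)
  have fn: "f n \<in> CH" using Suc by auto
  define r where "r = f n - (\<Sum>k<m. ip (f n) (g k) *\<^sub>C g k)"
  have gC: "\<And>k. k < m \<Longrightarrow> g k \<in> CH" using g by (auto simp: onorm_fam_def)
  have r: "r \<in> CH" unfolding r_def using fn gC by auto
  show ?case
  proof (cases "nm r = 0")
    case True
    then show ?thesis using g * by (intro exI[of _ m] exI[of _ g]) (auto simp: less_Suc_eq r_def)
  next
    case False
    define c where "c = complex_of_real (1 / nm r)"
    define g' where "g' = g(m := c *\<^sub>C r)"
    have rg: "ip r (g k) = 0" if "k < m" for k
      using ip_proj_right[OF _ g fn] that by (simp add: r_def)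
    have gr: "ip (g k) r = 0" if "k < m" for k
      using rg[OF that] herm[OF r gC[OF that]] by simp
    have rr: "ip (c *\<^sub>C r) (c *\<^sub>C r) = 1"
      using r False nm_sq[OF r, symmetric] by (simp add: ip_scale_left ip_scale_right mem_scale c_def)
         (simp add: power2_eq_square)
    have g'on: "onorm_fam {..<Suc m} g'"
      using g rg gr rr r gC
      by (auto simp: onorm_fam_def g'_def less_Suc_eq ip_scale_left ip_scale_right mem_scale)
    have "nm (f j - (\<Sum>k<Suc m. ip (f j) (g' k) *\<^sub>C g' k)) = 0" if j: "j < Suc n" for j
    proof (cases "j = n")
      case True
      have "ip (f n) r = ip r r"
      proof -
        have "f n = r + (\<Sum>k<m. ip (f n) (g k) *\<^sub>C g k)" by (simp add: r_def)
        then have "ip (f n) r = ip (r + (\<Sum>k<m. ip (f n) (g k) *\<^sub>C g k)) r" by (rule arg_cong)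
        also have "\<dots> = ip r r + ip (\<Sum>k<m. ip (f n) (g k) *\<^sub>C g k) r"
          using r gC by (intro ip_add_left) auto
        also have "\<dots> = ip r r + (\<Sum>k<m. ip (f n) (g k) * ip (g k) r)"
          using r gC by (subst ip_lincomb_left) auto
        finally show ?thesis using gr by simp
      qed
      then have "ip (f n) (c *\<^sub>C r) *\<^sub>C (c *\<^sub>C r) = (cnj c * ip r r * c) *\<^sub>C r"
        using r fn by (simp add: ip_scale_right)
      also have "cnj c * ip r r * c = 1" using rr r by (simp add: ip_scale_left ip_scale_right mem_scale algebra_simps)
      finally have "f n - (\<Sum>k<Suc m. ip (f n) (g' k) *\<^sub>C g' k) = 0"
        by (simp add: g'_def r_def)
      then show ?thesis using True by simp
    next
      case False
      then have jn: "j < n" using j by simp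
      let ?s = "f j - (\<Sum>k<m. ip (f j) (g k) *\<^sub>C g k)"
      have fj: "f j \<in> CH" using Suc j by auto
      have s: "?s \<in> CH" using fj gC by auto
      have "cmod (ip ?s r) \<le> 0" using Cauchy_Schwarz[OF s r] *[OF jn] by simp
      moreover have "ip ?s r = ip (f j) r"
        using fj gC r gr by (subst ip_diff_left) (auto intro!: mem_lincomb, subst ip_lincomb_left, auto)
      ultimately have "ip (f j) (c *\<^sub>C r) = 0" using r fj by (simp add: ip_scale_right)
      then show ?thesis using *[OF jn] by (simp add: g'_def)
    qed
    then show ?thesis using g'on by blast
  qed
qed

end

lemma hilbert_pre_hilb:
  assumes "hilbert_space H"
  shows "pre_hilb H"
proof
  note h = assms[unfolded hilbert_space_def]
  show "complex_vec.subspace (hcarrier H)" by (rule h[THEN conjunct1])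
  show "linear_on (hcarrier H) (\<lambda>x. hinner H x y)" if "y \<in> hcarrier H" for y
    using h[THEN conjunct2, THEN conjunct1] that by (rule bspec)
  show "hinner H y x = cnj (hinner H x y)" if "x \<in> hcarrier H" "y \<in> hcarrier H" for x y
    using h[THEN conjunct2, THEN conjunct2, THEN conjunct1] that by blast
  show "hinner H x x \<in> \<real>\<^sub>\<ge>\<^sub>0" if "x \<in> hcarrier H" for x
    using h[THEN conjunct2, THEN conjunct2, THEN conjunct2, THEN conjunct1] that by blast
qed

text \<open>Polarisation: the imaginary part of \<open>B (x + y) (x + y)\<close> and that of
  \<open>B (x + \<i> y) (x + \<i> y)\<close> give the imaginary and the real part of the claim.\<close>

lemma hermitian_if_real_diag:
  fixes B :: "'a::complex_vector \<Rightarrow> 'a \<Rightarrow> complex"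
  assumes U: "complex_vec.subspace U"
    and addl: "\<And>x y z. x \<in> U \<Longrightarrow> y \<in> U \<Longrightarrow> z \<in> U \<Longrightarrow> B (x + y) z = B x z + B y z"
    and addr: "\<And>x y z. x \<in> U \<Longrightarrow> y \<in> U \<Longrightarrow> z \<in> U \<Longrightarrow> B z (x + y) = B z x + B z y"
    and scl: "\<And>c x z. x \<in> U \<Longrightarrow> z \<in> U \<Longrightarrow> B (c *\<^sub>C x) z = c * B x z"
    and scr: "\<And>c x z. x \<in> U \<Longrightarrow> z \<in> U \<Longrightarrow> B z (c *\<^sub>C x) = cnj c * B z x"
    and real: "\<And>x. x \<in> U \<Longrightarrow> Im (B x x) = 0"
    and x: "x \<in> U" and y: "y \<in> U"
  shows "B y x = cnj (B x y)"
proof -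
  have iy: "\<i> *\<^sub>C y \<in> U" using U y by (rule complex_vec.subspace_scale)
  have 1: "Im (B x y) + Im (B y x) = 0"
    using real[of "x + y"] real[OF x] real[OF y] x y complex_vec.subspace_add[OF U x y]
    by (simp add: addl addr)
  have 2: "Re (B y x) - Re (B x y) = 0"
    using real[of "x + \<i> *\<^sub>C y"] real[OF x] real[OF iy] x iy y complex_vec.subspace_add[OF U x iy]
    by (simp add: addl addr scl scr)
  show ?thesis using 1 2 by (simp add: complex_eq_iff)
qed

section \<open>Operator norms and matrix norms\<close>

text \<open>The sesquilinear form of a matrix of operators. The bounds on matrix norms below are stated
  through it, so that vectors need not be extended by zero and no operator on the power is formed.\<close>

definition mform :: "'h::complex_vector hilb \<Rightarrow> nat \<Rightarrow> (nat \<Rightarrow> nat \<Rightarrow> 'h \<Rightarrow> 'h) \<Rightarrow> (nat \<Rightarrow> 'h) \<Rightarrow> (nat \<Rightarrow> 'h) \<Rightarrow> complex" where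
  "mform H n x \<zeta> \<eta> = (\<Sum>i<n. \<Sum>j<n. hinner H (x i j (\<zeta> j)) (\<eta> i))"

definition vnorm :: "'h::complex_vector hilb \<Rightarrow> nat \<Rightarrow> (nat \<Rightarrow> 'h) \<Rightarrow> real" where
  "vnorm H n \<zeta> = sqrt (\<Sum>i<n. (hnorm H (\<zeta> i))\<^sup>2)"

definition vec :: "'h hilb \<Rightarrow> nat \<Rightarrow> (nat \<Rightarrow> 'h) \<Rightarrow> bool" where
  "vec H n \<zeta> \<longleftrightarrow> (\<forall>i<n. \<zeta> i \<in> hcarrier H)"

definition id_mat :: "'h::complex_vector hilb \<Rightarrow> nat \<Rightarrow> nat \<Rightarrow> 'h \<Rightarrow> 'h" where
  "id_mat H i j = (if i = j then id_op H else 0)"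

lemma vecD: "vec H n \<zeta> \<Longrightarrow> i < n \<Longrightarrow> \<zeta> i \<in> hcarrier H"
  by (simp add: vec_def)

lemma matsD: "x \<in> mats n X \<Longrightarrow> i < n \<Longrightarrow> j < n \<Longrightarrow> x i j \<in> X"
  by (simp add: mats_def)

lemma mats_mono: "x \<in> mats n X \<Longrightarrow> X \<subseteq> Y \<Longrightarrow> x \<in> mats n Y"
  by (auto simp: mats_def)

lemma vnorm_ge_0[simp]: "0 \<le> vnorm H n \<zeta>"
  by (simp add: vnorm_def sum_nonneg)

lemma vnorm_sq: "(vnorm H n \<zeta>)\<^sup>2 = (\<Sum>i<n. (hnorm H (\<zeta> i))\<^sup>2)"
  by (simp add: vnorm_def sum_nonneg)

context pre_hilb
begin

lemma bopD:
  assumes "T \<in> bounded_ops H"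
  shows "x \<in> CH \<Longrightarrow> T x \<in> CH" "x \<notin> CH \<Longrightarrow> T x = 0" "linear_on CH T"
    "\<exists>M. \<forall>x\<in>CH. nm (T x) \<le> M * nm x"
  using assms by (auto simp: bounded_ops_def)

lemma bop_eqI:
  assumes "S \<in> bounded_ops H" "T \<in> bounded_ops H" "\<And>x. x \<in> CH \<Longrightarrow> S x = T x"
  shows "S = T"
proof
  fix x show "S x = T x" using assms bopD(2)[OF assms(1), of x] bopD(2)[OF assms(2), of x] by (cases "x \<in> CH") auto
qed

lemma op_norm_set:
  assumes "T \<in> bounded_ops H"
  shows "bdd_above {nm (T x) | x. x \<in> CH \<and> nm x \<le> 1}" "{nm (T x) | x. x \<in> CH \<and> nm x \<le> 1} \<noteq> {}"
proof -
  from bopD(4)[OF assms] obtain M where M: "\<And>x. x \<in> CH \<Longrightarrow> nm (T x) \<le> M * nm x" by auto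
  have "nm (T x) \<le> \<bar>M\<bar>" if "x \<in> CH" "nm x \<le> 1" for x
  proof -
    have "nm (T x) \<le> \<bar>M\<bar> * nm x" using M[OF that(1)] nm_ge_0[OF that(1)]
      by (smt (verit) mult_right_mono)
    also have "\<dots> \<le> \<bar>M\<bar>" using that by (simp add: mult_left_le)
    finally show ?thesis .
  qed
  then show "bdd_above {nm (T x) | x. x \<in> CH \<and> nm x \<le> 1}" unfolding bdd_above_def by blast
  show "{nm (T x) | x. x \<in> CH \<and> nm x \<le> 1} \<noteq> {}" using mem_0 nm_0 by force
qed

lemma op_norm_ge_0:
  assumes "T \<in> bounded_ops H"
  shows "0 \<le> op_norm H T"
proof -
  have "nm (T 0) \<le> op_norm H T" unfolding op_norm_def
    by (rule cSup_upper[OF _ op_norm_set(1)[OF assms]]) force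
  moreover have "0 \<le> nm (T 0)" using bopD(1)[OF assms mem_0] by simp
  ultimately show ?thesis by linarith
qed

lemma op_norm_bound:
  assumes "T \<in> bounded_ops H" and x: "x \<in> CH"
  shows "nm (T x) \<le> op_norm H T * nm x"
proof (cases "nm x = 0")
  case True
  from bopD(4)[OF assms(1)] obtain M where "\<And>x. x \<in> CH \<Longrightarrow> nm (T x) \<le> M * nm x" by auto
  then show ?thesis using x True by force
next
  case False
  then have p: "nm x > 0" using nm_ge_0[OF x] by simp
  let ?c = "complex_of_real (1 / nm x)"
  have "nm (?c *\<^sub>C x) = 1" using p x by (subst nm_scale) (auto simp: norm_divide)
  then have "nm (T (?c *\<^sub>C x)) \<le> op_norm H T" unfolding op_norm_def
    using x by (intro cSup_upper[OF _ op_norm_set(1)[OF assms(1)]]) force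
  moreover have "nm (T (?c *\<^sub>C x)) = nm (T x) / nm x"
    using linear_onD(2)[OF bopD(3)[OF assms(1)] x] nm_scale[OF bopD(1)[OF assms]] p by (simp add: norm_divide)
  ultimately have "nm (T x) / nm x \<le> op_norm H T" by metis
  then show ?thesis using p by (simp add: pos_divide_le_eq)
qed

lemma op_norm_leI:
  assumes "0 \<le> c" "\<And>x. x \<in> CH \<Longrightarrow> nm (T x) \<le> c * nm x"
  shows "op_norm H T \<le> c"
proof -
  have "nm (T x) \<le> c" if "x \<in> CH" "nm x \<le> 1" for x
    using assms(2)[OF that(1)] mult_left_le[OF that(2) assms(1)] by linarith
  then show ?thesis unfolding op_norm_def
    by (intro cSup_least) (use mem_0 nm_0 in force)+
qed

lemma op_form_bound:
  assumes "T \<in> bounded_ops H" "x \<in> CH" "y \<in> CH"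
  shows "cmod (ip (T x) y) \<le> op_norm H T * nm x * nm y"
  using Cauchy_Schwarz[OF bopD(1)[OF assms(1,2)] assms(3)] 
    mult_right_mono[OF op_norm_bound[OF assms(1,2)] nm_ge_0[OF assms(3)]] by linarith

text \<open>The second alternative is there because \<open>c\<close> may be negative when every vector has norm zero.\<close>

lemma nm_le_if_form:
  assumes "\<And>y. y \<in> CH \<Longrightarrow> cmod (ip z y) \<le> c * nm y" "z \<in> CH"
  shows "nm z \<le> c \<or> nm z = 0"
proof -
  have "ip z z = complex_of_real ((nm z)\<^sup>2)" using nm_sq[OF assms(2)] by simp
  then have "(nm z)\<^sup>2 \<le> c * nm z" using assms(1)[OF assms(2)] by (simp del: of_real_power)
  then show ?thesis using nm_ge_0[OF assms(2)] by (auto simp: power2_eq_square)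
qed

lemma op_norm_le_formI:
  assumes "0 \<le> c" "\<And>x. x \<in> CH \<Longrightarrow> T x \<in> CH"
    "\<And>x y. x \<in> CH \<Longrightarrow> y \<in> CH \<Longrightarrow> cmod (ip (T x) y) \<le> c * nm x * nm y"
  shows "op_norm H T \<le> c"
proof (rule op_norm_leI[OF assms(1)])
  fix x assume x: "x \<in> CH"
  have "nm (T x) \<le> c * nm x \<or> nm (T x) = 0"
    by (rule nm_le_if_form) (use assms x in auto)
  then show "nm (T x) \<le> c * nm x" using assms(1) nm_ge_0[OF x] by auto
qed

lemma bop_zero: "0 \<in> bounded_ops H"
  by (auto simp: bounded_ops_def linear_on_def intro!: exI[of _ 0])

lemma bop_add: 
  assumes "S \<in> bounded_ops H" "T \<in> bounded_ops H"
  shows "S + T \<in> bounded_ops H"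
proof -
  have "nm (S x + T x) \<le> (op_norm H S + op_norm H T) * nm x" if x: "x \<in> CH" for x
    using nm_triangle[OF bopD(1)[OF assms(1) x] bopD(1)[OF assms(2) x]]
      op_norm_bound[OF assms(1) x] op_norm_bound[OF assms(2) x] by (simp add: distrib_right)
  moreover have "linear_on CH (S + T)"
    using bopD(3)[OF assms(1)] bopD(3)[OF assms(2)]
    by (auto simp: linear_on_def algebra_simps complex_vec.scale_right_distrib)
  ultimately show ?thesis using bopD(1,2)[OF assms(1)] bopD(1,2)[OF assms(2)]
    unfolding bounded_ops_def by auto
qed

lemma bop_scale: 
  assumes "T \<in> bounded_ops H"
  shows "c *\<^sub>C T \<in> bounded_ops H"
proof -
  have "nm (c *\<^sub>C T x) \<le> (cmod c * op_norm H T) * nm x" if x: "x \<in> CH" for x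
    using nm_scale[OF bopD(1)[OF assms(1) x]]
      mult_left_mono[OF op_norm_bound[OF assms(1) x], of "cmod c"] by (simp add: mult.assoc)
  moreover have "linear_on CH (c *\<^sub>C T)"
    using bopD(3)[OF assms(1)]
    by (auto simp: linear_on_def scaleC_fun_def complex_vec.scale_right_distrib mult.commute)
  ultimately show ?thesis using bopD(1,2)[OF assms(1)]
    unfolding bounded_ops_def by (auto simp: scaleC_fun_def)
qed

lemma subspace_bop: "complex_vec.subspace (bounded_ops H)"
  by (intro complex_vec.subspaceI bop_zero bop_add bop_scale)

lemma id_op_bop: "id_op H \<in> bounded_ops H"
  by (auto simp: bounded_ops_def id_op_def linear_on_def mem_add mem_scale intro!: exI[of _ 1])

lemma op_norm_triangle:
  assumes "S \<in> bounded_ops H" "T \<in> bounded_ops H"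
  shows "op_norm H (S + T) \<le> op_norm H S + op_norm H T"
proof (rule op_norm_leI)
  fix x assume x: "x \<in> CH"
  show "nm ((S + T) x) \<le> (op_norm H S + op_norm H T) * nm x"
    using nm_triangle[OF bopD(1)[OF assms(1) x] bopD(1)[OF assms(2) x]]
      op_norm_bound[OF assms(1) x] op_norm_bound[OF assms(2) x] by (simp add: distrib_right)
qed (use assms op_norm_ge_0 in auto)

lemma op_norm_scale_le:
  assumes "T \<in> bounded_ops H"
  shows "op_norm H (c *\<^sub>C T) \<le> cmod c * op_norm H T"
proof (rule op_norm_leI)
  fix x assume x: "x \<in> CH"
  show "nm ((c *\<^sub>C T) x) \<le> (cmod c * op_norm H T) * nm x"
    using nm_scale[OF bopD(1)[OF assms(1) x]]
      mult_left_mono[OF op_norm_bound[OF assms(1) x], of "cmod c"] by (simp add: mult.assoc scaleC_fun_def)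
qed (use assms op_norm_ge_0 in auto)

lemma op_norm_scale:
  assumes "T \<in> bounded_ops H"
  shows "op_norm H (c *\<^sub>C T) = cmod c * op_norm H T"
proof (cases "c = 0")
  case True
  have "op_norm H 0 \<le> 0" by (rule op_norm_leI) auto
  then show ?thesis using True op_norm_ge_0[OF bop_zero] by simp
next
  case False
  have "op_norm H T = op_norm H ((1/c) *\<^sub>C (c *\<^sub>C T))" using False by simp
  also have "\<dots> \<le> cmod (1/c) * op_norm H (c *\<^sub>C T)"
    by (rule op_norm_scale_le[OF bop_scale[OF assms]])
  finally have "cmod c * op_norm H T \<le> op_norm H (c *\<^sub>C T)" using False 
    by (simp add: norm_divide field_simps)
  then show ?thesis using op_norm_scale_le[OF assms, of c] by linarith
qed

lemma op_norm_0: "op_norm H 0 = 0"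
  using op_norm_scale[OF bop_zero, of 0] by simp

lemma hilb_power_carrier: "\<zeta> \<in> hcarrier (hilb_power H n) \<longleftrightarrow> vec H n \<zeta> \<and> (\<forall>i\<ge>n. \<zeta> i = 0)"
  by (simp add: hilb_power_def vec_def)

lemma hilb_power_inner: "hinner (hilb_power H n) \<zeta> \<eta> = (\<Sum>i<n. ip (\<zeta> i) (\<eta> i))"
  by (simp add: hilb_power_def)

lemma pre_hilb_power: "pre_hilb (hilb_power H n)"
proof
  show "complex_vec.subspace (hcarrier (hilb_power H n))"
    by (rule complex_vec.subspaceI) (auto simp: hilb_power_carrier vec_def scaleC_fun_def)
next
  fix \<eta> assume "\<eta> \<in> hcarrier (hilb_power H n)"
  then show "linear_on (hcarrier (hilb_power H n)) (\<lambda>\<zeta>. hinner (hilb_power H n) \<zeta> \<eta>)"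
    by (auto simp: linear_on_def hilb_power_carrier hilb_power_inner vec_def ip_add_left
        scaleC_complex_def scaleC_fun_def ip_scale_left sum.distrib sum_distrib_left)
next
  fix \<zeta> \<eta> assume "\<zeta> \<in> hcarrier (hilb_power H n)" "\<eta> \<in> hcarrier (hilb_power H n)"
  then show "hinner (hilb_power H n) \<eta> \<zeta> = cnj (hinner (hilb_power H n) \<zeta> \<eta>)"
    unfolding hilb_power_carrier hilb_power_inner vec_def cnj_sum by (intro sum.cong herm) auto
next
  fix \<zeta> assume "\<zeta> \<in> hcarrier (hilb_power H n)"
  then show "hinner (hilb_power H n) \<zeta> \<zeta> \<in> \<real>\<^sub>\<ge>\<^sub>0"
    using pos by (auto simp: hilb_power_carrier hilb_power_inner vec_def complex_nonneg_Reals_iff intro!: sum_nonneg)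
qed

lemma hilb_power_norm: "\<zeta> \<in> hcarrier (hilb_power H n) \<Longrightarrow> hnorm (hilb_power H n) \<zeta> = vnorm H n \<zeta>"
  unfolding hnorm_def[of "hilb_power H n"] vnorm_def hilb_power_inner Re_sum
  by (auto simp: hilb_power_carrier nm_sq_Re vec_def)

definition trunc :: "nat \<Rightarrow> (nat \<Rightarrow> 'h) \<Rightarrow> nat \<Rightarrow> 'h" where
  "trunc n \<zeta> = (\<lambda>i. if i < n then \<zeta> i else 0)"

lemma trunc_carrier: "vec H n \<zeta> \<Longrightarrow> trunc n \<zeta> \<in> hcarrier (hilb_power H n)"
  by (simp add: trunc_def hilb_power_carrier vec_def)

lemma vnorm_trunc[simp]: "vnorm H n (trunc n \<zeta>) = vnorm H n \<zeta>"
  by (simp add: vnorm_def trunc_def)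

lemma mform_trunc[simp]: "mform H n x (trunc n \<zeta>) (trunc n \<eta>) = mform H n x \<zeta> \<eta>"
  by (simp add: mform_def trunc_def)

lemma nm_le_vnorm: "i < n \<Longrightarrow> vec H n \<zeta> \<Longrightarrow> nm (\<zeta> i) \<le> vnorm H n \<zeta>"
  unfolding vnorm_def by (rule real_le_rsqrt) (rule member_le_sum[where f="\<lambda>i. (nm (\<zeta> i))\<^sup>2"], auto)

lemma mform_mat_op:
  assumes "x \<in> mats n (bounded_ops H)" "\<zeta> \<in> hcarrier (hilb_power H n)" "\<eta> \<in> hcarrier (hilb_power H n)"
  shows "hinner (hilb_power H n) (mat_op H n x \<zeta>) \<eta> = mform H n x \<zeta> \<eta>"
proof -
  have "ip (\<Sum>j<n. x i j (\<zeta> j)) (\<eta> i) = (\<Sum>j<n. ip (x i j (\<zeta> j)) (\<eta> i))" if "i < n" for i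
    using that assms by (intro ip_sum_left bopD(1)[OF matsD[OF assms(1)]]) (auto simp: hilb_power_carrier vec_def)
  then show ?thesis using assms(2) by (simp add: hilb_power_inner mat_op_def mform_def)
qed

text \<open>Only the finiteness of this bound matters: it makes a matrix of bounded operators a bounded
  operator, so that its operator norm is a supremum of a bounded set.\<close>

lemma mform_crude_bound:
  assumes "x \<in> mats n (bounded_ops H)" "vec H n \<zeta>" "vec H n \<eta>"
  shows "cmod (mform H n x \<zeta> \<eta>) \<le> (\<Sum>i<n. \<Sum>j<n. op_norm H (x i j)) * vnorm H n \<zeta> * vnorm H n \<eta>"
proof -
  have "cmod (mform H n x \<zeta> \<eta>) \<le> (\<Sum>i<n. \<Sum>j<n. cmod (ip (x i j (\<zeta> j)) (\<eta> i)))"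
    unfolding mform_def by (intro order.trans[OF norm_sum] sum_mono norm_sum)
  also have "\<dots> \<le> (\<Sum>i<n. \<Sum>j<n. op_norm H (x i j) * vnorm H n \<zeta> * vnorm H n \<eta>)"
  proof (intro sum_mono)
    fix i j assume "i \<in> {..<n}" "j \<in> {..<n}"
    then have ij: "i < n" "j < n" by auto
    have "cmod (ip (x i j (\<zeta> j)) (\<eta> i)) \<le> op_norm H (x i j) * nm (\<zeta> j) * nm (\<eta> i)"
      using ij assms by (intro op_form_bound) (auto simp: mats_def vec_def)
    also have "\<dots> \<le> op_norm H (x i j) * vnorm H n \<zeta> * vnorm H n \<eta>"
      using ij assms by (intro mult_mono nm_le_vnorm mult_nonneg_nonneg nm_ge_0 op_norm_ge_0) (auto simp: mats_def vec_def)
    finally show "cmod (ip (x i j (\<zeta> j)) (\<eta> i)) \<le> op_norm H (x i j) * vnorm H n \<zeta> * vnorm H n \<eta>" .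
  qed
  finally show ?thesis by (simp add: sum_distrib_right)
qed

lemma mat_op_carrier:
  assumes "x \<in> mats n (bounded_ops H)" "\<zeta> \<in> hcarrier (hilb_power H n)"
  shows "mat_op H n x \<zeta> \<in> hcarrier (hilb_power H n)"
  using assms bopD(1)[OF matsD[OF assms(1)]]
  by (auto simp: mat_op_def hilb_power_carrier vec_def)

lemma mat_op_bop:
  assumes x: "x \<in> mats n (bounded_ops H)"
  shows "mat_op H n x \<in> bounded_ops (hilb_power H n)"
proof -
  interpret P: pre_hilb "hilb_power H n" by (rule pre_hilb_power)
  let ?c = "\<Sum>i<n. \<Sum>j<n. op_norm H (x i j)"
  have c: "0 \<le> ?c" using x by (intro sum_nonneg op_norm_ge_0) (auto simp: mats_def)
  have "P.nm (mat_op H n x \<zeta>) \<le> ?c * P.nm \<zeta>" if z: "\<zeta> \<in> hcarrier (hilb_power H n)" for \<zeta>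
  proof -
    have "P.nm (mat_op H n x \<zeta>) \<le> ?c * P.nm \<zeta> \<or> P.nm (mat_op H n x \<zeta>) = 0"
    proof (rule P.nm_le_if_form[OF _ mat_op_carrier[OF x z]])
      fix \<eta> assume e: "\<eta> \<in> hcarrier (hilb_power H n)"
      show "cmod (P.ip (mat_op H n x \<zeta>) \<eta>) \<le> ?c * P.nm \<zeta> * P.nm \<eta>"
        using mform_crude_bound[OF x, of \<zeta> \<eta>] z e
        by (simp add: mform_mat_op[OF x z e] hilb_power_norm[OF z] hilb_power_norm[OF e] hilb_power_carrier)
    qed
    then show ?thesis using c P.nm_ge_0[OF z] by auto
  qed
  moreover have "linear_on (hcarrier (hilb_power H n)) (mat_op H n x)"
  proof -
    have 1: "mat_op H n x (\<zeta> + \<eta>) = mat_op H n x \<zeta> + mat_op H n x \<eta>"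
      if "\<zeta> \<in> P.CH" "\<eta> \<in> P.CH" for \<zeta> \<eta>
    proof
      fix i
      have "x i j (\<zeta> j + \<eta> j) = x i j (\<zeta> j) + x i j (\<eta> j)" if "i < n" "j < n" for j
        using linear_onD(1)[OF bopD(3)[OF matsD[OF x that]]] \<open>\<zeta> \<in> P.CH\<close> \<open>\<eta> \<in> P.CH\<close> that
        by (auto simp: hilb_power_carrier vec_def)
      then show "mat_op H n x (\<zeta> + \<eta>) i = (mat_op H n x \<zeta> + mat_op H n x \<eta>) i"
        using that P.mem_add[OF that] by (simp add: mat_op_def sum.distrib)
    qed
    have 2: "mat_op H n x (c *\<^sub>C \<zeta>) = c *\<^sub>C mat_op H n x \<zeta>"
      if "\<zeta> \<in> P.CH" for c \<zeta>
    proof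
      fix i
      have "x i j (c *\<^sub>C \<zeta> j) = c *\<^sub>C x i j (\<zeta> j)" if "i < n" "j < n" for j
        using linear_onD(2)[OF bopD(3)[OF matsD[OF x that]]] \<open>\<zeta> \<in> P.CH\<close> that
        by (auto simp: hilb_power_carrier vec_def)
      then show "mat_op H n x (c *\<^sub>C \<zeta>) i = (c *\<^sub>C mat_op H n x \<zeta>) i"
        using that P.mem_scale[OF that, of c] by (simp add: mat_op_def scaleC_fun_def complex_vec.scale_sum_right)
    qed
    show ?thesis using 1 2 by (simp add: linear_on_def)
  qed
  ultimately show ?thesis using mat_op_carrier[OF x]
    unfolding bounded_ops_def by (auto simp: mat_op_def)
qed

lemma mat_norm_ge_0:
  assumes "x \<in> mats n (bounded_ops H)"
  shows "0 \<le> mat_norm H n x"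
  unfolding mat_norm_def by (rule pre_hilb.op_norm_ge_0[OF pre_hilb_power mat_op_bop[OF assms]])

lemma mat_norm_bound:
  assumes x: "x \<in> mats n (bounded_ops H)" and v: "vec H n \<zeta>" "vec H n \<eta>"
  shows "cmod (mform H n x \<zeta> \<eta>) \<le> mat_norm H n x * vnorm H n \<zeta> * vnorm H n \<eta>"
proof -
  have "cmod (hinner (hilb_power H n) (mat_op H n x (trunc n \<zeta>)) (trunc n \<eta>))
    \<le> mat_norm H n x * hnorm (hilb_power H n) (trunc n \<zeta>) * hnorm (hilb_power H n) (trunc n \<eta>)"
    unfolding mat_norm_def
    by (rule pre_hilb.op_form_bound[OF pre_hilb_power mat_op_bop[OF x] trunc_carrier[OF v(1)] trunc_carrier[OF v(2)]])
  then show ?thesis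
    by (simp add: mform_mat_op[OF x trunc_carrier[OF v(1)] trunc_carrier[OF v(2)]] 
        hilb_power_norm[OF trunc_carrier[OF v(1)]] hilb_power_norm[OF trunc_carrier[OF v(2)]])
qed

lemma mat_norm_leI:
  assumes x: "x \<in> mats n (bounded_ops H)" and c: "0 \<le> c"
    and *: "\<And>\<zeta> \<eta>. vec H n \<zeta> \<Longrightarrow> vec H n \<eta> \<Longrightarrow> cmod (mform H n x \<zeta> \<eta>) \<le> c * vnorm H n \<zeta> * vnorm H n \<eta>"
  shows "mat_norm H n x \<le> c"
  unfolding mat_norm_def
proof (rule pre_hilb.op_norm_le_formI[OF pre_hilb_power c mat_op_carrier[OF x]])
  fix \<zeta> \<eta> assume z: "\<zeta> \<in> hcarrier (hilb_power H n)" and e: "\<eta> \<in> hcarrier (hilb_power H n)"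
  show "cmod (hinner (hilb_power H n) (mat_op H n x \<zeta>) \<eta>) \<le> c * hnorm (hilb_power H n) \<zeta> * hnorm (hilb_power H n) \<eta>"
    using *[of \<zeta> \<eta>] z e by (simp add: mform_mat_op[OF x z e] hilb_power_norm[OF z] hilb_power_norm[OF e] hilb_power_carrier)
qed

lemma mat_positive_iff:
  assumes x: "x \<in> mats n (bounded_ops H)"
  shows "mat_positive H n x \<longleftrightarrow> (\<forall>\<zeta>. vec H n \<zeta> \<longrightarrow> mform H n x \<zeta> \<zeta> \<in> \<real>\<^sub>\<ge>\<^sub>0)"
  unfolding mat_positive_def positive_op_def
proof (intro iffI allI impI ballI)
  fix \<zeta> assume *: "\<forall>\<zeta>\<in>hcarrier (hilb_power H n). hinner (hilb_power H n) (mat_op H n x \<zeta>) \<zeta> \<in> \<real>\<^sub>\<ge>\<^sub>0" and v: "vec H n \<zeta>"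
  show "mform H n x \<zeta> \<zeta> \<in> \<real>\<^sub>\<ge>\<^sub>0"
    using bspec[OF * trunc_carrier[OF v]] by (simp add: mform_mat_op[OF x trunc_carrier[OF v] trunc_carrier[OF v]])
next
  fix \<zeta> assume *: "\<forall>\<zeta>. vec H n \<zeta> \<longrightarrow> mform H n x \<zeta> \<zeta> \<in> \<real>\<^sub>\<ge>\<^sub>0" and z: "\<zeta> \<in> hcarrier (hilb_power H n)"
  show "hinner (hilb_power H n) (mat_op H n x \<zeta>) \<zeta> \<in> \<real>\<^sub>\<ge>\<^sub>0"
  proof -
    have "vec H n \<zeta>" using z unfolding hilb_power_carrier by (rule conjunct1)
    then have "mform H n x \<zeta> \<zeta> \<in> \<real>\<^sub>\<ge>\<^sub>0" by (rule *[rule_format])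
    then show ?thesis unfolding mform_mat_op[OF x z z] .
  qed
qed

lemma mats_app:
  assumes "x \<in> mats n (bounded_ops H)" "vec H n \<zeta>" "i < n" "j < n"
  shows "x i j (\<zeta> j) \<in> CH"
  by (rule bopD(1)[OF matsD[OF assms(1,3,4)] vecD[OF assms(2,4)]])

lemma mform_add: 
  assumes "x \<in> mats n (bounded_ops H)" "y \<in> mats n (bounded_ops H)" "vec H n \<zeta>" "vec H n \<eta>"
  shows "mform H n (\<lambda>i j. x i j + y i j) \<zeta> \<eta> = mform H n x \<zeta> \<eta> + mform H n y \<zeta> \<eta>"
proof -
  have "ip (x i j (\<zeta> j) + y i j (\<zeta> j)) (\<eta> i) = ip (x i j (\<zeta> j)) (\<eta> i) + ip (y i j (\<zeta> j)) (\<eta> i)" if "i < n" "j < n" for i j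
    by (rule ip_add_left[OF mats_app[OF assms(1,3) that] mats_app[OF assms(2,3) that] vecD[OF assms(4) that(1)]])
  then show ?thesis by (simp add: mform_def sum.distrib)
qed

lemma mform_scale: 
  assumes "x \<in> mats n (bounded_ops H)" "vec H n \<zeta>" "vec H n \<eta>"
  shows "mform H n (\<lambda>i j. c *\<^sub>C x i j) \<zeta> \<eta> = c * mform H n x \<zeta> \<eta>"
proof -
  have "ip (c *\<^sub>C x i j (\<zeta> j)) (\<eta> i) = c * ip (x i j (\<zeta> j)) (\<eta> i)" if "i < n" "j < n" for i j
    by (rule ip_scale_left[OF mats_app[OF assms(1,2) that] vecD[OF assms(3) that(1)]])
  then show ?thesis by (simp add: mform_def sum_distrib_left scaleC_fun_def)
qed

lemma id_mat_mats: "id_mat H \<in> mats n (bounded_ops H)"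
  by (simp add: mats_def id_mat_def id_op_bop bop_zero)

lemma mform_id:
  assumes "vec H n \<zeta>" "vec H n \<eta>"
  shows "mform H n (id_mat H) \<zeta> \<eta> = (\<Sum>i<n. ip (\<zeta> i) (\<eta> i))"
proof -
  have "ip (id_mat H i j (\<zeta> j)) (\<eta> i) = (if i = j then ip (\<zeta> i) (\<eta> i) else 0)" if "i < n" "j < n" for i j
    using that assms by (auto simp: id_mat_def id_op_def vec_def)
  then have "mform H n (id_mat H) \<zeta> \<eta> = (\<Sum>i<n. \<Sum>j<n. if i = j then ip (\<zeta> i) (\<eta> i) else 0)"
    unfolding mform_def by (intro sum.cong) auto
  then show ?thesis by simp
qed

lemma mform_id_diag:
  assumes "vec H n \<zeta>"
  shows "mform H n (id_mat H) \<zeta> \<zeta> = complex_of_real ((vnorm H n \<zeta>)\<^sup>2)"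
  using assms unfolding mform_id[OF assms assms] vnorm_sq of_real_sum
  by (intro sum.cong) (auto simp: nm_sq[symmetric] vec_def)

lemma mform_CS_id:
  assumes "vec H n \<zeta>" "vec H n \<eta>"
  shows "cmod (\<Sum>i<n. ip (\<zeta> i) (\<eta> i)) \<le> vnorm H n \<zeta> * vnorm H n \<eta>"
proof -
  interpret P: pre_hilb "hilb_power H n" by (rule pre_hilb_power)
  show ?thesis using P.Cauchy_Schwarz[OF trunc_carrier[OF assms(1)] trunc_carrier[OF assms(2)]]
    by (simp add: hilb_power_inner trunc_def[of n \<zeta>] trunc_def[of n \<eta>] 
       hilb_power_norm[OF trunc_carrier[OF assms(1), unfolded trunc_def]] hilb_power_norm[OF trunc_carrier[OF assms(2), unfolded trunc_def]]
       vnorm_trunc[of n \<zeta>, unfolded trunc_def] vnorm_trunc[of n \<eta>, unfolded trunc_def])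
qed

lemma mat_norm_id_le: "mat_norm H n (id_mat H) \<le> 1"
  by (rule mat_norm_leI[OF id_mat_mats]) (auto simp: mform_id mform_CS_id)

lemma mat_norm_scale_le:
  assumes x: "x \<in> mats n (bounded_ops H)"
  shows "mat_norm H n (\<lambda>i j. c *\<^sub>C x i j) \<le> cmod c * mat_norm H n x"
proof (rule mat_norm_leI)
  show "(\<lambda>i j. c *\<^sub>C x i j) \<in> mats n (bounded_ops H)"
    using x bop_scale by (simp add: mats_def)
  fix \<zeta> \<eta> assume v: "vec H n \<zeta>" "vec H n \<eta>"
  show "cmod (mform H n (\<lambda>i j. c *\<^sub>C x i j) \<zeta> \<eta>) \<le> (cmod c * mat_norm H n x) * vnorm H n \<zeta> * vnorm H n \<eta>"
    using mult_left_mono[OF mat_norm_bound[OF x v], of "cmod c"]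
    by (simp add: mform_scale[OF x v] norm_mult mult.assoc)
qed (use mat_norm_ge_0 x in auto)

lemma op_norm_le_mat_norm:
  assumes x: "x \<in> mats n (bounded_ops H)" and ij: "i < n" "j < n"
  shows "op_norm H (x i j) \<le> mat_norm H n x"
proof (rule op_norm_le_formI[OF mat_norm_ge_0[OF x] bopD(1)[OF matsD[OF x ij]]])
  fix a b assume a: "a \<in> CH" and b: "b \<in> CH"
  define \<zeta> \<eta> where "\<zeta> = (\<lambda>k. if k = j then a else 0)" and "\<eta> = (\<lambda>k. if k = i then b else 0)"
  have v: "vec H n \<zeta>" "vec H n \<eta>" using a b by (auto simp: vec_def \<zeta>_def \<eta>_def)
  have "(\<Sum>k<n. (nm (\<zeta> k))\<^sup>2) = (\<Sum>k<n. if k = j then (nm a)\<^sup>2 else 0)"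
    by (intro sum.cong) (auto simp: \<zeta>_def)
  then have za: "vnorm H n \<zeta> = nm a" using a ij by (simp add: vnorm_def)
  have "(\<Sum>k<n. (nm (\<eta> k))\<^sup>2) = (\<Sum>k<n. if k = i then (nm b)\<^sup>2 else 0)"
    by (intro sum.cong) (auto simp: \<eta>_def)
  then have eb: "vnorm H n \<eta> = nm b" using b ij by (simp add: vnorm_def)
  have "(\<Sum>l<n. ip (x k l (\<zeta> l)) (\<eta> k)) = (if k = i then ip (x i j a) b else 0)" if "k < n" for k
  proof -
    have "ip (x k l (\<zeta> l)) (\<eta> k) = (if l = j then (if k = i then ip (x i j a) b else 0) else 0)" if "l < n" for l
    proof (cases "l = j")
      case True
      have "x k j a \<in> CH" by (rule bopD(1)[OF matsD[OF x \<open>k < n\<close> ij(2)] a])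
      then show ?thesis using True by (simp add: \<zeta>_def \<eta>_def)
    next
      case False
      have "\<eta> k \<in> CH" by (rule vecD[OF v(2) \<open>k < n\<close>])
      then show ?thesis using False linear_on_zero[OF bopD(3)[OF matsD[OF x \<open>k < n\<close> that]] subsp] 
        by (simp add: \<zeta>_def)
    qed
    then show ?thesis using ij by simp
  qed
  then have "mform H n x \<zeta> \<eta> = ip (x i j a) b" using ij by (simp add: mform_def)
  then show "cmod (ip (x i j a) b) \<le> mat_norm H n x * nm a * nm b"
    using mat_norm_bound[OF x v] by (simp add: za eb)
qed

lemma mat_norm_1:
  assumes "T \<in> bounded_ops H"
  shows "mat_norm H 1 (\<lambda>_ _. T) = op_norm H T"
proof (rule antisym)
  have m: "(\<lambda>_ _. T) \<in> mats 1 (bounded_ops H)" using assms by (simp add: mats_def)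
  show "op_norm H T \<le> mat_norm H 1 (\<lambda>_ _. T)"
    using op_norm_le_mat_norm[OF m, of 0 0] by simp
  show "mat_norm H 1 (\<lambda>_ _. T) \<le> op_norm H T"
    by (rule mat_norm_leI[OF m op_norm_ge_0[OF assms]])
      (use op_form_bound[OF assms] in \<open>simp add: mform_def vnorm_def vec_def\<close>)
qed

end

section \<open>The Hahn-Banach theorem\<close>

definition sublin :: "'a::complex_vector set \<Rightarrow> ('a \<Rightarrow> real) \<Rightarrow> bool" where
  "sublin U p \<longleftrightarrow> (\<forall>x\<in>U. \<forall>y\<in>U. p (x + y) \<le> p x + p y) \<and>
     (\<forall>x\<in>U. \<forall>r>0. p (complex_of_real r *\<^sub>C x) \<le> r * p x)"

definition convex_in :: "'a::complex_vector set \<Rightarrow> bool" where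
  "convex_in A \<longleftrightarrow> (\<forall>a\<in>A. \<forall>b\<in>A. \<forall>t::real. 0 \<le> t \<longrightarrow> t \<le> 1 \<longrightarrow>
     complex_of_real t *\<^sub>C a + complex_of_real (1 - t) *\<^sub>C b \<in> A)"

context
  fixes U :: "'a::complex_vector set"
  assumes U: "complex_vec.subspace U"
begin

lemma sublinD:
  assumes "sublin U p"
  shows "x \<in> U \<Longrightarrow> y \<in> U \<Longrightarrow> p (x + y) \<le> p x + p y"
    "x \<in> U \<Longrightarrow> 0 < r \<Longrightarrow> p (complex_of_real r *\<^sub>C x) \<le> r * p x"
  using assms by (auto simp: sublin_def)

lemma sublin_0:
  assumes "sublin U p"
  shows "p 0 = 0"
  using sublinD(2)[OF assms complex_vec.subspace_0[OF U], of 2]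
    sublinD(2)[OF assms complex_vec.subspace_0[OF U], of "1/2"] by simp

lemma sublin_scale:
  assumes p: "sublin U p" and x: "x \<in> U" and r: "0 \<le> r"
  shows "p (complex_of_real r *\<^sub>C x) = r * p x"
proof (cases "r = 0")
  case True
  then show ?thesis using sublin_0[OF p] by simp
next
  case False
  then have r: "r > 0" using r by simp
  have "p x = p (complex_of_real (1/r) *\<^sub>C (complex_of_real r *\<^sub>C x))" using r by simp
  also have "\<dots> \<le> (1/r) * p (complex_of_real r *\<^sub>C x)"
    using r by (intro sublinD(2)[OF p] complex_vec.subspace_scale[OF U x]) auto
  finally have "r * p x \<le> p (complex_of_real r *\<^sub>C x)" using r by (simp add: field_simps)
  then show ?thesis using sublinD(2)[OF p x r] by simp
qed

lemma sublin_neg: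
  assumes p: "sublin U p" and x: "x \<in> U"
  shows "- p (- x) \<le> p x"
  using sublinD(1)[OF p x complex_vec.subspace_neg[OF U x]] sublin_0[OF p] by simp

text \<open>The largest sublinear functional below \<open>p\<close> that is at most \<open>- c\<close> on \<open>- A\<close>. For a singleton \<open>A\<close>
  this is the step that shows minimal sublinear functionals to be linear; for a general convex set
  it is the step that turns separation into domination.\<close>

definition lower :: "('a \<Rightarrow> real) \<Rightarrow> 'a set \<Rightarrow> real \<Rightarrow> 'a \<Rightarrow> real" where
  "lower p A c u = (if u \<in> U then Inf {p (u + complex_of_real t *\<^sub>C a) - t * c | t a. 0 \<le> t \<and> a \<in> A} else 0)"

text \<open>Subadditivity is where convexity of \<open>A\<close> enters: \<open>t a + s b\<close> is \<open>t + s\<close> times a point of \<open>A\<close>.\<close>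

lemma lower_props:
  assumes p: "sublin U p" and A: "A \<subseteq> U" "A \<noteq> {}" "convex_in A" and c: "\<And>a. a \<in> A \<Longrightarrow> c \<le> p a"
  shows "sublin U (lower p A c)" "x \<in> U \<Longrightarrow> lower p A c x \<le> p x" "a \<in> A \<Longrightarrow> lower p A c (- a) \<le> - c"
proof -
  let ?S = "\<lambda>u. {p (u + complex_of_real t *\<^sub>C a) - t * c | t a. 0 \<le> t \<and> a \<in> A}"
  have mem: "u + complex_of_real t *\<^sub>C a \<in> U" if "u \<in> U" "a \<in> A" for u t a
    using that A U by (meson complex_vec.subspace_add complex_vec.subspace_scale subsetD)
  have low: "- p (- u) \<le> p (u + complex_of_real t *\<^sub>C a) - t * c" if "u \<in> U" "0 \<le> t" "a \<in> A" for u t a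
  proof -
    have a: "a \<in> U" using that A by auto
    have "t * c \<le> t * p a" using c that by (intro mult_left_mono) auto
    also have "\<dots> = p (complex_of_real t *\<^sub>C a)" using sublin_scale[OF p a that(2)] by simp
    also have "\<dots> = p ((u + complex_of_real t *\<^sub>C a) + (- u))" by simp
    also have "\<dots> \<le> p (u + complex_of_real t *\<^sub>C a) + p (- u)"
      using that mem complex_vec.subspace_neg[OF U] by (intro sublinD(1)[OF p]) auto
    finally show ?thesis by simp
  qed
  have bdd: "bdd_below (?S u)" if "u \<in> U" for u
    unfolding bdd_below_def using low[OF that] by blast
  have ne: "?S u \<noteq> {}" for u using A(2) by force
  have le: "lower p A c u \<le> p (u + complex_of_real t *\<^sub>C a) - t * c" if "u \<in> U" "0 \<le> t" "a \<in> A" for u t a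
    unfolding lower_def using that by (auto intro!: cInf_lower bdd)
  have ex: "\<exists>t a. 0 \<le> t \<and> a \<in> A \<and> p (u + complex_of_real t *\<^sub>C a) - t * c < lower p A c u + e"
    if "u \<in> U" "0 < e" for u e
    using cInf_lessD[OF ne, of u "lower p A c u + e"] that by (auto simp: lower_def)
  show 1: "lower p A c x \<le> p x" if "x \<in> U" for x
    using A(2) le[OF that order.refl] by auto
  show "lower p A c (- a) \<le> - c" if "a \<in> A" for a
    using le[of "- a" 1 a] that A complex_vec.subspace_neg[OF U] sublin_0[OF p] by auto
  show "sublin U (lower p A c)" unfolding sublin_def
  proof safe
    fix x y assume x: "x \<in> U" and y: "y \<in> U"
    show "lower p A c (x + y) \<le> lower p A c x + lower p A c y"
    proof (rule field_le_epsilon)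
      fix e :: real assume e: "0 < e"
      obtain t a where ta: "0 \<le> t" "a \<in> A" "p (x + complex_of_real t *\<^sub>C a) - t * c < lower p A c x + e/2"
        using ex[OF x, of "e/2"] e by auto
      obtain s b where sb: "0 \<le> s" "b \<in> A" "p (y + complex_of_real s *\<^sub>C b) - s * c < lower p A c y + e/2"
        using ex[OF y, of "e/2"] e by auto
      obtain d where d: "d \<in> A" "complex_of_real (t + s) *\<^sub>C d = complex_of_real t *\<^sub>C a + complex_of_real s *\<^sub>C b"
      proof (cases "t + s = 0")
        case True
        then have "t = 0" "s = 0" using ta sb by auto
        then show ?thesis using that[OF ta(2)] by simp
      next
        case False
        have "complex_of_real (t/(t+s)) *\<^sub>C a + complex_of_real (1 - t/(t+s)) *\<^sub>C b \<in> A"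
          using ta sb False by (intro A(3)[unfolded convex_in_def, rule_format]) (auto simp: divide_le_eq_1)
        moreover have "complex_of_real (t + s) *\<^sub>C (complex_of_real (t/(t+s)) *\<^sub>C a + complex_of_real (1 - t/(t+s)) *\<^sub>C b)
          = complex_of_real ((t+s) * (t/(t+s))) *\<^sub>C a + complex_of_real ((t+s) * (1 - t/(t+s))) *\<^sub>C b"
          by (simp only: complex_vec.scale_right_distrib scaleC_scaleC of_real_mult)
        moreover have "(t+s) * (t/(t+s)) = t" "(t+s) * (1 - t/(t+s)) = s" using False by (auto simp: field_simps)
        ultimately show ?thesis using that by metis
      qed
      have "lower p A c (x + y) \<le> p (x + y + complex_of_real (t + s) *\<^sub>C d) - (t + s) * c"
        using complex_vec.subspace_add[OF U x y] ta sb d by (intro le) auto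
      also have "x + y + complex_of_real (t + s) *\<^sub>C d = (x + complex_of_real t *\<^sub>C a) + (y + complex_of_real s *\<^sub>C b)"
        unfolding d by simp
      also have "p \<dots> \<le> p (x + complex_of_real t *\<^sub>C a) + p (y + complex_of_real s *\<^sub>C b)"
        using x y ta sb mem by (intro sublinD(1)[OF p]) auto
      finally show "lower p A c (x + y) \<le> lower p A c x + lower p A c y + e"
        using ta(3) sb(3) by (simp add: algebra_simps)
    qed
  next
    fix x and r :: real assume x: "x \<in> U" and r: "0 < r"
    show "lower p A c (complex_of_real r *\<^sub>C x) \<le> r * lower p A c x"
    proof (rule field_le_epsilon)
      fix e :: real assume e: "0 < e"
      obtain t a where ta: "0 \<le> t" "a \<in> A" "p (x + complex_of_real t *\<^sub>C a) - t * c < lower p A c x + e/r"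
        using ex[OF x, of "e/r"] e r by auto
      have "lower p A c (complex_of_real r *\<^sub>C x) \<le> p (complex_of_real r *\<^sub>C x + complex_of_real (r * t) *\<^sub>C a) - (r * t) * c"
        using complex_vec.subspace_scale[OF U x] ta r by (intro le) auto
      also have "complex_of_real r *\<^sub>C x + complex_of_real (r * t) *\<^sub>C a = complex_of_real r *\<^sub>C (x + complex_of_real t *\<^sub>C a)"
        by (simp add: complex_vec.scale_right_distrib)
      also have "p \<dots> \<le> r * p (x + complex_of_real t *\<^sub>C a)" using mem[OF x ta(2)] r by (rule sublinD(2)[OF p])
      also have "r * p (x + complex_of_real t *\<^sub>C a) - r * t * c = r * (p (x + complex_of_real t *\<^sub>C a) - t * c)"
        by (simp add: algebra_simps)
      also have "\<dots> \<le> r * (lower p A c x + e/r)" using ta r by (intro mult_left_mono) auto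
      finally show "lower p A c (complex_of_real r *\<^sub>C x) \<le> r * lower p A c x + e"
        using r by (simp add: algebra_simps)
    qed
  qed
qed

text \<open>Zorn's lemma for the reversed pointwise order. The infimum of a chain is finite because every
  member lies above \<open>x \<mapsto> - p (- x)\<close>. Values off \<open>U\<close> are set to zero, which makes the order
  antisymmetric.\<close>

lemma minimal_sublin_exists:
  assumes p: "sublin U p"
  shows "\<exists>q. sublin U q \<and> (\<forall>x\<in>U. q x \<le> p x) \<and>
    (\<forall>q'. sublin U q' \<and> (\<forall>x\<in>U. q' x \<le> q x) \<longrightarrow> (\<forall>x\<in>U. q' x = q x))"
proof -
  define Q where "Q = {q. sublin U q \<and> (\<forall>x\<in>U. q x \<le> p x) \<and> (\<forall>x. x \<notin> U \<longrightarrow> q x = 0)}"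
  define P where "P = (\<lambda>a b :: 'a \<Rightarrow> real. b \<le> a)"
  have res: "sublin U (\<lambda>x. if x \<in> U then q x else 0)" if "sublin U q" for q
    using that complex_vec.subspace_add[OF U] complex_vec.subspace_scale[OF U] by (auto simp: sublin_def)
  have "\<exists>m\<in>Q. \<forall>a\<in>Q. P m a \<longrightarrow> a = m"
  proof (rule predicate_Zorn)
    show "partial_order_on Q (relation_of P Q)"
      by (rule partial_order_on_relation_ofI) (auto simp: P_def)
  next
    fix C assume C: "C \<in> Chains (relation_of P Q)"
    then have CQ: "C \<subseteq> Q" and tot: "\<And>a b. a \<in> C \<Longrightarrow> b \<in> C \<Longrightarrow> a \<le> b \<or> b \<le> a"
      by (auto simp: Chains_def relation_of_def P_def)
    show "\<exists>u\<in>Q. \<forall>a\<in>C. P a u"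
    proof (cases "C = {}")
      case True
      have "(\<lambda>x. if x \<in> U then p x else 0) \<in> Q" using res[OF p] by (auto simp: Q_def)
      then show ?thesis using True by auto
    next
      case False
      define u where "u x = (if x \<in> U then Inf ((\<lambda>q. q x) ` C) else 0)" for x
      have qs: "sublin U q" if "q \<in> C" for q using CQ that by (auto simp: Q_def)
      have bdd: "bdd_below ((\<lambda>q. q x) ` C)" if "x \<in> U" for x
      proof -
        have "- p (- x) \<le> q x" if "q \<in> C" for q
          using sublin_neg[OF qs[OF that] \<open>x \<in> U\<close>] CQ that complex_vec.subspace_neg[OF U \<open>x \<in> U\<close>] 
          by (force simp: Q_def)
        then show ?thesis unfolding bdd_below_def by blast
      qed
      have ule: "u x \<le> q x" if "q \<in> C" "x \<in> U" for q x
        using that bdd by (auto simp: u_def intro!: cInf_lower)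
      have uex: "\<exists>q\<in>C. q x < u x + e" if "x \<in> U" "0 < e" for x e
        using cInf_lessD[of "(\<lambda>q. q x) ` C" "u x + e"] False that by (auto simp: u_def)
      have "sublin U u" unfolding sublin_def
      proof safe
        fix x y assume x: "x \<in> U" and y: "y \<in> U"
        show "u (x + y) \<le> u x + u y"
        proof (rule field_le_epsilon)
          fix e :: real assume e: "0 < e"
          obtain q where q: "q \<in> C" "q x < u x + e/2" using uex[OF x, of "e/2"] e by auto
          obtain r where r: "r \<in> C" "r y < u y + e/2" using uex[OF y, of "e/2"] e by auto
          have "\<exists>s\<in>C. s \<le> q \<and> s \<le> r" using tot[OF q(1) r(1)] q r by auto
          then obtain s where s: "s \<in> C" "s \<le> q" "s \<le> r" by auto
          have "u (x + y) \<le> s (x + y)" using ule[OF s(1)] complex_vec.subspace_add[OF U x y] by auto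
          also have "\<dots> \<le> s x + s y" by (rule sublinD(1)[OF qs[OF s(1)] x y])
          also have "\<dots> \<le> q x + r y" using s by (intro add_mono) (auto simp: le_fun_def)
          finally show "u (x + y) \<le> u x + u y + e" using q r by simp
        qed
      next
        fix x and r :: real assume x: "x \<in> U" and r: "0 < r"
        show "u (complex_of_real r *\<^sub>C x) \<le> r * u x"
        proof (rule field_le_epsilon)
          fix e :: real assume e: "0 < e"
          obtain q where q: "q \<in> C" "q x < u x + e/r" using uex[OF x, of "e/r"] e r by auto
          have "u (complex_of_real r *\<^sub>C x) \<le> q (complex_of_real r *\<^sub>C x)"
            using ule[OF q(1)] complex_vec.subspace_scale[OF U x] by auto
          also have "\<dots> \<le> r * q x" by (rule sublinD(2)[OF qs[OF q(1)] x r])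
          also have "\<dots> \<le> r * (u x + e/r)" using q r by (intro mult_left_mono) auto
          finally show "u (complex_of_real r *\<^sub>C x) \<le> r * u x + e" using r by (simp add: algebra_simps)
        qed
      qed
      moreover have "u x \<le> p x" if "x \<in> U" for x
      proof -
        obtain q where "q \<in> C" using False by auto
        then show ?thesis using ule[of q x] CQ that by (fastforce simp: Q_def)
      qed
      ultimately have "u \<in> Q" by (auto simp: Q_def u_def)
      moreover have "P q u" if "q \<in> C" for q
      proof -
        have "q x = 0" if "x \<notin> U" for x using CQ \<open>q \<in> C\<close> that by (auto simp: Q_def)
        then show ?thesis using ule[OF that] by (auto simp: P_def le_fun_def u_def)
      qed
      ultimately show ?thesis by blast
    qed
  qed
  then obtain m where m: "m \<in> Q" "\<And>a. a \<in> Q \<Longrightarrow> a \<le> m \<Longrightarrow> a = m" by (auto simp: P_def)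
  have "\<forall>x\<in>U. q' x = m x" if q': "sublin U q'" "\<forall>x\<in>U. q' x \<le> m x" for q'
  proof -
    let ?a = "\<lambda>x. if x \<in> U then q' x else 0"
    have "?a \<in> Q" using res[OF q'(1)] q' m(1) by (auto simp: Q_def intro: order.trans)
    moreover have "?a \<le> m" using q' m(1) by (auto simp: Q_def le_fun_def)
    ultimately have "?a = m" by (rule m(2))
    then show ?thesis using fun_cong[of ?a m] by (metis (full_types))
  qed
  then show ?thesis using m(1) by (intro exI[of _ m]) (auto simp: Q_def)
qed

lemma minimal_sublin_linear:
  assumes q: "sublin U q"
    and min: "\<And>q'. sublin U q' \<Longrightarrow> (\<And>x. x \<in> U \<Longrightarrow> q' x \<le> q x) \<Longrightarrow> (\<And>x. x \<in> U \<Longrightarrow> q' x = q x)"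
  shows "x \<in> U \<Longrightarrow> y \<in> U \<Longrightarrow> q (x + y) = q x + q y" "x \<in> U \<Longrightarrow> q (complex_of_real r *\<^sub>C x) = r * q x"
proof -
  have add: "q (x + y) = q x + q y" if x: "x \<in> U" and y: "y \<in> U" for x y
  proof -
    have yn: "- y \<in> U" using complex_vec.subspace_neg[OF U y] .
    have B: "{y} \<subseteq> U" "{y} \<noteq> {}" "convex_in {y}" 
      using y by (auto simp: convex_in_def simp flip: scaleC_add_left of_real_add)
    have c: "\<And>a. a \<in> {y} \<Longrightarrow> q y \<le> q a" by auto
    note L = lower_props[OF q B c]
    have "q (- y) \<le> - q y" using L(3) min[OF L(1) L(2) yn] by auto
    moreover have "q ((x + y) + (- y)) \<le> q (x + y) + q (- y)"
      by (rule sublinD(1)[OF q complex_vec.subspace_add[OF U x y] yn])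
    moreover have "q (x + y) \<le> q x + q y" by (rule sublinD(1)[OF q x y])
    ultimately show ?thesis by simp
  qed
  show "q (x + y) = q x + q y" if "x \<in> U" "y \<in> U" using add[OF that] .
  show "q (complex_of_real r *\<^sub>C x) = r * q x" if x: "x \<in> U"
  proof (cases "0 \<le> r")
    case True
    then show ?thesis by (rule sublin_scale[OF q x])
  next
    case False
    let ?z = "complex_of_real (- r) *\<^sub>C x"
    have z: "?z \<in> U" using complex_vec.subspace_scale[OF U x] .
    have "q ?z + q (- ?z) = 0" using add[OF z complex_vec.subspace_neg[OF U z]] sublin_0[OF q] by simp
    moreover have "q ?z = - r * q x" using False by (intro sublin_scale[OF q x]) auto
    moreover have "- ?z = complex_of_real r *\<^sub>C x" by simp
    ultimately show ?thesis by simp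
  qed
qed

text \<open>Domination and separation in one statement: \<open>A\<close> is a convex set at distance at least \<open>c\<close> from
  the origin, and the functional of norm at most one keeps it at that distance. A minimal sublinear
  functional below \<open>lower p A c\<close> is real linear; its complexification has the same norm by rotation.\<close>

theorem Hahn_Banach_convex:
  fixes p :: "'a \<Rightarrow> real"
  assumes padd: "\<And>x y. x \<in> U \<Longrightarrow> y \<in> U \<Longrightarrow> p (x + y) \<le> p x + p y"
    and psc: "\<And>x c. x \<in> U \<Longrightarrow> p (c *\<^sub>C x) = cmod c * p x"
    and A: "A \<subseteq> U" "A \<noteq> {}" "convex_in A" and c: "\<And>a. a \<in> A \<Longrightarrow> c \<le> p a"
  shows "\<exists>g :: 'a \<Rightarrow> complex. linear_on U g \<and> (\<forall>x\<in>U. cmod (g x) \<le> p x) \<and> (\<forall>a\<in>A. c \<le> Re (g a))"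
proof -
  have p: "sublin U p" using padd psc by (auto simp: sublin_def)
  note L = lower_props[OF p A c]
  obtain f where f: "sublin U f" "\<And>x. x \<in> U \<Longrightarrow> f x \<le> lower p A c x"
    and min: "\<And>q' x. sublin U q' \<Longrightarrow> (\<And>x. x \<in> U \<Longrightarrow> q' x \<le> f x) \<Longrightarrow> x \<in> U \<Longrightarrow> q' x = f x"
    using minimal_sublin_exists[OF L(1)] by blast
  have fl: "f (x + y) = f x + f y" "f (complex_of_real r *\<^sub>C x) = r * f x" if "x \<in> U" "y \<in> U" for x y r
  proof -
    show "f (x + y) = f x + f y" by (rule minimal_sublin_linear(1)[OF f(1)]) (use min that in blast)+
    show "f (complex_of_real r *\<^sub>C x) = r * f x" by (rule minimal_sublin_linear(2)[OF f(1)]) (use min that in blast)+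
  qed
  have fp: "f x \<le> p x" if "x \<in> U" for x using f(2)[OF that] L(2)[OF _ that] by fastforce
  define g where "g x = complex_of_real (f x) - \<i> * complex_of_real (f (\<i> *\<^sub>C x))" for x
  have iU: "\<i> *\<^sub>C x \<in> U" if "x \<in> U" for x using complex_vec.subspace_scale[OF U that] .
  have gadd: "g (x + y) = g x + g y" if "x \<in> U" "y \<in> U" for x y
    using that by (simp add: g_def fl(1) iU complex_vec.scale_right_distrib algebra_simps)
  have gsc: "g (d *\<^sub>C x) = d * g x" if x: "x \<in> U" for d x
  proof -
    have rU: "\<And>r. complex_of_real r *\<^sub>C x \<in> U" "\<And>r. complex_of_real r *\<^sub>C \<i> *\<^sub>C x \<in> U"
      using complex_vec.subspace_scale[OF U] x iU by auto
    have d: "d *\<^sub>C x = complex_of_real (Re d) *\<^sub>C x + complex_of_real (Im d) *\<^sub>C \<i> *\<^sub>C x"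
      by (simp add: complex_eq flip: scaleC_add_left) (metis complex_eq mult.commute)
    have id: "\<i> *\<^sub>C d *\<^sub>C x = complex_of_real (Re d) *\<^sub>C \<i> *\<^sub>C x + complex_of_real (- Im d) *\<^sub>C x"
    proof -
      have "\<i> * d = complex_of_real (Re d) * \<i> + complex_of_real (- Im d)" by (simp add: complex_eq_iff)
      then show ?thesis unfolding scaleC_scaleC by (metis scaleC_add_left)
    qed
    have "f (d *\<^sub>C x) = Re d * f x + Im d * f (\<i> *\<^sub>C x)"
      unfolding d by (subst fl(1)[OF rU]) (simp only: fl(2)[OF _ x] x iU)
    moreover have "f (\<i> *\<^sub>C d *\<^sub>C x) = Re d * f (\<i> *\<^sub>C x) - Im d * f x"
      unfolding id by (subst fl(1)[OF rU(2,1)]) (simp only: fl(2)[OF _ x] x iU)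
    ultimately show ?thesis by (simp add: g_def complex_eq_iff)
  qed
  have "linear_on U g" using gadd gsc by (simp add: linear_on_def scaleC_complex_def)
  moreover have "cmod (g x) \<le> p x" if x: "x \<in> U" for x
  proof (cases "g x = 0")
    case True
    have "0 \<le> p x" using sublin_neg[OF p x] psc[OF x, of "-1"] by simp
    then show ?thesis using True by simp
  next
    case False
    define d where "d = cnj (g x) / cmod (g x)"
    have "g (d *\<^sub>C x) = complex_of_real (cmod (g x))"
      using False unfolding gsc[OF x] d_def 
      by (simp add: complex_norm_square[symmetric] mult.commute power2_eq_square)
    then have "cmod (g x) = f (d *\<^sub>C x)" by (simp add: g_def complex_eq_iff)
    also have "\<dots> \<le> p (d *\<^sub>C x)" using fp complex_vec.subspace_scale[OF U x] by auto
    also have "\<dots> = p x" using psc[OF x] False by (simp add: d_def norm_divide)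
    finally show ?thesis .
  qed
  moreover have "c \<le> Re (g a)" if "a \<in> A" for a
  proof -
    have a: "a \<in> U" using that A by auto
    have "f (- a) \<le> - c" using f(2)[OF complex_vec.subspace_neg[OF U a]] L(3)[OF _ that] by fastforce
    moreover have "f (- a) = - f a" using fl(2)[OF a a, of "-1"] by simp
    ultimately show ?thesis by (simp add: g_def)
  qed
  ultimately show ?thesis by blast
qed

end

section \<open>Positivity is determined by the norm and the unit\<close>

text \<open>The matrix \<open>t + x\<close>. As \<open>t\<close> grows, \<open>\<parallel>t + x\<parallel> - t\<close> tends to the maximum of the real part of the
  numerical range of \<open>x\<close>; this is how positivity is read off from the norm and the unit.\<close>

definition shift :: "'h::complex_vector hilb \<Rightarrow> real \<Rightarrow> (nat \<Rightarrow> nat \<Rightarrow> 'h \<Rightarrow> 'h) \<Rightarrow> nat \<Rightarrow> nat \<Rightarrow> 'h \<Rightarrow> 'h" where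
  "shift H t x i j = complex_of_real t *\<^sub>C id_mat H i j + x i j"

definition dissipative :: "'h::complex_vector hilb \<Rightarrow> nat \<Rightarrow> (nat \<Rightarrow> nat \<Rightarrow> 'h \<Rightarrow> 'h) \<Rightarrow> bool" where
  "dissipative H n x \<longleftrightarrow> (\<forall>\<zeta>. vec H n \<zeta> \<longrightarrow> Re (mform H n x \<zeta> \<zeta>) \<le> 0)"

lemma shift_mats:
  assumes "complex_vec.subspace X" "id_op H \<in> X" "x \<in> mats n X"
  shows "shift H t x \<in> mats n X"
  using assms complex_vec.subspace_0[OF assms(1)] complex_vec.subspace_add[OF assms(1)] complex_vec.subspace_scale[OF assms(1)]
  by (auto simp: mats_def shift_def id_mat_def)

lemma scale_mats:
  assumes "complex_vec.subspace X" "x \<in> mats n X"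
  shows "(\<lambda>i j. c *\<^sub>C x i j) \<in> mats n X"
  using assms complex_vec.subspace_scale[OF assms(1)] by (auto simp: mats_def)

context pre_hilb
begin

text \<open>Expand \<open>\<parallel>t x + T x\<parallel>\<^sup>2\<close>.\<close>

lemma op_norm_shift_le:
  assumes T: "T \<in> bounded_ops H" and t: "0 \<le> t" and c: "0 \<le> c"
    and s: "\<And>x. x \<in> CH \<Longrightarrow> Re (ip (T x) x) \<le> s * (nm x)\<^sup>2"
    and tc: "t\<^sup>2 + 2 * t * s + (op_norm H T)\<^sup>2 \<le> c\<^sup>2"
    and S: "\<And>x. x \<in> CH \<Longrightarrow> S x = complex_of_real t *\<^sub>C x + T x"
  shows "op_norm H S \<le> c"
proof (rule op_norm_leI[OF c])
  fix x assume x: "x \<in> CH"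
  have Tx: "T x \<in> CH" by (rule bopD(1)[OF T x])
  have "Re (ip (complex_of_real t *\<^sub>C x) (T x)) = t * Re (ip (T x) x)"
    using herm[OF Tx x] x Tx by (simp add: ip_scale_left)
  also have "\<dots> \<le> t * (s * (nm x)\<^sup>2)" using s[OF x] t by (rule mult_left_mono)
  finally have 1: "Re (ip (complex_of_real t *\<^sub>C x) (T x)) \<le> t * s * (nm x)\<^sup>2" by simp
  have 2: "(nm (T x))\<^sup>2 \<le> (op_norm H T)\<^sup>2 * (nm x)\<^sup>2"
    unfolding power_mult_distrib[symmetric]
    by (rule power_mono[OF op_norm_bound[OF T x] nm_ge_0[OF Tx]])
  have 3: "nm (complex_of_real t *\<^sub>C x) = t * nm x" using nm_scale[OF x] t by simp
  have "(nm (S x))\<^sup>2 = t\<^sup>2 * (nm x)\<^sup>2 + 2 * Re (ip (complex_of_real t *\<^sub>C x) (T x)) + (nm (T x))\<^sup>2"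
    using nm_add_sq[OF mem_scale[OF x, of "complex_of_real t"] Tx] by (simp add: S[OF x] 3 power_mult_distrib)
  also have "\<dots> \<le> (t\<^sup>2 + 2 * t * s + (op_norm H T)\<^sup>2) * (nm x)\<^sup>2"
    using 1 2 by (simp add: algebra_simps)
  also have "\<dots> \<le> c\<^sup>2 * (nm x)\<^sup>2" using tc by (rule mult_right_mono) simp
  finally have "(nm (S x))\<^sup>2 \<le> (c * nm x)\<^sup>2" by (simp add: power_mult_distrib)
  then show "nm (S x) \<le> c * nm x" by (rule power2_le_imp_le) (use c nm_ge_0[OF x] in simp)
qed

lemma mform_shift:
  assumes "x \<in> mats n (bounded_ops H)" "vec H n \<zeta>"
  shows "mform H n (shift H t x) \<zeta> \<zeta> = complex_of_real (t * (vnorm H n \<zeta>)\<^sup>2) + mform H n x \<zeta> \<zeta>"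
  unfolding shift_def
  by (simp add: mform_add[OF scale_mats[OF subspace_bop id_mat_mats] assms(1) assms(2,2)]
     mform_scale[OF id_mat_mats assms(2,2)] mform_id_diag[OF assms(2)])

lemma mat_norm_shift_le:
  assumes x: "x \<in> mats n (bounded_ops H)" and t: "0 \<le> t" and c: "0 \<le> c"
    and s: "\<And>\<zeta>. vec H n \<zeta> \<Longrightarrow> Re (mform H n x \<zeta> \<zeta>) \<le> s * (vnorm H n \<zeta>)\<^sup>2"
    and tc: "t\<^sup>2 + 2 * t * s + (mat_norm H n x)\<^sup>2 \<le> c\<^sup>2"
  shows "mat_norm H n (shift H t x) \<le> c"
  unfolding mat_norm_def
proof (rule pre_hilb.op_norm_shift_le[OF pre_hilb_power mat_op_bop[OF x] t c _ tc[unfolded mat_norm_def]])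
  fix \<zeta> assume z: "\<zeta> \<in> hcarrier (hilb_power H n)"
  have v: "vec H n \<zeta>" using z by (simp add: hilb_power_carrier)
  show "Re (hinner (hilb_power H n) (mat_op H n x \<zeta>) \<zeta>) \<le> s * (hnorm (hilb_power H n) \<zeta>)\<^sup>2"
    using s[OF v] by (simp add: mform_mat_op[OF x z z] hilb_power_norm[OF z])
  show "mat_op H n (shift H t x) \<zeta> = complex_of_real t *\<^sub>C \<zeta> + mat_op H n x \<zeta>"
  proof
    fix i
    have "(\<Sum>j<n. shift H t x i j (\<zeta> j)) = complex_of_real t *\<^sub>C \<zeta> i + (\<Sum>j<n. x i j (\<zeta> j))" if i: "i < n"
    proof -
      have "shift H t x i j (\<zeta> j) = (if i = j then complex_of_real t *\<^sub>C \<zeta> i else 0) + x i j (\<zeta> j)" if "j < n" for j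
        using vecD[OF v that] by (simp add: shift_def id_mat_def id_op_def scaleC_fun_def)
      then show ?thesis using i by (simp add: sum.distrib)
    qed
    then show "mat_op H n (shift H t x) \<zeta> i = (complex_of_real t *\<^sub>C \<zeta> + mat_op H n x \<zeta>) i"
      using z by (simp add: mat_op_def scaleC_fun_def hilb_power_carrier)
  qed
qed

lemma mat_norm_shift_ge:
  assumes x: "x \<in> mats n (bounded_ops H)" and v: "vec H n \<zeta>" "vnorm H n \<zeta> = 1"
  shows "t + Re (mform H n x \<zeta> \<zeta>) \<le> mat_norm H n (shift H t x)"
proof -
  have "Re (mform H n (shift H t x) \<zeta> \<zeta>) \<le> mat_norm H n (shift H t x)"
    using mat_norm_bound[OF shift_mats[OF subspace_bop id_op_bop x] v(1,1)] complex_Re_le_cmod v(2)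
    by (metis mult.right_neutral order.trans)
  then show ?thesis using mform_shift[OF x v(1), of t] v(2) by simp
qed

lemma mform_homogeneous:
  assumes x: "x \<in> mats n (bounded_ops H)" and v: "vec H n \<zeta>"
  shows "mform H n x (\<lambda>i. complex_of_real r *\<^sub>C \<zeta> i) (\<lambda>i. complex_of_real r *\<^sub>C \<zeta> i) = complex_of_real (r\<^sup>2) * mform H n x \<zeta> \<zeta>"
proof -
  have "ip (x i j (complex_of_real r *\<^sub>C \<zeta> j)) (complex_of_real r *\<^sub>C \<zeta> i) = complex_of_real (r\<^sup>2) * ip (x i j (\<zeta> j)) (\<zeta> i)"
    if ij: "i < n" "j < n" for i j
    using linear_onD(2)[OF bopD(3)[OF matsD[OF x ij]] vecD[OF v ij(2)]] vecD[OF v ij(1)]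
      mats_app[OF x v ij] by (simp add: ip_scale_left ip_scale_right mem_scale power2_eq_square)
  then show ?thesis by (simp add: mform_def sum_distrib_left)
qed

lemma vnorm_scale:
  assumes "vec H n \<zeta>"
  shows "vnorm H n (\<lambda>i. c *\<^sub>C \<zeta> i) = cmod c * vnorm H n \<zeta>"
proof -
  have "(\<Sum>i<n. (nm (c *\<^sub>C \<zeta> i))\<^sup>2) = (\<Sum>i<n. (cmod c)\<^sup>2 * (nm (\<zeta> i))\<^sup>2)"
    using assms by (intro sum.cong) (auto simp: nm_scale vec_def power_mult_distrib)
  then show ?thesis by (simp add: vnorm_def sum_distrib_left[symmetric] real_sqrt_mult)
qed

lemma vec_scale: "vec H n \<zeta> \<Longrightarrow> vec H n (\<lambda>i. c *\<^sub>C \<zeta> i)"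
  by (simp add: vec_def mem_scale)

lemma unit_vec_obtain:
  assumes v: "vec H n \<zeta>" and 0: "vnorm H n \<zeta> \<noteq> 0"
  shows "vec H n (\<lambda>i. complex_of_real (1 / vnorm H n \<zeta>) *\<^sub>C \<zeta> i)"
    "vnorm H n (\<lambda>i. complex_of_real (1 / vnorm H n \<zeta>) *\<^sub>C \<zeta> i) = 1"
  using vec_scale[OF v] vnorm_scale[OF v, of "complex_of_real (1 / vnorm H n \<zeta>)"] 0 
  by (auto simp: norm_divide)

text \<open>If \<open>Re \<langle>x \<zeta>, \<zeta>\<rangle> = p > 0\<close> for a unit vector, then \<open>(t + p)\<^sup>2 \<le> t\<^sup>2 + \<parallel>x\<parallel>\<^sup>2\<close> fails for large \<open>t\<close>.\<close>

lemma dissipative_iff: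
  assumes x: "x \<in> mats n (bounded_ops H)"
  shows "dissipative H n x \<longleftrightarrow> (\<forall>t>0. mat_norm H n (shift H t x) \<le> sqrt (t\<^sup>2 + (mat_norm H n x)\<^sup>2))"
proof
  assume d: "dissipative H n x"
  show "\<forall>t>0. mat_norm H n (shift H t x) \<le> sqrt (t\<^sup>2 + (mat_norm H n x)\<^sup>2)"
    using d unfolding dissipative_def
    by (intro allI impI mat_norm_shift_le[OF x, where s=0]) auto
next
  assume *: "\<forall>t>0. mat_norm H n (shift H t x) \<le> sqrt (t\<^sup>2 + (mat_norm H n x)\<^sup>2)"
  show "dissipative H n x" unfolding dissipative_def
  proof (intro allI impI)
    fix \<zeta> assume v: "vec H n \<zeta>"
    show "Re (mform H n x \<zeta> \<zeta>) \<le> 0"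
    proof (cases "vnorm H n \<zeta> = 0")
      case True
      then show ?thesis using mat_norm_bound[OF x v v] by simp
    next
      case False
      define r where "r = 1 / vnorm H n \<zeta>"
      define \<eta> where "\<eta> = (\<lambda>i. complex_of_real r *\<^sub>C \<zeta> i)"
      define p where "p = Re (mform H n x \<eta> \<eta>)"
      have e: "vec H n \<eta>" "vnorm H n \<eta> = 1" using unit_vec_obtain[OF v False] by (auto simp: \<eta>_def r_def)
      have p: "p = r\<^sup>2 * Re (mform H n x \<zeta> \<zeta>)" unfolding p_def \<eta>_def mform_homogeneous[OF x v] by simp
      have "p \<le> 0"
      proof (rule ccontr)
        assume "\<not> p \<le> 0"
        then have pp: "p > 0" by simp
        \<comment> \<open>Chosen so that \<open>2 t p\<close> exceeds \<open>\<parallel>x\<parallel>\<^sup>2\<close> by \<open>1\<close>.\<close>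
        define t where "t = ((mat_norm H n x)\<^sup>2 + 1) / (2 * p)"
        have t: "t > 0" using pp by (simp add: t_def add_nonneg_pos)
        have "t + p \<le> sqrt (t\<^sup>2 + (mat_norm H n x)\<^sup>2)"
          using mat_norm_shift_ge[OF x e, of t] *[rule_format, OF t] by (simp add: p_def)
        then have "(t + p)\<^sup>2 \<le> t\<^sup>2 + (mat_norm H n x)\<^sup>2"
          using t pp by (metis add_nonneg_nonneg less_imp_le real_sqrt_le_iff real_sqrt_unique)
        then have "2 * t * p \<le> (mat_norm H n x)\<^sup>2" by (simp add: power2_sum) (smt (verit) zero_le_power2)
        moreover have "2 * t * p = (mat_norm H n x)\<^sup>2 + 1" using pp by (simp add: t_def)
        ultimately show False by simp
      qed
      moreover have "r\<^sup>2 > 0" using False by (simp add: r_def)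
      ultimately show ?thesis using p by (simp add: mult_le_0_iff)
    qed
  qed
qed

text \<open>Positivity confines the numerical range to a half-line, which is the intersection of three half
  planes; each of them is a dissipativity condition and hence a condition on norms.\<close>

lemma mat_positive_dissipative:
  assumes x: "x \<in> mats n (bounded_ops H)"
  shows "mat_positive H n x \<longleftrightarrow> dissipative H n (\<lambda>i j. (-1) *\<^sub>C x i j) \<and>
    dissipative H n (\<lambda>i j. \<i> *\<^sub>C x i j) \<and> dissipative H n (\<lambda>i j. (-\<i>) *\<^sub>C x i j)"
  unfolding mat_positive_iff[OF x] dissipative_def complex_nonneg_Reals_iff
proof (intro iffI conjI allI impI)
  fix \<zeta> assume v: "vec H n \<zeta>" and *: "\<forall>\<zeta>. vec H n \<zeta> \<longrightarrow> 0 \<le> Re (mform H n x \<zeta> \<zeta>) \<and> Im (mform H n x \<zeta> \<zeta>) = 0"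
  show "Re (mform H n (\<lambda>i j. (-1) *\<^sub>C x i j) \<zeta> \<zeta>) \<le> 0" "Re (mform H n (\<lambda>i j. \<i> *\<^sub>C x i j) \<zeta> \<zeta>) \<le> 0"
    "Re (mform H n (\<lambda>i j. (-\<i>) *\<^sub>C x i j) \<zeta> \<zeta>) \<le> 0"
    unfolding mform_scale[OF x v v] using *[rule_format, OF v] by simp_all
next
  fix \<zeta> assume v: "vec H n \<zeta>" and *: "(\<forall>\<zeta>. vec H n \<zeta> \<longrightarrow> Re (mform H n (\<lambda>i j. (-1) *\<^sub>C x i j) \<zeta> \<zeta>) \<le> 0) \<and>
     (\<forall>\<zeta>. vec H n \<zeta> \<longrightarrow> Re (mform H n (\<lambda>i j. \<i> *\<^sub>C x i j) \<zeta> \<zeta>) \<le> 0) \<and>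
     (\<forall>\<zeta>. vec H n \<zeta> \<longrightarrow> Re (mform H n (\<lambda>i j. (-\<i>) *\<^sub>C x i j) \<zeta> \<zeta>) \<le> 0)"
  note ** = *[THEN conjunct1, rule_format, OF v] *[THEN conjunct2, THEN conjunct1, rule_format, OF v]
    *[THEN conjunct2, THEN conjunct2, rule_format, OF v]
  show "0 \<le> Re (mform H n x \<zeta> \<zeta>)" "Im (mform H n x \<zeta> \<zeta>) = 0"
    using **[unfolded mform_scale[OF x v v]] by simp_all
qed

end

text \<open>A unital complete isometry preserves dissipativity in both directions, because it preserves the
  norms of all \<open>t + x\<close>. Positivity and adjoints follow.\<close>

locale unital_cisom = H: pre_hilb H + K: pre_hilb K
  for H :: "'h::complex_vector hilb" and K :: "'k::complex_vector hilb" +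
  fixes X :: "('h \<Rightarrow> 'h) set" and u :: "('h \<Rightarrow> 'h) \<Rightarrow> 'k \<Rightarrow> 'k"
  assumes Xb: "X \<subseteq> bounded_ops H" and Xs: "complex_vec.subspace X" and Xid: "id_op H \<in> X"
    and ub: "\<And>x. x \<in> X \<Longrightarrow> u x \<in> bounded_ops K"
    and ci: "completely_isometric H X K u" and uid: "u (id_op H) = id_op K"
begin

lemma ulin: "linear_on X u" and
  uiso: "x \<in> mats n X \<Longrightarrow> mat_norm K n (\<lambda>i j. u (x i j)) = mat_norm H n x"
  using ci by (auto simp: completely_isometric_def)

lemma u_mats: "x \<in> mats n X \<Longrightarrow> (\<lambda>i j. u (x i j)) \<in> mats n (bounded_ops K)"
  using ub by (auto simp: mats_def)

lemma u_id_mat: "u (id_mat H i j) = id_mat K i j"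
  by (simp add: id_mat_def uid linear_on_zero[OF ulin Xs])

lemma id_mat_X: "id_mat H i j \<in> X"
  by (simp add: id_mat_def Xid complex_vec.subspace_0[OF Xs])

lemma u_shift: "x \<in> mats n X \<Longrightarrow> i < n \<Longrightarrow> j < n \<Longrightarrow> u (shift H t x i j) = shift K t (\<lambda>i j. u (x i j)) i j"
  unfolding shift_def
  using linear_onD(1)[OF ulin complex_vec.subspace_scale[OF Xs id_mat_X] matsD]
    linear_onD(2)[OF ulin id_mat_X] u_id_mat by metis

lemma mat_norm_cong:
  assumes "\<And>i j. i < n \<Longrightarrow> j < n \<Longrightarrow> x i j = y i j"
  shows "mat_norm K n x = mat_norm K n y"
proof -
  have "mat_op K n x = mat_op K n y" using assms by (auto simp: mat_op_def fun_eq_iff intro!: sum.cong)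
  then show ?thesis by (simp add: mat_norm_def)
qed

lemma u_dissipative:
  assumes x: "x \<in> mats n X"
  shows "dissipative K n (\<lambda>i j. u (x i j)) \<longleftrightarrow> dissipative H n x"
proof -
  have "mat_norm K n (shift K t (\<lambda>i j. u (x i j))) = mat_norm H n (shift H t x)" for t
    using mat_norm_cong[of n "\<lambda>i j. u (shift H t x i j)" "shift K t (\<lambda>i j. u (x i j))"]
      u_shift[OF x] uiso[OF shift_mats[OF Xs Xid x]] by simp
  then show ?thesis
    by (simp add: H.dissipative_iff[OF mats_mono[OF x Xb]] K.dissipative_iff[OF u_mats[OF x]] uiso[OF x])
qed

lemma u_dissipative_scale:
  assumes x: "x \<in> mats n X"
  shows "dissipative K n (\<lambda>i j. c *\<^sub>C u (x i j)) \<longleftrightarrow> dissipative H n (\<lambda>i j. c *\<^sub>C x i j)"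
proof -
  have "mform K n (\<lambda>i j. c *\<^sub>C u (x i j)) \<zeta> \<zeta> = mform K n (\<lambda>i j. u (c *\<^sub>C x i j)) \<zeta> \<zeta>" for \<zeta>
    unfolding mform_def using linear_onD(2)[OF ulin matsD[OF x]] by (intro sum.cong) auto
  then show ?thesis using u_dissipative[OF scale_mats[OF Xs x], of c] by (simp add: dissipative_def)
qed

lemma u_positive:
  assumes x: "x \<in> mats n X"
  shows "mat_positive K n (\<lambda>i j. u (x i j)) \<longleftrightarrow> mat_positive H n x"
  by (simp only: H.mat_positive_dissipative[OF mats_mono[OF x Xb]] K.mat_positive_dissipative[OF u_mats[OF x]]
     u_dissipative_scale[OF x])

lemma u_inj: 
  assumes def: "\<And>a. a \<in> hcarrier H \<Longrightarrow> hinner H a a = 0 \<Longrightarrow> a = 0"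
  shows "inj_on u X"
proof (rule inj_onI)
  fix x y assume x: "x \<in> X" and y: "y \<in> X" and eq: "u x = u y"
  let ?d = "x - y"
  have d: "?d \<in> X" using complex_vec.subspace_diff[OF Xs x y] .
  have db: "?d \<in> bounded_ops H" using d Xb by auto
  have m: "(\<lambda>_ _. ?d) \<in> mats 1 X" using d by (simp add: mats_def)
  have "u ?d = 0" using linear_on_diff[OF ulin Xs x y] eq by simp
  then have "op_norm H ?d = 0"
    using uiso[OF m] H.mat_norm_1[OF db] K.mat_norm_1[OF K.bop_zero] K.op_norm_0 by simp
  then have "?d a = 0" if "a \<in> hcarrier H" for a
    using H.op_norm_bound[OF db that] H.nm_ge_0[OF H.bopD(1)[OF db that]] H.nm_sq[OF H.bopD(1)[OF db that]]
      def[OF H.bopD(1)[OF db that]] by auto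
  then have "?d = 0" by (intro H.bop_eqI[OF db H.bop_zero]) auto
  then show "x = y" by simp
qed

lemma u_real_diag:
  assumes x: "x \<in> X" and r: "\<And>a. a \<in> hcarrier H \<Longrightarrow> Im (hinner H (x a) a) = 0"
    and a: "a \<in> hcarrier K" "b \<in> hcarrier K"
  shows "hinner K (u x a) b = hinner K a (u x b)"
proof -
  have m: "(\<lambda>_ _. x) \<in> mats 1 X" using x by (simp add: mats_def)
  have mb: "(\<lambda>_ _. x) \<in> mats 1 (bounded_ops H)" using mats_mono[OF m Xb] .
  have d: "dissipative H 1 (\<lambda>_ _. c *\<^sub>C x)" if "c = \<i> \<or> c = - \<i>" for c
    unfolding dissipative_def
  proof (intro allI impI)
    fix \<zeta> assume v: "vec H 1 \<zeta>"
    show "Re (mform H 1 (\<lambda>_ _. c *\<^sub>C x) \<zeta> \<zeta>) \<le> 0"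
      unfolding H.mform_scale[OF mb v v] using that r[OF vecD[OF v, of 0]] by (auto simp: mform_def)
  qed
  have im: "Im (hinner K (u x e) e) = 0" if e: "e \<in> hcarrier K" for e
  proof -
    have v: "vec K 1 (\<lambda>_. e)" using e by (simp add: vec_def)
    have "Re (mform K 1 (\<lambda>_ _. c *\<^sub>C u x) (\<lambda>_. e) (\<lambda>_. e)) \<le> 0" if "c = \<i> \<or> c = - \<i>" for c
      using d[OF that] u_dissipative_scale[OF m, of c] v by (simp add: dissipative_def)
    from this[of \<i>] this[of "- \<i>"] show ?thesis
      unfolding K.mform_scale[OF u_mats[OF m] v v] by (auto simp: mform_def)
  qed
  note ul = linear_onD[OF K.bopD(3)[OF ub[OF x]]] and uc = K.bopD(1)[OF ub[OF x]]
  have "hinner K (u x b) a = cnj (hinner K (u x a) b)"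
    by (rule hermitian_if_real_diag[OF K.subsp, of "\<lambda>a b. hinner K (u x a) b"])
      (use a im in \<open>auto simp: ul uc K.ip_add_left K.ip_add_right K.ip_scale_left K.ip_scale_right\<close>)
  then show ?thesis using K.herm[OF uc[OF a(2)] a(1)] by simp
qed

text \<open>Both \<open>x + x'\<close> and \<open>\<i> (x - x')\<close> have real numerical range, so their images are hermitian.\<close>

lemma u_adjoint:
  assumes x: "x \<in> X" "x' \<in> X" and adj: "is_adjoint H x x'"
  shows "is_adjoint K (u x) (u x')"
  unfolding is_adjoint_def
proof (intro conjI ballI ub[OF x(2)])
  fix a b assume a: "a \<in> hcarrier K" and b: "b \<in> hcarrier K"
  have xb: "x \<in> bounded_ops H" "x' \<in> bounded_ops H" using x Xb by auto
  define y z where "y = x + x'" and "z = \<i> *\<^sub>C (x - x')"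
  have yz: "y \<in> X" "z \<in> X" unfolding y_def z_def
    using x Xs complex_vec.subspace_add complex_vec.subspace_diff complex_vec.subspace_scale by metis+
  have A: "hinner H (x' c) c = cnj (hinner H (x c) c)" if c: "c \<in> hcarrier H" for c
    using adj c H.herm[OF c H.bopD(1)[OF xb(2) c]] by (auto simp: is_adjoint_def)
  have Im: "Im (hinner H (y c) c) = 0" "Im (hinner H (z c) c) = 0" if c: "c \<in> hcarrier H" for c
    using A[OF c] H.bopD(1)[OF xb(1) c] H.bopD(1)[OF xb(2) c] c
    by (auto simp: y_def z_def scaleC_fun_def H.ip_add_left H.ip_scale_left H.ip_diff_left H.mem_diff)
  have uy: "u y = u x + u x'" unfolding y_def by (rule linear_onD(1)[OF ulin x])
  have uz: "u z = \<i> *\<^sub>C (u x - u x')" unfolding z_def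
    using linear_onD(2)[OF ulin complex_vec.subspace_diff[OF Xs x]] linear_on_diff[OF ulin Xs x] by simp
  note c = K.bopD(1)[OF ub[OF x(1)]] K.bopD(1)[OF ub[OF x(2)]]
  have 1: "hinner K (u x a) b + hinner K (u x' a) b = hinner K a (u x b) + hinner K a (u x' b)"
    using u_real_diag[OF yz(1) Im(1) a b] c a b by (simp add: uy K.ip_add_left K.ip_add_right)
  have 2: "\<i> * (hinner K (u x a) b - hinner K (u x' a) b) = - \<i> * (hinner K a (u x b) - hinner K a (u x' b))"
    using u_real_diag[OF yz(2) Im(2) a b] c a b
    by (simp add: uz scaleC_fun_def K.ip_scale_left K.ip_scale_right K.ip_diff_left K.ip_diff_right K.mem_diff)
  have "\<i> * (hinner K (u x a) b - hinner K (u x' a) b) = \<i> * (hinner K a (u x' b) - hinner K a (u x b))"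
    using 2 by (simp add: algebra_simps)
  then have "hinner K (u x a) b - hinner K (u x' a) b = hinner K a (u x' b) - hinner K a (u x b)"
    by (metis mult_left_cancel complex_i_not_zero)
  with 1 show "hinner K (u x a) b = hinner K a (u x' b)" by (simp add: complex_eq_iff)
qed

lemma u_order_iso:
  assumes def: "\<And>a. a \<in> hcarrier H \<Longrightarrow> hinner H a a = 0 \<Longrightarrow> a = 0"
  shows "complete_order_isomorphism H X K (u ` X) u"
proof -
  note inj = u_inj[OF def]
  have inv: "inv_into X u (u x) = x" if "x \<in> X" for x using inv_into_f_f[OF inj that] .
  have "completely_positive H X K u"
    unfolding completely_positive_def using ulin u_positive by auto
  moreover have "completely_positive K (u ` X) H (inv_into X u)"
    unfolding completely_positive_def
  proof (intro conjI allI ballI impI)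
    show "linear_on (u ` X) (inv_into X u)"
      unfolding linear_on_def
      using linear_onD[OF ulin, symmetric] complex_vec.subspace_add[OF Xs] complex_vec.subspace_scale[OF Xs] 
      by (auto simp: inv)
    fix n y assume y: "y \<in> mats n (u ` X)" and p: "mat_positive K n y"
    define x where "x = (\<lambda>i j. if i < n \<and> j < n then inv_into X u (y i j) else 0)"
    have x: "x \<in> mats n X" using y by (auto simp: mats_def x_def intro: inv_into_into)
    have "u (x i j) = y i j" if "i < n" "j < n" for i j
      using f_inv_into_f[OF matsD[OF y that]] that by (simp add: x_def)
    then have "mat_op K n (\<lambda>i j. u (x i j)) = mat_op K n y" 
      by (auto simp: mat_op_def fun_eq_iff intro!: sum.cong)
    then have "mat_positive H n x" using u_positive[OF x] p by (simp add: mat_positive_def)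
    moreover have "mat_op H n x = mat_op H n (\<lambda>i j. inv_into X u (y i j))"
      by (auto simp: mat_op_def x_def fun_eq_iff intro!: sum.cong)
    ultimately show "mat_positive H n (\<lambda>i j. inv_into X u (y i j))" by (simp add: mat_positive_def)
  qed
  ultimately show ?thesis using inj by (simp add: complete_order_isomorphism_def bij_betw_def)
qed

lemma u_operator_system:
  assumes "operator_system H X"
  shows "operator_system K (u ` X)"
  unfolding operator_system_def
proof (intro conjI ballI)
  show "complex_vec.subspace (u ` X)"
  proof (rule complex_vec.subspaceI)
    show "0 \<in> u ` X" using linear_on_zero[OF ulin Xs] complex_vec.subspace_0[OF Xs] by force
    fix x y assume "x \<in> u ` X" "y \<in> u ` X"
    then show "x + y \<in> u ` X" using linear_onD(1)[OF ulin, symmetric] complex_vec.subspace_add[OF Xs] by auto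
  next
    fix c x assume "x \<in> u ` X"
    then show "c *\<^sub>C x \<in> u ` X" using linear_onD(2)[OF ulin, symmetric] complex_vec.subspace_scale[OF Xs] by auto
  qed
  fix T assume "T \<in> u ` X"
  then obtain x where x: "x \<in> X" "T = u x" by auto
  then obtain x' where "x' \<in> X" "is_adjoint H x x'" using assms by (auto simp: operator_system_def)
  then show "\<exists>T'\<in>u ` X. is_adjoint K T T'" using u_adjoint x by auto
qed (use ub uid Xid in force)+

end

section \<open>Operator space duality as a pairing\<close>

locale hilb = pre_hilb H for H :: "'h::complex_vector hilb" +
  assumes definite: "x \<in> hcarrier H \<Longrightarrow> hinner H x x = 0 \<Longrightarrow> x = 0"
    and complete: "(\<And>k::nat. s k \<in> hcarrier H) \<Longrightarrow> (\<And>e. e > 0 \<Longrightarrow> \<exists>N. \<forall>k\<ge>N. \<forall>l\<ge>N. hnorm H (s k - s l) < e) \<Longrightarrow>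
      \<exists>x\<in>hcarrier H. (\<lambda>k. hnorm H (s k - x)) \<longlonglongrightarrow> 0"

lemma hilbert_hilb:
  assumes "hilbert_space H"
  shows "hilb H"
proof -
  interpret pre_hilb H by (rule hilbert_pre_hilb[OF assms])
  note h = assms[unfolded hilbert_space_def]
  show ?thesis
  proof
    show "x = 0" if "x \<in> hcarrier H" "hinner H x x = 0" for x
      using h[THEN conjunct2, THEN conjunct2, THEN conjunct2, THEN conjunct1] that by blast
    show "\<exists>x\<in>hcarrier H. (\<lambda>k. hnorm H (s k - x)) \<longlonglongrightarrow> 0"
      if "\<And>k::nat. s k \<in> hcarrier H" "\<And>e. e > 0 \<Longrightarrow> \<exists>N. \<forall>k\<ge>N. \<forall>l\<ge>N. hnorm H (s k - s l) < e" for s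
      using h[THEN conjunct2, THEN conjunct2, THEN conjunct2, THEN conjunct2, rule_format, of s] that by blast
  qed
qed

context hilb
begin

lemma nm_eq_0: "x \<in> CH \<Longrightarrow> nm x = 0 \<Longrightarrow> x = 0"
  using definite nm_sq[of x] by simp

text \<open>The pointwise limit exists because the space is complete; the Cauchy estimate is uniform on the
  unit ball, so the convergence is in norm.\<close>

lemma bounded_ops_complete:
  fixes T :: "nat \<Rightarrow> 'h \<Rightarrow> 'h"
  assumes T: "\<And>k. T k \<in> bounded_ops H"
    and Cauchy: "\<And>e. e > 0 \<Longrightarrow> \<exists>N. \<forall>k\<ge>N. \<forall>l\<ge>N. op_norm H (T k - T l) < e"
  shows "\<exists>S\<in>bounded_ops H. (\<lambda>k. op_norm H (T k - S)) \<longlonglongrightarrow> 0"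
proof -
  have Td: "T k - T l \<in> bounded_ops H" for k l
    using complex_vec.subspace_diff[OF subspace_bop T T] .
  have app: "nm (T k x - T l x) \<le> op_norm H (T k - T l) * nm x" if "x \<in> CH" for k l x
    using op_norm_bound[OF Td that] by simp
  have Tx: "T k x \<in> CH" if "x \<in> CH" for k x using bopD(1)[OF T that] .
  have "\<exists>y\<in>CH. (\<lambda>k. nm (T k x - y)) \<longlonglongrightarrow> 0" if x: "x \<in> CH" for x
  proof (rule complete[OF Tx[OF x]])
    fix e :: real assume e: "e > 0"
    obtain N where N: "\<forall>k\<ge>N. \<forall>l\<ge>N. op_norm H (T k - T l) < e / (nm x + 1)"
      using Cauchy[of "e / (nm x + 1)"] e nm_ge_0[OF x] by (auto simp: add_nonneg_pos)
    have "nm (T k x - T l x) < e" if "k \<ge> N" "l \<ge> N" for k l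
    proof -
      have "nm (T k x - T l x) \<le> e / (nm x + 1) * nm x"
        using app[OF x, of k l] N that nm_ge_0[OF x] by (smt (verit) mult_right_mono)
      also have "\<dots> < e" using e nm_ge_0[OF x] by (simp add: field_simps)
      finally show ?thesis .
    qed
    then show "\<exists>N. \<forall>k\<ge>N. \<forall>l\<ge>N. nm (T k x - T l x) < e" by blast
  qed
  then obtain S0 where S0: "\<And>x. x \<in> CH \<Longrightarrow> S0 x \<in> CH" "\<And>x. x \<in> CH \<Longrightarrow> (\<lambda>k. nm (T k x - S0 x)) \<longlonglongrightarrow> 0"
    by metis
  define S where "S x = (if x \<in> CH then S0 x else 0)" for x
  have S: "\<And>x. x \<in> CH \<Longrightarrow> S x \<in> CH" "\<And>x. x \<in> CH \<Longrightarrow> (\<lambda>k. nm (T k x - S x)) \<longlonglongrightarrow> 0"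
    using S0 by (auto simp: S_def)
  have zero: "z = 0" if z: "z \<in> CH" and le: "\<And>k. nm z \<le> f k" and f: "f \<longlonglongrightarrow> 0" for z and f :: "nat \<Rightarrow> real"
    using LIMSEQ_le_const[OF f, of "nm z"] le nm_ge_0[OF z] nm_eq_0[OF z] by auto
  have lin: "linear_on CH S"
    unfolding linear_on_def
  proof (intro conjI ballI allI)
    fix x y assume x: "x \<in> CH" and y: "y \<in> CH"
    note xy = mem_add[OF x y]
    have "S (x + y) - (S x + S y) = 0"
    proof (rule zero)
      show "(\<lambda>k. nm (T k (x + y) - S (x + y)) + (nm (T k x - S x) + nm (T k y - S y))) \<longlonglongrightarrow> 0"
        using S(2)[OF xy] S(2)[OF x] S(2)[OF y] by (auto intro!: tendsto_eq_intros)
      fix k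
      have "S (x + y) - (S x + S y) = (S (x + y) - T k (x + y)) + ((T k x - S x) + (T k y - S y))"
        using linear_onD(1)[OF bopD(3)[OF T] x y, of k] by simp
      also have "nm \<dots> \<le> nm (S (x + y) - T k (x + y)) + nm ((T k x - S x) + (T k y - S y))"
        using S Tx x y xy by (intro nm_triangle mem_add mem_diff) auto
      also have "\<dots> \<le> nm (S (x + y) - T k (x + y)) + (nm (T k x - S x) + nm (T k y - S y))"
        using S Tx x y xy by (intro add_left_mono nm_triangle mem_diff) auto
      finally show "nm (S (x + y) - (S x + S y)) \<le> nm (T k (x + y) - S (x + y)) + (nm (T k x - S x) + nm (T k y - S y))"
        using nm_diff_commute[OF S(1)[OF xy] Tx[OF xy]] by simp
    qed (use S x y xy in \<open>auto intro!: mem_diff mem_add\<close>)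
    then show "S (x + y) = S x + S y" by simp
  next
    fix c x assume x: "x \<in> CH"
    note cx = mem_scale[OF x, of c]
    have "S (c *\<^sub>C x) - c *\<^sub>C S x = 0"
    proof (rule zero)
      show "(\<lambda>k. nm (T k (c *\<^sub>C x) - S (c *\<^sub>C x)) + cmod c * nm (T k x - S x)) \<longlonglongrightarrow> 0"
        using S(2)[OF cx] S(2)[OF x] by (auto intro!: tendsto_eq_intros)
      fix k
      have "S (c *\<^sub>C x) - c *\<^sub>C S x = (S (c *\<^sub>C x) - T k (c *\<^sub>C x)) + c *\<^sub>C (T k x - S x)"
        using linear_onD(2)[OF bopD(3)[OF T] x, of k c] by (simp add: complex_vec.scale_right_diff_distrib)
      also have "nm \<dots> \<le> nm (S (c *\<^sub>C x) - T k (c *\<^sub>C x)) + nm (c *\<^sub>C (T k x - S x))"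
        using S Tx x cx by (intro nm_triangle mem_scale mem_diff) auto
      finally show "nm (S (c *\<^sub>C x) - c *\<^sub>C S x) \<le> nm (T k (c *\<^sub>C x) - S (c *\<^sub>C x)) + cmod c * nm (T k x - S x)"
        using nm_diff_commute[OF S(1)[OF cx] Tx[OF cx]] nm_scale[OF mem_diff[OF Tx[OF x] S(1)[OF x]]] by simp
    qed (use S x cx in \<open>auto intro!: mem_diff mem_scale\<close>)
    then show "S (c *\<^sub>C x) = c *\<^sub>C S x" by simp
  qed
  have unif: "nm (T k x - S x) \<le> e * nm x" if N: "\<forall>k\<ge>N. \<forall>l\<ge>N. op_norm H (T k - T l) < e" and k: "k \<ge> N" and x: "x \<in> CH" for N k x and e :: real
  proof (rule LIMSEQ_le_const)
    show "(\<lambda>l. e * nm x + nm (T l x - S x)) \<longlonglongrightarrow> e * nm x"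
      using S(2)[OF x] by (auto intro!: tendsto_eq_intros)
    have "nm (T k x - S x) \<le> e * nm x + nm (T l x - S x)" if l: "l \<ge> N" for l
    proof -
      have "T k x - S x = (T k x - T l x) + (T l x - S x)" by simp
      also have "nm \<dots> \<le> nm (T k x - T l x) + nm (T l x - S x)"
        using S Tx x by (intro nm_triangle mem_diff) auto
      also have "nm (T k x - T l x) \<le> op_norm H (T k - T l) * nm x" by (rule app[OF x])
      also have "\<dots> \<le> e * nm x" using N k l nm_ge_0[OF x] by (intro mult_right_mono) (auto intro: less_imp_le)
      finally show ?thesis by simp
    qed
    then show "\<exists>N. \<forall>n\<ge>N. nm (T k x - S x) \<le> e * nm x + nm (T n x - S x)" by blast
  qed
  obtain N1 where N1: "\<forall>k\<ge>N1. \<forall>l\<ge>N1. op_norm H (T k - T l) < 1" using Cauchy[of 1] by auto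
  have "nm (S x) \<le> (op_norm H (T N1) + 1) * nm x" if x: "x \<in> CH" for x
  proof -
    have "S x = T N1 x - (T N1 x - S x)" by simp
    also have "nm \<dots> \<le> nm (T N1 x) + nm (T N1 x - S x)" using S Tx x by (intro nm_triangle_diff mem_diff) auto
    finally show ?thesis using unif[OF N1 order.refl x] op_norm_bound[OF T x, of N1] by (simp add: distrib_right)
  qed
  then have Sb: "S \<in> bounded_ops H" using lin S(1) by (auto simp: bounded_ops_def S_def)
  have "(\<lambda>k. op_norm H (T k - S)) \<longlonglongrightarrow> 0"
  proof (rule LIMSEQ_I)
    fix r :: real assume r: "0 < r"
    obtain N where N: "\<forall>k\<ge>N. \<forall>l\<ge>N. op_norm H (T k - T l) < r/2" using Cauchy[of "r/2"] r by auto
    have "norm (op_norm H (T k - S) - 0) < r" if "k \<ge> N" for k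
    proof -
      have "op_norm H (T k - S) \<le> r/2"
        using r unif[OF N that] by (intro op_norm_leI) auto
      moreover have "0 \<le> op_norm H (T k - S)"
        by (rule op_norm_ge_0[OF complex_vec.subspace_diff[OF subspace_bop T Sb]])
      ultimately show ?thesis using r by simp
    qed
    then show "\<exists>N. \<forall>k\<ge>N. norm (op_norm H (T k - S) - 0) < r" by blast
  qed
  then show ?thesis using Sb by blast
qed

end

definition sum_sq :: "nat \<Rightarrow> nat \<Rightarrow> (nat \<Rightarrow> nat \<Rightarrow> complex) \<Rightarrow> real" where
  "sum_sq m n a = (\<Sum>l<m. \<Sum>j<n. (cmod (a l j))\<^sup>2)"

lemma sum_sq_ge_0[simp]: "0 \<le> sum_sq m n a"
  by (simp add: sum_sq_def sum_nonneg)

text \<open>A matrix compressed by a scalar row and a scalar column. This is what makes every bounded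
  functional completely bounded with the same norm.\<close>

lemma (in pre_hilb) op_norm_compress:
  assumes v: "v \<in> mats m (bounded_ops H)"
  shows "op_norm H (\<Sum>k<m. \<Sum>l<m. (\<alpha> l * cnj (\<beta> k)) *\<^sub>C v k l)
    \<le> mat_norm H m v * sqrt (\<Sum>l<m. (cmod (\<alpha> l))\<^sup>2) * sqrt (\<Sum>k<m. (cmod (\<beta> k))\<^sup>2)"
proof (rule op_norm_le_formI)
  let ?T = "\<Sum>k<m. \<Sum>l<m. (\<alpha> l * cnj (\<beta> k)) *\<^sub>C v k l"
  have T: "?T \<in> bounded_ops H"
    using v by (intro complex_vec.subspace_sum[OF subspace_bop] bop_scale) (auto simp: mats_def)
  show "?T a \<in> CH" if "a \<in> CH" for a by (rule bopD(1)[OF T that])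
  show "0 \<le> mat_norm H m v * sqrt (\<Sum>l<m. (cmod (\<alpha> l))\<^sup>2) * sqrt (\<Sum>k<m. (cmod (\<beta> k))\<^sup>2)"
    using mat_norm_ge_0[OF v] by (intro mult_nonneg_nonneg real_sqrt_ge_zero sum_nonneg) auto
  fix a b assume a: "a \<in> CH" and b: "b \<in> CH"
  have va: "vec H m (\<lambda>l. \<alpha> l *\<^sub>C a)" and vb: "vec H m (\<lambda>k. \<beta> k *\<^sub>C b)" using a b by (auto simp: vec_def mem_scale)
  have nv: "vnorm H m (\<lambda>l. \<gamma> l *\<^sub>C c) = sqrt (\<Sum>l<m. (cmod (\<gamma> l))\<^sup>2) * nm c" if "c \<in> CH" for \<gamma> c
    using that nm_ge_0[OF that]
    by (simp add: vnorm_def nm_scale power_mult_distrib sum_distrib_right[symmetric] real_sqrt_mult)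
  have sumapp: "(\<Sum>k<m. g k) a = (\<Sum>k<m. g k a)" for g :: "nat \<Rightarrow> 'h \<Rightarrow> 'h"
    by (induction m) auto
  have ent: "v k l a \<in> CH" "v k l (\<alpha> l *\<^sub>C a) = \<alpha> l *\<^sub>C v k l a" if "k < m" "l < m" for k l
    using bopD(1)[OF matsD[OF v that] a] linear_onD(2)[OF bopD(3)[OF matsD[OF v that]] a] by auto
  have "ip (?T a) b = ip (\<Sum>k<m. \<Sum>l<m. (\<alpha> l * cnj (\<beta> k)) *\<^sub>C v k l a) b"
    by (simp add: sumapp scaleC_fun_def)
  also have "\<dots> = (\<Sum>k<m. ip (\<Sum>l<m. (\<alpha> l * cnj (\<beta> k)) *\<^sub>C v k l a) b)"
    by (rule ip_sum_left) (use ent b in \<open>auto intro!: mem_sum mem_scale\<close>)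
  also have "\<dots> = (\<Sum>k<m. \<Sum>l<m. ip ((\<alpha> l * cnj (\<beta> k)) *\<^sub>C v k l a) b)"
    by (intro sum.cong refl ip_sum_left) (use ent b in \<open>auto intro!: mem_scale\<close>)
  also have "\<dots> = mform H m v (\<lambda>l. \<alpha> l *\<^sub>C a) (\<lambda>k. \<beta> k *\<^sub>C b)"
    unfolding mform_def using ent b by (intro sum.cong refl) (simp add: ip_scale_left ip_scale_right mem_scale)
  finally show "cmod (ip (?T a) b) \<le> mat_norm H m v * sqrt (\<Sum>l<m. (cmod (\<alpha> l))\<^sup>2) * sqrt (\<Sum>k<m. (cmod (\<beta> k))\<^sup>2) * nm a * nm b"
    using mat_norm_bound[OF v va vb] by (simp add: nv a b mult_ac)
qed

lemma (in pre_hilb) mat_norm_single_entry: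
  assumes T: "T \<in> bounded_ops H" and pq: "p < n" "q < n"
  shows "mat_norm H n (\<lambda>i j. if i = p \<and> j = q then T else 0) \<le> op_norm H T"
proof (rule mat_norm_leI[OF _ op_norm_ge_0[OF T]])
  show "(\<lambda>i j. if i = p \<and> j = q then T else 0) \<in> mats n (bounded_ops H)"
    using T bop_zero by (auto simp: mats_def)
  fix \<zeta> \<eta> assume v: "vec H n \<zeta>" "vec H n \<eta>"
  have "(\<Sum>j<n. ip ((if i = p \<and> j = q then T else 0) (\<zeta> j)) (\<eta> i)) = (if i = p then ip (T (\<zeta> q)) (\<eta> p) else 0)" if "i < n" for i
  proof -
    have "ip ((if i = p \<and> j = q then T else 0) (\<zeta> j)) (\<eta> i) = (if j = q then (if i = p then ip (T (\<zeta> q)) (\<eta> p) else 0) else 0)" for j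
      using vecD[OF v(2) that] by simp
    then show ?thesis using pq by simp
  qed
  then have "mform H n (\<lambda>i j. if i = p \<and> j = q then T else 0) \<zeta> \<eta> = ip (T (\<zeta> q)) (\<eta> p)"
    using pq by (simp add: mform_def)
  also have "cmod \<dots> \<le> op_norm H T * nm (\<zeta> q) * nm (\<eta> p)"
    using v pq by (intro op_form_bound[OF T]) (auto simp: vec_def)
  also have "\<dots> \<le> op_norm H T * vnorm H n \<zeta> * vnorm H n \<eta>"
    using v pq op_norm_ge_0[OF T] by (intro mult_mono nm_le_vnorm mult_nonneg_nonneg nm_ge_0) (auto simp: vec_def)
  finally show "cmod (mform H n (\<lambda>i j. if i = p \<and> j = q then T else 0) \<zeta> \<eta>) \<le> op_norm H T * vnorm H n \<zeta> * vnorm H n \<eta>" .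
qed

lemma pre_hilb_complex: "pre_hilb complex_hilb"
  by standard (auto simp: complex_hilb_def linear_on_def scaleC_complex_def algebra_simps complex_nonneg_Reals_iff
     complex_vec.subspace_def)

interpretation CC: pre_hilb complex_hilb by (rule pre_hilb_complex)

lemma complex_hilb_simps[simp]: "hcarrier complex_hilb = UNIV" "hinner complex_hilb z w = z * cnj w"
  "hnorm complex_hilb z = cmod z"
  by (simp_all add: complex_hilb_def hnorm_def) (simp add: cmod_def power2_eq_square)

lemma mult_op_bop: "(\<lambda>z. a * z) \<in> bounded_ops complex_hilb"
  by (auto simp: bounded_ops_def linear_on_def scaleC_complex_def algebra_simps norm_mult intro!: exI[of _ "cmod a"])

lemma mform_mult:
  "mform complex_hilb n (\<lambda>i j z. f i j * z) a b = (\<Sum>i<n. \<Sum>j<n. f i j * a j * cnj (b i))"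
  by (simp add: mform_def)

lemma vec_complex[simp]: "vec complex_hilb n a"
  by (simp add: vec_def)

text \<open>The matrix \<open>b\<^sup>* v a\<close> for scalar matrices \<open>a\<close> and \<open>b\<close>.\<close>

definition amp :: "nat \<Rightarrow> (nat \<Rightarrow> nat \<Rightarrow> 'a::complex_vector) \<Rightarrow> (nat \<Rightarrow> nat \<Rightarrow> complex) \<Rightarrow> (nat \<Rightarrow> nat \<Rightarrow> complex) \<Rightarrow> nat \<Rightarrow> nat \<Rightarrow> 'a" where
  "amp m v a b i j = (\<Sum>k<m. \<Sum>l<m. (a l j * cnj (b k i)) *\<^sub>C v k l)"

lemma sum_swap4:
  "(\<Sum>k<(m::nat). \<Sum>l<m. \<Sum>i<(n::nat). \<Sum>j<n. f k l i j) = (\<Sum>i<n. \<Sum>j<n. \<Sum>k<m. \<Sum>l<m. (f k l i j :: complex))"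
proof -
  have "(\<Sum>k<m. \<Sum>l<m. \<Sum>i<n. \<Sum>j<n. f k l i j) = (\<Sum>k<m. \<Sum>i<n. \<Sum>l<m. \<Sum>j<n. f k l i j)"
    by (intro sum.cong refl sum.swap)
  also have "\<dots> = (\<Sum>k<m. \<Sum>i<n. \<Sum>j<n. \<Sum>l<m. f k l i j)"
    by (intro sum.cong refl sum.swap)
  also have "\<dots> = (\<Sum>i<n. \<Sum>k<m. \<Sum>j<n. \<Sum>l<m. f k l i j)"
    by (rule sum.swap)
  also have "\<dots> = (\<Sum>i<n. \<Sum>j<n. \<Sum>k<m. \<Sum>l<m. f k l i j)"
    by (intro sum.cong refl sum.swap)
  finally show ?thesis .
qed

text \<open>The hypotheses of the theorem. A matrix \<open>w\<close> over \<open>V\<close> acts on matrices over \<open>X\<close> by the scalar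
  pairing \<open>\<Sum>\<^sub>i\<^sub>j J x\<^sub>i\<^sub>j w\<^sub>i\<^sub>j\<close>, and in this way the matrices over \<open>V\<close> become a predual of \<open>M\<^sub>n(X)\<close>.\<close>

locale dual_system =
  fixes H :: "'h::complex_vector hilb" and X :: "('h \<Rightarrow> 'h) set"
    and L :: "'l::complex_vector hilb" and V :: "('l \<Rightarrow> 'l) set"
    and J :: "('h \<Rightarrow> 'h) \<Rightarrow> ('l \<Rightarrow> 'l) \<Rightarrow> complex"
  assumes hH: "hilbert_space H" and oX: "operator_system H X"
    and hL: "hilbert_space L" and oV: "operator_space L V"
    and di: "dual_identification H X L V J"

sublocale dual_system \<subseteq> H: hilb H by (rule hilbert_hilb[OF hH])
sublocale dual_system \<subseteq> L: hilb L by (rule hilbert_hilb[OF hL])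

context dual_system
begin

lemma Xb: "X \<subseteq> bounded_ops H" and Xs: "complex_vec.subspace X" and Xid: "id_op H \<in> X"
  using oX by (auto simp: operator_system_def)

lemma Vb: "V \<subseteq> bounded_ops L" and Vs: "complex_vec.subspace V"
  using oV by (auto simp: operator_space_def)

lemma matsX: "x \<in> mats n X \<Longrightarrow> x \<in> mats n (bounded_ops H)"
  using mats_mono[OF _ Xb] .

lemma matsV: "v \<in> mats n V \<Longrightarrow> v \<in> mats n (bounded_ops L)"
  using mats_mono[OF _ Vb] .

lemma J_dual: "x \<in> X \<Longrightarrow> J x \<in> dual_space L V"
  using di by (auto simp: dual_identification_def bij_betw_def)

lemma J_lin: "x \<in> X \<Longrightarrow> linear_on V (J x)"
  using J_dual by (auto simp: dual_space_def)

lemma J_bdd: "x \<in> X \<Longrightarrow> \<exists>M\<ge>0. \<forall>v\<in>V. cmod (J x v) \<le> M * op_norm L v"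
proof -
  assume "x \<in> X"
  from J_dual[OF this] obtain M where M: "\<And>v. v \<in> V \<Longrightarrow> cmod (J x v) \<le> M * op_norm L v"
    unfolding dual_space_def by blast
  have "cmod (J x v) \<le> \<bar>M\<bar> * op_norm L v" if "v \<in> V" for v
    using M[OF that] L.op_norm_ge_0[of v] Vb that mult_right_mono[of M "\<bar>M\<bar>" "op_norm L v"] by fastforce
  then show ?thesis by (intro exI[of _ "\<bar>M\<bar>"]) auto
qed

lemma J_add: "x \<in> X \<Longrightarrow> y \<in> X \<Longrightarrow> J (x + y) v = J x v + J y v"
  using di linear_onD(1)[of X J x y] by (simp add: dual_identification_def)

lemma J_scale: "x \<in> X \<Longrightarrow> J (c *\<^sub>C x) v = c * J x v"
  using di linear_onD(2)[of X J x c] by (simp add: dual_identification_def scaleC_fun_def scaleC_complex_def)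

lemma J_zero: "J 0 v = 0"
  using J_scale[OF complex_vec.subspace_0[OF Xs], of 0 v] by simp

lemma J_v_add: "x \<in> X \<Longrightarrow> v \<in> V \<Longrightarrow> w \<in> V \<Longrightarrow> J x (v + w) = J x v + J x w"
  using linear_onD(1)[OF J_lin] .

lemma J_v_scale: "x \<in> X \<Longrightarrow> v \<in> V \<Longrightarrow> J x (c *\<^sub>C v) = c * J x v"
  using linear_onD(2)[OF J_lin] by (simp add: scaleC_complex_def)

lemma J_v_zero: "x \<in> X \<Longrightarrow> J x 0 = 0"
  using linear_on_zero[OF J_lin Vs] .

lemma J_surj: "f \<in> dual_space L V \<Longrightarrow> \<exists>x\<in>X. J x = f"
  using di unfolding dual_identification_def bij_betw_def by (metis imageE)

lemma dual_form:
  fixes \<zeta> \<eta> :: "nat \<Rightarrow> nat \<Rightarrow> complex"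
  assumes z: "vec (hilb_power complex_hilb n) m \<zeta>" and e: "vec (hilb_power complex_hilb n) m \<eta>"
  shows "mform (hilb_power complex_hilb n) m (\<lambda>k l. mat_op complex_hilb n (\<lambda>i j z. f i j (v k l) * z)) \<zeta> \<eta>
    = (\<Sum>k<m. \<Sum>l<m. \<Sum>i<n. \<Sum>j<n. f i j (v k l) * \<zeta> l j * cnj (\<eta> k i))"
proof -
  interpret CC: pre_hilb complex_hilb by (rule pre_hilb_complex)
  have m: "(\<lambda>i j z. f i j (v k l) * z) \<in> mats n (bounded_ops complex_hilb)" for k l
    using mult_op_bop by (simp add: mats_def)
  show ?thesis unfolding mform_def[of "hilb_power complex_hilb n"]
  proof (intro sum.cong refl)
    fix k l assume "k \<in> {..<m}" "l \<in> {..<m}"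
    then show "hinner (hilb_power complex_hilb n) (mat_op complex_hilb n (\<lambda>i j z. f i j (v k l) * z) (\<zeta> l)) (\<eta> k)
      = (\<Sum>i<n. \<Sum>j<n. f i j (v k l) * \<zeta> l j * cnj (\<eta> k i))"
      using CC.mform_mat_op[OF m vecD[OF z] vecD[OF e]] by (simp add: mform_mult)
  qed
qed

lemma dual_vnorm: 
  assumes "vec (hilb_power complex_hilb n) m \<zeta>"
  shows "vnorm (hilb_power complex_hilb n) m \<zeta> = sqrt (sum_sq m n \<zeta>)"
proof -
  interpret CC: pre_hilb complex_hilb by (rule pre_hilb_complex)
  have "(hnorm (hilb_power complex_hilb n) (\<zeta> l))\<^sup>2 = (\<Sum>j<n. (cmod (\<zeta> l j))\<^sup>2)" if "l < m" for l
    using CC.hilb_power_norm[OF vecD[OF assms that]] by (simp add: vnorm_sq)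
  then show ?thesis by (simp add: vnorm_def sum_sq_def)
qed

lemma J_sum: 
  assumes "x \<in> X" "\<And>k l. k < m \<Longrightarrow> l < m \<Longrightarrow> v k l \<in> V"
  shows "J x (\<Sum>k<(m::nat). \<Sum>l<m. c k l *\<^sub>C v k l) = (\<Sum>k<m. \<Sum>l<m. c k l * J x (v k l))"
proof -
  have inner: "(\<Sum>l<m. c k l *\<^sub>C v k l) \<in> V" if "k < m" for k
    using assms that by (intro complex_vec.subspace_sum[OF Vs] complex_vec.subspace_scale[OF Vs]) auto
  have "J x (\<Sum>k<m. \<Sum>l<m. c k l *\<^sub>C v k l) = (\<Sum>k<m. J x (\<Sum>l<m. c k l *\<^sub>C v k l))"
    by (rule linear_on_sum[OF J_lin[OF assms(1)] Vs]) (use inner in auto)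
  also have "\<dots> = (\<Sum>k<m. \<Sum>l<m. c k l * J x (v k l))"
    using linear_on_lincomb[OF J_lin[OF assms(1)] Vs, of "{..<m}"] assms(2)
    by (intro sum.cong refl) (auto simp: scaleC_complex_def)
  finally show ?thesis .
qed

definition pairing :: "nat \<Rightarrow> (nat \<Rightarrow> nat \<Rightarrow> 'h \<Rightarrow> 'h) \<Rightarrow> (nat \<Rightarrow> nat \<Rightarrow> 'l \<Rightarrow> 'l) \<Rightarrow> complex" where
  "pairing n x w = (\<Sum>i<n. \<Sum>j<n. J (x i j) (w i j))"

lemma amp_V: "v \<in> mats m V \<Longrightarrow> amp m v a b i j \<in> V"
  unfolding amp_def
  by (intro complex_vec.subspace_sum[OF Vs] complex_vec.subspace_scale[OF Vs]) (auto simp: mats_def)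

text \<open>The amplification that defines the dual matrix norm, paired with two scalar matrices, is the
  pairing with an element of the predual of the form \<open>b\<^sup>* v a\<close>.\<close>

lemma dual_form_amp:
  assumes "x \<in> mats n X" "v \<in> mats m V"
  shows "(\<Sum>k<m. \<Sum>l<m. \<Sum>i<n. \<Sum>j<n. J (x i j) (v k l) * a l j * cnj (b k i)) = pairing n x (amp m v a b)"
proof -
  have "(\<Sum>k<m. \<Sum>l<m. \<Sum>i<n. \<Sum>j<n. J (x i j) (v k l) * a l j * cnj (b k i))
    = (\<Sum>i<n. \<Sum>j<n. \<Sum>k<m. \<Sum>l<m. J (x i j) (v k l) * a l j * cnj (b k i))"
    by (rule sum_swap4)
  also have "\<dots> = pairing n x (amp m v a b)"
    unfolding pairing_def amp_def
  proof (intro sum.cong refl)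
    fix i j assume "i \<in> {..<n}" "j \<in> {..<n}"
    then have "x i j \<in> X" using assms by (auto simp: mats_def)
    from J_sum[where c="\<lambda>k l. a l j * cnj (b k i)", OF this matsD[OF assms(2)]]
    show "(\<Sum>k<m. \<Sum>l<m. J (x i j) (v k l) * a l j * cnj (b k i))
      = J (x i j) (\<Sum>k<m. \<Sum>l<m. (a l j * cnj (b k i)) *\<^sub>C v k l)" by (simp add: mult_ac)
  qed
  finally show ?thesis .
qed

text \<open>The supremum that defines the dual matrix norm is finite; otherwise its value would say nothing
  about its members.\<close>

lemma amp_crude:
  assumes x: "x \<in> mats n X"
  shows "\<exists>M\<ge>0. \<forall>m v a b. v \<in> mats m V \<longrightarrow> mat_norm L m v \<le> 1 \<longrightarrow>
    cmod (pairing n x (amp m v a b)) \<le> M * sqrt (sum_sq m n a) * sqrt (sum_sq m n b)"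
proof -
  obtain B where B: "\<And>y. y \<in> X \<Longrightarrow> B y \<ge> 0" "\<And>y v. y \<in> X \<Longrightarrow> v \<in> V \<Longrightarrow> cmod (J y v) \<le> B y * op_norm L v"
    using J_bdd by metis
  define M where "M i j = B (x i j)" for i j
  have M: "\<And>i j. i < n \<Longrightarrow> j < n \<Longrightarrow> M i j \<ge> 0"
    "\<And>i j v. i < n \<Longrightarrow> j < n \<Longrightarrow> v \<in> V \<Longrightarrow> cmod (J (x i j) v) \<le> M i j * op_norm L v"
    using B matsD[OF x] by (auto simp: M_def)
  have le: "sqrt (\<Sum>l<m. (cmod (a l j))\<^sup>2) \<le> sqrt (sum_sq m n a)" if "j < n" for j m and a :: "nat \<Rightarrow> nat \<Rightarrow> complex"
    unfolding sum_sq_def using that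
    by (intro real_sqrt_le_mono sum_mono member_le_sum[where f="\<lambda>j. (cmod (a _ j))\<^sup>2"]) auto
  have "cmod (pairing n x (amp m v a b)) \<le> (\<Sum>i<n. \<Sum>j<n. M i j) * sqrt (sum_sq m n a) * sqrt (sum_sq m n b)"
    if v: "v \<in> mats m V" "mat_norm L m v \<le> 1" for m v a b
  proof -
    have "cmod (pairing n x (amp m v a b)) \<le> (\<Sum>i<n. \<Sum>j<n. cmod (J (x i j) (amp m v a b i j)))"
      unfolding pairing_def by (intro order.trans[OF norm_sum] sum_mono norm_sum)
    also have "\<dots> \<le> (\<Sum>i<n. \<Sum>j<n. M i j * (sqrt (sum_sq m n a) * sqrt (sum_sq m n b)))"
    proof (intro sum_mono)
      fix i j assume "i \<in> {..<n}" "j \<in> {..<n}"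
      then have ij: "i < n" "j < n" by auto
      have "op_norm L (amp m v a b i j) \<le> mat_norm L m v * sqrt (\<Sum>l<m. (cmod (a l j))\<^sup>2) * sqrt (\<Sum>k<m. (cmod (b k i))\<^sup>2)"
        unfolding amp_def by (rule L.op_norm_compress[OF matsV[OF v(1)]])
      also have "\<dots> \<le> 1 * sqrt (sum_sq m n a) * sqrt (sum_sq m n b)"
        using v le ij by (intro mult_mono mult_nonneg_nonneg real_sqrt_ge_zero sum_nonneg) auto
      finally have "M i j * op_norm L (amp m v a b i j) \<le> M i j * (sqrt (sum_sq m n a) * sqrt (sum_sq m n b))"
        using M(1)[OF ij] by (intro mult_left_mono) auto
      then show "cmod (J (x i j) (amp m v a b i j)) \<le> M i j * (sqrt (sum_sq m n a) * sqrt (sum_sq m n b))"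
        using M(2)[OF ij amp_V[OF v(1), of a b i j]] by linarith
    qed
    also have "\<dots> = (\<Sum>i<n. \<Sum>j<n. M i j) * sqrt (sum_sq m n a) * sqrt (sum_sq m n b)"
      by (simp add: sum_distrib_right mult.assoc)
    finally show ?thesis .
  qed
  then show ?thesis using M(1) by (intro exI[of _ "\<Sum>i<n. \<Sum>j<n. M i j"]) (auto intro!: sum_nonneg)
qed

definition dmat :: "nat \<Rightarrow> (nat \<Rightarrow> nat \<Rightarrow> 'h \<Rightarrow> 'h) \<Rightarrow> (nat \<Rightarrow> nat \<Rightarrow> 'l \<Rightarrow> 'l) \<Rightarrow> nat \<Rightarrow> nat \<Rightarrow> (nat \<Rightarrow> complex) \<Rightarrow> nat \<Rightarrow> complex" where
  "dmat n x v = (\<lambda>k l. mat_op complex_hilb n (\<lambda>i j z. J (x i j) (v k l) * z))"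

lemma dmat_mats: "dmat n x v \<in> mats m (bounded_ops (hilb_power complex_hilb n))"
  unfolding mats_def dmat_def 
  by (auto intro!: pre_hilb.mat_op_bop[OF pre_hilb_complex] simp: mult_op_bop mats_def)

lemma mat_norm_eq_Sup:
  "x \<in> mats n X \<Longrightarrow> mat_norm H n x = Sup {mat_norm (hilb_power complex_hilb n) m (dmat n x v) | m v. v \<in> mats m V \<and> mat_norm L m v \<le> 1}"
  using di unfolding dual_identification_def dual_mat_norm_def cb_norm_def dmat_def by auto

lemma dmat_form:
  assumes "x \<in> mats n X" "v \<in> mats m V" "vec (hilb_power complex_hilb n) m a" "vec (hilb_power complex_hilb n) m b"
  shows "mform (hilb_power complex_hilb n) m (dmat n x v) a b = pairing n x (amp m v a b)"
  unfolding dmat_def using dual_form[OF assms(3,4), of "\<lambda>i j. J (x i j)" v] dual_form_amp[OF assms(1,2), of a b] by simp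

lemma dmat_norm_le:
  assumes "x \<in> mats n X" "v \<in> mats m V" "0 \<le> c"
    "\<And>a b. cmod (pairing n x (amp m v a b)) \<le> c * sqrt (sum_sq m n a) * sqrt (sum_sq m n b)"
  shows "mat_norm (hilb_power complex_hilb n) m (dmat n x v) \<le> c"
  by (rule pre_hilb.mat_norm_leI[OF pre_hilb.pre_hilb_power[OF pre_hilb_complex] dmat_mats assms(3)])
    (simp add: dmat_form[OF assms(1,2)] dual_vnorm assms(4))

text \<open>Together with \<open>mat_norm_le_amp\<close> this replaces the definition of the dual matrix norm: the norm of
  \<open>M\<^sub>n(X)\<close> is the least constant in these inequalities.\<close>

lemma amp_bound:
  assumes x: "x \<in> mats n X" and v: "v \<in> mats m V" "mat_norm L m v \<le> 1"
  shows "cmod (pairing n x (amp m v a b)) \<le> mat_norm H n x * sqrt (sum_sq m n a) * sqrt (sum_sq m n b)"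
proof -
  obtain M where M: "M \<ge> 0" "\<And>m v a b. v \<in> mats m V \<Longrightarrow> mat_norm L m v \<le> 1 \<Longrightarrow>
    cmod (pairing n x (amp m v a b)) \<le> M * sqrt (sum_sq m n a) * sqrt (sum_sq m n b)"
    using amp_crude[OF x] by blast
  let ?S = "{mat_norm (hilb_power complex_hilb n) m (dmat n x v) | m v. v \<in> mats m V \<and> mat_norm L m v \<le> 1}"
  have "bdd_above ?S" unfolding bdd_above_def using dmat_norm_le[OF x _ M(1) M(2)] by blast
  then have 1: "mat_norm (hilb_power complex_hilb n) m (dmat n x v) \<le> mat_norm H n x"
    unfolding mat_norm_eq_Sup[OF x] using v by (intro cSup_upper) auto
  define a' b' where "a' = (\<lambda>l j. if j < n then a l j else 0)" and "b' = (\<lambda>l j. if j < n then b l j else 0)"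
  have vec: "vec (hilb_power complex_hilb n) m a'" "vec (hilb_power complex_hilb n) m b'"
    by (auto simp: vec_def a'_def b'_def pre_hilb.hilb_power_carrier[OF pre_hilb_complex])
  have c: "sum_sq m n a' = sum_sq m n a" "sum_sq m n b' = sum_sq m n b" by (auto simp: sum_sq_def a'_def b'_def)
  have am: "pairing n x (amp m v a' b') = pairing n x (amp m v a b)"
    unfolding pairing_def amp_def a'_def b'_def by (intro sum.cong refl) auto
  have "cmod (pairing n x (amp m v a' b')) \<le> mat_norm (hilb_power complex_hilb n) m (dmat n x v) * sqrt (sum_sq m n a') * sqrt (sum_sq m n b')"
    using pre_hilb.mat_norm_bound[OF pre_hilb.pre_hilb_power[OF pre_hilb_complex] dmat_mats vec, of x v]
    by (simp only: dmat_form[OF x v(1) vec] dual_vnorm[OF vec(1)] dual_vnorm[OF vec(2)])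
  also have "\<dots> \<le> mat_norm H n x * sqrt (sum_sq m n a') * sqrt (sum_sq m n b')"
    using 1 by (intro mult_right_mono) auto
  finally show ?thesis unfolding am c .
qed

lemma mat_norm_le_amp:
  assumes x: "x \<in> mats n X" and c: "0 \<le> c"
    and *: "\<And>m v a b. v \<in> mats m V \<Longrightarrow> mat_norm L m v \<le> 1 \<Longrightarrow>
      cmod (pairing n x (amp m v a b)) \<le> c * sqrt (sum_sq m n a) * sqrt (sum_sq m n b)"
  shows "mat_norm H n x \<le> c"
  unfolding mat_norm_eq_Sup[OF x]
proof (rule cSup_least)
  have "(\<lambda>_ _. 0) \<in> mats 0 V" by (simp add: mats_def)
  moreover have "mat_norm L 0 (\<lambda>_ _. 0) \<le> 1"
    by (rule L.mat_norm_leI) (auto simp: mats_def mform_def)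
  ultimately show "{mat_norm (hilb_power complex_hilb n) m (dmat n x v) | m v. v \<in> mats m V \<and> mat_norm L m v \<le> 1} \<noteq> {}"
    by blast
qed (use dmat_norm_le[OF x _ c *] in blast)

end

lemma scaleC_fun_apply: "(c *\<^sub>C f) x = c *\<^sub>C f x"
  by (simp add: scaleC_fun_def)

lemma subspace_mats: "complex_vec.subspace X \<Longrightarrow> complex_vec.subspace (mats n X)"
  by (rule complex_vec.subspaceI)
    (auto simp: mats_def scaleC_fun_apply complex_vec.subspace_0 complex_vec.subspace_add complex_vec.subspace_scale)

definition single :: "nat \<Rightarrow> nat \<Rightarrow> 'a::zero \<Rightarrow> nat \<Rightarrow> nat \<Rightarrow> 'a" where
  "single p q v i j = (if i = p \<and> j = q then v else 0)"

lemma single_mats: "complex_vec.subspace X \<Longrightarrow> v \<in> X \<Longrightarrow> single p q v \<in> mats n X"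
  by (auto simp: mats_def single_def complex_vec.subspace_0)

lemma sum_single:
  assumes "p < n" "q < n" "\<And>i j. i < n \<Longrightarrow> j < n \<Longrightarrow> \<not> (i = p \<and> j = q) \<Longrightarrow> f i j = 0"
  shows "(\<Sum>i<n. \<Sum>j<(n::nat). f i j) = (f p q :: complex)"
proof -
  have "(\<Sum>j<n. f i j) = (if i = p then f p q else 0)" if i: "i < n" for i
  proof -
    have "(\<Sum>j<n. f i j) = (\<Sum>j<n. if j = q then (if i = p then f p q else 0) else 0)"
      using assms(3)[OF i] by (intro sum.cong) auto
    then show ?thesis using assms(2) by simp
  qed
  then show ?thesis using assms(1) by simp
qed

context dual_system
begin

lemma pairing_add_right: "x \<in> mats n X \<Longrightarrow> v \<in> mats n V \<Longrightarrow> w \<in> mats n V \<Longrightarrow> pairing n x (v + w) = pairing n x v + pairing n x w"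
  by (simp add: pairing_def mats_def J_v_add sum.distrib)

lemma pairing_scale_right: "x \<in> mats n X \<Longrightarrow> w \<in> mats n V \<Longrightarrow> pairing n x (c *\<^sub>C w) = c * pairing n x w"
  by (simp add: pairing_def mats_def scaleC_fun_apply J_v_scale sum_distrib_left)

lemma pairing_zero_right: "x \<in> mats n X \<Longrightarrow> pairing n x 0 = 0"
  by (simp add: pairing_def mats_def J_v_zero)

lemma pairing_linear: "x \<in> mats n X \<Longrightarrow> linear_on (mats n V) (pairing n x)"
  by (simp add: linear_on_def pairing_add_right pairing_scale_right scaleC_complex_def)

lemma pairing_diff_right: "x \<in> mats n X \<Longrightarrow> v \<in> mats n V \<Longrightarrow> w \<in> mats n V \<Longrightarrow> pairing n x (v - w) = pairing n x v - pairing n x w"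
  by (rule linear_on_diff[OF pairing_linear subspace_mats[OF Vs]])

lemma pairing_add_left: "x \<in> mats n X \<Longrightarrow> y \<in> mats n X \<Longrightarrow> pairing n (\<lambda>i j. x i j + y i j) w = pairing n x w + pairing n y w"
  by (simp add: pairing_def mats_def J_add sum.distrib)

lemma pairing_scale_left: "x \<in> mats n X \<Longrightarrow> pairing n (\<lambda>i j. c *\<^sub>C x i j) w = c * pairing n x w"
  by (simp add: pairing_def mats_def J_scale sum_distrib_left)

lemma pairing_single_left: "x \<in> X \<Longrightarrow> p < n \<Longrightarrow> q < n \<Longrightarrow> pairing n (single p q x) w = J x (w p q)"
  unfolding pairing_def by (subst sum_single[of p n q]) (auto simp: single_def J_zero)

lemma pairing_single_right: "x \<in> mats n X \<Longrightarrow> p < n \<Longrightarrow> q < n \<Longrightarrow> pairing n x (single p q v) = J (x p q) v"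
  unfolding pairing_def by (subst sum_single[of p n q]) (auto simp: single_def mats_def J_v_zero)

lemma pairing_shift: "x \<in> mats n X \<Longrightarrow> pairing n (shift H t x) w = complex_of_real t * pairing n (id_mat H) w + pairing n x w"
proof -
  assume x: "x \<in> mats n X"
  have i: "id_mat H \<in> mats n X" using Xid complex_vec.subspace_0[OF Xs] by (simp add: mats_def id_mat_def)
  show ?thesis using pairing_add_left[OF scale_mats[OF Xs i] x, of "complex_of_real t" w]
    by (simp add: shift_def[abs_def] pairing_scale_left[OF i])
qed

lemma id_mats: "id_mat H \<in> mats n X"
  using Xid complex_vec.subspace_0[OF Xs] by (simp add: mats_def id_mat_def)

lemma op_norm_V_ge_0: "v \<in> V \<Longrightarrow> 0 \<le> op_norm L v"
  using L.op_norm_ge_0 Vb by auto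

lemma J_bound:
  assumes x: "x \<in> X" and v: "v \<in> V"
  shows "cmod (J x v) \<le> op_norm H x * op_norm L v"
proof (cases "op_norm L v = 0")
  case True
  then show ?thesis using J_bdd[OF x] v by force
next
  case False
  then have p: "op_norm L v > 0" using op_norm_V_ge_0[OF v] by simp
  define v' where "v' = complex_of_real (1 / op_norm L v) *\<^sub>C v"
  have v': "v' \<in> V" unfolding v'_def by (rule complex_vec.subspace_scale[OF Vs v])
  have vb: "v \<in> bounded_ops L" using v Vb by auto
  have n1: "op_norm L v' = 1" unfolding v'_def using L.op_norm_scale[OF vb] p by (simp add: norm_divide)
  have m: "(\<lambda>_ _. x) \<in> mats 1 X" "(\<lambda>_ _. v') \<in> mats 1 V" using x v' by (auto simp: mats_def)
  have "mat_norm L 1 (\<lambda>_ _. v') \<le> 1" using L.mat_norm_1[of v'] v' Vb n1 by auto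
  from amp_bound[OF m this, of "\<lambda>_ _. 1" "\<lambda>_ _. 1"]
  have "cmod (J x v') \<le> op_norm H x" using H.mat_norm_1[of x] x Xb
    by (auto simp: pairing_def amp_def sum_sq_def)
  moreover have "J x v' = J x v / op_norm L v" unfolding v'_def using J_v_scale[OF x v] by simp
  ultimately show ?thesis using p by (simp add: norm_divide field_simps)
qed

lemma pairing_crude:
  assumes x: "x \<in> mats n X" and w: "w \<in> mats n V"
  shows "cmod (pairing n x w) \<le> mat_norm H n x * (\<Sum>i<n. \<Sum>j<n. op_norm L (w i j))"
proof -
  have "cmod (pairing n x w) \<le> (\<Sum>i<n. \<Sum>j<n. cmod (J (x i j) (w i j)))"
    unfolding pairing_def by (intro order.trans[OF norm_sum] sum_mono norm_sum)
  also have "\<dots> \<le> (\<Sum>i<n. \<Sum>j<n. mat_norm H n x * op_norm L (w i j))"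
  proof (intro sum_mono)
    fix i j assume "i \<in> {..<n}" "j \<in> {..<n}"
    then have ij: "i < n" "j < n" by auto
    show "cmod (J (x i j) (w i j)) \<le> mat_norm H n x * op_norm L (w i j)"
      using J_bound[OF matsD[OF x ij] matsD[OF w ij]]
        mult_right_mono[OF H.op_norm_le_mat_norm[OF matsX[OF x] ij] op_norm_V_ge_0[OF matsD[OF w ij]]] by linarith
  qed
  finally show ?thesis by (simp add: sum_distrib_left)
qed

text \<open>The norm of the predual of \<open>M\<^sub>n(X)\<close>, as a supremum over the unit ball of \<open>M\<^sub>n(X)\<close>.\<close>

definition predual_norm :: "nat \<Rightarrow> (nat \<Rightarrow> nat \<Rightarrow> 'l \<Rightarrow> 'l) \<Rightarrow> real" where
  "predual_norm n w = Sup {cmod (pairing n x w) | x. x \<in> mats n X \<and> mat_norm H n x \<le> 1}"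

lemma mat_norm_0: "mat_norm H n 0 = 0" 
proof -
  have m: "0 \<in> mats n (bounded_ops H)" using H.bop_zero by (simp add: mats_def)
  have "mat_norm H n 0 \<le> 0"
    by (rule H.mat_norm_leI[OF m]) (auto simp: mform_def vec_def)
  then show ?thesis using H.mat_norm_ge_0[OF m] by simp
qed

lemma zero_mats: "0 \<in> mats n X"
  using complex_vec.subspace_0[OF Xs] by (simp add: mats_def)

lemma predual_norm_bdd:
  assumes w: "w \<in> mats n V"
  shows "bdd_above {cmod (pairing n x w) | x. x \<in> mats n X \<and> mat_norm H n x \<le> 1}"
proof -
  let ?c = "\<Sum>i<n. \<Sum>j<n. op_norm L (w i j)"
  have c: "0 \<le> ?c" using w by (intro sum_nonneg op_norm_V_ge_0) (auto simp: mats_def)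
  have "cmod (pairing n x w) \<le> ?c" if "x \<in> mats n X" "mat_norm H n x \<le> 1" for x
    using pairing_crude[OF that(1) w] mult_right_mono[OF that(2) c] by linarith
  then show ?thesis unfolding bdd_above_def by blast
qed

lemma predual_norm_leI:
  assumes "\<And>x. x \<in> mats n X \<Longrightarrow> mat_norm H n x \<le> 1 \<Longrightarrow> cmod (pairing n x w) \<le> c"
  shows "predual_norm n w \<le> c"
  unfolding predual_norm_def
proof (rule cSup_least)
  show "{cmod (pairing n x w) | x. x \<in> mats n X \<and> mat_norm H n x \<le> 1} \<noteq> {}"
    using zero_mats[of n] mat_norm_0[of n] by (metis (mono_tags, lifting) empty_Collect_eq zero_le_one)
qed (use assms in auto)

lemma pairing_le_1:
  assumes "w \<in> mats n V" "x \<in> mats n X" "mat_norm H n x \<le> 1"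
  shows "cmod (pairing n x w) \<le> predual_norm n w"
  unfolding predual_norm_def using assms by (intro cSup_upper predual_norm_bdd) auto

lemma predual_norm_ge_0: "w \<in> mats n V \<Longrightarrow> 0 \<le> predual_norm n w"
  using pairing_le_1[OF _ zero_mats, of w n] mat_norm_0[of n] norm_ge_zero[of "pairing n 0 w"] by linarith

lemma pairing_le:
  assumes w: "w \<in> mats n V" and x: "x \<in> mats n X"
  shows "cmod (pairing n x w) \<le> mat_norm H n x * predual_norm n w"
proof (cases "mat_norm H n x = 0")
  case True
  then show ?thesis using pairing_crude[OF x w] by simp
next
  case False
  then have p: "mat_norm H n x > 0" using H.mat_norm_ge_0[OF matsX[OF x]] by simp
  let ?c = "complex_of_real (1 / mat_norm H n x)"
  have "mat_norm H n (\<lambda>i j. ?c *\<^sub>C x i j) \<le> 1"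
    using H.mat_norm_scale_le[OF matsX[OF x], of ?c] p by (simp add: norm_divide)
  from pairing_le_1[OF w scale_mats[OF Xs x] this]
  have "cmod (pairing n x w) / mat_norm H n x \<le> predual_norm n w" using pairing_scale_left[OF x, of ?c w] p by (simp add: norm_divide)
  then show ?thesis using p by (simp add: field_simps)
qed

lemma predual_norm_add:
  assumes "v \<in> mats n V" "w \<in> mats n V"
  shows "predual_norm n (v + w) \<le> predual_norm n v + predual_norm n w"
proof (rule predual_norm_leI)
  fix x assume x: "x \<in> mats n X" "mat_norm H n x \<le> 1"
  show "cmod (pairing n x (v + w)) \<le> predual_norm n v + predual_norm n w"
    using norm_triangle_ineq[of "pairing n x v" "pairing n x w"] pairing_le_1[OF assms(1) x] pairing_le_1[OF assms(2) x]
    by (simp add: pairing_add_right[OF x(1) assms])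
qed

lemma predual_norm_scale_le:
  assumes "w \<in> mats n V"
  shows "predual_norm n (c *\<^sub>C w) \<le> cmod c * predual_norm n w"
proof (rule predual_norm_leI)
  fix x assume x: "x \<in> mats n X" "mat_norm H n x \<le> 1"
  show "cmod (pairing n x (c *\<^sub>C w)) \<le> cmod c * predual_norm n w"
    using pairing_le_1[OF assms(1) x] by (simp add: pairing_scale_right[OF x(1) assms] norm_mult mult_left_mono)
qed

lemma mats_V_add: "v \<in> mats n V \<Longrightarrow> w \<in> mats n V \<Longrightarrow> v + w \<in> mats n V"
  using complex_vec.subspace_add[OF subspace_mats[OF Vs]] .
lemma mats_V_diff: "v \<in> mats n V \<Longrightarrow> w \<in> mats n V \<Longrightarrow> v - w \<in> mats n V"
  using complex_vec.subspace_diff[OF subspace_mats[OF Vs]] .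
lemma mats_V_scale: "v \<in> mats n V \<Longrightarrow> c *\<^sub>C v \<in> mats n V"
  using complex_vec.subspace_scale[OF subspace_mats[OF Vs]] .
lemma mats_V_zero: "0 \<in> mats n V"
  using complex_vec.subspace_0[OF subspace_mats[OF Vs]] .

lemma predual_norm_zero: "predual_norm n 0 = 0"
proof (rule antisym)
  show "predual_norm n 0 \<le> 0" by (rule predual_norm_leI) (simp add: pairing_zero_right)
qed (rule predual_norm_ge_0[OF mats_V_zero])

lemma predual_norm_scale:
  assumes "w \<in> mats n V"
  shows "predual_norm n (c *\<^sub>C w) = cmod c * predual_norm n w"
proof (cases "c = 0")
  case True
  then show ?thesis using predual_norm_zero by simp
next
  case False
  have "w = (1/c) *\<^sub>C (c *\<^sub>C w)" using False by simp
  then have "predual_norm n w \<le> cmod (1/c) * predual_norm n (c *\<^sub>C w)" using predual_norm_scale_le[OF mats_V_scale[OF assms]] by metis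
  then have "cmod c * predual_norm n w \<le> predual_norm n (c *\<^sub>C w)" using False by (simp add: norm_divide field_simps)
  then show ?thesis using predual_norm_scale_le[OF assms, of c] by linarith
qed

lemma predual_norm_minus: "w \<in> mats n V \<Longrightarrow> predual_norm n (- w) = predual_norm n w"
  using predual_norm_scale[of w n "-1"] by simp

lemma predual_norm_diff_commute: "v \<in> mats n V \<Longrightarrow> w \<in> mats n V \<Longrightarrow> predual_norm n (v - w) = predual_norm n (w - v)"
  using predual_norm_minus[OF mats_V_diff, of v n w] by simp

lemma predual_norm_triangle3:
  assumes "u \<in> mats n V" "v \<in> mats n V" "w \<in> mats n V"
  shows "predual_norm n (u - w) \<le> predual_norm n (u - v) + predual_norm n (v - w)"
  using predual_norm_add[OF mats_V_diff[OF assms(1,2)] mats_V_diff[OF assms(2,3)]] by simp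

lemma predual_norm_single:
  assumes v: "v \<in> V" and pq: "p < n" "q < n"
  shows "predual_norm n (single p q v) \<le> op_norm L v"
proof (rule predual_norm_leI)
  fix x assume x: "x \<in> mats n X" "mat_norm H n x \<le> 1"
  have "op_norm H (x p q) \<le> 1" using H.op_norm_le_mat_norm[OF matsX[OF x(1)] pq] x(2) by simp
  then have "op_norm H (x p q) * op_norm L v \<le> 1 * op_norm L v"
    by (intro mult_right_mono op_norm_V_ge_0 v)
  then show "cmod (pairing n x (single p q v)) \<le> op_norm L v"
    using J_bound[OF matsD[OF x(1) pq] v] by (simp add: pairing_single_right[OF x(1) pq])
qed

text \<open>The compressions \<open>b\<^sup>* v a\<close> already norm \<open>M\<^sub>n(X)\<close>, and they have predual norm at most
  \<open>\<parallel>a\<parallel> \<parallel>b\<parallel>\<close>.\<close>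

lemma mat_norm_le_predual_norm:
  assumes x: "x \<in> mats n X" and c: "0 \<le> c" and *: "\<And>w. w \<in> mats n V \<Longrightarrow> cmod (pairing n x w) \<le> c * predual_norm n w"
  shows "mat_norm H n x \<le> c"
proof (rule mat_norm_le_amp[OF x c])
  fix m v a b assume v: "v \<in> mats m V" "mat_norm L m v \<le> 1"
  have am: "amp m v a b \<in> mats n V" using amp_V[OF v(1)] by (simp add: mats_def)
  have "predual_norm n (amp m v a b) \<le> sqrt (sum_sq m n a) * sqrt (sum_sq m n b)"
  proof (rule predual_norm_leI)
    fix y assume y: "y \<in> mats n X" "mat_norm H n y \<le> 1"
    have "mat_norm H n y * (sqrt (sum_sq m n a) * sqrt (sum_sq m n b)) \<le> 1 * (sqrt (sum_sq m n a) * sqrt (sum_sq m n b))"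
      using y(2) by (intro mult_right_mono) auto
    then show "cmod (pairing n y (amp m v a b)) \<le> sqrt (sum_sq m n a) * sqrt (sum_sq m n b)"
      using amp_bound[OF y(1) v, of a b] by (simp add: mult.assoc)
  qed
  then have "c * predual_norm n (amp m v a b) \<le> c * (sqrt (sum_sq m n a) * sqrt (sum_sq m n b))" using c by (rule mult_left_mono)
  then show "cmod (pairing n x (amp m v a b)) \<le> c * sqrt (sum_sq m n a) * sqrt (sum_sq m n b)"
    using *[OF am] by simp
qed

text \<open>The dual of the predual is \<open>M\<^sub>n(X)\<close>, isometrically: restricting \<open>g\<close> to single entries gives
  bounded functionals on \<open>V\<close>, hence the entries of a matrix over \<open>X\<close>.\<close>

lemma predual_norm_rep:
  assumes g: "linear_on (mats n V) g" and c: "0 \<le> c" and gb: "\<And>w. w \<in> mats n V \<Longrightarrow> cmod (g w) \<le> c * predual_norm n w"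
  shows "\<exists>x\<in>mats n X. mat_norm H n x \<le> c \<and> (\<forall>w\<in>mats n V. g w = pairing n x w)"
proof -
  note Ws = subspace_mats[OF Vs, of n]
  have "\<exists>x\<in>X. \<forall>v\<in>V. J x v = g (single i j v)" if ij: "i < n" "j < n" for i j
  proof -
    let ?f = "\<lambda>v. if v \<in> V then g (single i j v) else 0"
    have "single i j (v + w) = single i j v + single i j w" "single i j (d *\<^sub>C v) = d *\<^sub>C single i j v" for v w :: "'l \<Rightarrow> 'l" and d
      by (auto simp: single_def fun_eq_iff scaleC_fun_def)
    then have "linear_on V ?f"
      using linear_onD[OF g] single_mats[OF Vs] complex_vec.subspace_add[OF Vs] complex_vec.subspace_scale[OF Vs]
      by (simp add: linear_on_def)
    moreover have "cmod (?f v) \<le> c * op_norm L v" if v: "v \<in> V" for v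
      using gb[OF single_mats[OF Vs v], of i j] mult_left_mono[OF predual_norm_single[OF v ij] c] v by simp
    ultimately have "?f \<in> dual_space L V" unfolding dual_space_def by auto
    then obtain x where "x \<in> X" "J x = ?f" using J_surj by blast
    then show ?thesis by (intro bexI[of _ x]) auto
  qed
  then obtain x where x: "\<And>i j. i < n \<Longrightarrow> j < n \<Longrightarrow> x i j \<in> X" 
    "\<And>i j v. i < n \<Longrightarrow> j < n \<Longrightarrow> v \<in> V \<Longrightarrow> J (x i j) v = g (single i j v)" by metis
  have xm: "x \<in> mats n X" using x by (simp add: mats_def)
  have eq: "g w = pairing n x w" if w: "w \<in> mats n V" for w
  proof -
    define w' where "w' = (\<Sum>i<n. \<Sum>j<n. single i j (w i j))"
    have inner: "(\<Sum>j<n. single i j (w i j)) \<in> mats n V" if "i < n" for i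
      using single_mats[OF Vs] matsD[OF w that] by (intro complex_vec.subspace_sum[OF Ws]) auto
    have w': "w' \<in> mats n V" unfolding w'_def by (rule complex_vec.subspace_sum[OF Ws]) (use inner in blast)
    have sumapp: "(\<Sum>i\<in>A. f i) p q = (\<Sum>i\<in>A. f i p q)" for A :: "nat set" and f :: "nat \<Rightarrow> nat \<Rightarrow> nat \<Rightarrow> 'l \<Rightarrow> 'l" and p q
      by (induction A rule: infinite_finite_induct) auto
    have "w' p q = w p q" if "p < n" "q < n" for p q
    proof -
      have "w' p q = (\<Sum>i<n. \<Sum>j<n. single i j (w i j) p q)" by (simp add: w'_def sumapp)
      also have "\<dots> = (\<Sum>i<n. \<Sum>j<n. if j = q then (if i = p then w p q else 0) else 0)"
        by (intro sum.cong) (auto simp: single_def)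
      finally show ?thesis using that by simp
    qed
    then have "pairing n y (w - w') = 0" if "y \<in> mats n X" for y
      using that by (simp add: pairing_def J_v_zero mats_def)
    then have "predual_norm n (w - w') \<le> 0" by (intro predual_norm_leI) simp
    then have "c * predual_norm n (w - w') \<le> 0" using c by (simp add: mult_nonneg_nonpos)
    then have "cmod (g (w - w')) \<le> 0" using gb[OF mats_V_diff[OF w w']] by linarith
    then have "g w = g w'" using linear_on_diff[OF g Ws w w'] by simp
    also have "\<dots> = (\<Sum>i<n. g (\<Sum>j<n. single i j (w i j)))"
      unfolding w'_def by (rule linear_on_sum[OF g Ws]) (use inner in blast)
    also have "\<dots> = (\<Sum>i<n. \<Sum>j<n. g (single i j (w i j)))"
    proof (intro sum.cong refl)
      fix i assume "i \<in> {..<n}"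
      then have "\<And>j. j \<in> {..<n} \<Longrightarrow> single i j (w i j) \<in> mats n V"
        using single_mats[OF Vs] matsD[OF w] by auto
      then show "g (\<Sum>j<n. single i j (w i j)) = (\<Sum>j<n. g (single i j (w i j)))"
        by (rule linear_on_sum[OF g Ws])
    qed
    also have "\<dots> = pairing n x w" unfolding pairing_def using x w by (intro sum.cong refl) (auto simp: mats_def)
    finally show ?thesis .
  qed
  have "mat_norm H n x \<le> c" by (rule mat_norm_le_predual_norm[OF xm c]) (use eq gb in auto)
  then show ?thesis using xm eq by blast
qed

text \<open>Hahn-Banach in \<open>V\<close>: the norming functional is some \<open>J x\<close>, and \<open>\<parallel>x\<parallel> \<le> 1\<close> because scalar
  functionals are completely bounded with the same norm.\<close>

lemma op_norm_le_J:
  assumes v: "v \<in> V" and c: "\<And>x. x \<in> X \<Longrightarrow> op_norm H x \<le> 1 \<Longrightarrow> cmod (J x v) \<le> c"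
  shows "op_norm L v \<le> c"
proof -
  have vb: "u \<in> bounded_ops L" if "u \<in> V" for u using Vb that by auto
  have conv: "convex_in {v}" by (auto simp: convex_in_def simp flip: scaleC_add_left of_real_add)
  obtain g where g: "linear_on V g" "\<And>u. u \<in> V \<Longrightarrow> cmod (g u) \<le> op_norm L u" "op_norm L v \<le> Re (g v)"
    using Hahn_Banach_convex[OF Vs, of "op_norm L" "{v}" "op_norm L v"] v vb conv L.op_norm_triangle L.op_norm_scale by auto
  let ?f = "\<lambda>u. if u \<in> V then g u else 0"
  have "linear_on V ?f" using g(1) complex_vec.subspace_add[OF Vs] complex_vec.subspace_scale[OF Vs] by (simp add: linear_on_def)
  then have "?f \<in> dual_space L V" using g(2) unfolding dual_space_def by (auto intro!: exI[of _ 1])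
  then obtain x where x: "x \<in> X" "J x = ?f" using J_surj by blast
  have m: "(\<lambda>_ _. x) \<in> mats 1 X" using x by (simp add: mats_def)
  have "mat_norm H 1 (\<lambda>_ _. x) \<le> 1"
  proof (rule mat_norm_le_amp[OF m])
    fix k u a b assume u: "u \<in> mats k V" "mat_norm L k u \<le> 1"
    have "pairing 1 (\<lambda>_ _. x) (amp k u a b) = g (amp k u a b 0 0)"
      using amp_V[OF u(1)] x(2) by (simp add: pairing_def)
    moreover have "op_norm L (amp k u a b 0 0) \<le> mat_norm L k u * sqrt (\<Sum>l<k. (cmod (a l 0))\<^sup>2) * sqrt (\<Sum>l<k. (cmod (b l 0))\<^sup>2)"
      unfolding amp_def by (rule L.op_norm_compress[OF matsV[OF u(1)]])
    moreover have "mat_norm L k u * sqrt (\<Sum>l<k. (cmod (a l 0))\<^sup>2) * sqrt (\<Sum>l<k. (cmod (b l 0))\<^sup>2) \<le> 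
       1 * sqrt (\<Sum>l<k. (cmod (a l 0))\<^sup>2) * sqrt (\<Sum>l<k. (cmod (b l 0))\<^sup>2)"
      using u(2) by (intro mult_right_mono) (auto intro!: sum_nonneg)
    ultimately show "cmod (pairing 1 (\<lambda>_ _. x) (amp k u a b)) \<le> 1 * sqrt (sum_sq k 1 a) * sqrt (sum_sq k 1 b)"
      using g(2)[OF amp_V[OF u(1)], of a b 0 0] by (simp add: sum_sq_def)
  qed simp
  then have "op_norm H x \<le> 1" using H.mat_norm_1[of x] x Xb by auto
  from c[OF x(1) this] show ?thesis using g(3) complex_Re_le_cmod[of "g v"] x v by simp
qed

lemma op_norm_le_predual_norm:
  assumes w: "w \<in> mats n V" and ij: "i < n" "j < n"
  shows "op_norm L (w i j) \<le> predual_norm n w"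
proof (rule op_norm_le_J[OF matsD[OF w ij]])
  fix x assume x: "x \<in> X" "op_norm H x \<le> 1"
  have "x \<in> bounded_ops H" using x Xb by auto
  then have "mat_norm H n (single i j x) \<le> 1"
    using H.mat_norm_single_entry[OF _ ij, of x] x(2) by (simp add: single_def[abs_def])
  then show "cmod (J x (w i j)) \<le> predual_norm n w"
    using pairing_le_1[OF w single_mats[OF Xs x(1)], of i j] by (simp add: pairing_single_left[OF x(1) ij])
qed

text \<open>The predual norm dominates the operator norms of the entries, so completeness of \<open>V\<close> applies
  entrywise. Geometric decay is all that the later iterations produce.\<close>

lemma predual_norm_complete_geom:
  assumes w: "\<And>k. w k \<in> mats n V" and c: "\<And>k. predual_norm n (w k - w (Suc k)) \<le> c / 2 ^ k"
  shows "\<exists>u\<in>mats n V. \<forall>k. predual_norm n (w k - u) \<le> 2 * c / 2 ^ k"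
proof -
  have c0: "0 \<le> c" using c[of 0] predual_norm_ge_0[OF mats_V_diff[OF w w], of 0 1] by simp
  have geom: "predual_norm n (w k - w (k + l)) \<le> (2 * c / 2 ^ k) * (1 - 1 / 2 ^ l)" for k l
  proof (induction l)
    case 0
    have z: "predual_norm n (w k - w (k + 0)) = 0" unfolding add_0_right diff_self by (rule predual_norm_zero)
    show ?case unfolding z by simp
  next
    case (Suc l)
    have "predual_norm n (w k - w (k + Suc l)) \<le> predual_norm n (w k - w (k + l)) + predual_norm n (w (k + l) - w (Suc (k + l)))"
      using predual_norm_triangle3[OF w[of k] w[of "k + l"] w[of "Suc (k + l)"]] by simp
    also have "\<dots> \<le> (2 * c / 2 ^ k) * (1 - 1 / 2 ^ l) + c / 2 ^ (k + l)" by (rule add_mono[OF Suc.IH c])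
    also have "\<dots> = (2 * c / 2 ^ k) * (1 - 1 / 2 ^ Suc l)" by (simp add: field_simps power_add)
    finally show ?case .
  qed
  have geom': "predual_norm n (w k - w l) \<le> 2 * c / 2 ^ k" if "k \<le> l" for k l
  proof -
    have "predual_norm n (w k - w l) \<le> (2 * c / 2 ^ k) * (1 - 1 / 2 ^ (l - k))" using geom[of k "l - k"] that by simp
    also have "\<dots> \<le> (2 * c / 2 ^ k) * 1" using c0 by (intro mult_left_mono) auto
    finally show ?thesis by simp
  qed
  have vb: "\<And>u. u \<in> V \<Longrightarrow> u \<in> bounded_ops L" using Vb by auto
  have ent: "op_norm L (w k i j - w l i j) \<le> predual_norm n (w k - w l)" if "i < n" "j < n" for k l i j
    using op_norm_le_predual_norm[OF mats_V_diff[OF w w] that, of k l] by simp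
  have "\<exists>u\<in>V. (\<lambda>k. op_norm L (w k i j - u)) \<longlonglongrightarrow> 0" if ij: "i < n" "j < n" for i j
  proof -
    have "\<exists>S\<in>bounded_ops L. (\<lambda>k. op_norm L (w k i j - S)) \<longlonglongrightarrow> 0"
    proof (rule L.bounded_ops_complete)
      show "w k i j \<in> bounded_ops L" for k using matsD[OF w ij] vb by auto
      fix e :: real assume e: "e > 0"
      obtain N where N: "2 * c / 2 ^ N < e"
      proof -
        have "(\<lambda>N. 2 * c * (1/2) ^ N) \<longlonglongrightarrow> 2 * c * 0" by (intro tendsto_intros) auto
        then have "\<forall>\<^sub>F N in sequentially. 2 * c * (1/2) ^ N < e" using e by (intro order_tendstoD(2)[of _ "2 * c * 0"]) auto
        then show ?thesis using that by (auto simp: eventually_sequentially power_divide)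
      qed
      have lt: "op_norm L (w k i j - w l i j) < e" if "k \<ge> N" "l \<ge> N" "k \<le> l" for k l
      proof -
        have "2 * c / 2 ^ k \<le> 2 * c / 2 ^ N" using c0 that by (intro divide_left_mono) auto
        then show ?thesis using ent[OF ij, of k l] geom'[OF that(3)] N by linarith
      qed
      have "op_norm L (w k i j - w l i j) < e" if "k \<ge> N" "l \<ge> N" for k l
      proof (cases "k \<le> l")
        case True
        then show ?thesis using lt that by simp
      next
        case False
        have "w l i j - w k i j \<in> bounded_ops L" 
          using complex_vec.subspace_diff[OF Vs matsD[OF w ij] matsD[OF w ij]] vb by auto
        from L.op_norm_scale[OF this, of "-1"] show ?thesis using lt[of l k] False that by simp
      qed
      then show "\<exists>N. \<forall>k\<ge>N. \<forall>l\<ge>N. op_norm L (w k i j - w l i j) < e" by blast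
    qed
    then obtain S where S: "S \<in> bounded_ops L" "(\<lambda>k. op_norm L (w k i j - S)) \<longlonglongrightarrow> 0" by blast
    have "S \<in> V"
      using oV[unfolded operator_space_def, THEN conjunct2, THEN conjunct2, rule_format, of S "\<lambda>k. w k i j"] S matsD[OF w ij] by blast
    then show ?thesis using S(2) by blast
  qed
  then obtain u where u: "\<And>i j. i < n \<Longrightarrow> j < n \<Longrightarrow> u i j \<in> V" 
    "\<And>i j. i < n \<Longrightarrow> j < n \<Longrightarrow> (\<lambda>k. op_norm L (w k i j - u i j)) \<longlonglongrightarrow> 0" by metis
  have um: "u \<in> mats n V" using u by (simp add: mats_def)
  have "predual_norm n (w k - u) \<le> 2 * c / 2 ^ k" for k
  proof (rule predual_norm_leI)
    fix x assume x: "x \<in> mats n X" "mat_norm H n x \<le> 1"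
    show "cmod (pairing n x (w k - u)) \<le> 2 * c / 2 ^ k"
    proof (rule LIMSEQ_le_const)
      let ?s = "\<lambda>l. \<Sum>i<n. \<Sum>j<n. op_norm L (w l i j - u i j)"
      show "(\<lambda>l. 2 * c / 2 ^ k + mat_norm H n x * ?s l) \<longlonglongrightarrow> 2 * c / 2 ^ k"
        using u(2) by (auto intro!: tendsto_eq_intros)
      have "cmod (pairing n x (w k - u)) \<le> 2 * c / 2 ^ k + mat_norm H n x * ?s l" if "l \<ge> k" for l
      proof -
        have "pairing n x (w k - u) = pairing n x (w k - w l) + pairing n x (w l - u)"
          using w um x by (simp add: pairing_diff_right)
        then have "cmod (pairing n x (w k - u)) \<le> cmod (pairing n x (w k - w l)) + cmod (pairing n x (w l - u))"
          using norm_triangle_ineq by metis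
        moreover have "cmod (pairing n x (w k - w l)) \<le> 2 * c / 2 ^ k"
          using pairing_le_1[OF mats_V_diff[OF w w] x, of k l] geom'[OF that] by linarith
        moreover have "cmod (pairing n x (w l - u)) \<le> mat_norm H n x * ?s l"
          using pairing_crude[OF x(1) mats_V_diff[OF w um], of l] by simp
        ultimately show ?thesis by linarith
      qed
      then show "\<exists>N. \<forall>l\<ge>N. cmod (pairing n x (w k - u)) \<le> 2 * c / 2 ^ k + mat_norm H n x * ?s l" by blast
    qed
  qed
  then show ?thesis using um by blast
qed

text \<open>If no element of the unit ball of \<open>M\<^sub>n(X)\<close> separates \<open>w0\<close> from the convex set \<open>D\<close> by more than
  \<open>c\<close>, then \<open>w0\<close> has distance at most \<open>c\<close> from \<open>D\<close>. The separating functional is normal because it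
  is found on the predual.\<close>

lemma separation:
  assumes D: "D \<subseteq> mats n V" "D \<noteq> {}" "convex_in D" and w0: "w0 \<in> mats n V" and e: "0 < e" and c: "0 \<le> c"
    and *: "\<And>y d. y \<in> mats n X \<Longrightarrow> mat_norm H n y \<le> 1 \<Longrightarrow> 0 < d \<Longrightarrow> \<exists>w\<in>D. Re (pairing n y w0) \<le> Re (pairing n y w) + c + d"
  shows "\<exists>w\<in>D. predual_norm n (w0 - w) \<le> c + e"
proof (rule ccontr)
  assume "\<not> ?thesis"
  then have far: "c + e \<le> predual_norm n (w0 - w)" if "w \<in> D" for w using that by force
  note Ws = subspace_mats[OF Vs, of n]
  let ?A = "(\<lambda>w. w0 - w) ` D"
  have "convex_in ?A" unfolding convex_in_def
  proof safe
    fix a b and t :: real assume ab: "a \<in> D" "b \<in> D" "0 \<le> t" "t \<le> 1"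
    have "complex_of_real t *\<^sub>C (w0 - a) + complex_of_real (1 - t) *\<^sub>C (w0 - b) = 
      (complex_of_real t *\<^sub>C w0 + complex_of_real (1 - t) *\<^sub>C w0) - (complex_of_real t *\<^sub>C a + complex_of_real (1 - t) *\<^sub>C b)"
      by (simp only: complex_vec.scale_right_diff_distrib add_diff_add)
    also have "complex_of_real t *\<^sub>C w0 + complex_of_real (1 - t) *\<^sub>C w0 = w0"
      by (simp flip: scaleC_add_left of_real_add)
    finally have eq: "complex_of_real t *\<^sub>C (w0 - a) + complex_of_real (1 - t) *\<^sub>C (w0 - b) =
      w0 - (complex_of_real t *\<^sub>C a + complex_of_real (1 - t) *\<^sub>C b)" .
    have "complex_of_real t *\<^sub>C a + complex_of_real (1 - t) *\<^sub>C b \<in> D"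
      using D(3) ab unfolding convex_in_def by blast
    then show "complex_of_real t *\<^sub>C (w0 - a) + complex_of_real (1 - t) *\<^sub>C (w0 - b) \<in> ?A"
      unfolding eq by (rule imageI)
  qed
  moreover have "?A \<subseteq> mats n V" using D(1) w0 mats_V_diff by auto
  ultimately obtain g where g: "linear_on (mats n V) g" "\<forall>w\<in>mats n V. cmod (g w) \<le> predual_norm n w" "\<forall>a\<in>?A. c + e \<le> Re (g a)"
    using Hahn_Banach_convex[OF Ws, of "predual_norm n" ?A "c + e"] predual_norm_add predual_norm_scale D(2) far by blast
  obtain y where y: "y \<in> mats n X" "mat_norm H n y \<le> 1" "\<forall>w\<in>mats n V. g w = pairing n y w"
    using predual_norm_rep[OF g(1), of 1] g(2) by auto
  obtain w where w: "w \<in> D" "Re (pairing n y w0) \<le> Re (pairing n y w) + c + e/2" using *[OF y(1,2), of "e/2"] e by auto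
  have wV: "w \<in> mats n V" using w D by auto
  have "c + e \<le> Re (g (w0 - w))" using g(3) w by auto
  also have "\<dots> = Re (pairing n y w0) - Re (pairing n y w)" using y(3) mats_V_diff[OF w0 wV] pairing_diff_right[OF y(1) w0 wV] by simp
  finally show False using w(2) e by simp
qed

end

section \<open>Normal states\<close>

text \<open>The strictly upper triangular \<open>2 \<times> 2\<close> matrix with corner \<open>2 x\<close>. It turns the norm of \<open>x\<close> into the
  maximum of a numerical range, which states can see.\<close>

definition corner :: "nat \<Rightarrow> (nat \<Rightarrow> nat \<Rightarrow> 'a \<Rightarrow> 'a::complex_vector) \<Rightarrow> nat \<Rightarrow> nat \<Rightarrow> 'a \<Rightarrow> 'a" where
  "corner n x i j = (if i < n \<and> n \<le> j then 2 *\<^sub>C x i (j - n) else 0)"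

lemma sum_lessThan_double:
  fixes f :: "nat \<Rightarrow> 'a::comm_monoid_add"
  shows "(\<Sum>i<n+m. f i) = (\<Sum>i<n. f i) + (\<Sum>i<m. f (n + i))"
  by (induction m) (auto simp: add.assoc)

definition numerical_max :: "'h::complex_vector hilb \<Rightarrow> nat \<Rightarrow> (nat \<Rightarrow> nat \<Rightarrow> 'h \<Rightarrow> 'h) \<Rightarrow> real" where
  "numerical_max H n y = Sup {Re (mform H n y \<zeta> \<zeta>) | \<zeta>. vec H n \<zeta> \<and> vnorm H n \<zeta> = 1}"

lemma corner_mats:
  assumes "complex_vec.subspace X" "x \<in> mats n X"
  shows "corner n x \<in> mats (n + n) X"
  using assms complex_vec.subspace_scale[OF assms(1)] complex_vec.subspace_0[OF assms(1)]
  by (auto simp: mats_def corner_def)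

context pre_hilb
begin

lemma mform_corner:
  assumes x: "x \<in> mats n (bounded_ops H)" and v: "vec H (n + n) \<theta>"
  shows "mform H (n + n) (corner n x) \<theta> \<theta> = 2 * mform H n x (\<lambda>j. \<theta> (n + j)) \<theta>"
proof -
  have e: "ip (corner n x i j (\<theta> j)) (\<theta> i) = (if i < n \<and> n \<le> j then 2 * ip (x i (j - n) (\<theta> j)) (\<theta> i) else 0)"
    if "i < n + n" "j < n + n" for i j
    using bopD(1)[OF matsD[OF x, of i "j - n"] vecD[OF v that(2)]] vecD[OF v that(1)] that
    by (auto simp: corner_def scaleC_fun_apply ip_scale_left)
  have "mform H (n + n) (corner n x) \<theta> \<theta> = (\<Sum>i<n+n. \<Sum>j<n+n. if i < n \<and> n \<le> j then 2 * ip (x i (j - n) (\<theta> j)) (\<theta> i) else 0)"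
    unfolding mform_def using e by (intro sum.cong) auto
  then show ?thesis by (simp add: sum_lessThan_double mform_def sum_distrib_left)
qed

lemma numerical_max_bdd:
  assumes y: "y \<in> mats n (bounded_ops H)"
  shows "bdd_above {Re (mform H n y \<zeta> \<zeta>) | \<zeta>. vec H n \<zeta> \<and> vnorm H n \<zeta> = 1}"
proof -
  have "Re (mform H n y \<zeta> \<zeta>) \<le> mat_norm H n y" if "vec H n \<zeta>" "vnorm H n \<zeta> = 1" for \<zeta>
    using mat_norm_bound[OF y that(1,1)] that(2) complex_Re_le_cmod[of "mform H n y \<zeta> \<zeta>"] by simp
  then show ?thesis unfolding bdd_above_def by blast
qed

lemma numerical_max_ge:
  assumes y: "y \<in> mats n (bounded_ops H)" and v: "vec H n \<zeta>"
  shows "Re (mform H n y \<zeta> \<zeta>) \<le> numerical_max H n y * (vnorm H n \<zeta>)\<^sup>2"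
proof (cases "vnorm H n \<zeta> = 0")
  case True
  then show ?thesis using mat_norm_bound[OF y v v] by simp
next
  case False
  define r where "r = 1 / vnorm H n \<zeta>"
  have "Re (complex_of_real (r\<^sup>2) * mform H n y \<zeta> \<zeta>) \<le> numerical_max H n y"
    unfolding numerical_max_def mform_homogeneous[OF y v, symmetric]
    using unit_vec_obtain[OF v False] by (intro cSup_upper numerical_max_bdd[OF y]) (auto simp: r_def)
  then have "r\<^sup>2 * Re (mform H n y \<zeta> \<zeta>) \<le> numerical_max H n y" by simp
  then show ?thesis using False by (simp add: r_def power_divide field_simps)
qed

lemma numerical_max_shift_ge:
  assumes y: "y \<in> mats n (bounded_ops H)" and unit: "vec H n \<zeta>0" "vnorm H n \<zeta>0 = 1"
  shows "t + numerical_max H n y \<le> mat_norm H n (shift H t y)"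
proof -
  have "numerical_max H n y \<le> mat_norm H n (shift H t y) - t" unfolding numerical_max_def
  proof (rule cSup_least)
    show "{Re (mform H n y \<zeta> \<zeta>) | \<zeta>. vec H n \<zeta> \<and> vnorm H n \<zeta> = 1} \<noteq> {}" using unit by blast
  qed (use mat_norm_shift_ge[OF y, of _ t] in force)
  then show ?thesis by simp
qed

lemma numerical_max_lower:
  assumes y: "y \<in> mats n (bounded_ops H)" and unit: "vec H n \<zeta>0" "vnorm H n \<zeta>0 = 1"
  shows "- mat_norm H n y \<le> numerical_max H n y"
proof -
  have "- mat_norm H n y \<le> Re (mform H n y \<zeta>0 \<zeta>0)"
    using mat_norm_bound[OF y unit(1,1)] unit(2) abs_Re_le_cmod[of "mform H n y \<zeta>0 \<zeta>0"] by simp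
  then show ?thesis using numerical_max_ge[OF y unit(1)] unit(2) by simp
qed

text \<open>The constant comes from completing the square: with \<open>u = s + N\<^sup>2 / (2 t)\<close> one has
  \<open>t\<^sup>2 + 2 t s + N\<^sup>2 \<le> (t + u)\<^sup>2\<close>.\<close>

lemma numerical_max_shift_le:
  assumes y: "y \<in> mats n (bounded_ops H)" and unit: "vec H n \<zeta>0" "vnorm H n \<zeta>0 = 1" and t: "0 < t"
  shows "mat_norm H n (shift H t y) \<le> t + numerical_max H n y + (mat_norm H n y)\<^sup>2 / (2 * t)"
proof (rule mat_norm_shift_le[OF y _ _ numerical_max_ge[OF y]])
  let ?s = "numerical_max H n y" and ?N = "mat_norm H n y"
  define u where "u = ?s + ?N\<^sup>2 / (2 * t)"
  have e: "2 * t * u = 2 * t * ?s + ?N\<^sup>2" using t by (simp add: u_def field_simps)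
  have "t\<^sup>2 + 2 * t * ?s + ?N\<^sup>2 \<le> t\<^sup>2 + 2 * t * u + u\<^sup>2" using e by simp
  then show "t\<^sup>2 + 2 * t * ?s + ?N\<^sup>2 \<le> (t + ?s + ?N\<^sup>2 / (2 * t))\<^sup>2"
    by (simp add: u_def power2_sum algebra_simps)
  have "0 \<le> (t - ?N)\<^sup>2 + t\<^sup>2" by simp
  then have "2 * t * ?N \<le> 2 * t * t + ?N\<^sup>2" by (simp add: power2_diff) (simp add: power2_eq_square)
  then have "?N \<le> t + ?N\<^sup>2 / (2 * t)" using t by (simp add: field_simps)
  then show "0 \<le> t + ?s + ?N\<^sup>2 / (2 * t)" using numerical_max_lower[OF y unit] by linarith
qed (use t in auto)

lemma vnorm_concat: "(vnorm H (n + n) \<theta>)\<^sup>2 = (vnorm H n \<theta>)\<^sup>2 + (vnorm H n (\<lambda>j. \<theta> (n + j)))\<^sup>2"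
  by (simp add: vnorm_sq sum_lessThan_double)

text \<open>At \<open>(\<eta>, \<zeta>)\<close> the form of the corner matrix is \<open>2 \<langle>x \<zeta>, \<eta>\<rangle>\<close>; rotate and normalise.\<close>

lemma norm_le_numerical_max_corner:
  assumes x: "x \<in> mats n (bounded_ops H)"
    and unit: "vec H (n + n) \<zeta>0" "vnorm H (n + n) \<zeta>0 = 1"
  shows "mat_norm H n x \<le> numerical_max H (n + n) (corner n x)"
proof (rule mat_norm_leI[OF x])
  let ?s = "numerical_max H (n + n) (corner n x)"
  have c: "corner n x \<in> mats (n + n) (bounded_ops H)" by (rule corner_mats[OF subspace_bop x])
  have main: "2 * Re (mform H n x \<zeta> \<eta>) \<le> ?s * ((vnorm H n \<eta>)\<^sup>2 + (vnorm H n \<zeta>)\<^sup>2)" if v: "vec H n \<zeta>" "vec H n \<eta>" for \<zeta> \<eta>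
  proof -
    define \<theta> where "\<theta> = (\<lambda>i. if i < n then \<eta> i else \<zeta> (i - n))"
    have t: "vec H (n + n) \<theta>" using v by (auto simp: vec_def \<theta>_def)
    have "mform H n x (\<lambda>j. \<theta> (n + j)) \<theta> = mform H n x \<zeta> \<eta>" by (simp add: mform_def \<theta>_def)
    moreover have "vnorm H n \<theta> = vnorm H n \<eta>" by (simp add: vnorm_def \<theta>_def)
    moreover have "(\<lambda>j. \<theta> (n + j)) = \<zeta>" by (simp add: \<theta>_def)
    ultimately show ?thesis using numerical_max_ge[OF c t] by (simp add: mform_corner[OF x t] vnorm_concat)
  qed
  show s0: "0 \<le> ?s"
  proof -
    have "mform H n x (\<lambda>_. 0) \<eta> = 0" if "vec H n \<eta>" for \<eta>
      using mat_norm_bound[OF x, of "\<lambda>_. 0" \<eta>] that by (simp add: vec_def vnorm_def)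
    moreover have "mform H n x \<zeta> (\<lambda>_. 0) = 0" if "vec H n \<zeta>" for \<zeta>
      using mat_norm_bound[OF x, of \<zeta> "\<lambda>_. 0"] that by (simp add: vec_def vnorm_def)
    ultimately have a: "0 \<le> ?s * (vnorm H n \<zeta>)\<^sup>2" if "vec H n \<zeta>" for \<zeta>
      using main[OF _ that, of "\<lambda>_. 0"] that by (simp add: vec_def vnorm_def)
    have "vec H n \<zeta>0" "vec H n (\<lambda>j. \<zeta>0 (n + j))" using unit(1) by (auto simp: vec_def)
    from add_nonneg_nonneg[OF a[OF this(1)] a[OF this(2)]]
    have "0 \<le> ?s * (vnorm H (n + n) \<zeta>0)\<^sup>2" unfolding vnorm_concat by (simp add: distrib_left)
    then show ?thesis using unit(2) by simp
  qed
  fix \<zeta> \<eta> assume v: "vec H n \<zeta>" "vec H n \<eta>"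
  show "cmod (mform H n x \<zeta> \<eta>) \<le> ?s * vnorm H n \<zeta> * vnorm H n \<eta>"
  proof (cases "vnorm H n \<zeta> = 0 \<or> vnorm H n \<eta> = 0")
    case True
    then show ?thesis using mat_norm_bound[OF x v] by auto
  next
    case False
    define q where "q = mform H n x \<zeta> \<eta>"
    define a b where "a = vnorm H n \<zeta>" and "b = vnorm H n \<eta>"
    have ab: "a > 0" "b > 0" using False by (auto simp: a_def b_def less_le)
    define c where "c = (if q = 0 then 1 else cnj q / cmod q)"
    have c: "cmod c = 1" "c * q = complex_of_real (cmod q)" 
      by (auto simp: c_def norm_divide complex_norm_square[symmetric] mult.commute power2_eq_square)
    define \<zeta>' \<eta>' where "\<zeta>' = (\<lambda>i. (c / a) *\<^sub>C \<zeta> i)" and "\<eta>' = (\<lambda>i. complex_of_real (1 / b) *\<^sub>C \<eta> i)"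
    have v': "vec H n \<zeta>'" "vec H n \<eta>'" unfolding \<zeta>'_def \<eta>'_def using vec_scale v by auto
    have n': "vnorm H n \<zeta>' = 1" "vnorm H n \<eta>' = 1" unfolding \<zeta>'_def \<eta>'_def
      using vnorm_scale[OF v(1)] vnorm_scale[OF v(2)] c ab by (auto simp: a_def b_def norm_divide)
    have "mform H n x \<zeta>' \<eta>' = (c / a) * complex_of_real (1 / b) * q"
    proof -
      have "ip (x i j ((c / a) *\<^sub>C \<zeta> j)) (complex_of_real (1 / b) *\<^sub>C \<eta> i) = ((c / a) * complex_of_real (1 / b)) * ip (x i j (\<zeta> j)) (\<eta> i)"
        if ij: "i < n" "j < n" for i j
        using linear_onD(2)[OF bopD(3)[OF matsD[OF x ij]] vecD[OF v(1) ij(2)]] vecD[OF v(2) ij(1)]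
          mats_app[OF x v(1) ij] by (simp add: ip_scale_left ip_scale_right mem_scale)
      then show ?thesis unfolding \<zeta>'_def \<eta>'_def q_def by (simp add: mform_def sum_distrib_left)
    qed
    also have "\<dots> = (c * q) * complex_of_real (1 / (a * b))" by (simp add: field_simps)
    also have "\<dots> = complex_of_real (cmod q / (a * b))" unfolding c by simp
    finally have "cmod q / (a * b) \<le> ?s" using main[OF v'] n' by simp
    then show ?thesis using ab by (simp add: q_def a_def b_def field_simps)
  qed
qed

end

context dual_system
begin

definition nstate :: "nat \<Rightarrow> (nat \<Rightarrow> nat \<Rightarrow> 'l \<Rightarrow> 'l) \<Rightarrow> bool" where
  "nstate n w \<longleftrightarrow> w \<in> mats n V \<and> predual_norm n w \<le> 1 \<and> pairing n (id_mat H) w = 1"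

text \<open>Elements of the unit ball of the predual at which the unit almost attains its norm.\<close>

definition near_state :: "nat \<Rightarrow> real \<Rightarrow> (nat \<Rightarrow> nat \<Rightarrow> 'l \<Rightarrow> 'l) \<Rightarrow> bool" where
  "near_state n e w \<longleftrightarrow> w \<in> mats n V \<and> predual_norm n w \<le> 1 \<and> 1 - e \<le> Re (pairing n (id_mat H) w)"

lemma pairing_id_le: "w \<in> mats n V \<Longrightarrow> cmod (pairing n (id_mat H) w) \<le> predual_norm n w"
  by (rule pairing_le_1[OF _ id_mats H.mat_norm_id_le])

lemma Re_pairing_le: 
  assumes "w \<in> mats n V" "x \<in> mats n X" "predual_norm n w \<le> 1"
  shows "Re (pairing n x w) \<le> mat_norm H n x" "- mat_norm H n x \<le> Re (pairing n x w)"
proof -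
  have "mat_norm H n x * predual_norm n w \<le> mat_norm H n x * 1"
    using assms(3) H.mat_norm_ge_0[OF matsX[OF assms(2)]] by (rule mult_left_mono)
  then show "Re (pairing n x w) \<le> mat_norm H n x" "- mat_norm H n x \<le> Re (pairing n x w)"
    using pairing_le[OF assms(1,2)] abs_Re_le_cmod[of "pairing n x w"] by auto
qed

lemma convex_near: "convex_in {w. near_state n e w}"
  unfolding convex_in_def
proof safe
  fix a b and t :: real assume a: "near_state n e a" and b: "near_state n e b" and t: "0 \<le> t" "t \<le> 1"
  let ?u = "complex_of_real t *\<^sub>C a" and ?v = "complex_of_real (1 - t) *\<^sub>C b"
  have m: "?u \<in> mats n V" "?v \<in> mats n V" using a b mats_V_scale by (auto simp: near_state_def)
  have "predual_norm n (?u + ?v) \<le> predual_norm n ?u + predual_norm n ?v" by (rule predual_norm_add[OF m])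
  also have "\<dots> = t * predual_norm n a + (1 - t) * predual_norm n b"
    using a b t predual_norm_scale[of a n] predual_norm_scale[of b n] by (auto simp: near_state_def simp del: of_real_diff)
  also have "\<dots> \<le> t * 1 + (1 - t) * 1" using a b t by (intro add_mono mult_left_mono) (auto simp: near_state_def)
  finally have 1: "predual_norm n (?u + ?v) \<le> 1" by simp
  have "t * (1 - e) + (1 - t) * (1 - e) \<le> t * Re (pairing n (id_mat H) a) + (1 - t) * Re (pairing n (id_mat H) b)"
    using a b t by (intro add_mono mult_left_mono) (auto simp: near_state_def)
  also have "\<dots> = Re (pairing n (id_mat H) (?u + ?v))"
    using pairing_add_right[OF id_mats m] pairing_scale_right[OF id_mats, of _ n] a b
    by (simp add: near_state_def del: of_real_diff)
  finally show "near_state n e (?u + ?v)" using 1 mats_V_add[OF m] by (simp add: near_state_def algebra_simps)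
qed

lemma norming:
  assumes y: "y \<in> mats n X" and e: "0 < e"
  shows "\<exists>w\<in>mats n V. predual_norm n w \<le> 1 \<and> mat_norm H n y - e \<le> Re (pairing n y w)"
proof (cases "mat_norm H n y - e \<le> 0")
  case True
  then show ?thesis using mats_V_zero predual_norm_zero pairing_zero_right[OF y] by (intro bexI[of _ 0]) auto
next
  case False
  show ?thesis
  proof (rule ccontr)
    assume "\<not> ?thesis"
    then have *: "Re (pairing n y w) < mat_norm H n y - e" if "w \<in> mats n V" "predual_norm n w \<le> 1" for w using that by force
    have "cmod (pairing n y w) \<le> (mat_norm H n y - e) * predual_norm n w" if w: "w \<in> mats n V" for w
    proof (cases "pairing n y w = 0 \<or> predual_norm n w = 0")
      case True
      then show ?thesis using pairing_le[OF w y] predual_norm_ge_0[OF w] False by auto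
    next
      case nz: False
      then have p: "predual_norm n w > 0" using predual_norm_ge_0[OF w] by simp
      define c where "c = cnj (pairing n y w) / (cmod (pairing n y w) * predual_norm n w)"
      have cm: "cmod c = 1 / predual_norm n w" using nz p by (simp add: c_def norm_divide norm_mult)
      have "c * pairing n y w = complex_of_real (cmod (pairing n y w) / predual_norm n w)"
        using nz by (simp add: c_def complex_norm_square[symmetric] mult.commute power2_eq_square)
      then have "Re (pairing n y (c *\<^sub>C w)) = cmod (pairing n y w) / predual_norm n w" using pairing_scale_right[OF y w] by simp
      moreover have "predual_norm n (c *\<^sub>C w) \<le> 1" using predual_norm_scale[OF w] cm p by simp
      ultimately have "cmod (pairing n y w) / predual_norm n w < mat_norm H n y - e" using *[OF mats_V_scale[OF w]] by metis
      then show ?thesis using p by (simp add: field_simps)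
    qed
    then have "mat_norm H n y \<le> mat_norm H n y - e" using False by (intro mat_norm_le_predual_norm[OF y]) auto
    then show False using e by simp
  qed
qed

text \<open>Take \<open>w\<close> that almost norms \<open>t + y\<close>. For large \<open>t\<close> it must almost norm the unit, and what is
  left for \<open>y\<close> is at least \<open>\<parallel>t + y\<parallel> - t\<close> up to the error.\<close>

lemma near_state_attains:
  assumes y: "y \<in> mats n X" and e: "0 < e" and d: "0 < d" and unit: "vec H n \<zeta>0" "vnorm H n \<zeta>0 = 1"
  shows "\<exists>w. near_state n d w \<and> numerical_max H n y - e \<le> Re (pairing n y w)"
proof -
  let ?N = "mat_norm H n y"
  have N: "0 \<le> ?N" by (rule H.mat_norm_ge_0[OF matsX[OF y]])
  \<comment> \<open>Large enough that losing \<open>2 \<parallel>y\<parallel> + e\<close> from \<open>t\<close> costs the unit at most \<open>d\<close>.\<close>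
  define t where "t = (2 * ?N + e) / d"
  have t: "t > 0" using N e d by (simp add: t_def add_nonneg_pos)
  have td: "t * d = 2 * ?N + e" using d by (simp add: t_def)
  obtain w where w: "w \<in> mats n V" "predual_norm n w \<le> 1" "mat_norm H n (shift H t y) - e \<le> Re (pairing n (shift H t y) w)"
    using norming[OF shift_mats[OF Xs Xid y] e] by blast
  have "t + numerical_max H n y - e \<le> t * Re (pairing n (id_mat H) w) + Re (pairing n y w)"
    using w(3) H.numerical_max_shift_ge[OF matsX[OF y] unit, of t] pairing_shift[OF y, of t w] by simp
  moreover have "Re (pairing n (id_mat H) w) \<le> 1" 
    using pairing_id_le[OF w(1)] w(2) complex_Re_le_cmod[of "pairing n (id_mat H) w"] by linarith
  then have "t * Re (pairing n (id_mat H) w) \<le> t" using t by simp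
  moreover have "Re (pairing n y w) \<le> ?N" using Re_pairing_le[OF w(1) y w(2)] by simp
  moreover have "- ?N \<le> numerical_max H n y" by (rule H.numerical_max_lower[OF matsX[OF y] unit])
  ultimately have 1: "numerical_max H n y - e \<le> Re (pairing n y w)" and "t - t * d \<le> t * Re (pairing n (id_mat H) w)"
    using td by linarith+
  then have "t * (1 - d) \<le> t * Re (pairing n (id_mat H) w)" by (simp add: algebra_simps)
  then have "1 - d \<le> Re (pairing n (id_mat H) w)" using t by simp
  then show ?thesis using 1 w by (auto simp: near_state_def)
qed

text \<open>For \<open>\<parallel>y\<parallel> \<le> 1\<close> a near state satisfies
  \<open>Re \<langle>y, v\<rangle> \<le> \<parallel>t + y\<parallel> - t (1 - \<epsilon>) \<le> s(y) + 1 / (2 t) + t \<epsilon>\<close>, where \<open>s(y)\<close> is the numerical maximum,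
  and the value \<open>s(y)\<close> is almost attained by states that are as near as desired. With
  \<open>t = 1 / sqrt \<epsilon>\<close> the excess is \<open>3/2 sqrt \<epsilon>\<close>, so separation gives a much nearer state at distance
  \<open>2 sqrt \<epsilon>\<close>.\<close>

lemma near_state_improve:
  assumes v: "near_state n \<epsilon> v" and \<epsilon>: "0 < \<epsilon>" and d: "0 < d" and unit: "vec H n \<zeta>0" "vnorm H n \<zeta>0 = 1"
  shows "\<exists>w. near_state n d w \<and> predual_norm n (v - w) \<le> 2 * sqrt \<epsilon>"
proof -
  have vm: "v \<in> mats n V" "predual_norm n v \<le> 1" using v by (auto simp: near_state_def)
  define c where "c = 3/2 * sqrt \<epsilon>"
  have "\<exists>w\<in>{w. near_state n d w}. predual_norm n (v - w) \<le> c + sqrt \<epsilon> / 2"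
  proof (rule separation)
    show "{w. near_state n d w} \<subseteq> mats n V" by (auto simp: near_state_def)
    show "{w. near_state n d w} \<noteq> {}" using near_state_attains[OF zero_mats _ d unit, of 1] by auto
    show "convex_in {w. near_state n d w}" by (rule convex_near)
    fix y e assume y: "y \<in> mats n X" "mat_norm H n y \<le> 1" and e: "(0::real) < e"
    obtain w where w: "near_state n d w" "numerical_max H n y - e \<le> Re (pairing n y w)"
      using near_state_attains[OF y(1) e d unit] by blast
    define t where "t = 1 / sqrt \<epsilon>"
    have t: "t > 0" using \<epsilon> by (simp add: t_def)
    have te: "t * \<epsilon> = sqrt \<epsilon>" using \<epsilon> by (simp add: t_def real_div_sqrt)
    have "Re (pairing n (shift H t y) v) \<le> mat_norm H n (shift H t y)"
      by (rule Re_pairing_le(1)[OF vm(1) shift_mats[OF Xs Xid y(1)] vm(2)])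
    also have "\<dots> \<le> t + numerical_max H n y + (mat_norm H n y)\<^sup>2 / (2 * t)"
      by (rule H.numerical_max_shift_le[OF matsX[OF y(1)] unit t])
    also have "(mat_norm H n y)\<^sup>2 / (2 * t) \<le> 1 / (2 * t)"
      using y(2) t H.mat_norm_ge_0[OF matsX[OF y(1)]] by (intro divide_right_mono) (auto simp: power_le_one)
    also have "1 / (2 * t) = sqrt \<epsilon> / 2" by (simp add: t_def)
    finally have "t * Re (pairing n (id_mat H) v) + Re (pairing n y v) \<le> t + numerical_max H n y + sqrt \<epsilon> / 2"
      using pairing_shift[OF y(1), of t v] by simp
    moreover have "t * (1 - \<epsilon>) \<le> t * Re (pairing n (id_mat H) v)"
      using v t by (intro mult_left_mono) (auto simp: near_state_def)
    ultimately have "Re (pairing n y v) \<le> numerical_max H n y + sqrt \<epsilon> / 2 + sqrt \<epsilon>" using te by (simp add: algebra_simps)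
    then show "\<exists>w\<in>{w. near_state n d w}. Re (pairing n y v) \<le> Re (pairing n y w) + c + e"
      using w by (intro bexI[of _ w]) (auto simp: c_def)
  qed (use vm \<epsilon> in \<open>auto simp: c_def\<close>)
  then show ?thesis by (auto simp: c_def)
qed

text \<open>Improve repeatedly with errors \<open>\<epsilon> / 4\<^sup>k\<close>. The steps are at most \<open>2 sqrt \<epsilon> / 2\<^sup>k\<close>, so they
  converge in the predual, and the limit is an exact state.\<close>

lemma near_to_state:
  assumes v: "near_state n \<epsilon> v" and \<epsilon>: "0 < \<epsilon>" and unit: "vec H n \<zeta>0" "vnorm H n \<zeta>0 = 1"
  shows "\<exists>w. nstate n w \<and> predual_norm n (v - w) \<le> 4 * sqrt \<epsilon>"
proof -
  have "\<exists>f. \<forall>k. near_state n (\<epsilon> / 4 ^ k) (f k) \<and> (k = 0 \<longrightarrow> f k = v) \<and> predual_norm n (f k - f (Suc k)) \<le> 2 * sqrt (\<epsilon> / 4 ^ k)"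
    (is "\<exists>f. \<forall>k. ?P k (f k) \<and> ?Q k (f k) (f (Suc k))")
  proof -
    have "\<exists>f. \<forall>k. (near_state n (\<epsilon> / 4 ^ k) (f k) \<and> (k = 0 \<longrightarrow> f k = v)) \<and> predual_norm n (f k - f (Suc k)) \<le> 2 * sqrt (\<epsilon> / 4 ^ k)"
    proof (rule dependent_nat_choice)
      show "\<exists>x. near_state n (\<epsilon> / 4 ^ 0) x \<and> (0 = 0 \<longrightarrow> x = v)" using v by auto
      fix x k assume "near_state n (\<epsilon> / 4 ^ k) x \<and> (k = 0 \<longrightarrow> x = v)"
      then have x: "near_state n (\<epsilon> / 4 ^ k) x" by simp
      have "0 < \<epsilon> / 4 ^ k" "0 < \<epsilon> / 4 ^ Suc k" using \<epsilon> by auto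
      then obtain w where "near_state n (\<epsilon> / 4 ^ Suc k) w" "predual_norm n (x - w) \<le> 2 * sqrt (\<epsilon> / 4 ^ k)"
        using near_state_improve[OF x _ _ unit] by blast
      then show "\<exists>y. (near_state n (\<epsilon> / 4 ^ Suc k) y \<and> (Suc k = 0 \<longrightarrow> y = v)) \<and> predual_norm n (x - y) \<le> 2 * sqrt (\<epsilon> / 4 ^ k)"
        by auto
    qed
    then show ?thesis by blast
  qed
  then obtain f where f: "\<And>k. near_state n (\<epsilon> / 4 ^ k) (f k)" "f 0 = v"
    "\<And>k. predual_norm n (f k - f (Suc k)) \<le> 2 * sqrt (\<epsilon> / 4 ^ k)" by blast
  have fm: "f k \<in> mats n V" "predual_norm n (f k) \<le> 1" for k using f(1) by (auto simp: near_state_def)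
  have s4: "sqrt (\<epsilon> / 4 ^ k) = sqrt \<epsilon> / 2 ^ k" for k
  proof -
    have "(4::real) ^ k = (2 ^ k)\<^sup>2" by (metis mult.commute power2_eq_square power_mult real_sqrt_four real_sqrt_pow2 semiring_norm(80) zero_le_numeral)
    then show ?thesis by (simp add: real_sqrt_divide)
  qed
  have "predual_norm n (f k - f (Suc k)) \<le> (2 * sqrt \<epsilon>) / 2 ^ k" for k using f(3)[of k] s4[of k] by simp
  from predual_norm_complete_geom[OF fm(1) this] obtain u where u: "u \<in> mats n V" 
    "\<And>k. predual_norm n (f k - u) \<le> 2 * (2 * sqrt \<epsilon>) / 2 ^ k" by blast
  have lim0: "(\<lambda>k. C / (2::real) ^ k) \<longlonglongrightarrow> 0" for C
  proof -
    have "(\<lambda>k. C * (1/2::real) ^ k) \<longlonglongrightarrow> C * 0" by (intro tendsto_intros) auto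
    then show ?thesis by (simp add: power_divide)
  qed
  have lim4: "(\<lambda>k. C / (4::real) ^ k) \<longlonglongrightarrow> 0" for C
  proof -
    have "(\<lambda>k. C * (1/4::real) ^ k) \<longlonglongrightarrow> C * 0" by (intro tendsto_intros) auto
    then show ?thesis by (simp add: power_divide)
  qed
  have "predual_norm n u \<le> 1"
  proof (rule LIMSEQ_le_const)
    show "(\<lambda>k. 1 + 2 * (2 * sqrt \<epsilon>) / 2 ^ k) \<longlonglongrightarrow> 1"
      using tendsto_add[OF tendsto_const[of 1] lim0[of "2 * (2 * sqrt \<epsilon>)"]] by simp
    have "predual_norm n u \<le> 1 + 2 * (2 * sqrt \<epsilon>) / 2 ^ k" for k
      using predual_norm_triangle3[OF u(1) fm(1)[of k] mats_V_zero] predual_norm_diff_commute[OF u(1) fm(1)[of k]] u(2)[of k] fm(2)[of k] by simp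
    then show "\<exists>N. \<forall>k\<ge>N. predual_norm n u \<le> 1 + 2 * (2 * sqrt \<epsilon>) / 2 ^ k" by blast
  qed
  moreover have "1 \<le> Re (pairing n (id_mat H) u)"
  proof (rule LIMSEQ_le_const2)
    show "(\<lambda>k. (1 - \<epsilon> / 4 ^ k) - 2 * (2 * sqrt \<epsilon>) / 2 ^ k) \<longlonglongrightarrow> 1"
      using tendsto_diff[OF tendsto_diff[OF tendsto_const[of 1] lim4[of \<epsilon>]] lim0[of "2 * (2 * sqrt \<epsilon>)"]] by simp
    have "(1 - \<epsilon> / 4 ^ k) - 2 * (2 * sqrt \<epsilon>) / 2 ^ k \<le> Re (pairing n (id_mat H) u)" for k
    proof -
      have "cmod (pairing n (id_mat H) (f k - u)) \<le> 2 * (2 * sqrt \<epsilon>) / 2 ^ k"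
        using pairing_id_le[OF mats_V_diff[OF fm(1) u(1)], of k] u(2)[of k] by linarith
      then have "Re (pairing n (id_mat H) (f k - u)) \<le> 2 * (2 * sqrt \<epsilon>) / 2 ^ k"
        using complex_Re_le_cmod order_trans by blast
      then show ?thesis using f(1)[of k] pairing_diff_right[OF id_mats fm(1)[of k] u(1)] by (simp add: near_state_def)
    qed
    then show "\<exists>N. \<forall>k\<ge>N. (1 - \<epsilon> / 4 ^ k) - 2 * (2 * sqrt \<epsilon>) / 2 ^ k \<le> Re (pairing n (id_mat H) u)" by blast
  qed
  ultimately have "pairing n (id_mat H) u = 1"
  proof -
    assume a: "predual_norm n u \<le> 1" "1 \<le> Re (pairing n (id_mat H) u)"
    let ?z = "pairing n (id_mat H) u"
    have "cmod ?z \<le> 1" using pairing_id_le[OF u(1)] a by simp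
    moreover have "(cmod ?z)\<^sup>2 = (Re ?z)\<^sup>2 + (Im ?z)\<^sup>2" by (rule cmod_power2)
    moreover have "1 \<le> (Re ?z)\<^sup>2" using a(2) by (simp add: one_le_power)
    moreover have "(cmod ?z)\<^sup>2 \<le> 1" using calculation(1) by (simp add: power_le_one)
    ultimately have "(Im ?z)\<^sup>2 \<le> 0" "(Re ?z)\<^sup>2 \<le> 1" using zero_le_power2[of "Im ?z"] by linarith+
    then have "Im ?z = 0" "Re ?z \<le> 1" by (auto simp: power2_le_iff_abs_le abs_le_iff power_le_one_iff)
      (metis abs_le_iff abs_square_le_1)
    then show ?thesis using a(2) by (simp add: complex_eq_iff)
  qed
  then have "nstate n u" using \<open>predual_norm n u \<le> 1\<close> u(1) by (simp add: nstate_def)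
  then show ?thesis using u(2)[of 0] f(2) by (intro exI[of _ u]) simp
qed

lemma state_attains:
  assumes y: "y \<in> mats n X" and e: "0 < e" and unit: "vec H n \<zeta>0" "vnorm H n \<zeta>0 = 1"
  shows "\<exists>w. nstate n w \<and> numerical_max H n y - e \<le> Re (pairing n y w)"
proof -
  let ?N = "mat_norm H n y"
  have N: "0 \<le> ?N" by (rule H.mat_norm_ge_0[OF matsX[OF y]])
  define r where "r = e / (8 * (?N + 1))"
  have r: "r > 0" using N e by (simp add: r_def)
  have rN: "?N * (4 * r) \<le> e / 2"
  proof -
    have "(?N + 1) * (4 * r) = e / 2" using N by (simp add: r_def field_simps)
    moreover have "?N * (4 * r) \<le> (?N + 1) * (4 * r)" using r by (intro mult_right_mono) auto
    ultimately show ?thesis by linarith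
  qed
  have r2: "0 < r\<^sup>2" and e2: "0 < e/2" using r e by auto
  obtain v where v: "near_state n (r\<^sup>2) v" "numerical_max H n y - e/2 \<le> Re (pairing n y v)"
    using near_state_attains[OF y e2 r2 unit] by blast
  obtain w where w: "nstate n w" "predual_norm n (v - w) \<le> 4 * r" using near_to_state[OF v(1) r2 unit] r by auto
  have m: "v \<in> mats n V" "w \<in> mats n V" using v w by (auto simp: near_state_def nstate_def)
  have "cmod (pairing n y (v - w)) \<le> ?N * predual_norm n (v - w)" by (rule pairing_le[OF mats_V_diff[OF m] y])
  also have "\<dots> \<le> ?N * (4 * r)" using w(2) N by (rule mult_left_mono)
  finally have "Re (pairing n y (v - w)) \<le> e / 2" using rN complex_Re_le_cmod[of "pairing n y (v - w)"] by linarith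
  then show ?thesis using v(2) w(1) pairing_diff_right[OF y m] by (intro exI[of _ w]) auto
qed

end

text \<open>Optimise over \<open>t\<close>; in the degenerate cases let \<open>t\<close> tend to infinity or to zero. This recovers
  a Cauchy-Schwarz bound from an inequality of arithmetic-geometric type.\<close>

lemma real_sqrt_bound_of_quadratic:
  fixes s M a b :: real
  assumes *: "\<And>t. 0 < t \<Longrightarrow> 2 * t * s \<le> M * (t\<^sup>2 * a + b)" and M: "0 \<le> M" and a: "0 \<le> a" and b: "0 \<le> b"
  shows "s \<le> M * sqrt a * sqrt b"
proof (cases "a = 0 \<or> b = 0")
  case True
  have "s \<le> 0"
  proof (rule ccontr)
    assume "\<not> s \<le> 0"
    then have s: "s > 0" by simp
    show False
    proof (cases "a = 0")
      case True
      have "2 * ((M * b + 1) / (2 * s)) * s \<le> M * b"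
        using *[of "(M * b + 1) / (2 * s)"] s M b True by (simp add: add_nonneg_pos)
      then show False using s by simp
    next
      case False
      then have b0: "b = 0" and a': "a > 0" using True a by auto
      have t: "0 < s / (M * a + 1)" using s M a by (simp add: add_nonneg_pos)
      have "2 * (s / (M * a + 1)) * s \<le> (s / (M * a + 1)) * ((s / (M * a + 1)) * (M * a))"
        using *[OF t] b0 by (simp add: power2_eq_square mult_ac)
      then have "(s / (M * a + 1)) * (2 * s) \<le> (s / (M * a + 1)) * ((s / (M * a + 1)) * (M * a))"
        by (simp add: mult_ac)
      then have "2 * s \<le> (s / (M * a + 1)) * (M * a)" by (rule mult_left_le_imp_le[OF _ t])
      also have "\<dots> = s * (M * a / (M * a + 1))" by simp
      also have "\<dots> \<le> s * 1" using s M a by (intro mult_left_mono) (auto simp: divide_le_eq_1 add_nonneg_pos)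
      finally show False using s by simp
    qed
  qed
  also have "0 \<le> M * sqrt a * sqrt b" using M a b by simp
  finally show ?thesis .
next
  case False
  then have ab: "a > 0" "b > 0" using a b by auto
  define t where "t = sqrt b / sqrt a"
  have t: "t > 0" using ab by (simp add: t_def)
  have ta: "t\<^sup>2 * a = b" using ab by (simp add: t_def power_divide)
  have "2 * t * s \<le> M * (b + b)" using *[OF t] unfolding ta .
  then have "t * s \<le> M * b" by simp
  also have "\<dots> = t * (M * sqrt a * sqrt b)" using ab by (simp add: t_def)
  finally show ?thesis by (rule mult_left_le_imp_le[OF _ t])
qed

lemma amp_mats: 
  assumes "complex_vec.subspace X" "x \<in> mats m X"
  shows "amp m x a b \<in> mats n X"
proof -
  have "amp m x a b i j \<in> X" for i j unfolding amp_def
    by (intro complex_vec.subspace_sum[OF assms(1)] complex_vec.subspace_scale[OF assms(1)] matsD[OF assms(2)]) auto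
  then show ?thesis by (simp add: mats_def)
qed

lemma (in pre_hilb) mform_amp:
  assumes x: "x \<in> mats m (bounded_ops H)" and z: "vec H n \<zeta>" and e: "vec H n \<eta>"
  shows "mform H n (amp m x a b) \<zeta> \<eta> = mform H m x (\<lambda>q. \<Sum>j<n. a q j *\<^sub>C \<zeta> j) (\<lambda>p. \<Sum>i<n. b p i *\<^sub>C \<eta> i)"
proof -
  have sumapp: "(\<Sum>k<(r::nat). g k) c = (\<Sum>k<r. g k c)" for g :: "nat \<Rightarrow> 'h \<Rightarrow> 'h" and c r
    by (induction r) auto
  have xz: "x p q (\<zeta> j) \<in> CH" if "p < m" "q < m" "j < n" for p q j
    using bopD(1)[OF matsD[OF x that(1,2)] vecD[OF z that(3)]] .
  have l: "ip (amp m x a b i j (\<zeta> j)) (\<eta> i) = (\<Sum>p<m. \<Sum>q<m. (a q j * cnj (b p i)) * ip (x p q (\<zeta> j)) (\<eta> i))"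
    if ij: "i < n" "j < n" for i j
  proof -
    have "ip (amp m x a b i j (\<zeta> j)) (\<eta> i) = ip (\<Sum>p<m. \<Sum>q<m. (a q j * cnj (b p i)) *\<^sub>C x p q (\<zeta> j)) (\<eta> i)"
      by (simp add: amp_def sumapp scaleC_fun_def)
    also have "\<dots> = (\<Sum>p<m. ip (\<Sum>q<m. (a q j * cnj (b p i)) *\<^sub>C x p q (\<zeta> j)) (\<eta> i))"
      by (rule ip_sum_left) (use xz ij vecD[OF e] in \<open>auto intro!: mem_lincomb\<close>)
    also have "\<dots> = (\<Sum>p<m. \<Sum>q<m. (a q j * cnj (b p i)) * ip (x p q (\<zeta> j)) (\<eta> i))"
      by (intro sum.cong refl ip_lincomb_left) (use xz ij vecD[OF e] in auto)
    finally show ?thesis .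
  qed
  have r: "ip (x p q (\<Sum>j<n. a q j *\<^sub>C \<zeta> j)) (\<Sum>i<n. b p i *\<^sub>C \<eta> i) 
      = (\<Sum>i<n. \<Sum>j<n. (a q j * cnj (b p i)) * ip (x p q (\<zeta> j)) (\<eta> i))" if pq: "p < m" "q < m" for p q
  proof -
    have "x p q (\<Sum>j<n. a q j *\<^sub>C \<zeta> j) = (\<Sum>j<n. a q j *\<^sub>C x p q (\<zeta> j))"
      by (rule linear_on_lincomb[OF bopD(3)[OF matsD[OF x pq]] subsp]) (use vecD[OF z] in auto)
    then have "ip (x p q (\<Sum>j<n. a q j *\<^sub>C \<zeta> j)) (\<Sum>i<n. b p i *\<^sub>C \<eta> i)
      = ip (\<Sum>j<n. a q j *\<^sub>C x p q (\<zeta> j)) (\<Sum>i<n. b p i *\<^sub>C \<eta> i)" by simp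
    also have "\<dots> = (\<Sum>i<n. cnj (b p i) * ip (\<Sum>j<n. a q j *\<^sub>C x p q (\<zeta> j)) (\<eta> i))"
      by (rule ip_lincomb_right) (use xz pq vecD[OF e] in \<open>auto intro!: mem_lincomb\<close>)
    also have "\<dots> = (\<Sum>i<n. cnj (b p i) * (\<Sum>j<n. a q j * ip (x p q (\<zeta> j)) (\<eta> i)))"
      by (intro sum.cong refl arg_cong2[where f="(*)"] ip_lincomb_left) (use xz pq vecD[OF e] in auto)
    finally show ?thesis by (simp add: sum_distrib_left mult_ac)
  qed
  have "mform H n (amp m x a b) \<zeta> \<eta> = (\<Sum>i<n. \<Sum>j<n. \<Sum>p<m. \<Sum>q<m. (a q j * cnj (b p i)) * ip (x p q (\<zeta> j)) (\<eta> i))"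
    unfolding mform_def using l by (intro sum.cong refl) auto
  also have "\<dots> = (\<Sum>p<m. \<Sum>q<m. \<Sum>i<n. \<Sum>j<n. (a q j * cnj (b p i)) * ip (x p q (\<zeta> j)) (\<eta> i))"
    by (rule sum_swap4)
  also have "\<dots> = mform H m x (\<lambda>q. \<Sum>j<n. a q j *\<^sub>C \<zeta> j) (\<lambda>p. \<Sum>i<n. b p i *\<^sub>C \<eta> i)"
    unfolding mform_def using r by (intro sum.cong refl) auto
  finally show ?thesis .
qed

context dual_system
begin

text \<open>A complex number in the closed unit disc with real part at least \<open>1\<close> is \<open>1\<close>.\<close>

lemma nstate_iff_near: "nstate n w \<longleftrightarrow> near_state n 0 w"
proof
  assume "near_state n 0 w"
  then have w: "w \<in> mats n V" "predual_norm n w \<le> 1" "1 \<le> Re (pairing n (id_mat H) w)" by (auto simp: near_state_def)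
  let ?z = "pairing n (id_mat H) w"
  have z: "cmod ?z \<le> 1" using pairing_id_le[OF w(1)] w(2) by simp
  then have "Re ?z = 1" using w(3) complex_Re_le_cmod[of ?z] by linarith
  moreover have "(cmod ?z)\<^sup>2 \<le> 1" using z by (simp add: power_le_one)
  ultimately have "Im ?z = 0" by (simp add: cmod_power2)
  with \<open>Re ?z = 1\<close> have "?z = 1" by (simp add: complex_eq_iff)
  then show "nstate n w" using w by (simp add: nstate_def)
qed (auto simp: nstate_def near_state_def)

lemma nstate_convex:
  assumes "nstate n a" "nstate n b" "0 \<le> t" "t \<le> 1"
  shows "nstate n (complex_of_real t *\<^sub>C a + complex_of_real (1 - t) *\<^sub>C b)"
  using convex_near[of n 0] assms unfolding nstate_iff_near convex_in_def by blast

text \<open>Off-diagonal corners of normal states of \<open>M\<^sub>2(X)\<close> cannot be separated from the unit ball of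
  \<open>V\<close>: the corner matrix of \<open>x\<close> has numerical maximum at least \<open>\<parallel>x\<parallel>\<close>, and states attain it up to
  any error.\<close>

lemma corner_dense:
  assumes v: "v \<in> V" "op_norm L v \<le> 1" and e: "0 < e" and unit: "a0 \<in> hcarrier H" "hnorm H a0 = 1"
  shows "\<exists>w. nstate 2 w \<and> op_norm L (v - 2 *\<^sub>C w 0 1) \<le> e"
proof -
  define \<zeta>0 where "\<zeta>0 = (\<lambda>i::nat. if i = 0 then a0 else 0)"
  have u2: "vec H (1 + 1) \<zeta>0" "vnorm H (1 + 1) \<zeta>0 = 1" 
    using unit by (auto simp: vec_def \<zeta>0_def vnorm_def numeral_2_eq_2)
  define D where "D = (\<lambda>w (i::nat) (j::nat). 2 *\<^sub>C w (0::nat) (1::nat)) ` {w. nstate 2 w}"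
  have wV: "w 0 1 \<in> V" if "nstate 2 w" for w using that by (auto simp: nstate_def mats_def)
  have "\<exists>d\<in>D. predual_norm 1 ((\<lambda>_ _. v) - d) \<le> 0 + e"
  proof (rule separation)
    show "D \<subseteq> mats 1 V" using wV complex_vec.subspace_scale[OF Vs] by (auto simp: D_def mats_def)
    show "convex_in D" unfolding convex_in_def
    proof (intro ballI allI impI)
      fix a b and t :: real assume "a \<in> D" "b \<in> D" and t: "0 \<le> t" "t \<le> 1"
      then obtain p q where p: "nstate 2 p" "a = (\<lambda>i j. 2 *\<^sub>C p 0 1)" and q: "nstate 2 q" "b = (\<lambda>i j. 2 *\<^sub>C q 0 1)"
        by (auto simp: D_def)
      let ?r = "complex_of_real t *\<^sub>C p + complex_of_real (1 - t) *\<^sub>C q"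
      have eq: "complex_of_real t *\<^sub>C a + complex_of_real (1 - t) *\<^sub>C b = (\<lambda>i j. 2 *\<^sub>C ?r 0 1)"
        unfolding p q by (simp add: fun_eq_iff scaleC_fun_def complex_vec.scale_right_distrib mult.commute)
      have "?r \<in> {w. nstate 2 w}" using nstate_convex[OF p(1) q(1) t] unfolding mem_Collect_eq .
      then show "complex_of_real t *\<^sub>C a + complex_of_real (1 - t) *\<^sub>C b \<in> D"
        unfolding D_def eq by (rule imageI)
    qed
    show "(\<lambda>_ _. v) \<in> mats 1 V" using v by (simp add: mats_def)
    have ex: "\<exists>w. nstate 2 w \<and> mat_norm H 1 y - d \<le> Re (pairing 1 y (\<lambda>_ _. 2 *\<^sub>C w 0 1))" if y: "y \<in> mats 1 X" and d: "0 < d" for y d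
    proof -
      obtain w where w: "nstate 2 w" "numerical_max H 2 (corner 1 y) - d \<le> Re (pairing 2 (corner 1 y) w)"
        using state_attains[OF corner_mats[OF Xs y] d u2] unfolding one_add_one by blast
      have y0: "y 0 0 \<in> X" using y by (simp add: mats_def)
      have "pairing 2 (corner 1 y) w = J (2 *\<^sub>C y 0 0) (w 0 1)"
        by (simp add: pairing_def corner_def numeral_2_eq_2 J_zero)
      also have "\<dots> = pairing 1 y (\<lambda>_ _. 2 *\<^sub>C w 0 1)" 
        using J_scale[OF y0] J_v_scale[OF y0 wV[OF w(1)]] by (simp add: pairing_def)
      finally show ?thesis using w H.norm_le_numerical_max_corner[OF matsX[OF y] u2] unfolding one_add_one
        by (intro exI[of _ w]) auto
    qed
    show "D \<noteq> {}" using ex[OF zero_mats, of 1] by (auto simp: D_def)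
    fix y d assume y: "y \<in> mats 1 X" "mat_norm H 1 y \<le> 1" and d: "(0::real) < d"
    obtain w where w: "nstate 2 w" "mat_norm H 1 y - d \<le> Re (pairing 1 y (\<lambda>_ _. 2 *\<^sub>C w 0 1))" using ex[OF y(1) d] by blast
    have "Re (pairing 1 y (\<lambda>_ _. v)) \<le> mat_norm H 1 y"
    proof -
      have "cmod (pairing 1 y (\<lambda>_ _. v)) \<le> mat_norm H 1 y * op_norm L v" using pairing_crude[OF y(1), of "\<lambda>_ _. v"] v
        by (simp add: mats_def)
      also have "\<dots> \<le> mat_norm H 1 y * 1" using v H.mat_norm_ge_0[OF matsX[OF y(1)]] by (intro mult_left_mono) auto
      finally show ?thesis using complex_Re_le_cmod[of "pairing 1 y (\<lambda>_ _. v)"] by linarith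
    qed
    then show "\<exists>w\<in>D. Re (pairing 1 y (\<lambda>_ _. v)) \<le> Re (pairing 1 y w) + 0 + d"
      using w by (intro bexI[of _ "\<lambda>_ _. 2 *\<^sub>C w 0 1"]) (auto simp: D_def)
  qed (use e in auto)
  then obtain w where w: "nstate 2 w" "predual_norm 1 ((\<lambda>_ _. v) - (\<lambda>i j. 2 *\<^sub>C w 0 1)) \<le> e" by (auto simp: D_def)
  have "(\<lambda>_ _. v) - (\<lambda>i j. 2 *\<^sub>C w 0 1) \<in> mats 1 V"
    using v wV[OF w(1)] complex_vec.subspace_scale[OF Vs] by (intro mats_V_diff) (auto simp: mats_def)
  from op_norm_le_predual_norm[OF this, of 0 0] have "op_norm L (v - 2 *\<^sub>C w 0 1) \<le> predual_norm 1 ((\<lambda>_ _. v) - (\<lambda>i j. 2 *\<^sub>C w 0 1))"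
    by simp
  then show ?thesis using w by (intro exI[of _ w]) auto
qed

text \<open>Subtract an approximating corner, double the remainder and repeat. The states used form a series
  with weights \<open>1 / 2\<^sup>k\<close>, whose sum is again a normal state since the set of normal states is convex
  and closed. So a single state has exactly the required corner.\<close>

lemma corner_exact:
  assumes v: "v \<in> V" "op_norm L v \<le> 1" and unit: "a0 \<in> hcarrier H" "hnorm H a0 = 1"
  shows "\<exists>w. nstate 2 w \<and> v = 4 *\<^sub>C w 0 1"
proof -
  have "\<exists>w. nstate 2 w \<and> op_norm L (r - 2 *\<^sub>C w 0 1) \<le> 1/2" if "r \<in> V" "op_norm L r \<le> 1" for r
    using corner_dense[OF that _ unit, of "1/2"] by simp
  then obtain St where St: "\<And>r. r \<in> V \<Longrightarrow> op_norm L r \<le> 1 \<Longrightarrow> nstate 2 (St r)"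
    "\<And>r. r \<in> V \<Longrightarrow> op_norm L r \<le> 1 \<Longrightarrow> op_norm L (r - 2 *\<^sub>C St r 0 1) \<le> 1/2" by metis
  \<comment> \<open>The doubled remainders; each stays in the unit ball, since corners approximate it to within \<open>1/2\<close>.\<close>
  define r where "r = rec_nat v (\<lambda>_ r. 2 *\<^sub>C (r - 2 *\<^sub>C St r 0 1))"
  have r0: "r 0 = v" and rS: "r (Suc k) = 2 *\<^sub>C (r k - 2 *\<^sub>C St (r k) 0 1)" for k by (simp_all add: r_def)
  have wV: "w 0 1 \<in> V" if "nstate 2 w" for w using that by (auto simp: nstate_def mats_def)
  have r: "r k \<in> V \<and> op_norm L (r k) \<le> 1" for k
  proof (induction k)
    case (Suc k)
    then have d: "r k - 2 *\<^sub>C St (r k) 0 1 \<in> V"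
      using St(1) wV complex_vec.subspace_diff[OF Vs] complex_vec.subspace_scale[OF Vs] by auto
    have db: "r k - 2 *\<^sub>C St (r k) 0 1 \<in> bounded_ops L" using d Vb by auto
    have "op_norm L (r (Suc k)) = 2 * op_norm L (r k - 2 *\<^sub>C St (r k) 0 1)"
      unfolding rS using L.op_norm_scale[OF db, of 2] by simp
    also have "\<dots> \<le> 1" using St(2)[of "r k"] Suc by simp
    finally show ?case unfolding rS using complex_vec.subspace_scale[OF Vs d] by blast
  qed (use r0 v in auto)
  have stk: "nstate 2 (St (r k))" for k using St(1) r by blast
  \<comment> \<open>The partial sums of the series of states; the weights add up to \<open>1\<close>.\<close>
  define u where "u = rec_nat 0 (\<lambda>k u. u + complex_of_real (1 / 2 ^ Suc k) *\<^sub>C St (r k))"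
  have u0: "u 0 = 0" and uS: "u (Suc k) = u k + complex_of_real (1 / 2 ^ Suc k) *\<^sub>C St (r k)" for k by (simp_all add: u_def)
  have sm: "complex_of_real c *\<^sub>C St (r k) \<in> mats 2 V" for c k using stk mats_V_scale by (auto simp: nstate_def)
  have um: "u k \<in> mats 2 V" for k
  proof (induction k)
    case 0 then show ?case unfolding u0 by (rule mats_V_zero)
  next
    case (Suc k) then show ?case unfolding uS by (rule mats_V_add[OF _ sm])
  qed
  have nS: "predual_norm 2 (complex_of_real (1 / 2 ^ Suc k) *\<^sub>C St (r k)) \<le> 1 / 2 ^ Suc k" for k
  proof -
    have "predual_norm 2 (complex_of_real (1 / 2 ^ Suc k) *\<^sub>C St (r k)) = (1 / 2 ^ Suc k) * predual_norm 2 (St (r k))"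
      using predual_norm_scale[of "St (r k)" 2 "complex_of_real (1 / 2 ^ Suc k)"] stk[of k] by (simp add: nstate_def norm_divide norm_power)
    also have "\<dots> \<le> (1 / 2 ^ Suc k) * 1" using stk[of k] by (intro mult_left_mono) (auto simp: nstate_def)
    finally show ?thesis by simp
  qed
  have step: "predual_norm 2 (u k - u (Suc k)) \<le> (1/2) / 2 ^ k" for k
  proof -
    have "predual_norm 2 (u k - u (Suc k)) = predual_norm 2 (u (Suc k) - u k)" by (rule predual_norm_diff_commute[OF um um])
    also have "u (Suc k) - u k = complex_of_real (1 / 2 ^ Suc k) *\<^sub>C St (r k)" unfolding uS by (rule add_diff_cancel_left')
    also note nS[of k]
    also have "1 / 2 ^ Suc k = (1/2) / (2::real) ^ k" by simp
    finally show ?thesis .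
  qed
  obtain w where w: "w \<in> mats 2 V" "\<And>k. predual_norm 2 (u k - w) \<le> 2 * (1/2) / 2 ^ k"
    using predual_norm_complete_geom[OF um step] by blast
  have nu: "predual_norm 2 (u k) \<le> 1 - 1 / 2 ^ k" for k
  proof (induction k)
    case 0 show ?case unfolding u0 predual_norm_zero by simp
  next
    case (Suc k)
    have "predual_norm 2 (u (Suc k)) \<le> (1 - 1 / 2 ^ k) + 1 / 2 ^ Suc k"
      unfolding uS by (rule order.trans[OF predual_norm_add[OF um sm] add_mono[OF Suc.IH nS]])
    also have "\<dots> = 1 - 1 / 2 ^ Suc k" by simp
    finally show ?case .
  qed
  have pu: "pairing 2 (id_mat H) (u k) = complex_of_real (1 - 1 / 2 ^ k)" for k
  proof (induction k)
    case 0 show ?case unfolding u0 pairing_zero_right[OF id_mats] by simp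
  next
    case (Suc k)
    have "pairing 2 (id_mat H) (u (Suc k)) = complex_of_real (1 - 1 / 2 ^ k) + complex_of_real (1 / 2 ^ Suc k) * 1"
      unfolding uS pairing_add_right[OF id_mats um sm] Suc
      using pairing_scale_right[OF id_mats, of "St (r k)" 2] stk[of k] by (simp add: nstate_def)
    then show ?case by simp
  qed
  have vu: "v = 4 *\<^sub>C u k 0 1 + complex_of_real (1 / 2 ^ k) *\<^sub>C r k" for k
  proof (induction k)
    case 0
    have z: "(0 :: nat \<Rightarrow> nat \<Rightarrow> 'l \<Rightarrow> 'l) 0 1 = 0" by simp
    show ?case unfolding u0 r0 z
      by (simp only: complex_vec.scale_zero_right power_0 div_by_1 of_real_1 scaleC_one add_0_left)
  next
    case (Suc k)
    have c: "complex_of_real (1 / 2 ^ k) = complex_of_real (1 / 2 ^ Suc k) * 2" by simp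
    have "r k = complex_of_real (1/2) *\<^sub>C r (Suc k) + 2 *\<^sub>C St (r k) 0 1" 
    proof -
      have h: "complex_of_real (1/2) * 2 = 1" by simp
      show ?thesis unfolding rS scaleC_scaleC h scaleC_one by (rule diff_add_cancel[symmetric])
    qed
    then have "complex_of_real (1 / 2 ^ k) *\<^sub>C r k = complex_of_real (1 / 2 ^ k) *\<^sub>C (complex_of_real (1/2) *\<^sub>C r (Suc k) + 2 *\<^sub>C St (r k) 0 1)"
      by (rule arg_cong)
    also have "\<dots> = complex_of_real (1 / 2 ^ Suc k) *\<^sub>C r (Suc k) + (4 * complex_of_real (1 / 2 ^ Suc k)) *\<^sub>C St (r k) 0 1"
    proof -
      have h: "complex_of_real (1 / 2 ^ k) * complex_of_real (1/2) = complex_of_real (1 / 2 ^ Suc k)"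
        "complex_of_real (1 / 2 ^ k) * 2 = 4 * complex_of_real (1 / 2 ^ Suc k)" by simp_all
      show ?thesis unfolding complex_vec.scale_right_distrib scaleC_scaleC h ..
    qed
    finally have "v = 4 *\<^sub>C u k 0 1 + ((4 * complex_of_real (1 / 2 ^ Suc k)) *\<^sub>C St (r k) 0 1 + complex_of_real (1 / 2 ^ Suc k) *\<^sub>C r (Suc k))"
      using Suc by (simp only: add.commute)
    also have "\<dots> = 4 *\<^sub>C u (Suc k) 0 1 + complex_of_real (1 / 2 ^ Suc k) *\<^sub>C r (Suc k)"
      unfolding uS by (simp only: plus_fun_apply scaleC_fun_apply complex_vec.scale_right_distrib scaleC_scaleC add.assoc)
    finally show ?case .
  qed
  have lim0: "(\<lambda>k. C / (2::real) ^ k) \<longlonglongrightarrow> 0" for C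
  proof -
    have "(\<lambda>k. C * (1/2::real) ^ k) \<longlonglongrightarrow> C * 0" by (intro tendsto_intros) auto
    then show ?thesis by (simp add: power_divide)
  qed
  have "near_state 2 0 w" unfolding near_state_def
  proof (intro conjI w(1))
    show "predual_norm 2 w \<le> 1"
      using predual_norm_triangle3[OF w(1) um[of 0] mats_V_zero] predual_norm_diff_commute[OF w(1) um[of 0]] w(2)[of 0] nu[of 0] by simp
    show "1 - 0 \<le> Re (pairing 2 (id_mat H) w)"
    proof (rule LIMSEQ_le_const2)
      show "(\<lambda>k. 1 - 2 / 2 ^ k) \<longlonglongrightarrow> (1::real) - 0" using tendsto_diff[OF tendsto_const[of 1] lim0[of 2]] by simp
      have "1 - 2 / 2 ^ k \<le> Re (pairing 2 (id_mat H) w)" for k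
      proof -
        have "cmod (pairing 2 (id_mat H) (u k - w)) \<le> 1 / 2 ^ k"
          using pairing_id_le[OF mats_V_diff[OF um w(1)], of k] w(2)[of k] by simp
        then have "Re (pairing 2 (id_mat H) (u k - w)) \<le> 1 / 2 ^ k"
          using complex_Re_le_cmod order_trans by blast
        moreover have "pairing 2 (id_mat H) (u k - w) = complex_of_real (1 - 1 / 2 ^ k) - pairing 2 (id_mat H) w"
          unfolding pairing_diff_right[OF id_mats um w(1)] pu ..
        ultimately have "(1 - 1 / 2 ^ k) - Re (pairing 2 (id_mat H) w) \<le> 1 / 2 ^ k" by simp
        moreover have "2 / 2 ^ k = 1 / 2 ^ k + (1 / 2 ^ k :: real)" by simp
        ultimately show ?thesis by linarith
      qed
      then show "\<exists>N. \<forall>k\<ge>N. 1 - 2 / 2 ^ k \<le> Re (pairing 2 (id_mat H) w)" by blast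
    qed
  qed
  then have ws: "nstate 2 w" by (simp add: nstate_iff_near)
  have wb: "4 *\<^sub>C w 0 1 \<in> V" using wV[OF ws] complex_vec.subspace_scale[OF Vs] by auto
  have "J x v = J x (4 *\<^sub>C w 0 1)" if x: "x \<in> X" for x
  proof -
    have "cmod (J x v - J x (4 *\<^sub>C w 0 1)) \<le> 0"
    proof (rule LIMSEQ_le_const)
      show "(\<lambda>k. (op_norm H x * 5) / 2 ^ k) \<longlonglongrightarrow> 0" by (rule lim0)
      have "cmod (J x v - J x (4 *\<^sub>C w 0 1)) \<le> (op_norm H x * 5) / 2 ^ k" for k
      proof -
        have u01: "u k 0 1 \<in> V" "w 0 1 \<in> V" using um[of k] w(1) by (auto simp: mats_def)
        have d: "(u k - w) 0 1 = u k 0 1 - w 0 1" by simp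
        have "J x v = 4 * J x (u k 0 1) + complex_of_real (1 / 2 ^ k) * J x (r k)"
          using vu[of k] J_v_add[OF x complex_vec.subspace_scale[OF Vs u01(1)] complex_vec.subspace_scale[OF Vs], of "r k" 4 "complex_of_real (1 / 2 ^ k)"]
            J_v_scale[OF x u01(1)] J_v_scale[OF x, of "r k"] r[of k] by metis
        then have "J x v - J x (4 *\<^sub>C w 0 1) = 4 * J x (u k 0 1 - w 0 1) + complex_of_real (1 / 2 ^ k) * J x (r k)"
          unfolding J_v_scale[OF x u01(2)] linear_on_diff[OF J_lin[OF x] Vs u01] by (simp add: right_diff_distrib)
        also have "cmod \<dots> \<le> 4 * cmod (J x (u k 0 1 - w 0 1)) + (1 / 2 ^ k) * cmod (J x (r k))"
          by (rule order.trans[OF norm_triangle_ineq]) (simp add: norm_mult norm_divide norm_power)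
        also have "\<dots> \<le> 4 * (op_norm H x * (1 / 2 ^ k)) + (1 / 2 ^ k) * (op_norm H x * 1)"
        proof (intro add_mono mult_left_mono)
          have x0: "0 \<le> op_norm H x" using H.op_norm_ge_0 x Xb by auto
          have "op_norm L (u k 0 1 - w 0 1) \<le> 1 / 2 ^ k"
            using op_norm_le_predual_norm[OF mats_V_diff[OF um w(1)], of 0 1 k] w(2)[of k] d by simp
          then show "cmod (J x (u k 0 1 - w 0 1)) \<le> op_norm H x * (1 / 2 ^ k)"
            using J_bound[OF x complex_vec.subspace_diff[OF Vs u01]] x0 
            by (meson mult_left_mono order.trans)
          show "cmod (J x (r k)) \<le> op_norm H x * 1"
            using J_bound[OF x, of "r k"] r[of k] x0 by (meson mult_left_mono order.trans)
        qed auto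
        finally show ?thesis by (simp add: algebra_simps)
      qed
      then show "\<exists>N. \<forall>k\<ge>N. cmod (J x v - J x (4 *\<^sub>C w 0 1)) \<le> (op_norm H x * 5) / 2 ^ k" by blast
    qed
    then show ?thesis by simp
  qed
  then have "op_norm L (v - 4 *\<^sub>C w 0 1) \<le> 0"
    using linear_on_diff[OF J_lin Vs v(1) wb] by (intro op_norm_le_J complex_vec.subspace_diff[OF Vs v(1) wb]) simp
  then have z: "op_norm L (v - 4 *\<^sub>C w 0 1) = 0" using op_norm_V_ge_0[OF complex_vec.subspace_diff[OF Vs v(1) wb]] by simp
  have db: "v - 4 *\<^sub>C w 0 1 \<in> bounded_ops L" using complex_vec.subspace_diff[OF Vs v(1) wb] Vb by auto
  have "v - 4 *\<^sub>C w 0 1 = 0"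
  proof (rule L.bop_eqI[OF db L.bop_zero])
    fix a assume a: "a \<in> hcarrier L"
    have m: "(v - 4 *\<^sub>C w 0 1) a \<in> hcarrier L" by (rule L.bopD(1)[OF db a])
    have "hnorm L ((v - 4 *\<^sub>C w 0 1) a) = 0" using L.op_norm_bound[OF db a] L.nm_ge_0[OF m] z by simp
    from L.nm_eq_0[OF m this] show "(v - 4 *\<^sub>C w 0 1) a = 0 a" by simp
  qed
  then show ?thesis using ws by (intro exI[of _ w]) auto
qed

end

section \<open>The finite-dimensional representation of a normal state\<close>

context dual_system
begin

text \<open>The normal unital completely contractive maps from \<open>X\<close> to \<open>M\<^sub>m\<close>, with contractivity expressed
  through scalar matrices. The target space has one summand for each of them.\<close>

definition block :: "nat \<Rightarrow> (('h \<Rightarrow> 'h) \<Rightarrow> nat \<Rightarrow> nat \<Rightarrow> complex) \<Rightarrow> bool" where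
  "block m \<psi> \<longleftrightarrow>
     (\<forall>i<m. \<forall>j<m. \<exists>v\<in>V. \<forall>x\<in>X. \<psi> x i j = J x v) \<and>
     (\<forall>i<m. \<forall>j<m. \<psi> (id_op H) i j = (if i = j then 1 else 0)) \<and>
     (\<forall>k. \<forall>x\<in>mats k X. \<forall>a b. cmod (\<Sum>p<k. \<Sum>q<k. \<Sum>i<m. \<Sum>j<m. \<psi> (x p q) i j * a q j * cnj (b p i))
        \<le> mat_norm H k x * sqrt (sum_sq k m a) * sqrt (sum_sq k m b))"

text \<open>A state cannot exceed the numerical maximum: \<open>t + Re \<langle>z, w\<rangle> \<le> \<parallel>t + z\<parallel> \<le> t + s(z) + N\<^sup>2 / (2 t)\<close> for
  all \<open>t\<close>. Applied to \<open>z = - y\<close> this is a positivity statement.\<close>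

lemma state_accretive:
  assumes w: "nstate n w" and unit: "vec H n \<zeta>0" "vnorm H n \<zeta>0 = 1"
    and y: "y \<in> mats n X" and acc: "\<And>\<zeta>. vec H n \<zeta> \<Longrightarrow> 0 \<le> Re (mform H n y \<zeta> \<zeta>)"
  shows "0 \<le> Re (pairing n y w)"
proof -
  define z where "z = (\<lambda>i j. (-1) *\<^sub>C y i j)"
  have ym: "z \<in> mats n X" unfolding z_def by (rule scale_mats[OF Xs y])
  have "numerical_max H n z \<le> 0" unfolding numerical_max_def
  proof (rule cSup_least)
    show "{Re (mform H n z \<zeta> \<zeta>) | \<zeta>. vec H n \<zeta> \<and> vnorm H n \<zeta> = 1} \<noteq> {}" using unit by blast
    fix r assume "r \<in> {Re (mform H n z \<zeta> \<zeta>) | \<zeta>. vec H n \<zeta> \<and> vnorm H n \<zeta> = 1}"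
    then obtain \<zeta> where \<zeta>: "vec H n \<zeta>" "r = Re (mform H n z \<zeta> \<zeta>)" by blast
    show "r \<le> 0" unfolding \<zeta>(2) z_def H.mform_scale[OF matsX[OF y] \<zeta>(1,1)] using acc[OF \<zeta>(1)] by simp
  qed
  have "Re (pairing n z w) \<le> 0"
  proof (rule field_le_epsilon)
    fix e :: real assume e: "0 < e"
    define N t where "N = mat_norm H n z" and "t = (N\<^sup>2 + 1) / (2 * e)"
    have t: "t > 0" using e by (simp add: t_def add_nonneg_pos)
    have "t + Re (pairing n z w) = Re (pairing n (shift H t z) w)" using w pairing_shift[OF ym, of t w] by (simp add: nstate_def)
    also have "\<dots> \<le> mat_norm H n (shift H t z)"
      using w by (intro Re_pairing_le shift_mats[OF Xs Xid ym]) (auto simp: nstate_def)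
    also have "\<dots> \<le> t + numerical_max H n z + N\<^sup>2 / (2 * t)"
      unfolding N_def by (rule H.numerical_max_shift_le[OF matsX[OF ym] unit t])
    also have "N\<^sup>2 / (2 * t) = e * (N\<^sup>2 / (N\<^sup>2 + 1))"
    proof -
      have "N\<^sup>2 + 1 > 0" by (simp add: add_nonneg_pos)
      then show ?thesis using e unfolding t_def by (simp add: field_simps)
    qed
    also have "\<dots> \<le> e * 1" using e by (intro mult_left_mono) (auto simp: divide_le_eq_1 add_nonneg_pos)
    finally show "Re (pairing n z w) \<le> 0 + e" using \<open>numerical_max H n z \<le> 0\<close> by simp
  qed
  then show ?thesis unfolding z_def pairing_scale_left[OF y] by simp
qed

text \<open>The form \<open>\<langle>\<phi>(x) a, b\<rangle>\<close> of the map \<open>\<phi>\<close> from \<open>X\<close> to \<open>M\<^sub>n\<close> that corresponds to a functional on \<open>M\<^sub>n(X)\<close>.\<close>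

definition state_form :: "nat \<Rightarrow> (nat \<Rightarrow> nat \<Rightarrow> 'l \<Rightarrow> 'l) \<Rightarrow> ('h \<Rightarrow> 'h) \<Rightarrow> (nat \<Rightarrow> complex) \<Rightarrow> (nat \<Rightarrow> complex) \<Rightarrow> complex" where
  "state_form n w x a b = (\<Sum>i<n. \<Sum>j<n. a j * cnj (b i) * J x (w i j))"

lemma state_form_add_left: "state_form n w x (a + a') b = state_form n w x a b + state_form n w x a' b"
  by (simp add: state_form_def algebra_simps sum.distrib)
lemma state_form_add_right: "state_form n w x a (b + b') = state_form n w x a b + state_form n w x a b'"
  by (simp add: state_form_def algebra_simps sum.distrib)
lemma state_form_scale_left: "state_form n w x (c *\<^sub>C a) b = c * state_form n w x a b"
  by (simp add: state_form_def scaleC_fun_apply scaleC_complex_def sum_distrib_left mult_ac)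
lemma state_form_scale_right: "state_form n w x a (c *\<^sub>C b) = cnj c * state_form n w x a b"
  by (simp add: state_form_def scaleC_fun_apply scaleC_complex_def sum_distrib_left mult_ac)
lemma state_form_sum_left: "state_form n w x (\<Sum>l<(m::nat). c l *\<^sub>C g l) b = (\<Sum>l<m. c l * state_form n w x (g l) b)"
proof (induction m)
  case 0 show ?case by (simp add: state_form_def)
next
  case (Suc m) then show ?case unfolding sum.lessThan_Suc state_form_add_left state_form_scale_left by simp
qed
lemma state_form_sum_right: "state_form n w x a (\<Sum>l<(m::nat). c l *\<^sub>C g l) = (\<Sum>l<m. cnj (c l) * state_form n w x a (g l))"
proof (induction m)
  case 0 show ?case by (simp add: state_form_def)
next
  case (Suc m) then show ?case unfolding sum.lessThan_Suc state_form_add_right state_form_scale_right by simp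
qed

lemma pairing_amp:
  assumes x: "x \<in> mats k X"
  shows "pairing n (amp k x A B) w = (\<Sum>p<k. \<Sum>q<k. state_form n w (x p q) (A q) (B p))"
proof -
  have s0: "J (\<Sum>q<(m::nat). c q *\<^sub>C f q) v = (\<Sum>q<m. c q * J (f q) v)" if "\<And>q. q < m \<Longrightarrow> f q \<in> X" for c f m v
    using that
  proof (induction m)
    case 0 show ?case unfolding lessThan_0 sum.empty by (rule J_zero)
  next
    case (Suc m)
    have "(\<Sum>q<m. c q *\<^sub>C f q) \<in> X" "c m *\<^sub>C f m \<in> X"
      using Suc.prems by (auto intro!: complex_vec.subspace_sum[OF Xs] complex_vec.subspace_scale[OF Xs])
    then show ?case using Suc unfolding sum.lessThan_Suc by (subst J_add) (auto simp: J_scale)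
  qed
  have s1: "J (\<Sum>q<(m::nat). f q) v = (\<Sum>q<m. J (f q) v)" if "\<And>q. q < m \<Longrightarrow> f q \<in> X" for f m v
  proof -
    have "J (\<Sum>q<m. 1 *\<^sub>C f q) v = (\<Sum>q<m. 1 * J (f q) v)" by (rule s0) (rule that)
    then show ?thesis by simp
  qed
  have inner: "(\<Sum>q<k. (A q j * cnj (B p i)) *\<^sub>C x p q) \<in> X" if "p < k" for p i j
    using x that by (intro complex_vec.subspace_sum[OF Xs] complex_vec.subspace_scale[OF Xs]) (auto simp: mats_def)
  have "J (amp k x A B i j) v = (\<Sum>p<k. \<Sum>q<k. (A q j * cnj (B p i)) * J (x p q) v)" for i j v
  proof -
    have "J (amp k x A B i j) v = (\<Sum>p<k. J (\<Sum>q<k. (A q j * cnj (B p i)) *\<^sub>C x p q) v)"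
      unfolding amp_def by (rule s1) (rule inner)
    also have "\<dots> = (\<Sum>p<k. \<Sum>q<k. (A q j * cnj (B p i)) * J (x p q) v)"
      by (intro sum.cong refl s0) (use x in \<open>auto simp: mats_def\<close>)
    finally show ?thesis .
  qed
  then show ?thesis unfolding pairing_def state_form_def by (simp add: sum_swap4[of _ k n, symmetric])
qed

lemma state_form_id_amp: "pairing n (amp k (id_mat H) A B) w = (\<Sum>p<k. state_form n w (id_op H) (A p) (B p))"
proof -
  have "(\<Sum>q<k. state_form n w (id_mat H p q) (A q) (B p)) = state_form n w (id_op H) (A p) (B p)" if p: "p < k" for p
  proof -
    have "state_form n w (id_mat H p q) (A q) (B p) = (if q = p then state_form n w (id_op H) (A p) (B p) else 0)" for q
      by (simp add: id_mat_def state_form_def J_zero)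
    then show ?thesis using p by simp
  qed
  then show ?thesis by (simp add: pairing_amp[OF id_mats])
qed

lemma state_form_real:
  assumes w: "nstate n w" and unit: "vec H n \<zeta>0" "vnorm H n \<zeta>0 = 1"
  shows "state_form n w (id_op H) a a \<in> \<real>\<^sub>\<ge>\<^sub>0"
proof -
  define y where "y = amp 1 (id_mat H) (\<lambda>_. a) (\<lambda>_. a)"
  have y: "y \<in> mats n X" unfolding y_def by (rule amp_mats[OF Xs id_mats])
  have p: "pairing n y w = state_form n w (id_op H) a a" unfolding y_def state_form_id_amp by simp
  have f: "mform H n y \<zeta> \<zeta> = complex_of_real ((vnorm H 1 (\<lambda>q. \<Sum>j<n. a j *\<^sub>C \<zeta> j))\<^sup>2)" if z: "vec H n \<zeta>" for \<zeta>
  proof -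
    have "vec H 1 (\<lambda>q. \<Sum>j<n. a j *\<^sub>C \<zeta> j)" using z by (auto simp: vec_def intro!: H.mem_lincomb)
    then show ?thesis unfolding y_def H.mform_amp[OF H.id_mat_mats z z] by (rule H.mform_id_diag)
  qed
  have "0 \<le> Re (pairing n y w)" by (rule state_accretive[OF w unit y]) (simp add: f)
  moreover have "0 \<le> Re (pairing n (\<lambda>i j. c *\<^sub>C y i j) w)" if "c = \<i> \<or> c = - \<i>" for c
    by (rule state_accretive[OF w unit scale_mats[OF Xs y]]) (use that f in \<open>auto simp: H.mform_scale[OF matsX[OF y]]\<close>)
  from this[of \<i>] this[of "- \<i>"] have "Im (pairing n y w) = 0" unfolding pairing_scale_left[OF y] by simp
  ultimately show ?thesis unfolding p by (simp add: complex_nonneg_Reals_iff)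
qed

text \<open>Complete contractivity relative to the form of the unit. The matrix
  \<open>\<parallel>x\<parallel> (A\<^sup>* A + B\<^sup>* B) - 2 B\<^sup>* x A\<close> is accretive, so the state has nonnegative real part on it; scaling
  and rotating \<open>A\<close> turns the resulting inequality into a product of square roots.\<close>

lemma state_form_bound:
  assumes w: "nstate n w" and unit: "vec H n \<zeta>0" "vnorm H n \<zeta>0 = 1" and x: "x \<in> mats k X"
  shows "cmod (\<Sum>p<k. \<Sum>q<k. state_form n w (x p q) (A q) (B p))
    \<le> mat_norm H k x * sqrt (\<Sum>q<k. Re (state_form n w (id_op H) (A q) (A q))) * sqrt (\<Sum>p<k. Re (state_form n w (id_op H) (B p) (B p)))"
proof -
  let ?M = "mat_norm H k x"
  let ?S = "\<lambda>A. \<Sum>q<k. Re (state_form n w (id_op H) (A q) (A q))"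
  have M: "0 \<le> ?M" by (rule H.mat_norm_ge_0[OF matsX[OF x]])
  have S0: "0 \<le> ?S A" for A using state_form_real[OF w unit] by (intro sum_nonneg) (auto simp: complex_nonneg_Reals_iff)
  have claim: "2 * Re (\<Sum>p<k. \<Sum>q<k. state_form n w (x p q) (A q) (B p)) \<le> ?M * (?S A + ?S B)" for A B
  proof -
    let ?iA = "amp k (id_mat H) A A" and ?iB = "amp k (id_mat H) B B" and ?xx = "amp k x A B"
    define y where "y = (\<lambda>i j. (complex_of_real ?M *\<^sub>C ?iA i j + complex_of_real ?M *\<^sub>C ?iB i j) + (-2) *\<^sub>C ?xx i j)"
    have m: "?iA \<in> mats n X" "?iB \<in> mats n X" "?xx \<in> mats n X"
      using amp_mats[OF Xs] id_mats x by auto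
    note sm = scale_mats[OF Xs m(1), of "complex_of_real ?M"] scale_mats[OF Xs m(2), of "complex_of_real ?M"] scale_mats[OF Xs m(3), of "-2"]
    have add_m: "(\<lambda>i j. u i j + v i j) \<in> mats n X" if "u \<in> mats n X" "v \<in> mats n X" for u v
      using that complex_vec.subspace_add[OF Xs] by (auto simp: mats_def)
    have ym: "y \<in> mats n X" unfolding y_def by (intro add_m sm)
    have "0 \<le> Re (pairing n y w)"
    proof (rule state_accretive[OF w unit ym])
      fix \<zeta> assume z: "vec H n \<zeta>"
      let ?a = "\<lambda>q. \<Sum>j<n. A q j *\<^sub>C \<zeta> j" and ?b = "\<lambda>q. \<Sum>j<n. B q j *\<^sub>C \<zeta> j"
      have v: "vec H k ?a" "vec H k ?b" using z by (auto simp: vec_def intro!: H.mem_lincomb)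
      have f1: "mform H n ?iA \<zeta> \<zeta> = complex_of_real ((vnorm H k ?a)\<^sup>2)"
        unfolding H.mform_amp[OF H.id_mat_mats z z] by (rule H.mform_id_diag[OF v(1)])
      have f2: "mform H n ?iB \<zeta> \<zeta> = complex_of_real ((vnorm H k ?b)\<^sup>2)"
        unfolding H.mform_amp[OF H.id_mat_mats z z] by (rule H.mform_id_diag[OF v(2)])
      have f3: "mform H n ?xx \<zeta> \<zeta> = mform H k x ?a ?b" by (rule H.mform_amp[OF matsX[OF x] z z])
      have "mform H n y \<zeta> \<zeta> = complex_of_real ?M * complex_of_real ((vnorm H k ?a)\<^sup>2) + complex_of_real ?M * complex_of_real ((vnorm H k ?b)\<^sup>2) + (-2) * mform H k x ?a ?b"
        unfolding y_def H.mform_add[OF matsX[OF add_m[OF sm(1,2)]] matsX[OF sm(3)] z z] H.mform_add[OF matsX[OF sm(1)] matsX[OF sm(2)] z z]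
          H.mform_scale[OF matsX[OF m(1)] z z] H.mform_scale[OF matsX[OF m(2)] z z] H.mform_scale[OF matsX[OF m(3)] z z] f1 f2 f3 ..
      also have "\<dots> = complex_of_real (?M * ((vnorm H k ?a)\<^sup>2 + (vnorm H k ?b)\<^sup>2)) - 2 * mform H k x ?a ?b"
        by (simp add: algebra_simps)
      finally have "Re (mform H n y \<zeta> \<zeta>) = ?M * ((vnorm H k ?a)\<^sup>2 + (vnorm H k ?b)\<^sup>2) - 2 * Re (mform H k x ?a ?b)"
        by simp
      moreover have "2 * Re (mform H k x ?a ?b) \<le> ?M * ((vnorm H k ?a)\<^sup>2 + (vnorm H k ?b)\<^sup>2)"
      proof -
        have "Re (mform H k x ?a ?b) \<le> ?M * vnorm H k ?a * vnorm H k ?b"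
          using H.mat_norm_bound[OF matsX[OF x] v] complex_Re_le_cmod order_trans by blast
        then have "2 * Re (mform H k x ?a ?b) \<le> ?M * (2 * vnorm H k ?a * vnorm H k ?b)" by simp
        also have "\<dots> \<le> ?M * ((vnorm H k ?a)\<^sup>2 + (vnorm H k ?b)\<^sup>2)"
          by (rule mult_left_mono[OF sum_squares_bound M])
        finally show ?thesis .
      qed
      ultimately show "0 \<le> Re (mform H n y \<zeta> \<zeta>)" by linarith
    qed
    moreover have "pairing n y w = complex_of_real ?M * (\<Sum>p<k. state_form n w (id_op H) (A p) (A p)) + complex_of_real ?M * (\<Sum>p<k. state_form n w (id_op H) (B p) (B p))
       + (-2) * (\<Sum>p<k. \<Sum>q<k. state_form n w (x p q) (A q) (B p))"
      unfolding y_def pairing_add_left[OF add_m[OF sm(1,2)] sm(3)] pairing_add_left[OF sm(1,2)] pairing_scale_left[OF m(1)] pairing_scale_left[OF m(2)]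
        pairing_scale_left[OF m(3)] state_form_id_amp pairing_amp[OF x] ..
    ultimately show ?thesis by (simp add: algebra_simps)
  qed
  define qq where "qq = (\<Sum>p<k. \<Sum>q<k. state_form n w (x p q) (A q) (B p))"
  have "cmod qq \<le> ?M * sqrt (?S A) * sqrt (?S B)"
  proof (rule real_sqrt_bound_of_quadratic[OF _ M S0 S0])
    fix t :: real assume t: "0 < t"
    define c where "c = (if qq = 0 then 1 else cnj qq / cmod qq)"
    have c: "cmod c = 1" "c * qq = complex_of_real (cmod qq)" 
      by (auto simp: c_def norm_divide complex_norm_square[symmetric] mult.commute power2_eq_square)
    define A' where "A' = (\<lambda>q. (complex_of_real t * c) *\<^sub>C A q)"
    have 1: "(\<Sum>p<k. \<Sum>q<k. state_form n w (x p q) (A' q) (B p)) = complex_of_real t * (c * qq)"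
      unfolding qq_def by (simp add: A'_def state_form_scale_left sum_distrib_left mult_ac)
    have cc: "c * cnj c = 1" using c(1) by (metis complex_norm_square of_real_1 one_power2)
    have "state_form n w (id_op H) (A' q) (A' q) = complex_of_real (t\<^sup>2) * (c * cnj c) * state_form n w (id_op H) (A q) (A q)" for q
      by (simp add: A'_def state_form_scale_left state_form_scale_right power2_eq_square)
    then have 2: "?S A' = t\<^sup>2 * ?S A" unfolding cc by (simp add: sum_distrib_left)
    show "2 * t * cmod qq \<le> ?M * (t\<^sup>2 * ?S A + ?S B)"
      using claim[of A' B] unfolding 1 2 c(2) by simp
  qed
  then show ?thesis unfolding qq_def .
qed

text \<open>The form of the unit is an inner product on \<open>\<complex>\<^sup>n\<close>, possibly degenerate. With respect to an
  orthonormal basis \<open>g\<close> of it the map \<open>\<phi>\<close> becomes unital and completely contractive. Vectors of norm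
  zero are invisible to every \<open>\<phi>(x)\<close>, so the coordinates \<open>c\<close> of the standard basis with respect to
  \<open>g\<close> recover the state.\<close>

theorem state_representation:
  assumes w: "nstate n w" and unit: "vec H n \<zeta>0" "vnorm H n \<zeta>0 = 1"
  shows "\<exists>m \<psi> c. block m \<psi> \<and> sum_sq n m c \<le> 1 \<and>
    (\<forall>y\<in>mats n X. pairing n y w = (\<Sum>i<n. \<Sum>j<n. \<Sum>k<m. \<Sum>l<m. \<psi> (y i j) k l * c j l * cnj (c i k)))"
proof -
  let ?B = "state_form n w (id_op H)"
  define E where "E = \<lparr>hcarrier = (UNIV :: (nat \<Rightarrow> complex) set), hinner = ?B\<rparr>"
  have E[simp]: "hcarrier E = UNIV" "hinner E = ?B" by (auto simp: E_def)
  interpret E: pre_hilb E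
  proof
    show "complex_vec.subspace (hcarrier E)" by simp
    show "linear_on (hcarrier E) (\<lambda>x. hinner E x y)" for y
      by (simp add: linear_on_def state_form_add_left state_form_scale_left scaleC_complex_def)
    show "hinner E y x = cnj (hinner E x y)" for x y
      unfolding E by (rule hermitian_if_real_diag[of UNIV ?B])
        (use state_form_real[OF w unit] in \<open>auto simp: state_form_add_left state_form_add_right state_form_scale_left state_form_scale_right complex_nonneg_Reals_iff\<close>)
    show "hinner E x x \<in> \<real>\<^sub>\<ge>\<^sub>0" for x using state_form_real[OF w unit] by simp
  qed
  have En: "(hnorm E a)\<^sup>2 = Re (?B a a)" for a using E.nm_sq_Re[of a] by simp
  have bd: "cmod (state_form n w x a b) \<le> op_norm H x * hnorm E a * hnorm E b" if x: "x \<in> X" for x a b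
  proof -
    have m: "(\<lambda>_ _. x) \<in> mats 1 X" using x by (simp add: mats_def)
    have xb: "x \<in> bounded_ops H" using x Xb by auto
    show ?thesis using state_form_bound[OF w unit m, of "\<lambda>_. a" "\<lambda>_. b"] H.mat_norm_1[OF xb]
      by (simp add: En[symmetric] E.nm_ge_0[simplified])
  qed
  define e where "e j = (\<lambda>i::nat. if i = j then 1 else 0 :: complex)" for j
  obtain m :: nat and g where g: "E.onorm_fam {..<m} g" 
    and null: "\<And>j. j < n \<Longrightarrow> hnorm E (e j - (\<Sum>k<m. ?B (e j) (g k) *\<^sub>C g k)) = 0"
    using E.Gram_Schmidt[of n e] by auto
  have gg: "?B (g k) (g l) = (if k = l then 1 else 0)" if "k < m" "l < m" for k l
    using g that by (auto simp: E.onorm_fam_def)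
  define \<psi> where "\<psi> x k l = state_form n w x (g l) (g k)" for x k l
  define c where "c j l = ?B (e j) (g l)" for j l
  define e' where "e' j = (\<Sum>k<m. c j k *\<^sub>C g k)" for j
  have wV: "w i j \<in> V" if "i < n" "j < n" for i j using w that by (auto simp: nstate_def mats_def)
  have "block m \<psi>" unfolding block_def
  proof (intro conjI allI impI ballI)
    fix i j assume "i < m" "j < m"
    let ?v = "\<Sum>p<n. \<Sum>q<n. (g j q * cnj (g i p)) *\<^sub>C w p q"
    have "?v \<in> V" using wV by (intro complex_vec.subspace_sum[OF Vs] complex_vec.subspace_scale[OF Vs]) auto
    moreover have "\<psi> x i j = J x ?v" if "x \<in> X" for x
      unfolding \<psi>_def state_form_def using J_sum[OF that, of n w "\<lambda>p q. g j q * cnj (g i p)"] wV by simp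
    ultimately show "\<exists>v\<in>V. \<forall>x\<in>X. \<psi> x i j = J x v" by blast
    show "\<psi> (id_op H) i j = (if i = j then 1 else 0)" unfolding \<psi>_def using gg \<open>i < m\<close> \<open>j < m\<close> by auto
  next
    fix k x and a b :: "nat \<Rightarrow> nat \<Rightarrow> complex" assume x: "x \<in> mats k X"
    let ?A = "\<lambda>q. \<Sum>j<m. a q j *\<^sub>C g j" and ?C = "\<lambda>q. \<Sum>j<m. b q j *\<^sub>C g j"
    have s: "(\<Sum>q<k. Re (?B (\<Sum>j<m. a q j *\<^sub>C g j) (\<Sum>j<m. a q j *\<^sub>C g j))) = sum_sq k m a" for a :: "nat \<Rightarrow> nat \<Rightarrow> complex"
      unfolding sum_sq_def En[symmetric] by (intro sum.cong refl E.nm_lincomb_onorm g) auto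
    have "(\<Sum>p<k. \<Sum>q<k. \<Sum>i<m. \<Sum>j<m. \<psi> (x p q) i j * a q j * cnj (b p i)) = (\<Sum>p<k. \<Sum>q<k. state_form n w (x p q) (?A q) (?C p))"
      by (simp add: state_form_sum_left state_form_sum_right \<psi>_def sum_distrib_left mult_ac)
    then show "cmod (\<Sum>p<k. \<Sum>q<k. \<Sum>i<m. \<Sum>j<m. \<psi> (x p q) i j * a q j * cnj (b p i))
        \<le> mat_norm H k x * sqrt (sum_sq k m a) * sqrt (sum_sq k m b)"
      using state_form_bound[OF w unit x, of ?A ?C] unfolding s by simp
  qed
  moreover have "sum_sq n m c \<le> 1"
  proof -
    have "sum_sq n m c \<le> (\<Sum>j<n. (hnorm E (e j))\<^sup>2)"
      unfolding sum_sq_def c_def using E.Bessel[of "{..<m}" g, OF _ g] by (intro sum_mono) simp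
    also have "\<dots> = (\<Sum>j<n. Re (J (id_op H) (w j j)))"
    proof (intro sum.cong refl)
      fix j assume j: "j \<in> {..<n}"
      have "?B (e j) (e j) = J (id_op H) (w j j)" unfolding state_form_def
        by (subst sum_single[of j n j]) (use j in \<open>auto simp: e_def\<close>)
      then show "(hnorm E (e j))\<^sup>2 = Re (J (id_op H) (w j j))" by (simp add: En)
    qed
    also have "\<dots> = Re (pairing n (id_mat H) w)"
    proof -
      have "(\<Sum>j<n. J (id_mat H i j) (w i j)) = J (id_op H) (w i i)" if "i < n" for i
      proof -
        have "J (id_mat H i j) (w i j) = (if j = i then J (id_op H) (w i i) else 0)" for j by (simp add: id_mat_def J_zero)
        then show ?thesis using that by simp
      qed
      then show ?thesis by (simp add: pairing_def)
    qed
    also have "\<dots> = 1" using w by (simp add: nstate_def)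
    finally show ?thesis .
  qed
  moreover have "pairing n y w = (\<Sum>i<n. \<Sum>j<n. \<Sum>k<m. \<Sum>l<m. \<psi> (y i j) k l * c j l * cnj (c i k))" if y: "y \<in> mats n X" for y
    unfolding pairing_def
  proof (intro sum.cong refl)
    fix i j assume "i \<in> {..<n}" "j \<in> {..<n}"
    then have ij: "i < n" "j < n" by auto
    have x: "y i j \<in> X" by (rule matsD[OF y ij])
    let ?x = "y i j"
    have ed: "e p = (e p - e' p) + e' p" for p by simp
    \<comment> \<open>\<open>e j - e' j\<close> has norm zero for the form of the unit.\<close>
    have z1: "state_form n w ?x (e j - e' j) b = 0" for b
      using bd[OF x, of "e j - e' j" b] null[OF ij(2)] by (simp add: e'_def c_def)
    have z2: "state_form n w ?x a (e i - e' i) = 0" for a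
      using bd[OF x, of a "e i - e' i"] null[OF ij(1)] by (simp add: e'_def c_def)
    have "J ?x (w i j) = state_form n w ?x (e j) (e i)" unfolding state_form_def
      by (subst sum_single[of i n j]) (use ij in \<open>auto simp: e_def\<close>)
    also have "\<dots> = state_form n w ?x (e' j) (e i)"
      by (subst ed[of j]) (simp only: state_form_add_left z1 add_0_left)
    also have "\<dots> = state_form n w ?x (e' j) (e' i)"
      by (subst ed[of i]) (simp only: state_form_add_right z2 add_0_left)
    also have "\<dots> = (\<Sum>k<m. \<Sum>l<m. \<psi> (y i j) k l * c j l * cnj (c i k))"
      unfolding e'_def state_form_sum_left state_form_sum_right \<psi>_def sum_distrib_left
      by (simp add: mult_ac)
    finally show "J ?x (w i j) = (\<Sum>k<m. \<Sum>l<m. \<psi> (y i j) k l * c j l * cnj (c i k))" .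
  qed
  ultimately show ?thesis by blast
qed

end

section \<open>Parseval's identity and trace class operators\<close>

context hilb
begin

lemma onb_fam:
  assumes "orthonormal_basis H E" "F \<subseteq> E"
  shows "onorm_fam F (\<lambda>e. e)"
  unfolding onorm_fam_def
proof (intro conjI ballI)
  fix k l assume "k \<in> F" "l \<in> F"
  then have "k \<in> E" "l \<in> E" using assms(2) by auto
  then show "ip k l = (if k = l then 1 else 0)"
    using assms(1) unfolding orthonormal_basis_def by blast
qed (use assms in \<open>auto simp: orthonormal_basis_def\<close>)

lemma onb_mem: "orthonormal_basis H E \<Longrightarrow> e \<in> E \<Longrightarrow> e \<in> CH"
  by (auto simp: orthonormal_basis_def)

lemma onb_ip: "orthonormal_basis H E \<Longrightarrow> e \<in> E \<Longrightarrow> f \<in> E \<Longrightarrow> ip e f = (if e = f then 1 else 0)"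
  unfolding orthonormal_basis_def by blast

definition proj :: "'h set \<Rightarrow> 'h \<Rightarrow> 'h" where
  "proj F x = (\<Sum>e\<in>F. ip x e *\<^sub>C e)"

lemma proj_mem: "orthonormal_basis H E \<Longrightarrow> F \<subseteq> E \<Longrightarrow> x \<in> CH \<Longrightarrow> proj F x \<in> CH"
  unfolding proj_def by (intro mem_lincomb) (auto simp: orthonormal_basis_def)

lemma Bessel_summable:
  assumes E: "orthonormal_basis H E" and x: "x \<in> CH"
  shows "(\<lambda>e. (cmod (ip x e))\<^sup>2) summable_on E"
proof (rule nonneg_bdd_above_summable_on)
  show "bdd_above (sum (\<lambda>e. (cmod (ip x e))\<^sup>2) ` {F. F \<subseteq> E \<and> finite F})"
    using Bessel[OF _ onb_fam[OF E] x] unfolding bdd_above_def by blast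
qed auto

text \<open>Choose finite sets whose Bessel sums approach the supremum. The corresponding projections form a
  Cauchy sequence, and its limit differs from \<open>x\<close> by a vector orthogonal to the whole basis. Larger
  finite sets do no worse.\<close>

lemma proj_converges:
  assumes E: "orthonormal_basis H E" and x: "x \<in> CH" and e: "0 < \<epsilon>"
  shows "\<exists>F0. finite F0 \<and> F0 \<subseteq> E \<and> (\<forall>F. finite F \<and> F0 \<subseteq> F \<and> F \<subseteq> E \<longrightarrow> nm (x - proj F x) < \<epsilon>)"
proof -
  define a where "a = (\<lambda>e. (cmod (ip x e))\<^sup>2)"
  define S where "S = infsum a E"
  have "(a has_sum S) E" unfolding S_def a_def by (rule has_sum_infsum[OF Bessel_summable[OF E x]])
  then have lim: "(sum a \<longlongrightarrow> S) (finite_subsets_at_top E)" by (simp add: has_sum_def)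
  have "\<exists>F0. finite F0 \<and> F0 \<subseteq> E \<and> (\<forall>F. finite F \<and> F0 \<subseteq> F \<and> F \<subseteq> E \<longrightarrow> dist (sum a F) S < r)" if "r > 0" for r
    using tendstoD[OF lim that] by (auto simp: eventually_finite_subsets_at_top)
  then have "\<exists>F0. finite F0 \<and> F0 \<subseteq> E \<and> (\<forall>F. finite F \<and> F0 \<subseteq> F \<and> F \<subseteq> E \<longrightarrow> dist (sum a F) S < 1 / Suc k)" for k
    by simp
  then obtain F0 where F0: "\<And>k. finite (F0 k)" "\<And>k. F0 k \<subseteq> E"
    "\<And>k F. finite F \<Longrightarrow> F0 k \<subseteq> F \<Longrightarrow> F \<subseteq> E \<Longrightarrow> dist (sum a F) S < 1 / Suc k" by metis
  define G where "G k = (\<Union>i\<le>k. F0 i)" for k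
  have G: "finite (G k)" "G k \<subseteq> E" "F0 k \<subseteq> G k" for k using F0 by (auto simp: G_def)
  have Gm: "G k \<subseteq> G l" if "k \<le> l" for k l using that by (force simp: G_def)
  have proj_sq: "(nm (x - proj F x))\<^sup>2 = (nm x)\<^sup>2 - sum a F" if "finite F" "F \<subseteq> E" for F
    using nm_diff_proj[OF that(1) onb_fam[OF E that(2)] x] by (simp add: proj_def a_def)
  have sumS: "sum a F \<le> S" if "finite F" "F \<subseteq> E" for F
    unfolding S_def a_def by (rule finite_sum_le_infsum[OF Bessel_summable[OF E x] that]) simp
  have sumG: "S - 1 / Suc k < sum a (G k)" for k using F0(3)[OF G(1) G(3) G(2), of k] by (auto simp: dist_real_def)
  define s where "s k = proj (G k) x" for k
  have sC: "s k \<in> CH" for k unfolding s_def by (rule proj_mem[OF E G(2) x])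
  have sdiff: "(nm (s l - s k))\<^sup>2 < 1 / Suc k" if kl: "k \<le> l" for k l
  proof -
    have "s l - s k = (\<Sum>e\<in>G l - G k. ip x e *\<^sub>C e)"
      unfolding s_def proj_def using sum_diff[OF G(1) Gm[OF kl], of "\<lambda>e. ip x e *\<^sub>C e"] by simp
    moreover have "(nm (\<Sum>e\<in>G l - G k. ip x e *\<^sub>C e))\<^sup>2 = sum a (G l - G k)"
      unfolding a_def by (rule nm_lincomb_onorm) (use G onb_fam[OF E, of "G l - G k"] in auto)
    ultimately have "(nm (s l - s k))\<^sup>2 = sum a (G l) - sum a (G k)"
      using sum_diff[OF G(1) Gm[OF kl], of a] by simp
    then show ?thesis using sumS[OF G(1,2), of l] sumG[of k] by linarith
  qed
  have small: "\<exists>N. \<forall>k\<ge>N. 1 / real (Suc k) < r\<^sup>2" if r0: "r > 0" for r :: real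
  proof -
    obtain N where "N > 0" "inverse (real N) < r\<^sup>2" using ex_inverse_of_nat_less[of "r\<^sup>2"] r0 by auto
    have "1 / real (Suc k) < r\<^sup>2" if "k \<ge> N" for k
    proof -
      have "1 / real (Suc k) \<le> 1 / real N" using \<open>N > 0\<close> that by (intro divide_left_mono) auto
      also have "\<dots> < r\<^sup>2" using \<open>inverse (real N) < r\<^sup>2\<close> by (simp add: inverse_eq_divide)
      finally show ?thesis .
    qed
    then show ?thesis by blast
  qed
  have "\<exists>z\<in>CH. (\<lambda>k. nm (s k - z)) \<longlonglongrightarrow> 0"
  proof (rule complete[OF sC])
    fix r :: real assume r: "r > 0"
    obtain N where N: "\<forall>k\<ge>N. 1 / real (Suc k) < r\<^sup>2" using small[OF r] by blast
    have lt: "nm (s l - s k) < r" if "k \<ge> N" "k \<le> l" for k l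
    proof -
      have "(nm (s l - s k))\<^sup>2 < r\<^sup>2" using sdiff[OF that(2)] N[rule_format, OF that(1)] by linarith
      then show ?thesis by (rule power_less_imp_less_base) (use r in simp)
    qed
    have "nm (s k - s l) < r" if "k \<ge> N" "l \<ge> N" for k l
    proof (cases "k \<le> l")
      case True then show ?thesis using lt[OF that(1) True] nm_diff_commute[OF sC sC] by metis
    next
      case False then show ?thesis using lt[of l k] that by simp
    qed
    then show "\<exists>N. \<forall>k\<ge>N. \<forall>l\<ge>N. nm (s k - s l) < r" by blast
  qed
  then obtain z where z: "z \<in> CH" "(\<lambda>k. nm (s k - z)) \<longlonglongrightarrow> 0" by blast
  have "ip (x - z) e = 0" if e: "e \<in> E" for e
  proof -
    have eC: "e \<in> CH" by (rule onb_mem[OF E e])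
    have "ip e e = 1" using E e unfolding orthonormal_basis_def by auto
    then have "(nm e)\<^sup>2 = 1" using nm_sq_Re[OF eC] by simp
    then have e1: "nm e = 1" using nm_ge_0[OF eC] by (auto simp: power2_eq_1_iff)
    have ks: "cmod (ip (x - s k) e) \<le> sqrt (1 / Suc k)" for k
    proof (cases "e \<in> G k")
      case True
      then show ?thesis using ip_proj_right[OF G(1) onb_fam[OF E G(2)] x True] by (simp add: s_def proj_def)
    next
      case False
      have "ip (s k) e = (\<Sum>f\<in>G k. ip x f * ip f e)" unfolding s_def proj_def
        by (rule ip_lincomb_left) (use G(2) onb_mem[OF E] eC in auto)
      also have "\<dots> = 0"
      proof (intro sum.neutral ballI)
        fix f assume "f \<in> G k"
        then have "f \<in> E" "f \<noteq> e" using G(2) False by auto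
        then show "ip x f * ip f e = 0" using onb_ip[OF E _ e] by simp
      qed
      finally have "ip (x - s k) e = ip x e" using x sC eC by (simp add: ip_diff_left)
      moreover have "a e + sum a (G k) \<le> S" using sumS[of "insert e (G k)"] G e False by simp
      then have "(cmod (ip x e))\<^sup>2 \<le> 1 / Suc k" using sumG[of k] by (simp add: a_def)
      ultimately show ?thesis by (simp add: real_le_rsqrt)
    qed
    have "cmod (ip (x - z) e) \<le> 0"
    proof (rule LIMSEQ_le_const)
      have "(\<lambda>k. 1 / real (Suc k)) \<longlonglongrightarrow> 0" using LIMSEQ_inverse_real_of_nat by (simp add: inverse_eq_divide)
      then have "(\<lambda>k. sqrt (1 / Suc k)) \<longlonglongrightarrow> 0" using tendsto_real_sqrt by fastforce
      from tendsto_add[OF this z(2)] show "(\<lambda>k. sqrt (1 / Suc k) + nm (s k - z)) \<longlonglongrightarrow> 0" by simp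
      have "cmod (ip (x - z) e) \<le> sqrt (1 / Suc k) + nm (s k - z)" for k
      proof -
        have "ip (x - z) e = ip (x - s k) e + ip (s k - z) e" using x z sC eC by (simp add: ip_diff_left)
        then have "cmod (ip (x - z) e) \<le> cmod (ip (x - s k) e) + cmod (ip (s k - z) e)"
          using norm_triangle_ineq by metis
        moreover have "cmod (ip (s k - z) e) \<le> nm (s k - z)"
          using Cauchy_Schwarz[OF mem_diff[OF sC z(1)] eC, of k] e1 by simp
        ultimately show ?thesis using ks[of k] by linarith
      qed
      then show "\<exists>N. \<forall>k\<ge>N. cmod (ip (x - z) e) \<le> sqrt (1 / Suc k) + nm (s k - z)" by blast
    qed
    then show ?thesis by simp
  qed
  then have "x - z = 0" using E mem_diff[OF x z(1)] unfolding orthonormal_basis_def by blast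
  then have "z = x" by simp
  then have "(\<lambda>k. nm (s k - x)) \<longlonglongrightarrow> 0" using z(2) by simp
  from LIMSEQ_D[OF this e] obtain k where "\<forall>l\<ge>k. norm (nm (s l - x) - 0) < \<epsilon>" by blast
  then have "norm (nm (s k - x) - 0) < \<epsilon>" by blast
  then have k: "nm (s k - x) < \<epsilon>" by simp
  have "nm (x - proj F x) < \<epsilon>" if F: "finite F" "G k \<subseteq> F" "F \<subseteq> E" for F
  proof -
    have "sum a (G k) \<le> sum a F" using F by (intro sum_mono2) (auto simp: a_def)
    then have "(nm (x - proj F x))\<^sup>2 \<le> (nm (x - s k))\<^sup>2"
      using proj_sq[OF F(1,3)] proj_sq[OF G(1,2), of k] by (simp add: s_def)
    then have "nm (x - proj F x) \<le> nm (x - s k)" by (rule power2_le_imp_le) (rule nm_ge_0[OF mem_diff[OF x sC]])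
    also note nm_diff_commute[OF x sC]
    also note k
    finally show ?thesis .
  qed
  then show ?thesis using G(1,2)[of k] by (intro exI[of _ "G k"]) simp
qed

text \<open>For uncountable bases too: convergence is along the finite subsets.\<close>

theorem Parseval:
  assumes E: "orthonormal_basis H E" and x: "x \<in> CH" and y: "y \<in> CH"
  shows "((\<lambda>e. ip x e * ip e y) has_sum ip x y) E"
  unfolding has_sum_def
proof (rule tendstoI)
  fix r :: real assume r: "0 < r"
  have "0 < r / (nm y + 1)" using r nm_ge_0[OF y] by (simp add: add_nonneg_pos)
  from proj_converges[OF E x this] obtain F0 where F0': "finite F0 \<and> F0 \<subseteq> E \<and>
    (\<forall>F. finite F \<and> F0 \<subseteq> F \<and> F \<subseteq> E \<longrightarrow> nm (x - proj F x) < r / (nm y + 1))" by (rule exE)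
  note F0 = F0'[THEN conjunct1] F0'[THEN conjunct2, THEN conjunct1]
    F0'[THEN conjunct2, THEN conjunct2, rule_format, OF conjI[OF _ conjI]]
  have "dist (\<Sum>e\<in>F. ip x e * ip e y) (ip x y) < r" if F: "finite F" "F0 \<subseteq> F" "F \<subseteq> E" for F
  proof -
    have p: "proj F x \<in> CH" by (rule proj_mem[OF E F(3) x])
    have "ip (proj F x) y = (\<Sum>e\<in>F. ip x e * ip e y)" unfolding proj_def
      by (rule ip_lincomb_left) (use F onb_mem[OF E] y in auto)
    then have "dist (\<Sum>e\<in>F. ip x e * ip e y) (ip x y) = cmod (ip (x - proj F x) y)"
      using x y p by (simp add: ip_diff_left dist_norm norm_minus_commute)
    also have "\<dots> \<le> nm (x - proj F x) * nm y" by (rule Cauchy_Schwarz[OF mem_diff[OF x p] y])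
    also have "\<dots> \<le> r / (nm y + 1) * nm y" using F0(3)[OF F] nm_ge_0[OF y] by (intro mult_right_mono) auto
    also have "\<dots> < r" using r nm_ge_0[OF y] by (simp add: field_simps)
    finally show ?thesis .
  qed
  then show "\<forall>\<^sub>F F in finite_subsets_at_top E. dist (\<Sum>e\<in>F. ip x e * ip e y) (ip x y) < r"
    unfolding eventually_finite_subsets_at_top using F0(1,2) by blast
qed

lemma Parseval_norm:
  assumes E: "orthonormal_basis H E" and x: "x \<in> CH"
  shows "((\<lambda>e. (cmod (ip x e))\<^sup>2) has_sum (nm x)\<^sup>2) E"
proof -
  have "((\<lambda>e. Re (ip x e * ip e x)) has_sum Re (ip x x)) E"
    using has_sum_Re[OF Parseval[OF E x x]] .
  moreover have "Re (ip x e * ip e x) = (cmod (ip x e))\<^sup>2" if "e \<in> E" for e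
    using herm[OF x onb_mem[OF E that]] by (simp add: complex_mult_cnj cmod_power2)
  ultimately show ?thesis using has_sum_cong[of E "\<lambda>e. Re (ip x e * ip e x)"] nm_sq_Re[OF x] by simp
qed

definition rank1 :: "'h \<Rightarrow> 'h \<Rightarrow> 'h \<Rightarrow> 'h" where
  "rank1 \<xi> \<eta> = (\<lambda>u. if u \<in> CH then ip u \<eta> *\<^sub>C \<xi> else 0)"

lemma rank1_bop:
  assumes x: "\<xi> \<in> CH" and e: "\<eta> \<in> CH"
  shows "rank1 \<xi> \<eta> \<in> bounded_ops H"
proof -
  have "nm (rank1 \<xi> \<eta> u) \<le> (nm \<eta> * nm \<xi>) * nm u" if u: "u \<in> CH" for u
    using nm_scale[OF x, of "ip u \<eta>"] mult_right_mono[OF Cauchy_Schwarz[OF u e] nm_ge_0[OF x]] u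
    by (simp add: rank1_def mult_ac)
  moreover have "linear_on CH (rank1 \<xi> \<eta>)"
    using e by (auto simp: linear_on_def rank1_def mem_add mem_scale ip_add_left ip_scale_left complex_vec.scale_left_distrib)
  ultimately show ?thesis using x unfolding bounded_ops_def by (auto simp: rank1_def)
qed

text \<open>The modulus of the operator \<open>u \<mapsto> \<langle>u, \<eta>\<rangle> \<xi>\<close> is \<open>u \<mapsto> (\<parallel>\<xi>\<parallel> / \<parallel>\<eta>\<parallel>) \<langle>u, \<eta>\<rangle> \<eta>\<close>. For \<open>\<eta> = 0\<close> the
  quotient is zero by convention and both operators vanish.\<close>

lemma rank1_trace_class:
  assumes x: "\<xi> \<in> CH" and e: "\<eta> \<in> CH" and E: "orthonormal_basis H E"
  shows "rank1 \<xi> \<eta> \<in> trace_class H"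
proof -
  define c where "c = complex_of_real (nm \<xi> / nm \<eta>)"
  define P where "P = rank1 (c *\<^sub>C \<eta>) \<eta>"
  have P: "P \<in> bounded_ops H" unfolding P_def by (rule rank1_bop) (use e in auto)
  have Pu: "P u = (ip u \<eta> * c) *\<^sub>C \<eta>" if "u \<in> CH" for u using that by (simp add: P_def rank1_def)
  have Pdiag: "ip (P u) u = complex_of_real ((nm \<xi> / nm \<eta>) * (cmod (ip u \<eta>))\<^sup>2)" if u: "u \<in> CH" for u
  proof -
    have "ip (P u) u = c * (ip u \<eta> * cnj (ip u \<eta>))" using herm[OF u e] u e by (simp add: Pu ip_scale_left)
    also have "ip u \<eta> * cnj (ip u \<eta>) = complex_of_real ((cmod (ip u \<eta>))\<^sup>2)"
      by (rule complex_norm_square[symmetric])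
    finally show ?thesis by (simp add: c_def)
  qed
  have "positive_op H P" unfolding positive_op_def
    using x e by (auto simp: Pdiag complex_nonneg_Reals_iff)
  moreover have "is_adjoint H (rank1 \<xi> \<eta>) (rank1 \<eta> \<xi>)" unfolding is_adjoint_def
  proof (intro conjI ballI rank1_bop[OF e x])
    fix u v assume u: "u \<in> CH" and v: "v \<in> CH"
    show "ip (rank1 \<xi> \<eta> u) v = ip u (rank1 \<eta> \<xi> v)"
      using herm[OF v x] u v x e by (simp add: rank1_def ip_scale_left ip_scale_right)
  qed
  moreover have "P \<circ> P = rank1 \<eta> \<xi> \<circ> rank1 \<xi> \<eta>"
  proof
    fix u
    show "(P \<circ> P) u = (rank1 \<eta> \<xi> \<circ> rank1 \<xi> \<eta>) u"
    proof (cases "u \<in> CH")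
      case False
      then show ?thesis using x e by (simp add: P_def rank1_def)
    next
      case True
      have "(P \<circ> P) u = (ip u \<eta> * (c * c * ip \<eta> \<eta>)) *\<^sub>C \<eta>"
        using True e by (simp add: Pu ip_scale_left mem_scale mult_ac)
      moreover have "(rank1 \<eta> \<xi> \<circ> rank1 \<xi> \<eta>) u = (ip u \<eta> * ip \<xi> \<xi>) *\<^sub>C \<eta>"
        using True x by (simp add: rank1_def ip_scale_left mem_scale)
      moreover have "\<eta> = 0 \<or> c * c * ip \<eta> \<eta> = ip \<xi> \<xi>"
        using nm_eq_0[OF e] nm_sq[OF e, symmetric] nm_sq[OF x, symmetric] by (auto simp: c_def power2_eq_square)
      ultimately show ?thesis by auto
    qed
  qed
  ultimately have mod: "is_modulus H (rank1 \<xi> \<eta>) P" unfolding is_modulus_def using P by blast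
  have "(\<lambda>e. complex_of_real ((nm \<xi> / nm \<eta>) * (cmod (ip \<eta> e))\<^sup>2)) summable_on E"
    using summable_on_cmult_right[OF Bessel_summable[OF E e], of "nm \<xi> / nm \<eta>"] 
    by (simp only: summable_on_of_real)
  moreover have "complex_of_real ((nm \<xi> / nm \<eta>) * (cmod (ip \<eta> f))\<^sup>2) = ip (P f) f" if "f \<in> E" for f
    using Pdiag[OF onb_mem[OF E that]] herm[OF onb_mem[OF E that] e] by simp
  ultimately have "(\<lambda>f. ip (P f) f) summable_on E"
    using summable_on_cong[of E "\<lambda>e. complex_of_real ((nm \<xi> / nm \<eta>) * (cmod (ip \<eta> e))\<^sup>2)" "\<lambda>f. ip (P f) f"] by blast
  then show ?thesis unfolding trace_class_def using rank1_bop[OF x e] mod E by blast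
qed

lemma trace_rank1:
  assumes x: "\<xi> \<in> CH" and e: "\<eta> \<in> CH" and E: "orthonormal_basis H E" and T: "T \<in> bounded_ops H"
  shows "trace H (T \<circ> rank1 \<xi> \<eta>) = ip (T \<xi>) \<eta>"
proof -
  define E0 where "E0 = (SOME E. orthonormal_basis H E)"
  have E0: "orthonormal_basis H E0" unfolding E0_def by (rule someI[of _ E]) (rule E)
  have "ip ((T \<circ> rank1 \<xi> \<eta>) f) f = ip (T \<xi>) f * ip f \<eta>" if "f \<in> E0" for f
    using onb_mem[OF E0 that] linear_onD(2)[OF bopD(3)[OF T] x] bopD(1)[OF T x]
    by (simp add: rank1_def ip_scale_left)
  then have "((\<lambda>f. ip ((T \<circ> rank1 \<xi> \<eta>) f) f) has_sum ip (T \<xi>) \<eta>) E0"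
    using Parseval[OF E0 bopD(1)[OF T x] e] by (subst has_sum_cong) auto
  then show ?thesis unfolding trace_def E0_def[symmetric] by (rule infsumI)
qed

end

context hilb
begin

text \<open>Two forms attached to a positive operator \<open>P\<close> take the place of its square root and of a polar
  decomposition: \<open>\<langle>P x, y\<rangle>\<close> and \<open>\<langle>P x, P y\<rangle>\<close>.\<close>

definition form_hilb :: "('h \<Rightarrow> 'h \<Rightarrow> complex) \<Rightarrow> 'h hilb" where
  "form_hilb B = \<lparr>hcarrier = CH, hinner = B\<rparr>"

lemma form_hilb_simps[simp]: "hcarrier (form_hilb B) = CH" "hinner (form_hilb B) = B"
  by (auto simp: form_hilb_def)

lemma positive_hermitian:
  assumes P: "P \<in> bounded_ops H" "positive_op H P" and x: "x \<in> CH" and y: "y \<in> CH"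
  shows "ip (P y) x = cnj (ip (P x) y)"
  by (rule hermitian_if_real_diag[OF subsp, of "\<lambda>x y. ip (P x) y"])
    (use x y P(2) linear_onD[OF bopD(3)[OF P(1)]] bopD(1)[OF P(1)] in 
      \<open>auto simp: ip_add_left ip_add_right ip_scale_left ip_scale_right positive_op_def complex_nonneg_Reals_iff\<close>)

lemma positive_selfadjoint:
  assumes P: "P \<in> bounded_ops H" "positive_op H P" and x: "x \<in> CH" and y: "y \<in> CH"
  shows "ip (P x) y = ip x (P y)"
  using positive_hermitian[OF P x y] herm[OF x bopD(1)[OF P(1) y]] by simp

lemma pre_hilb_positive:
  assumes P: "P \<in> bounded_ops H" "positive_op H P"
  shows "pre_hilb (form_hilb (\<lambda>x y. ip (P x) y))"
proof
  note l = linear_onD[OF bopD(3)[OF P(1)]] bopD(1)[OF P(1)]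
  show "complex_vec.subspace (hcarrier (form_hilb (\<lambda>x y. ip (P x) y)))" using subsp by simp
  show "linear_on (hcarrier (form_hilb (\<lambda>x y. ip (P x) y))) (\<lambda>x. hinner (form_hilb (\<lambda>x y. ip (P x) y)) x y)"
    if "y \<in> hcarrier (form_hilb (\<lambda>x y. ip (P x) y))" for y
    unfolding linear_on_def form_hilb_simps scaleC_complex_def
  proof (intro conjI ballI allI)
    have y: "y \<in> CH" using that by simp
    fix a b c assume a: "a \<in> CH"
    show "ip (P (a + b)) y = ip (P a) y + ip (P b) y" if b: "b \<in> CH"
      unfolding l(1)[OF a b] by (rule ip_add_left[OF l(3)[OF a] l(3)[OF b] y])
    show "ip (P (c *\<^sub>C a)) y = c * ip (P a) y"
      unfolding l(2)[OF a] by (rule ip_scale_left[OF l(3)[OF a] y])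
  qed
  show "hinner (form_hilb (\<lambda>x y. ip (P x) y)) y x = cnj (hinner (form_hilb (\<lambda>x y. ip (P x) y)) x y)"
    if "x \<in> hcarrier (form_hilb (\<lambda>x y. ip (P x) y))" "y \<in> hcarrier (form_hilb (\<lambda>x y. ip (P x) y))" for x y
    using that unfolding form_hilb_simps by (rule positive_hermitian[OF P])
  show "hinner (form_hilb (\<lambda>x y. ip (P x) y)) x x \<in> \<real>\<^sub>\<ge>\<^sub>0"
    if "x \<in> hcarrier (form_hilb (\<lambda>x y. ip (P x) y))" for x
    using P(2) that by (simp add: positive_op_def)
qed

lemma pre_hilb_range:
  assumes P: "P \<in> bounded_ops H"
  shows "pre_hilb (form_hilb (\<lambda>x y. ip (P x) (P y)))"
proof
  note l = linear_onD[OF bopD(3)[OF P(1)]] bopD(1)[OF P(1)]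
  show "complex_vec.subspace (hcarrier (form_hilb (\<lambda>x y. ip (P x) (P y))))" using subsp by simp
  show "linear_on (hcarrier (form_hilb (\<lambda>x y. ip (P x) (P y)))) (\<lambda>x. hinner (form_hilb (\<lambda>x y. ip (P x) (P y))) x y)"
    if "y \<in> hcarrier (form_hilb (\<lambda>x y. ip (P x) (P y)))" for y
    unfolding linear_on_def form_hilb_simps scaleC_complex_def
  proof (intro conjI ballI allI)
    have y: "P y \<in> CH" using l(3) that by simp
    fix a b c assume a: "a \<in> CH"
    show "ip (P (a + b)) (P y) = ip (P a) (P y) + ip (P b) (P y)" if b: "b \<in> CH"
      unfolding l(1)[OF a b] by (rule ip_add_left[OF l(3)[OF a] l(3)[OF b] y])
    show "ip (P (c *\<^sub>C a)) (P y) = c * ip (P a) (P y)"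
      unfolding l(2)[OF a] by (rule ip_scale_left[OF l(3)[OF a] y])
  qed
  show "hinner (form_hilb (\<lambda>x y. ip (P x) (P y))) y x = cnj (hinner (form_hilb (\<lambda>x y. ip (P x) (P y))) x y)"
    if "x \<in> hcarrier (form_hilb (\<lambda>x y. ip (P x) (P y)))" "y \<in> hcarrier (form_hilb (\<lambda>x y. ip (P x) (P y)))" for x y
    using that unfolding form_hilb_simps by (intro herm l(3))
  show "hinner (form_hilb (\<lambda>x y. ip (P x) (P y))) x x \<in> \<real>\<^sub>\<ge>\<^sub>0"
    if "x \<in> hcarrier (form_hilb (\<lambda>x y. ip (P x) (P y)))" for x
    using that unfolding form_hilb_simps by (intro pos l(3))
qed

text \<open>The hypothesis says that \<open>\<Sum>\<^sub>i z\<^sub>i z\<^sub>i\<^sup>*\<close> is at most \<open>c\<^sup>2\<close>, so the claim is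
  \<open>tr (P \<Sum>\<^sub>i z\<^sub>i z\<^sub>i\<^sup>*) \<le> c\<^sup>2 tr P\<close>. A basis \<open>g\<close> of the span of the \<open>z\<^sub>i\<close> that is orthonormal for \<open>\<langle>P x, y\<rangle>\<close>
  gives \<open>\<langle>P z\<^sub>i, z\<^sub>i\<rangle> = \<Sum>\<^sub>k |\<langle>z\<^sub>i, P g\<^sub>k\<rangle>|\<^sup>2\<close>; then Parseval for \<open>P g\<^sub>k\<close> and Bessel for the basis vectors finish.\<close>

lemma positive_trace_domination:
  assumes P: "P \<in> bounded_ops H" "positive_op H P" and E: "orthonormal_basis H E"
    and tr: "((\<lambda>e. Re (ip (P e) e)) has_sum \<tau>) E"
    and z: "\<And>i. i < n \<Longrightarrow> z i \<in> CH"
    and bound: "\<And>v. v \<in> CH \<Longrightarrow> (\<Sum>i<(n::nat). (cmod (ip (z i) v))\<^sup>2) \<le> c\<^sup>2 * (nm v)\<^sup>2"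
  shows "(\<Sum>i<n. Re (ip (P (z i)) (z i))) \<le> c\<^sup>2 * \<tau>"
proof -
  let ?F = "form_hilb (\<lambda>x y. ip (P x) y)"
  interpret F: pre_hilb ?F by (rule pre_hilb_positive[OF P])
  note PC = bopD(1)[OF P(1)]
  obtain m :: nat and g where g: "F.onorm_fam {..<m} g"
    and null: "\<And>i. i < n \<Longrightarrow> hnorm ?F (z i - (\<Sum>k<m. ip (P (z i)) (g k) *\<^sub>C g k)) = 0"
    using F.Gram_Schmidt[of n z] z by auto
  have gC: "g k \<in> CH" if "k < m" for k using g that by (auto simp: F.onorm_fam_def)
  have Fn: "(hnorm ?F x)\<^sup>2 = Re (ip (P x) x)" if "x \<in> CH" for x using F.nm_sq_Re[of x] that by simp
  have zsq: "Re (ip (P (z i)) (z i)) = (\<Sum>k<m. (cmod (ip (z i) (P (g k))))\<^sup>2)" if i: "i < n" for i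
    using F.nm_diff_proj[OF _ g, of "z i"] null[OF i] z[OF i] Fn[OF z[OF i]] positive_selfadjoint[OF P z[OF i] gC] by simp
  have "((\<lambda>e. \<Sum>k<m. (cmod (ip (P (g k)) e))\<^sup>2) has_sum (\<Sum>k<m. (nm (P (g k)))\<^sup>2)) E"
    using gC PC
  proof (induction m)
    case (Suc m)
    then show ?case using Parseval_norm[OF E, of "P (g m)"] by (simp add: has_sum_add)
  qed simp
  moreover have "(\<Sum>k<m. (cmod (ip (P (g k)) e))\<^sup>2) \<le> Re (ip (P e) e)" if e: "e \<in> E" for e
  proof -
    have eC: "e \<in> CH" by (rule onb_mem[OF E e])
    have "(\<Sum>k<m. (cmod (ip (P (g k)) e))\<^sup>2) = (\<Sum>k<m. (cmod (ip (P e) (g k)))\<^sup>2)"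
      by (intro sum.cong refl) (use positive_hermitian[OF P gC eC] in simp)
    also have "\<dots> \<le> Re (ip (P e) e)" using F.Bessel[OF _ g, of e] eC Fn[OF eC] by simp
    finally show ?thesis .
  qed
  ultimately have gm: "(\<Sum>k<m. (nm (P (g k)))\<^sup>2) \<le> \<tau>" using has_sum_mono[OF _ tr] by blast
  have "(\<Sum>i<n. Re (ip (P (z i)) (z i))) = (\<Sum>i<n. \<Sum>k<m. (cmod (ip (z i) (P (g k))))\<^sup>2)"
    using zsq by simp
  also have "\<dots> = (\<Sum>k<m. \<Sum>i<n. (cmod (ip (z i) (P (g k))))\<^sup>2)" by (rule sum.swap)
  also have "\<dots> \<le> (\<Sum>k<m. c\<^sup>2 * (nm (P (g k)))\<^sup>2)" using gC PC by (intro sum_mono bound) auto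
  also have "\<dots> \<le> c\<^sup>2 * \<tau>" using gm by (simp add: sum_distrib_left[symmetric] mult_left_mono)
  finally show ?thesis .
qed

text \<open>The hypothesis on \<open>R\<close> says that \<open>R = U P\<close> with \<open>\<parallel>U\<parallel> \<le> c\<close>. On the span of the given vectors \<open>e\<^sub>i\<close> an
  orthonormal basis \<open>P g\<^sub>k\<close> of the range of \<open>P\<close> makes \<open>U\<close> and its adjoint explicit: \<open>z\<^sub>i\<close> is \<open>U\<^sup>* e\<^sub>i\<close>, so
  \<open>\<langle>R e\<^sub>i, e\<^sub>i\<rangle> = \<langle>P e\<^sub>i, z\<^sub>i\<rangle>\<close>, and Cauchy-Schwarz for \<open>\<langle>P x, y\<rangle>\<close> separates the two factors.\<close>

lemma trace_norm_bound:
  assumes P: "P \<in> bounded_ops H" "positive_op H P" and E: "orthonormal_basis H E"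
    and tr: "((\<lambda>e. Re (ip (P e) e)) has_sum \<tau>) E"
    and R: "\<And>x. x \<in> CH \<Longrightarrow> R x \<in> CH" "linear_on CH R" and c: "0 \<le> c"
    and dom: "\<And>x. x \<in> CH \<Longrightarrow> nm (R x) \<le> c * nm (P x)"
    and e: "onorm_fam {..<n::nat} e"
  shows "(\<Sum>i<n. cmod (ip (R (e i)) (e i))) \<le> c * sqrt (\<Sum>i<n. Re (ip (P (e i)) (e i))) * sqrt \<tau>"
proof -
  let ?Q = "form_hilb (\<lambda>x y. ip (P x) (P y))" and ?F = "form_hilb (\<lambda>x y. ip (P x) y)"
  interpret Q: pre_hilb ?Q by (rule pre_hilb_range[OF P(1)])
  interpret F: pre_hilb ?F by (rule pre_hilb_positive[OF P])
  note PC = bopD(1)[OF P(1)] and Pl = linear_on_lincomb[OF bopD(3)[OF P(1)] subsp]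
  note Rl = linear_on_lincomb[OF R(2) subsp]
  have eC: "e i \<in> CH" if "i < n" for i using e that by (auto simp: onorm_fam_def)
  obtain m :: nat and g where g: "Q.onorm_fam {..<m} g"
    and null: "\<And>i. i < n \<Longrightarrow> hnorm ?Q (e i - (\<Sum>k<m. ip (P (e i)) (P (g k)) *\<^sub>C g k)) = 0"
    using Q.Gram_Schmidt[of n e] eC by auto
  have gC: "g k \<in> CH" if "k < m" for k using g that by (auto simp: Q.onorm_fam_def)
  have Pg: "onorm_fam {..<m} (\<lambda>k. P (g k))" using g PC by (auto simp: Q.onorm_fam_def onorm_fam_def)
  have Qn: "hnorm ?Q x = nm (P x)" for x by (simp add: hnorm_def)
  define z where "z i = (\<Sum>k<m. ip (e i) (R (g k)) *\<^sub>C P (g k))" for i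
  have zC: "z i \<in> CH" for i unfolding z_def using gC PC by (intro mem_lincomb) auto
  have Rz: "ip (R (e i)) (e i) = ip (P (e i)) (z i)" if i: "i < n" for i
  proof -
    let ?s = "\<Sum>k<m. ip (P (e i)) (P (g k)) *\<^sub>C g k"
    have sC: "?s \<in> CH" using gC by (intro mem_lincomb) auto
    have "nm (R (e i - ?s)) \<le> 0" using dom[OF mem_diff[OF eC[OF i] sC]] null[OF i] by (simp add: Qn)
    then have "R (e i - ?s) = 0" using R(1)[OF mem_diff[OF eC[OF i] sC]] nm_ge_0 nm_eq_0 by (metis antisym)
    then have "R (e i) = R ?s" using linear_on_diff[OF R(2) subsp eC[OF i] sC] by simp
    also have "\<dots> = (\<Sum>k<m. ip (P (e i)) (P (g k)) *\<^sub>C R (g k))" by (rule Rl) (use gC in auto)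
    finally have "ip (R (e i)) (e i) = (\<Sum>k<m. ip (P (e i)) (P (g k)) * ip (R (g k)) (e i))"
      using ip_lincomb_left[of "{..<m}" "\<lambda>k. R (g k)" "e i"] gC R(1) eC[OF i] by simp
    also have "\<dots> = (\<Sum>k<m. cnj (ip (e i) (R (g k))) * ip (P (e i)) (P (g k)))"
      by (intro sum.cong refl) (use herm[OF eC[OF i] R(1)[OF gC]] in \<open>simp add: mult.commute\<close>)
    also have "\<dots> = ip (P (e i)) (z i)" unfolding z_def
      by (rule ip_lincomb_right[symmetric]) (use gC PC eC[OF i] in auto)
    finally show ?thesis .
  qed
  have zb: "(\<Sum>i<n. (cmod (ip (z i) v))\<^sup>2) \<le> c\<^sup>2 * (nm v)\<^sup>2" if v: "v \<in> CH" for v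
  proof -
    define u where "u = (\<Sum>k<m. ip v (P (g k)) *\<^sub>C g k)"
    have uC: "u \<in> CH" unfolding u_def using gC by (intro mem_lincomb) auto
    have Ru: "R u = (\<Sum>k<m. ip v (P (g k)) *\<^sub>C R (g k))" unfolding u_def by (rule Rl) (use gC in auto)
    have Pu: "P u = (\<Sum>k<m. ip v (P (g k)) *\<^sub>C P (g k))" unfolding u_def by (rule Pl) (use gC in auto)
    have "ip (z i) v = ip (e i) (R u)" if i: "i < n" for i
    proof -
      have "ip (z i) v = (\<Sum>k<m. ip (e i) (R (g k)) * ip (P (g k)) v)" unfolding z_def
        by (rule ip_lincomb_left) (use gC PC v in auto)
      also have "\<dots> = (\<Sum>k<m. cnj (ip v (P (g k))) * ip (e i) (R (g k)))"
        by (intro sum.cong refl) (use herm[OF v PC[OF gC]] in \<open>simp add: mult.commute\<close>)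
      also have "\<dots> = ip (e i) (R u)" unfolding Ru
        by (rule ip_lincomb_right[symmetric]) (use gC R(1) eC[OF i] in auto)
      finally show ?thesis .
    qed
    then have "(\<Sum>i<n. (cmod (ip (z i) v))\<^sup>2) = (\<Sum>i<n. (cmod (ip (R u) (e i)))\<^sup>2)"
      by (intro sum.cong refl) (use herm[OF eC R(1)[OF uC]] in simp)
    also have "\<dots> \<le> (nm (R u))\<^sup>2" by (rule Bessel[OF _ e R(1)[OF uC]]) simp
    also have "\<dots> \<le> (c * nm (P u))\<^sup>2" by (rule power_mono[OF dom[OF uC] nm_ge_0[OF R(1)[OF uC]]])
    also have "\<dots> = c\<^sup>2 * (\<Sum>k<m. (cmod (ip v (P (g k))))\<^sup>2)"
      unfolding power_mult_distrib Pu nm_lincomb_onorm[OF finite_lessThan Pg] ..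
    also have "\<dots> \<le> c\<^sup>2 * (nm v)\<^sup>2" using Bessel[OF _ Pg v] by (intro mult_left_mono) auto
    finally show ?thesis .
  qed
  have zt: "(\<Sum>i<n. Re (ip (P (z i)) (z i))) \<le> c\<^sup>2 * \<tau>"
    by (rule positive_trace_domination[OF P E tr zC zb])
  have Fn: "(hnorm ?F x)\<^sup>2 = Re (ip (P x) x)" if "x \<in> CH" for x using F.nm_sq_Re[of x] that by simp
  have "(\<Sum>i<n. cmod (ip (R (e i)) (e i))) \<le> (\<Sum>i<n. hnorm ?F (e i) * hnorm ?F (z i))"
    by (intro sum_mono) (use Rz F.Cauchy_Schwarz[of "e _" "z _"] eC zC in auto)
  also have "\<dots> \<le> sqrt (\<Sum>i<n. (hnorm ?F (e i))\<^sup>2) * sqrt (\<Sum>i<n. (hnorm ?F (z i))\<^sup>2)"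
    unfolding real_sqrt_mult[symmetric]
    by (rule real_le_rsqrt) (rule Cauchy_Schwarz_ineq_sum)
  also have "\<dots> \<le> sqrt (\<Sum>i<n. Re (ip (P (e i)) (e i))) * sqrt (c\<^sup>2 * \<tau>)"
  proof (intro mult_mono real_sqrt_le_mono)
    show "(\<Sum>i<n. (hnorm ?F (e i))\<^sup>2) \<le> (\<Sum>i<n. Re (ip (P (e i)) (e i)))" using Fn eC by (intro sum_mono) auto
    show "(\<Sum>i<n. (hnorm ?F (z i))\<^sup>2) \<le> c\<^sup>2 * \<tau>" using Fn zC zt by simp
    have "0 \<le> (\<Sum>i<n. (hnorm ?F (e i))\<^sup>2)" by (intro sum_nonneg) auto
    then show "0 \<le> sqrt (\<Sum>i<n. Re (ip (P (e i)) (e i)))" using Fn eC by simp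
  qed (auto intro!: sum_nonneg)
  also have "\<dots> = c * sqrt (\<Sum>i<n. Re (ip (P (e i)) (e i))) * sqrt \<tau>" using c by (simp add: real_sqrt_mult)
  finally show ?thesis .
qed

text \<open>The previous bounds, reindexed from initial segments to arbitrary finite orthonormal sets. The
  first is the case \<open>z\<^sub>i = e\<^sub>i\<close>: the trace of \<open>P\<close> computed in another basis is no larger.\<close>

lemma trace_norm_bound_set:
  assumes P: "P \<in> bounded_ops H" "positive_op H P" and E: "orthonormal_basis H E"
    and tr: "((\<lambda>e. Re (ip (P e) e)) has_sum \<tau>) E"
    and G: "finite G" "onorm_fam G (\<lambda>e. e)"
  shows "(\<Sum>e\<in>G. Re (ip (P e) e)) \<le> \<tau>"
    and "\<lbrakk>\<And>x. x \<in> CH \<Longrightarrow> R x \<in> CH; linear_on CH R; 0 \<le> c; \<And>x. x \<in> CH \<Longrightarrow> nm (R x) \<le> c * nm (P x)\<rbrakk>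
      \<Longrightarrow> (\<Sum>e\<in>G. cmod (ip (R e) e)) \<le> c * sqrt (\<Sum>e\<in>G. Re (ip (P e) e)) * sqrt \<tau>"
proof -
  obtain h where h: "bij_betw h {..<card G} G" using ex_bij_betw_nat_finite[OF G(1)] by (auto simp: lessThan_atLeast0)
  have hG: "h i \<in> G" if "i < card G" for i using bij_betwE[OF h] that by auto
  have inj: "h i = h j \<longleftrightarrow> i = j" if "i < card G" "j < card G" for i j
    using bij_betw_imp_inj_on[OF h] that by (auto simp: inj_on_def)
  have hon: "onorm_fam {..<card G} h" using G(2) hG inj by (auto simp: onorm_fam_def)
  have re: "(\<Sum>i<card G. f (h i)) = (\<Sum>e\<in>G. f e)" for f :: "'h \<Rightarrow> real" by (rule sum.reindex_bij_betw[OF h])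
  have hC: "h i \<in> CH" if "i < card G" for i using hon that by (auto simp: onorm_fam_def)
  have "(\<Sum>i<card G. Re (ip (P (h i)) (h i))) \<le> 1\<^sup>2 * \<tau>"
  proof (rule positive_trace_domination[OF P E tr hC])
    fix v assume v: "v \<in> CH"
    have "(\<Sum>i<card G. (cmod (ip (h i) v))\<^sup>2) = (\<Sum>i<card G. (cmod (ip v (h i)))\<^sup>2)"
      by (intro sum.cong refl) (use herm[OF v hC] in simp)
    also have "\<dots> \<le> (nm v)\<^sup>2" by (rule Bessel[OF _ hon v]) simp
    finally show "(\<Sum>i<card G. (cmod (ip (h i) v))\<^sup>2) \<le> 1\<^sup>2 * (nm v)\<^sup>2" by simp
  qed
  then show "(\<Sum>e\<in>G. Re (ip (P e) e)) \<le> \<tau>" using re[of "\<lambda>e. Re (ip (P e) e)"] by simp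
  assume R: "\<And>x. x \<in> CH \<Longrightarrow> R x \<in> CH" "linear_on CH R" "0 \<le> c" "\<And>x. x \<in> CH \<Longrightarrow> nm (R x) \<le> c * nm (P x)"
  show "(\<Sum>e\<in>G. cmod (ip (R e) e)) \<le> c * sqrt (\<Sum>e\<in>G. Re (ip (P e) e)) * sqrt \<tau>"
    using trace_norm_bound[OF P E tr R hon] re[of "\<lambda>e. Re (ip (P e) e)"] re[of "\<lambda>e. cmod (ip (R e) e)"] by simp
qed

text \<open>The finite set does not depend on \<open>T\<close>: the tail of the trace of \<open>T S\<close> is controlled by
  \<open>\<parallel>T\<parallel>\<close> times the square root of the tail of the trace of the modulus of \<open>S\<close>. This uniformity is
  what makes trace functionals normal on \<open>X\<close>.\<close>

theorem trace_class_approx: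
  assumes S: "S \<in> trace_class H" and \<epsilon>: "0 < \<epsilon>"
  shows "\<exists>F. finite F \<and> F \<subseteq> CH \<and>
    (\<forall>T\<in>bounded_ops H. cmod (trace H (T \<circ> S) - (\<Sum>e\<in>F. ip (T (S e)) e)) \<le> \<epsilon> * op_norm H T)"
proof -
  from S obtain P E where Sb: "S \<in> bounded_ops H" and mod: "is_modulus H S P" and E: "orthonormal_basis H E"
    and sm: "(\<lambda>e. ip (P e) e) summable_on E" by (auto simp: trace_class_def)
  from mod obtain S' where P: "P \<in> bounded_ops H" "positive_op H P" and adj: "is_adjoint H S S'" and PP: "P \<circ> P = S' \<circ> S"
    by (auto simp: is_modulus_def)
  define \<tau> where "\<tau> = infsum (\<lambda>e. Re (ip (P e) e)) E"
  have tr: "((\<lambda>e. Re (ip (P e) e)) has_sum \<tau>) E"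
    unfolding \<tau>_def using summable_on_Re[OF sm] by (rule has_sum_infsum)
  have Pnn: "0 \<le> Re (ip (P e) e)" if "e \<in> CH" for e using P(2) that by (auto simp: positive_op_def complex_nonneg_Reals_iff)
  have \<tau>0: "0 \<le> \<tau>" unfolding \<tau>_def using Pnn onb_mem[OF E] by (intro infsum_nonneg) auto
  have SP: "nm (S x) = nm (P x)" if x: "x \<in> CH" for x
  proof -
    have "ip (S x) (S x) = ip x (S' (S x))" using adj x bopD(1)[OF Sb x] by (auto simp: is_adjoint_def)
    also have "S' (S x) = P (P x)" using fun_cong[OF PP, of x] by simp
    also have "ip x (P (P x)) = ip (P x) (P x)" by (rule positive_selfadjoint[OF P x bopD(1)[OF P(1) x], symmetric])
    finally show ?thesis by (simp add: hnorm_def)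
  qed
  define E0 where "E0 = (SOME E. orthonormal_basis H E)"
  have E0: "orthonormal_basis H E0" unfolding E0_def by (rule someI[of _ E]) (rule E)
  define a where "a = (\<lambda>e. Re (ip (P e) e))"
  have a0: "0 \<le> a e" if "e \<in> E0" for e unfolding a_def by (rule Pnn[OF onb_mem[OF E0 that]])
  have at: "sum a G \<le> \<tau>" if "finite G" "G \<subseteq> E0" for G
    unfolding a_def by (rule trace_norm_bound_set(1)[OF P E tr that(1) onb_fam[OF E0 that(2)]])
  have as: "a summable_on E0"
    by (rule nonneg_bdd_above_summable_on) (use a0 at in \<open>auto simp: bdd_above_def\<close>)
  have RG: "(\<Sum>e\<in>G. cmod (ip (T (S e)) e)) \<le> op_norm H T * sqrt (sum a G) * sqrt \<tau>"
    if T: "T \<in> bounded_ops H" and G: "finite G" "G \<subseteq> E0" for T G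
  proof -
    have 1: "T (S x) \<in> CH" if "x \<in> CH" for x using bopD(1)[OF T bopD(1)[OF Sb that]] .
    have 2: "linear_on CH (\<lambda>x. T (S x))"
      using linear_onD[OF bopD(3)[OF T]] linear_onD[OF bopD(3)[OF Sb]] bopD(1)[OF Sb] by (simp add: linear_on_def)
    have 3: "nm (T (S x)) \<le> op_norm H T * nm (P x)" if "x \<in> CH" for x
      using op_norm_bound[OF T bopD(1)[OF Sb that]] SP[OF that] by simp
    show ?thesis unfolding a_def
      by (rule trace_norm_bound_set(2)[OF P E tr G(1) onb_fam[OF E0 G(2)] 1 2 op_norm_ge_0[OF T] 3])
  qed
  define \<delta> where "\<delta> = (\<epsilon> / (sqrt \<tau> + 1))\<^sup>2"
  have st: "0 < sqrt \<tau> + 1" using \<tau>0 by (simp add: add_nonneg_pos)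
  have \<delta>: "0 < \<delta>" using \<epsilon> st by (simp add: \<delta>_def)
  have \<delta>\<epsilon>: "sqrt \<delta> * sqrt \<tau> \<le> \<epsilon>"
  proof -
    have "sqrt \<delta> = \<epsilon> / (sqrt \<tau> + 1)" using \<epsilon> st by (simp add: \<delta>_def)
    then have "sqrt \<delta> * sqrt \<tau> = \<epsilon> * (sqrt \<tau> / (sqrt \<tau> + 1))" by simp
    also have "\<dots> \<le> \<epsilon> * 1" using \<epsilon> st by (intro mult_left_mono) (auto simp: divide_le_eq_1)
    finally show ?thesis by simp
  qed
  obtain F where F: "finite F" "F \<subseteq> E0" "\<And>G. finite G \<Longrightarrow> F \<subseteq> G \<Longrightarrow> G \<subseteq> E0 \<Longrightarrow> dist (sum a G) (infsum a E0) < \<delta> / 2"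
  proof -
    have "(sum a \<longlongrightarrow> infsum a E0) (finite_subsets_at_top E0)" using has_sum_infsum[OF as] by (simp add: has_sum_def)
    from tendstoD[OF this, of "\<delta> / 2"] \<delta> show ?thesis using that by (auto simp: eventually_finite_subsets_at_top)
  qed
  have tail: "sum a G \<le> \<delta>" if G: "finite G" "G \<subseteq> E0 - F" for G
  proof -
    have "dist (sum a (F \<union> G)) (infsum a E0) < \<delta> / 2" using F G by (intro F(3)) auto
    moreover have "dist (sum a F) (infsum a E0) < \<delta> / 2" using F by (intro F(3)) auto
    moreover have "sum a (F \<union> G) = sum a F + sum a G" using F G by (intro sum.union_disjoint) auto
    ultimately show ?thesis by (simp add: dist_real_def abs_if split: if_splits)
  qed
  have "cmod (trace H (T \<circ> S) - (\<Sum>e\<in>F. ip (T (S e)) e)) \<le> \<epsilon> * op_norm H T" if T: "T \<in> bounded_ops H" for T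
  proof -
    let ?f = "\<lambda>e. ip (T (S e)) e"
    have T0: "0 \<le> op_norm H T" by (rule op_norm_ge_0[OF T])
    have tb: "(\<Sum>e\<in>G. cmod (?f e)) \<le> \<epsilon> * op_norm H T" if G: "finite G" "G \<subseteq> E0 - F" for G
    proof -
      have "(\<Sum>e\<in>G. cmod (?f e)) \<le> op_norm H T * sqrt (sum a G) * sqrt \<tau>" using G by (intro RG[OF T]) auto
      also have "\<dots> \<le> op_norm H T * sqrt \<delta> * sqrt \<tau>"
        using tail[OF G] T0 \<tau>0 by (intro mult_right_mono mult_left_mono) auto
      also have "\<dots> \<le> op_norm H T * \<epsilon>" using mult_left_mono[OF \<delta>\<epsilon> T0] by (simp add: mult.assoc)
      finally show ?thesis by (simp add: mult.commute)
    qed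
    have abs: "(\<lambda>e. norm (?f e)) summable_on (E0 - F)"
      by (rule nonneg_bdd_above_summable_on) (use tb in \<open>auto simp: bdd_above_def\<close>)
    have "?f summable_on (E0 - F)" by (rule abs_summable_summable[OF abs])
    then have hs: "(?f has_sum infsum ?f (E0 - F)) (E0 - F)" by (rule has_sum_infsum)
    have "(?f has_sum (sum ?f F + infsum ?f (E0 - F))) (F \<union> (E0 - F))"
      by (rule has_sum_Un_disjoint[OF has_sum_finite[OF F(1)] hs]) auto
    moreover have "F \<union> (E0 - F) = E0" using F(2) by auto
    ultimately have "trace H (T \<circ> S) = sum ?f F + infsum ?f (E0 - F)"
      unfolding trace_def E0_def[symmetric] by (simp add: infsumI)
    then have "cmod (trace H (T \<circ> S) - sum ?f F) = cmod (infsum ?f (E0 - F))" by simp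
    also have "\<dots> \<le> infsum (\<lambda>e. norm (?f e)) (E0 - F)" by (rule norm_infsum_bound[OF abs])
    also have "\<dots> \<le> \<epsilon> * op_norm H T" by (rule infsum_le_finite_sums[OF abs tb])
    finally show ?thesis .
  qed
  moreover have "F \<subseteq> CH" using F(2) onb_mem[OF E0] by auto
  ultimately show ?thesis using F(1) by blast
qed

end

section \<open>Hilbert space direct sums of finite-dimensional spaces\<close>

lemma summable_dominated:
  fixes f :: "'b \<Rightarrow> complex" and g :: "'b \<Rightarrow> real"
  assumes "g summable_on A" "\<And>b. b \<in> A \<Longrightarrow> cmod (f b) \<le> g b"
  shows "f summable_on A" "(\<lambda>b. cmod (f b)) summable_on A" "cmod (infsum f A) \<le> infsum g A"
proof -
  show s: "(\<lambda>b. cmod (f b)) summable_on A" by (rule Infinite_Sum.abs_summable_on_comparison_test'[OF assms])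
  then show "f summable_on A" by (rule abs_summable_summable)
  have "cmod (infsum f A) \<le> infsum (\<lambda>b. cmod (f b)) A" by (rule norm_infsum_bound[OF s])
  also have "\<dots> \<le> infsum g A" by (rule infsum_mono[OF s assms])
  finally show "cmod (infsum f A) \<le> infsum g A" .
qed

lemma infsum_complex_of_real: "infsum (\<lambda>b. complex_of_real (h b)) A = complex_of_real (infsum h A)"
proof (cases "h summable_on A")
  case True
  then show ?thesis by (intro infsumI has_sum_of_real has_sum_infsum)
next
  case False
  then have "\<not> (\<lambda>b. complex_of_real (h b)) summable_on A"
    using summable_on_Re[of "\<lambda>b. complex_of_real (h b)" A] by auto
  then show ?thesis using False by (simp add: infsum_not_exists)
qed

lemma summable_dominated_real:
  fixes f g :: "'b \<Rightarrow> real"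
  assumes "g summable_on A" "\<And>b. b \<in> A \<Longrightarrow> 0 \<le> f b" "\<And>b. b \<in> A \<Longrightarrow> f b \<le> g b"
  shows "f summable_on A"
proof -
  have "(\<lambda>b. norm (complex_of_real (f b))) summable_on A"
    by (rule Infinite_Sum.abs_summable_on_comparison_test'[OF assms(1)]) (use assms in auto)
  then show ?thesis using summable_on_cong[of A "\<lambda>b. norm (complex_of_real (f b))" f] assms(2) by simp
qed

text \<open>Summing the arithmetic-geometric form of the termwise bound and optimising afterwards.\<close>

lemma infsum_Cauchy_Schwarz:
  fixes T :: "'b \<Rightarrow> complex" and f g :: "'b \<Rightarrow> real"
  assumes f: "f summable_on A" "\<And>b. b \<in> A \<Longrightarrow> 0 \<le> f b" and g: "g summable_on A" "\<And>b. b \<in> A \<Longrightarrow> 0 \<le> g b"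
    and M: "0 \<le> M" and T: "\<And>b. b \<in> A \<Longrightarrow> cmod (T b) \<le> M * sqrt (f b) * sqrt (g b)"
  shows "T summable_on A" "cmod (infsum T A) \<le> M * sqrt (infsum f A) * sqrt (infsum g A)"
proof -
  have AM: "2 * t * cmod (T b) \<le> M * (t\<^sup>2 * f b + g b)" if "b \<in> A" "0 < t" for b t
  proof -
    have "2 * t * cmod (T b) \<le> 2 * t * (M * sqrt (f b) * sqrt (g b))" using T[OF that(1)] that(2) by simp
    also have "\<dots> = M * (2 * (t * sqrt (f b)) * sqrt (g b))" by simp
    also have "\<dots> \<le> M * ((t * sqrt (f b))\<^sup>2 + (sqrt (g b))\<^sup>2)" by (rule mult_left_mono[OF sum_squares_bound M])
    also have "\<dots> = M * (t\<^sup>2 * f b + g b)" using f(2)[OF that(1)] g(2)[OF that(1)] by (simp add: power_mult_distrib)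
    finally show ?thesis .
  qed
  have s: "(\<lambda>b. M / (2 * t) * (t\<^sup>2 * f b + g b)) summable_on A" for t
    by (intro summable_on_cmult_right summable_on_add f(1) g(1))
  have dom: "cmod (T b) \<le> M / (2 * t) * (t\<^sup>2 * f b + g b)" if "b \<in> A" "0 < t" for b t
    using AM[OF that] that(2) by (simp add: field_simps)
  show "T summable_on A" by (rule summable_dominated(1)[OF s[of 1]]) (rule dom, auto)
  show "cmod (infsum T A) \<le> M * sqrt (infsum f A) * sqrt (infsum g A)"
  proof (rule real_sqrt_bound_of_quadratic[OF _ M])
    fix t :: real assume t: "0 < t"
    have "cmod (infsum T A) \<le> infsum (\<lambda>b. M / (2 * t) * (t\<^sup>2 * f b + g b)) A"
      by (rule summable_dominated(3)[OF s[of t]]) (rule dom[OF _ t])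
    also have "\<dots> = M / (2 * t) * (t\<^sup>2 * infsum f A + infsum g A)"
      by (subst infsum_cmult_right', subst infsum_add[OF summable_on_cmult_right[OF f(1)] g(1)], subst infsum_cmult_right', rule refl)
    finally show "2 * t * cmod (infsum T A) \<le> M * (t\<^sup>2 * infsum f A + infsum g A)" using t by (simp add: field_simps)
  qed (intro infsum_nonneg f(2) g(2); assumption)+
qed

text \<open>For a vector of the direct sum, the squared norm of its component in the summand \<open>b = (m, \<psi>)\<close>,
  which is a copy of \<open>\<complex>\<^sup>m\<close>.\<close>

definition block_sq :: "(nat \<times> 'p \<times> nat \<Rightarrow> complex) \<Rightarrow> nat \<times> 'p \<Rightarrow> real" where
  "block_sq f b = (\<Sum>i<fst b. (cmod (f (fst b, snd b, i)))\<^sup>2)"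

definition block_inner :: "(nat \<times> 'p \<times> nat \<Rightarrow> complex) \<Rightarrow> (nat \<times> 'p \<times> nat \<Rightarrow> complex) \<Rightarrow> nat \<times> 'p \<Rightarrow> complex" where
  "block_inner f g b = (\<Sum>i<fst b. f (fst b, snd b, i) * cnj (g (fst b, snd b, i)))"

definition ell2 :: "(nat \<times> 'p) set \<Rightarrow> (nat \<times> 'p \<times> nat \<Rightarrow> complex) hilb" where
  "ell2 blocks = \<lparr>hcarrier = {f. (\<forall>m \<psi> i. \<not> ((m, \<psi>) \<in> blocks \<and> i < m) \<longrightarrow> f (m, \<psi>, i) = 0) \<and> block_sq f summable_on blocks},
     hinner = (\<lambda>f g. infsum (block_inner f g) blocks)\<rparr>"

lemma block_sq_ge_0[simp]: "0 \<le> block_sq f b" by (simp add: block_sq_def sum_nonneg)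

lemma block_inner_bound: "cmod (block_inner f g b) \<le> sqrt (block_sq f b) * sqrt (block_sq g b)"
proof -
  have "cmod (block_inner f g b) \<le> (\<Sum>i<fst b. cmod (f (fst b, snd b, i)) * cmod (g (fst b, snd b, i)))"
    unfolding block_inner_def by (rule order.trans[OF norm_sum]) (simp add: norm_mult)
  also have "\<dots> \<le> sqrt (block_sq f b * block_sq g b)" unfolding block_sq_def
    by (rule real_le_rsqrt) (rule Cauchy_Schwarz_ineq_sum)
  finally show ?thesis by (simp add: real_sqrt_mult)
qed

lemma block_inner_self: "block_inner f f b = complex_of_real (block_sq f b)"
  by (simp add: block_inner_def block_sq_def complex_norm_square del: of_real_power)

lemma block_sq_add_le: "block_sq (f + g) b \<le> 2 * block_sq f b + 2 * block_sq g b"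
proof -
  have "(cmod (z + w))\<^sup>2 \<le> 2 * (cmod z)\<^sup>2 + 2 * (cmod w)\<^sup>2" for z w
  proof -
    have "(cmod (z + w))\<^sup>2 \<le> (cmod z + cmod w)\<^sup>2" by (rule power_mono[OF norm_triangle_ineq]) simp
    then show ?thesis using sum_squares_bound[of "cmod z" "cmod w"] by (simp add: power2_sum)
  qed
  then show ?thesis unfolding block_sq_def sum_distrib_left sum.distrib[symmetric] by (intro sum_mono) simp
qed

lemma block_sq_scale: "block_sq (c *\<^sub>C f) b = (cmod c)\<^sup>2 * block_sq f b"
  by (simp add: block_sq_def scaleC_fun_apply scaleC_complex_def norm_mult power_mult_distrib sum_distrib_left)

lemma ell2_carrier: "f \<in> hcarrier (ell2 blocks) \<longleftrightarrow> (\<forall>m \<psi> i. \<not> ((m, \<psi>) \<in> blocks \<and> i < m) \<longrightarrow> f (m, \<psi>, i) = 0) \<and> block_sq f summable_on blocks"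
  by (simp add: ell2_def)

lemma ell2_inner: "hinner (ell2 blocks) f g = infsum (block_inner f g) blocks"
  by (simp add: ell2_def)

lemma ell2_block_sq: "f \<in> hcarrier (ell2 blocks) \<Longrightarrow> block_sq f summable_on blocks"
  by (simp add: ell2_carrier)

lemma block_inner_summable:
  assumes "f \<in> hcarrier (ell2 blocks)" "g \<in> hcarrier (ell2 blocks)"
  shows "block_inner f g summable_on blocks"
  by (rule infsum_Cauchy_Schwarz(1)[OF ell2_block_sq[OF assms(1)] _ ell2_block_sq[OF assms(2)], where M=1])
    (use block_inner_bound[of f g] in auto)

lemma ell2_subspace: "complex_vec.subspace (hcarrier (ell2 blocks))"
proof (rule complex_vec.subspaceI)
  show "0 \<in> hcarrier (ell2 blocks)" by (simp add: ell2_carrier block_sq_def[abs_def])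
  fix f g assume f: "f \<in> hcarrier (ell2 blocks)" and g: "g \<in> hcarrier (ell2 blocks)"
  have "block_sq (f + g) summable_on blocks"
    by (rule summable_dominated_real[OF summable_on_add[OF summable_on_cmult_right summable_on_cmult_right, OF ell2_block_sq[OF f] ell2_block_sq[OF g]]])
      (rule block_sq_ge_0, rule block_sq_add_le)
  then show "f + g \<in> hcarrier (ell2 blocks)" using f g by (simp add: ell2_carrier)
next
  fix c f assume f: "f \<in> hcarrier (ell2 blocks)"
  have "block_sq (c *\<^sub>C f) = (\<lambda>b. (cmod c)\<^sup>2 * block_sq f b)" by (rule ext) (rule block_sq_scale)
  then show "c *\<^sub>C f \<in> hcarrier (ell2 blocks)"
    using f summable_on_cmult_right[OF ell2_block_sq[OF f], of "(cmod c)\<^sup>2"] 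
    by (simp add: ell2_carrier scaleC_fun_apply scaleC_complex_def)
qed

lemma ell2_pre_hilb: "pre_hilb (ell2 blocks)"
proof
  show "complex_vec.subspace (hcarrier (ell2 blocks))" by (rule ell2_subspace)
next
  fix h assume h: "h \<in> hcarrier (ell2 blocks)"
  have "block_inner (f + g) h = (\<lambda>b. block_inner f h b + block_inner g h b)" "block_inner (c *\<^sub>C f) h = (\<lambda>b. c * block_inner f h b)" for f g c
    by (simp_all add: block_inner_def fun_eq_iff scaleC_fun_apply scaleC_complex_def algebra_simps sum.distrib sum_distrib_left)
  then show "linear_on (hcarrier (ell2 blocks)) (\<lambda>f. hinner (ell2 blocks) f h)"
    unfolding linear_on_def ell2_inner scaleC_complex_def
    using infsum_add[OF block_inner_summable[OF _ h] block_inner_summable[OF _ h]] by (simp add: infsum_cmult_right')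
next
  fix f g assume "f \<in> hcarrier (ell2 blocks)" "g \<in> hcarrier (ell2 blocks)"
  have "block_inner g f = (\<lambda>b. cnj (block_inner f g b))" by (simp add: block_inner_def fun_eq_iff mult.commute)
  then show "hinner (ell2 blocks) g f = cnj (hinner (ell2 blocks) f g)"
    unfolding ell2_inner by (simp add: infsum_cnj)
next
  fix f assume "f \<in> hcarrier (ell2 blocks)"
  have "block_inner f f = (\<lambda>b. complex_of_real (block_sq f b))" by (rule ext) (rule block_inner_self)
  then have "hinner (ell2 blocks) f f = complex_of_real (infsum (block_sq f) blocks)"
    unfolding ell2_inner by (simp add: infsum_complex_of_real)
  moreover have "0 \<le> infsum (block_sq f) blocks" by (rule infsum_nonneg) simp
  ultimately show "hinner (ell2 blocks) f f \<in> \<real>\<^sub>\<ge>\<^sub>0" by (simp add: complex_nonneg_Reals_iff)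
qed

lemma ell2_norm: "hnorm (ell2 blocks) f = sqrt (infsum (block_sq f) blocks)"
proof -
  have "block_inner f f = (\<lambda>b. complex_of_real (block_sq f b))" by (rule ext) (rule block_inner_self)
  then have "hinner (ell2 blocks) f f = complex_of_real (infsum (block_sq f) blocks)"
    unfolding ell2_inner by (simp add: infsum_complex_of_real)
  then show ?thesis by (simp add: hnorm_def)
qed

lemma ell2_norm_sq: "(hnorm (ell2 blocks) f)\<^sup>2 = infsum (block_sq f) blocks"
  unfolding ell2_norm by (simp add: infsum_nonneg)

lemma ell2_finite_le:
  assumes "f \<in> hcarrier (ell2 blocks)" "finite F" "F \<subseteq> blocks"
  shows "(\<Sum>b\<in>F. block_sq f b) \<le> (hnorm (ell2 blocks) f)\<^sup>2"
  unfolding ell2_norm_sq by (rule finite_sum_le_infsum[OF ell2_block_sq[OF assms(1)] assms(2,3)]) simp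

lemma ell2_coord_le:
  assumes f: "f \<in> hcarrier (ell2 blocks)" and b: "(m, \<psi>) \<in> blocks" and i: "i < m"
  shows "cmod (f (m, \<psi>, i)) \<le> hnorm (ell2 blocks) f"
proof (rule power2_le_imp_le)
  have "(cmod (f (m, \<psi>, i)))\<^sup>2 \<le> block_sq f (m, \<psi>)" unfolding block_sq_def fst_conv snd_conv
    by (rule member_le_sum[where f="\<lambda>i. (cmod (f (m, \<psi>, i)))\<^sup>2"]) (use i in auto)
  also have "\<dots> \<le> (hnorm (ell2 blocks) f)\<^sup>2" using ell2_finite_le[OF f, of "{(m, \<psi>)}"] b by simp
  finally show "(cmod (f (m, \<psi>, i)))\<^sup>2 \<le> (hnorm (ell2 blocks) f)\<^sup>2" .
  show "0 \<le> hnorm (ell2 blocks) f" unfolding ell2_norm by (simp add: infsum_nonneg)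
qed

lemma ell2_leI:
  assumes off: "\<And>m \<psi> i. \<not> ((m, \<psi>) \<in> blocks \<and> i < m) \<Longrightarrow> f (m, \<psi>, i) = 0"
    and c: "\<And>F. finite F \<Longrightarrow> F \<subseteq> blocks \<Longrightarrow> (\<Sum>b\<in>F. block_sq f b) \<le> c\<^sup>2" and c0: "0 \<le> c"
  shows "f \<in> hcarrier (ell2 blocks)" "hnorm (ell2 blocks) f \<le> c"
proof -
  have s: "block_sq f summable_on blocks"
    by (rule nonneg_bdd_above_summable_on) (use c in \<open>auto simp: bdd_above_def\<close>)
  then show "f \<in> hcarrier (ell2 blocks)" using off by (simp add: ell2_carrier)
  have "infsum (block_sq f) blocks \<le> c\<^sup>2" by (rule infsum_le_finite_sums[OF s c])
  then show "hnorm (ell2 blocks) f \<le> c" unfolding ell2_norm using c0 by (rule real_le_lsqrt[rotated]) 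
qed

text \<open>Coordinates converge; the estimate of the distance passes to the limit on finite sets of summands
  and then to the whole sum.\<close>

lemma ell2_complete:
  assumes s: "\<And>k::nat. s k \<in> hcarrier (ell2 blocks)"
    and Cauchy: "\<And>e. e > 0 \<Longrightarrow> \<exists>N. \<forall>k\<ge>N. \<forall>l\<ge>N. hnorm (ell2 blocks) (s k - s l) < e"
  shows "\<exists>f\<in>hcarrier (ell2 blocks). (\<lambda>k. hnorm (ell2 blocks) (s k - f)) \<longlonglongrightarrow> 0"
proof -
  interpret pre_hilb "ell2 blocks" by (rule ell2_pre_hilb)
  define f where "f = (\<lambda>t. lim (\<lambda>k. s k t))"
  have off: "s k (m, \<psi>, i) = 0" if "\<not> ((m, \<psi>) \<in> blocks \<and> i < m)" for k m \<psi> i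
    using s[of k] that by (auto simp: ell2_carrier)
  have lim: "(\<lambda>k. s k (m, \<psi>, i)) \<longlonglongrightarrow> f (m, \<psi>, i)" for m \<psi> i
  proof (cases "(m, \<psi>) \<in> blocks \<and> i < m")
    case True
    have "Cauchy (\<lambda>k. s k (m, \<psi>, i))"
    proof (rule metric_CauchyI)
      fix e :: real assume "e > 0"
      from Cauchy[OF this] obtain N where N: "\<forall>k\<ge>N. \<forall>l\<ge>N. nm (s k - s l) < e" by blast
      have "dist (s k (m, \<psi>, i)) (s l (m, \<psi>, i)) < e" if "k \<ge> N" "l \<ge> N" for k l
      proof -
        have "cmod ((s k - s l) (m, \<psi>, i)) \<le> nm (s k - s l)" using True by (intro ell2_coord_le mem_diff s) auto
        then show ?thesis using N[rule_format, OF that] by (simp add: dist_norm)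
      qed
      then show "\<exists>N. \<forall>k\<ge>N. \<forall>l\<ge>N. dist (s k (m, \<psi>, i)) (s l (m, \<psi>, i)) < e" by blast
    qed
    then show ?thesis unfolding f_def by (simp add: Cauchy_convergent_iff convergent_LIMSEQ_iff)
  next
    case False
    have "f (m, \<psi>, i) = 0" unfolding f_def using off[OF False] by simp
    then show ?thesis using off[OF False] by simp
  qed
  have f0: "f (m, \<psi>, i) = 0" if "\<not> ((m, \<psi>) \<in> blocks \<and> i < m)" for m \<psi> i
    unfolding f_def using off[OF that] by simp
  have key: "s k - f \<in> hcarrier (ell2 blocks) \<and> nm (s k - f) \<le> e"
    if N: "\<forall>k\<ge>N. \<forall>l\<ge>N. nm (s k - s l) < e" and k: "k \<ge> N" and e: "0 < e" for N k e
  proof -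
    have bound: "(\<Sum>b\<in>F. block_sq (s k - f) b) \<le> e\<^sup>2" if F: "finite F" "F \<subseteq> blocks" for F
    proof (rule LIMSEQ_le_const2)
      show "(\<lambda>l. \<Sum>b\<in>F. block_sq (s k - s l) b) \<longlonglongrightarrow> (\<Sum>b\<in>F. block_sq (s k - f) b)"
        unfolding block_sq_def by (intro tendsto_sum tendsto_power tendsto_norm) (simp, intro tendsto_diff tendsto_const lim)
      have "(\<Sum>b\<in>F. block_sq (s k - s l) b) \<le> e\<^sup>2" if "l \<ge> N" for l
      proof -
        have "(\<Sum>b\<in>F. block_sq (s k - s l) b) \<le> (nm (s k - s l))\<^sup>2" by (rule ell2_finite_le[OF mem_diff[OF s s] F])
        also have "\<dots> \<le> e\<^sup>2" using N[rule_format, OF k that] by (intro power_mono nm_ge_0 mem_diff s) auto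
        finally show ?thesis .
      qed
      then show "\<exists>N. \<forall>l\<ge>N. (\<Sum>b\<in>F. block_sq (s k - s l) b) \<le> e\<^sup>2" by blast
    qed
    have "(s k - f) (m, \<psi>, i) = 0" if "\<not> ((m, \<psi>) \<in> blocks \<and> i < m)" for m \<psi> i
      using off[OF that] f0[OF that] by simp
    from ell2_leI[of blocks "s k - f" e, OF this bound] e show ?thesis by simp
  qed
  obtain N1 where N1: "\<forall>k\<ge>N1. \<forall>l\<ge>N1. nm (s k - s l) < 1" using Cauchy[of 1] by auto
  have "s N1 - f \<in> hcarrier (ell2 blocks)" using key[OF N1, of N1] by simp
  then have "s N1 - (s N1 - f) \<in> hcarrier (ell2 blocks)" by (rule mem_diff[OF s])
  moreover have "s N1 - (s N1 - f) = f" by (rule diff_diff_eq2[THEN trans]) simp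
  ultimately have fC: "f \<in> hcarrier (ell2 blocks)" by simp
  have "(\<lambda>k. nm (s k - f)) \<longlonglongrightarrow> 0"
  proof (rule LIMSEQ_I)
    fix r :: real assume r: "0 < r"
    have r2: "0 < r/2" using r by simp
    obtain N where N: "\<forall>k\<ge>N. \<forall>l\<ge>N. nm (s k - s l) < r/2" using Cauchy[OF r2] by blast
    have "norm (nm (s k - f) - 0) < r" if "k \<ge> N" for k
      using key[OF N that r2] nm_ge_0[OF mem_diff[OF s fC], of k] r by simp
    then show "\<exists>N. \<forall>k\<ge>N. norm (nm (s k - f) - 0) < r" by blast
  qed
  then show ?thesis using fC by blast
qed

lemma ell2_definite:
  assumes f: "f \<in> hcarrier (ell2 blocks)" and 0: "hinner (ell2 blocks) f f = 0"
  shows "f = 0"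
proof
  fix t :: "nat \<times> 'a \<times> nat"
  obtain m \<psi> i where t: "t = (m, \<psi>, i)" by (cases t) auto
  have "hnorm (ell2 blocks) f = 0" using 0 by (simp add: hnorm_def)
  then show "f t = 0 t" using ell2_coord_le[OF f, of m \<psi> i] f by (cases "(m, \<psi>) \<in> blocks \<and> i < m") (auto simp: t ell2_carrier)
qed

theorem ell2_hilbert: "hilbert_space (ell2 blocks)"
proof -
  interpret P: pre_hilb "ell2 blocks" by (rule ell2_pre_hilb)
  show ?thesis unfolding hilbert_space_def
  proof (intro conjI ballI allI impI)
    fix s :: "nat \<Rightarrow> nat \<times> 'a \<times> nat \<Rightarrow> complex"
    assume a: "(\<forall>k. s k \<in> P.CH) \<and> (\<forall>e>0. \<exists>N. \<forall>k\<ge>N. \<forall>l\<ge>N. P.nm (s k - s l) < e)"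
    show "\<exists>x\<in>P.CH. (\<lambda>k. P.nm (s k - x)) \<longlonglongrightarrow> 0"
      by (rule ell2_complete) (rule a[THEN conjunct1, rule_format], rule a[THEN conjunct2, rule_format])
  next
    show "P.ip y x = cnj (P.ip x y)" if "x \<in> P.CH" "y \<in> P.CH" for x y by (rule P.herm[OF that])
    show "complex_vec.subspace P.CH" by (rule P.subsp)
    show "linear_on P.CH (\<lambda>x. P.ip x y)" if "y \<in> P.CH" for y by (rule P.linl[OF that])
    show "P.ip x x \<in> \<real>\<^sub>\<ge>\<^sub>0" if "x \<in> P.CH" for x by (rule P.pos[OF that])
    show "x = 0" if "x \<in> P.CH" "P.ip x x = 0" for x by (rule ell2_definite[OF that])
  qed
qed

definition delta :: "'i \<Rightarrow> 'i \<Rightarrow> complex" where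
  "delta t s = (if s = t then 1 else 0)"

lemma delta_eq_iff: "delta t = delta s \<longleftrightarrow> t = s"
proof
  assume "delta t = delta s"
  then have "delta t t = delta s t" by (rule fun_cong)
  then show "t = s" by (simp add: delta_def split: if_splits)
qed simp

lemma delta_mem:
  assumes b: "(m, \<psi>) \<in> blocks" and i: "i < m"
  shows "delta (m, \<psi>, i) \<in> hcarrier (ell2 blocks)"
proof (rule ell2_leI(1))
  have bs: "block_sq (delta (m, \<psi>, i)) b' = (if b' = (m, \<psi>) then 1 else 0)" for b'
  proof -
    have "block_sq (delta (m, \<psi>, i)) b' = (\<Sum>j<fst b'. if j = i then (if b' = (m, \<psi>) then 1 else 0) else 0)"
      unfolding block_sq_def by (intro sum.cong) (auto simp: delta_def prod_eq_iff)
    then show ?thesis using i by auto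
  qed
  show "(\<Sum>b\<in>F. block_sq (delta (m, \<psi>, i)) b) \<le> 1\<^sup>2" if "finite F" "F \<subseteq> blocks" for F
    using that by (simp add: bs)
qed (use assms in \<open>auto simp: delta_def\<close>)

lemma inner_delta:
  assumes b: "(m, \<psi>) \<in> blocks" and i: "i < m"
  shows "hinner (ell2 blocks) f (delta (m, \<psi>, i)) = f (m, \<psi>, i)"
proof -
  have bs: "block_inner f (delta (m, \<psi>, i)) b' = (if b' = (m, \<psi>) then f (m, \<psi>, i) else 0)" for b'
  proof -
    have "block_inner f (delta (m, \<psi>, i)) b' = (\<Sum>j<fst b'. if j = i then (if b' = (m, \<psi>) then f (m, \<psi>, i) else 0) else 0)"
      unfolding block_inner_def by (intro sum.cong) (auto simp: delta_def prod_eq_iff)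
    then show ?thesis using i by auto
  qed
  have "infsum (block_inner f (delta (m, \<psi>, i))) blocks = infsum (block_inner f (delta (m, \<psi>, i))) {(m, \<psi>)}"
    by (rule infsum_cong_neutral) (use b in \<open>auto simp: bs\<close>)
  then show ?thesis by (simp add: ell2_inner bs)
qed

definition ell2_index :: "(nat \<times> 'p) set \<Rightarrow> (nat \<times> 'p \<times> nat) set" where
  "ell2_index blocks = {(m, \<psi>, i). (m, \<psi>) \<in> blocks \<and> i < m}"

lemma ell2_onb: "orthonormal_basis (ell2 blocks) (delta ` ell2_index blocks)"
  unfolding orthonormal_basis_def
proof (intro conjI ballI impI)
  show "delta ` ell2_index blocks \<subseteq> hcarrier (ell2 blocks)"
  proof (rule image_subsetI)
    fix t assume "t \<in> ell2_index blocks"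
    then show "delta t \<in> hcarrier (ell2 blocks)" by (cases t) (simp add: ell2_index_def delta_mem)
  qed
  fix e f assume "e \<in> delta ` ell2_index blocks" and "f \<in> delta ` ell2_index blocks"
  then obtain t s where e: "e = delta t" and f: "f = delta s" and s: "s \<in> ell2_index blocks" by (elim imageE)
  obtain m \<psi> i where s': "s = (m, \<psi>, i)" by (cases s) auto
  have "e = f \<longleftrightarrow> t = s" unfolding e f by (rule delta_eq_iff)
  moreover have "hinner (ell2 blocks) e f = e s"
    using inner_delta[of m \<psi> blocks i e] s unfolding f s' by (simp add: ell2_index_def)
  ultimately show "hinner (ell2 blocks) e f = (if e = f then 1 else 0)" by (auto simp: e delta_def)
next
  fix f assume f: "f \<in> hcarrier (ell2 blocks)" and 0: "\<forall>e\<in>delta ` ell2_index blocks. hinner (ell2 blocks) f e = 0"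
  show "f = 0"
  proof
    fix t :: "nat \<times> 'a \<times> nat"
    obtain m \<psi> i where t: "t = (m, \<psi>, i)" by (cases t) auto
    show "f t = 0 t"
    proof (cases "t \<in> ell2_index blocks")
      case True
      then have "hinner (ell2 blocks) f (delta t) = 0" using 0 by blast
      then show ?thesis using inner_delta[of m \<psi> blocks i f] True by (simp add: t ell2_index_def)
    next
      case False
      then show ?thesis using f by (simp add: t ell2_carrier ell2_index_def)
    qed
  qed
qed

section \<open>The universal normal representation\<close>

lemma has_sum_sum_lessThan:
  fixes f :: "nat \<Rightarrow> 'b \<Rightarrow> 'c::topological_comm_monoid_add"
  assumes "\<And>p. p < (n::nat) \<Longrightarrow> (f p has_sum s p) A"
  shows "((\<lambda>b. \<Sum>p<n. f p b) has_sum (\<Sum>p<n. s p)) A"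
  using assms by (induction n) (auto intro!: has_sum_add)

context dual_system
begin

definition blocks :: "(nat \<times> (('h \<Rightarrow> 'h) \<Rightarrow> nat \<Rightarrow> nat \<Rightarrow> complex)) set" where
  "blocks = {(m, \<psi>). block m \<psi>}"

definition K :: "'h target hilb" where
  "K = ell2 blocks"

text \<open>The direct sum of all blocks: on the summand that belongs to \<open>(m, \<psi>)\<close> the operator is the matrix
  \<open>\<psi> x\<close>.\<close>

definition Phi :: "('h \<Rightarrow> 'h) \<Rightarrow> 'h target \<Rightarrow> 'h target" where
  "Phi x f = (\<lambda>(m, \<psi>, i). if f \<in> hcarrier K \<and> (m, \<psi>) \<in> blocks \<and> i < m then \<Sum>j<m. \<psi> x i j * f (m, \<psi>, j) else 0)"

end

sublocale dual_system \<subseteq> K: hilb K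
  unfolding K_def by (rule hilbert_hilb[OF ell2_hilbert])

context dual_system
begin

lemma K_carrier: "f \<in> hcarrier K \<longleftrightarrow> (\<forall>m \<psi> i. \<not> ((m, \<psi>) \<in> blocks \<and> i < m) \<longrightarrow> f (m, \<psi>, i) = 0) \<and> block_sq f summable_on blocks"
  by (simp add: K_def ell2_carrier)

lemma K_inner: "hinner K f g = infsum (block_inner f g) blocks"
  by (simp add: K_def ell2_inner)

lemma block_normal: "(m, \<psi>) \<in> blocks \<Longrightarrow> i < m \<Longrightarrow> j < m \<Longrightarrow> \<exists>v\<in>V. \<forall>x\<in>X. \<psi> x i j = J x v"
  by (simp add: blocks_def block_def)

lemma block_unital: "(m, \<psi>) \<in> blocks \<Longrightarrow> i < m \<Longrightarrow> j < m \<Longrightarrow> \<psi> (id_op H) i j = (if i = j then 1 else 0)"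
  by (simp add: blocks_def block_def)

lemma block_contractive: "(m, \<psi>) \<in> blocks \<Longrightarrow> x \<in> mats k X \<Longrightarrow>
  cmod (\<Sum>p<k. \<Sum>q<k. \<Sum>i<m. \<Sum>j<m. \<psi> (x p q) i j * a q j * cnj (b p i)) \<le> mat_norm H k x * sqrt (sum_sq k m a) * sqrt (sum_sq k m b)"
  by (simp add: blocks_def block_def)

lemma block_add: "(m, \<psi>) \<in> blocks \<Longrightarrow> i < m \<Longrightarrow> j < m \<Longrightarrow> x \<in> X \<Longrightarrow> y \<in> X \<Longrightarrow> \<psi> (x + y) i j = \<psi> x i j + \<psi> y i j"
  using block_normal[of m \<psi> i j] complex_vec.subspace_add[OF Xs, of x y] J_add[of x y] by metis

lemma block_scale: "(m, \<psi>) \<in> blocks \<Longrightarrow> i < m \<Longrightarrow> j < m \<Longrightarrow> x \<in> X \<Longrightarrow> \<psi> (c *\<^sub>C x) i j = c * \<psi> x i j"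
  using block_normal[of m \<psi> i j] complex_vec.subspace_scale[OF Xs, of x c] J_scale[of x c] by metis

lemma Phi_coord: "f \<in> hcarrier K \<Longrightarrow> (m, \<psi>) \<in> blocks \<Longrightarrow> i < m \<Longrightarrow> Phi x f (m, \<psi>, i) = (\<Sum>j<m. \<psi> x i j * f (m, \<psi>, j))"
  by (simp add: Phi_def)

lemma Phi_off: "\<not> ((m, \<psi>) \<in> blocks \<and> i < m) \<Longrightarrow> Phi x f (m, \<psi>, i) = 0"
  by (auto simp: Phi_def)

lemma block_inner_Phi: "f \<in> hcarrier K \<Longrightarrow> (m, \<psi>) \<in> blocks \<Longrightarrow>
  block_inner (Phi x f) g (m, \<psi>) = (\<Sum>i<m. \<Sum>j<m. \<psi> x i j * f (m, \<psi>, j) * cnj (g (m, \<psi>, i)))"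
  by (simp add: block_inner_def Phi_coord sum_distrib_right)

lemma block_inner_Phi_bound:
  assumes x: "x \<in> mats n X" and F: "vec K n F" and b: "b \<in> blocks"
  shows "cmod (\<Sum>p<n. \<Sum>q<n. block_inner (Phi (x p q) (F q)) (G p) b) \<le> mat_norm H n x * sqrt (\<Sum>q<n. block_sq (F q) b) * sqrt (\<Sum>p<n. block_sq (G p) b)"
proof -
  obtain m \<psi> where b': "b = (m, \<psi>)" by (cases b) auto
  have "(\<Sum>p<n. \<Sum>q<n. block_inner (Phi (x p q) (F q)) (G p) b)
    = (\<Sum>p<n. \<Sum>q<n. \<Sum>i<m. \<Sum>j<m. \<psi> (x p q) i j * F q (m, \<psi>, j) * cnj (G p (m, \<psi>, i)))"
    using block_inner_Phi[OF vecD[OF F]] b by (intro sum.cong refl) (simp add: b')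
  then show ?thesis using block_contractive[of m \<psi> x n "\<lambda>q j. F q (m, \<psi>, j)" "\<lambda>p i. G p (m, \<psi>, i)"] b x
    by (simp add: b' sum_sq_def block_sq_def)
qed

text \<open>Apply complete contractivity of the block to the vector and its image.\<close>

lemma block_sq_Phi_le:
  assumes x: "x \<in> X" and f: "f \<in> hcarrier K" and b: "b \<in> blocks"
  shows "block_sq (Phi x f) b \<le> (op_norm H x)\<^sup>2 * block_sq f b"
proof -
  have xb: "x \<in> bounded_ops H" using x Xb by auto
  have m: "(\<lambda>_ _. x) \<in> mats 1 X" using x by (simp add: mats_def)
  have v: "vec K 1 (\<lambda>_. f)" using f by (simp add: vec_def)
  define A B where "A = sqrt (block_sq f b)" and "B = sqrt (block_sq (Phi x f) b)"
  have AB: "0 \<le> A" "0 \<le> B" "A\<^sup>2 = block_sq f b" "B\<^sup>2 = block_sq (Phi x f) b" by (auto simp: A_def B_def)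
  have "cmod (block_inner (Phi x f) (Phi x f) b) \<le> op_norm H x * A * B"
    using block_inner_Phi_bound[OF m v b, of "\<lambda>_. Phi x f"] H.mat_norm_1[OF xb] by (simp add: A_def B_def)
  then have "B\<^sup>2 \<le> op_norm H x * A * B" unfolding block_inner_self AB(4) by simp
  then have "B \<le> op_norm H x * A"
    using AB H.op_norm_ge_0[OF xb] by (cases "B = 0") (auto simp: power2_eq_square)
  then have "B\<^sup>2 \<le> (op_norm H x * A)\<^sup>2" using AB by (intro power_mono)
  then show ?thesis by (simp only: power_mult_distrib AB)
qed

lemma Phi_carrier:
  assumes x: "x \<in> X" and f: "f \<in> hcarrier K"
  shows "Phi x f \<in> hcarrier K" "hnorm K (Phi x f) \<le> op_norm H x * hnorm K f"
proof -
  have x0: "0 \<le> op_norm H x" using H.op_norm_ge_0 x Xb by auto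
  have "(\<Sum>b\<in>F. block_sq (Phi x f) b) \<le> (op_norm H x * hnorm K f)\<^sup>2" if F: "finite F" "F \<subseteq> blocks" for F
  proof -
    have "(\<Sum>b\<in>F. block_sq (Phi x f) b) \<le> (\<Sum>b\<in>F. (op_norm H x)\<^sup>2 * block_sq f b)"
      using F by (intro sum_mono block_sq_Phi_le[OF x f]) auto
    also have "\<dots> \<le> (op_norm H x)\<^sup>2 * (hnorm K f)\<^sup>2"
      using ell2_finite_le[OF f[unfolded K_def] F] unfolding sum_distrib_left[symmetric] K_def by (intro mult_left_mono) auto
    finally show ?thesis by (simp add: power_mult_distrib)
  qed
  from ell2_leI[OF Phi_off this] x0 K.nm_ge_0[OF f]
  show "Phi x f \<in> hcarrier K" "hnorm K (Phi x f) \<le> op_norm H x * hnorm K f" by (auto simp: K_def)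
qed

lemma Phi_bop:
  assumes x: "x \<in> X"
  shows "Phi x \<in> bounded_ops K"
proof -
  have "linear_on (hcarrier K) (Phi x)" unfolding linear_on_def
  proof (intro conjI ballI allI)
    fix f g c assume f: "f \<in> hcarrier K"
    show "Phi x (f + g) = Phi x f + Phi x g" if g: "g \<in> hcarrier K"
    proof
      fix t :: "nat \<times> (('h \<Rightarrow> 'h) \<Rightarrow> nat \<Rightarrow> nat \<Rightarrow> complex) \<times> nat"
      obtain m \<psi> i where t: "t = (m, \<psi>, i)" by (cases t) auto
      show "Phi x (f + g) t = (Phi x f + Phi x g) t"
        using f g K.mem_add[OF f g] by (simp add: t Phi_def algebra_simps sum.distrib)
    qed
    show "Phi x (c *\<^sub>C f) = c *\<^sub>C Phi x f"
    proof
      fix t :: "nat \<times> (('h \<Rightarrow> 'h) \<Rightarrow> nat \<Rightarrow> nat \<Rightarrow> complex) \<times> nat"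
      obtain m \<psi> i where t: "t = (m, \<psi>, i)" by (cases t) auto
      show "Phi x (c *\<^sub>C f) t = (c *\<^sub>C Phi x f) t"
        using f K.mem_scale[OF f, of c] by (simp add: t Phi_def scaleC_fun_apply scaleC_complex_def sum_distrib_left mult_ac)
    qed
  qed
  moreover have "Phi x f = 0" if "f \<notin> hcarrier K" for f using that by (auto simp: Phi_def fun_eq_iff)
  ultimately show ?thesis using Phi_carrier[OF x] unfolding bounded_ops_def by blast
qed

lemma Phi_linear: "linear_on X Phi"
  unfolding linear_on_def
proof (intro conjI ballI allI)
  fix x y c assume x: "x \<in> X"
  show "Phi (x + y) = Phi x + Phi y" if y: "y \<in> X"
  proof (intro ext)
    fix f and t :: "nat \<times> (('h \<Rightarrow> 'h) \<Rightarrow> nat \<Rightarrow> nat \<Rightarrow> complex) \<times> nat"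
    obtain m \<psi> i where t: "t = (m, \<psi>, i)" by (cases t) auto
    show "Phi (x + y) f t = (Phi x + Phi y) f t"
    proof (cases "f \<in> hcarrier K \<and> (m, \<psi>) \<in> blocks \<and> i < m")
      case True
      have "(\<Sum>j<m. \<psi> (x + y) i j * f (m, \<psi>, j)) = (\<Sum>j<m. \<psi> x i j * f (m, \<psi>, j) + \<psi> y i j * f (m, \<psi>, j))"
      proof (intro sum.cong refl)
        fix j assume "j \<in> {..<m}"
        then have "\<psi> (x + y) i j = \<psi> x i j + \<psi> y i j" using True by (intro block_add x y) auto
        then show "\<psi> (x + y) i j * f (m, \<psi>, j) = \<psi> x i j * f (m, \<psi>, j) + \<psi> y i j * f (m, \<psi>, j)"
          unfolding distrib_right[symmetric] by (rule arg_cong)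
      qed
      then show ?thesis unfolding t plus_fun_apply using True by (simp only: Phi_coord sum.distrib)
    next
      case False
      then show ?thesis unfolding t plus_fun_apply Phi_def by auto
    qed
  qed
  show "Phi (c *\<^sub>C x) = c *\<^sub>C Phi x"
  proof (intro ext)
    fix f and t :: "nat \<times> (('h \<Rightarrow> 'h) \<Rightarrow> nat \<Rightarrow> nat \<Rightarrow> complex) \<times> nat"
    obtain m \<psi> i where t: "t = (m, \<psi>, i)" by (cases t) auto
    show "Phi (c *\<^sub>C x) f t = (c *\<^sub>C Phi x) f t"
    proof (cases "f \<in> hcarrier K \<and> (m, \<psi>) \<in> blocks \<and> i < m")
      case True
      have "(\<Sum>j<m. \<psi> (c *\<^sub>C x) i j * f (m, \<psi>, j)) = (\<Sum>j<m. c * (\<psi> x i j * f (m, \<psi>, j)))"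
      proof (intro sum.cong refl)
        fix j assume "j \<in> {..<m}"
        then have "\<psi> (c *\<^sub>C x) i j = c * \<psi> x i j" using True by (intro block_scale x) auto
        then show "\<psi> (c *\<^sub>C x) i j * f (m, \<psi>, j) = c * (\<psi> x i j * f (m, \<psi>, j))"
          unfolding mult.assoc[symmetric] by (rule arg_cong)
      qed
      then show ?thesis unfolding t scaleC_fun_apply scaleC_complex_def using True
        by (simp only: Phi_coord sum_distrib_left)
    next
      case False
      then show ?thesis unfolding t scaleC_fun_apply scaleC_complex_def Phi_def by auto
    qed
  qed
qed

lemma Phi_unital: "Phi (id_op H) = id_op K"
proof (intro ext)
  fix f and t :: "nat \<times> (('h \<Rightarrow> 'h) \<Rightarrow> nat \<Rightarrow> nat \<Rightarrow> complex) \<times> nat"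
  obtain m \<psi> i where t: "t = (m, \<psi>, i)" by (cases t) auto
  show "Phi (id_op H) f t = id_op K f t"
  proof (cases "f \<in> hcarrier K \<and> (m, \<psi>) \<in> blocks \<and> i < m")
    case True
    have "(\<Sum>j<m. \<psi> (id_op H) i j * f (m, \<psi>, j)) = (\<Sum>j<m. if j = i then f (m, \<psi>, i) else 0)"
      using True by (intro sum.cong) (auto simp: block_unital)
    then show ?thesis using True by (simp add: t Phi_coord id_op_def)
  next
    case False
    then show ?thesis by (auto simp: t Phi_def id_op_def K_carrier)
  qed
qed

lemma Phi_mats: "x \<in> mats n X \<Longrightarrow> (\<lambda>i j. Phi (x i j)) \<in> mats n (bounded_ops K)"
  using Phi_bop by (simp add: mats_def)

lemma K_norm_sq: "(hnorm K f)\<^sup>2 = infsum (block_sq f) blocks"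
  unfolding K_def by (rule ell2_norm_sq)

lemma K_block_sq: "f \<in> hcarrier K \<Longrightarrow> block_sq f summable_on blocks"
  by (simp add: K_carrier)

lemma vec_block_sq:
  assumes F: "vec K n F"
  shows "((\<lambda>b. \<Sum>q<n. block_sq (F q) b) has_sum (vnorm K n F)\<^sup>2) blocks"
  unfolding vnorm_sq K_norm_sq by (rule has_sum_sum_lessThan) (rule has_sum_infsum[OF K_block_sq[OF vecD[OF F]]])

lemma mat_norm_Phi_le:
  assumes x: "x \<in> mats n X"
  shows "mat_norm K n (\<lambda>i j. Phi (x i j)) \<le> mat_norm H n x"
proof (rule K.mat_norm_leI[OF Phi_mats[OF x] H.mat_norm_ge_0[OF matsX[OF x]]])
  fix F G assume F: "vec K n F" and G: "vec K n G"
  let ?T = "\<lambda>b. \<Sum>p<n. \<Sum>q<n. block_inner (Phi (x p q) (F q)) (G p) b"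
  have "(?T has_sum mform K n (\<lambda>i j. Phi (x i j)) F G) blocks"
    unfolding mform_def K_inner
  proof (intro has_sum_sum_lessThan has_sum_infsum)
    fix p q assume pq: "p < n" "q < n"
    show "block_inner (Phi (x p q) (F q)) (G p) summable_on blocks"
      using Phi_carrier(1)[OF matsD[OF x pq] vecD[OF F pq(2)]] vecD[OF G pq(1)] unfolding K_def by (rule block_inner_summable)
  qed
  then have e: "mform K n (\<lambda>i j. Phi (x i j)) F G = infsum ?T blocks" by (simp add: infsumI)
  have "cmod (infsum ?T blocks) \<le> mat_norm H n x * sqrt (infsum (\<lambda>b. \<Sum>q<n. block_sq (F q) b) blocks) * sqrt (infsum (\<lambda>b. \<Sum>p<n. block_sq (G p) b) blocks)"
    by (rule infsum_Cauchy_Schwarz(2)[OF has_sum_imp_summable[OF vec_block_sq[OF F]] _ has_sum_imp_summable[OF vec_block_sq[OF G]] _ H.mat_norm_ge_0[OF matsX[OF x]] block_inner_Phi_bound[OF x F]])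
      (auto intro!: sum_nonneg)
  then show "cmod (mform K n (\<lambda>i j. Phi (x i j)) F G) \<le> mat_norm H n x * vnorm K n F * vnorm K n G"
    unfolding e infsumI[OF vec_block_sq[OF F]] infsumI[OF vec_block_sq[OF G]] by simp
qed

text \<open>The vector \<open>c\<close> of \<open>\<complex>\<^sup>m\<close>, placed in the summand \<open>(m, \<psi>)\<close>.\<close>

definition block_vector :: "nat \<Rightarrow> (('h \<Rightarrow> 'h) \<Rightarrow> nat \<Rightarrow> nat \<Rightarrow> complex) \<Rightarrow> (nat \<Rightarrow> complex) \<Rightarrow> 'h target" where
  "block_vector m \<psi> c = (\<lambda>(m', \<psi>', i). if m' = m \<and> \<psi>' = \<psi> \<and> i < m then c i else 0)"

lemma block_sq_block_vector: "block_sq (block_vector m \<psi> c) b = (if b = (m, \<psi>) then \<Sum>i<m. (cmod (c i))\<^sup>2 else 0)"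
  by (cases b) (auto simp: block_sq_def block_vector_def intro!: sum.neutral)

lemma block_vector_mem:
  assumes b: "(m, \<psi>) \<in> blocks"
  shows "block_vector m \<psi> c \<in> hcarrier K" "(hnorm K (block_vector m \<psi> c))\<^sup>2 = (\<Sum>i<m. (cmod (c i))\<^sup>2)"
proof -
  have "infsum (block_sq (block_vector m \<psi> c)) blocks = infsum (block_sq (block_vector m \<psi> c)) {(m, \<psi>)}" 
    by (rule infsum_cong_neutral) (use b in \<open>auto simp: block_sq_block_vector\<close>)
  then show "(hnorm K (block_vector m \<psi> c))\<^sup>2 = (\<Sum>i<m. (cmod (c i))\<^sup>2)" by (simp add: K_norm_sq block_sq_block_vector)
  have "block_sq (block_vector m \<psi> c) summable_on blocks \<longleftrightarrow> block_sq (block_vector m \<psi> c) summable_on {(m, \<psi>)}"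
    by (rule summable_on_cong_neutral) (use b in \<open>auto simp: block_sq_block_vector\<close>)
  then have "block_sq (block_vector m \<psi> c) summable_on blocks" by simp
  then show "block_vector m \<psi> c \<in> hcarrier K" using b by (auto simp: K_carrier block_vector_def)
qed

lemma inner_Phi_block_vector:
  assumes b: "(m, \<psi>) \<in> blocks"
  shows "hinner K (Phi x (block_vector m \<psi> c)) (block_vector m \<psi> d) = (\<Sum>k<m. \<Sum>l<m. \<psi> x k l * c l * cnj (d k))"
proof -
  have z: "block_inner (Phi x (block_vector m \<psi> c)) (block_vector m \<psi> d) b' = 0" if "b' \<noteq> (m, \<psi>)" for b'
    unfolding block_inner_def by (rule sum.neutral) (use that in \<open>auto simp: block_vector_def prod_eq_iff\<close>)
  have "hinner K (Phi x (block_vector m \<psi> c)) (block_vector m \<psi> d) = infsum (block_inner (Phi x (block_vector m \<psi> c)) (block_vector m \<psi> d)) {(m, \<psi>)}"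
    unfolding K_inner by (rule infsum_cong_neutral) (use b z in auto)
  also have "\<dots> = block_inner (Phi x (block_vector m \<psi> c)) (block_vector m \<psi> d) (m, \<psi>)" by simp
  also have "\<dots> = (\<Sum>k<m. \<Sum>l<m. \<psi> x k l * c l * cnj (d k))"
    unfolding block_inner_Phi[OF block_vector_mem(1)[OF b] b] by (intro sum.cong refl) (simp add: block_vector_def)
  finally show ?thesis .
qed

text \<open>Every normal state of a matrix level is a vector functional of the representation, since its
  finite-dimensional representation is one of the summands.\<close>

lemma state_vectors:
  assumes w: "nstate n w" and unit: "vec H n \<zeta>0" "vnorm H n \<zeta>0 = 1"
  shows "\<exists>\<xi>. vec K n \<xi> \<and> vnorm K n \<xi> \<le> 1 \<and> (\<forall>y\<in>mats n X. pairing n y w = mform K n (\<lambda>i j. Phi (y i j)) \<xi> \<xi>)"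
proof -
  obtain m \<psi> c where b: "block m \<psi>" and c: "sum_sq n m c \<le> 1"
    and r: "\<forall>y\<in>mats n X. pairing n y w = (\<Sum>i<n. \<Sum>j<n. \<Sum>k<m. \<Sum>l<m. \<psi> (y i j) k l * c j l * cnj (c i k))"
    using state_representation[OF w unit] by (elim exE conjE)
  have b': "(m, \<psi>) \<in> blocks" using b by (simp add: blocks_def)
  let ?\<xi> = "\<lambda>j. block_vector m \<psi> (c j)"
  have "vec K n ?\<xi>" using block_vector_mem(1)[OF b'] by (simp add: vec_def)
  moreover have "(vnorm K n ?\<xi>)\<^sup>2 \<le> 1" using c unfolding vnorm_sq block_vector_mem(2)[OF b'] sum_sq_def .
  then have "vnorm K n ?\<xi> \<le> 1" by (simp add: power_le_one_iff)
  moreover have "\<forall>y\<in>mats n X. pairing n y w = mform K n (\<lambda>i j. Phi (y i j)) ?\<xi> ?\<xi>"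
    unfolding mform_def inner_Phi_block_vector[OF b'] by (rule r)
  ultimately show ?thesis by blast
qed

text \<open>A state that almost attains the numerical maximum of the corner matrix of \<open>x\<close> is a vector
  functional, and its value there is a form of \<open>Phi x\<close> at two vectors whose squared norms add up to
  at most \<open>1\<close>.\<close>

lemma mat_norm_le_Phi:
  assumes x: "x \<in> mats n X"
  shows "mat_norm H n x \<le> mat_norm K n (\<lambda>i j. Phi (x i j))"
proof (cases "\<exists>\<zeta>. vec H n \<zeta> \<and> vnorm H n \<zeta> \<noteq> 0")
  case False
  have "mat_norm H n x \<le> 0"
    by (rule H.mat_norm_leI[OF matsX[OF x]]) (use False H.mat_norm_bound[OF matsX[OF x]] in fastforce)+
  then show ?thesis using K.mat_norm_ge_0[OF Phi_mats[OF x]] by linarith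
next
  case True
  then obtain \<zeta> where "vec H n \<zeta>" "vnorm H n \<zeta> \<noteq> 0" by blast
  from H.unit_vec_obtain[OF this] obtain \<eta> where e: "vec H n \<eta>" "vnorm H n \<eta> = 1" by blast
  define \<zeta>0 where "\<zeta>0 = (\<lambda>i. if i < n then \<eta> i else 0)"
  have u1: "vec H (n + n) \<zeta>0" using e by (auto simp: vec_def \<zeta>0_def)
  have "(vnorm H (n + n) \<zeta>0)\<^sup>2 = (vnorm H n \<eta>)\<^sup>2"
    unfolding H.vnorm_concat by (simp add: vnorm_sq \<zeta>0_def)
  then have u2: "vnorm H (n + n) \<zeta>0 = 1" using e(2) vnorm_ge_0[of H "n + n" \<zeta>0] by (simp add: power2_eq_1_iff)
  let ?y = "corner n x" and ?P = "\<lambda>i j. Phi (x i j)"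
  have y: "?y \<in> mats (n + n) X" by (rule corner_mats[OF Xs x])
  show ?thesis
  proof (rule field_le_epsilon)
    fix r :: real assume r: "0 < r"
    obtain w where w: "nstate (n + n) w" "numerical_max H (n + n) ?y - r \<le> Re (pairing (n + n) ?y w)"
      using state_attains[OF y r u1 u2] by blast
    obtain \<xi> where \<xi>: "vec K (n + n) \<xi>" "vnorm K (n + n) \<xi> \<le> 1"
      and rep: "\<forall>y\<in>mats (n + n) X. pairing (n + n) y w = mform K (n + n) (\<lambda>i j. Phi (y i j)) \<xi> \<xi>"
      using state_vectors[OF w(1) u1 u2] by blast
    have "Phi (?y i j) = corner n ?P i j" if "i < n + n" "j < n + n" for i j
      using that linear_on_zero[OF Phi_linear Xs] linear_onD(2)[OF Phi_linear matsD[OF x]]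
      by (auto simp: corner_def)
    then have "mform K (n + n) (\<lambda>i j. Phi (?y i j)) \<xi> \<xi> = mform K (n + n) (corner n ?P) \<xi> \<xi>"
      unfolding mform_def by (intro sum.cong refl) auto
    also have "\<dots> = 2 * mform K n ?P (\<lambda>j. \<xi> (n + j)) \<xi>" by (rule K.mform_corner[OF Phi_mats[OF x] \<xi>(1)])
    finally have "pairing (n + n) ?y w = 2 * mform K n ?P (\<lambda>j. \<xi> (n + j)) \<xi>" using rep y by simp
    then have "Re (pairing (n + n) ?y w) \<le> 2 * cmod (mform K n ?P (\<lambda>j. \<xi> (n + j)) \<xi>)"
      using complex_Re_le_cmod[of "mform K n ?P (\<lambda>j. \<xi> (n + j)) \<xi>"] by simp
    also have "\<dots> \<le> mat_norm K n ?P"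
    proof -
      let ?M = "mat_norm K n ?P" and ?a = "vnorm K n (\<lambda>j. \<xi> (n + j))" and ?b = "vnorm K n \<xi>"
      have M: "0 \<le> ?M" by (rule K.mat_norm_ge_0[OF Phi_mats[OF x]])
      have v: "vec K n (\<lambda>j. \<xi> (n + j))" "vec K n \<xi>" using \<xi>(1) by (auto simp: vec_def)
      have "cmod (mform K n ?P (\<lambda>j. \<xi> (n + j)) \<xi>) \<le> ?M * ?a * ?b" by (rule K.mat_norm_bound[OF Phi_mats[OF x] v])
      then have "2 * cmod (mform K n ?P (\<lambda>j. \<xi> (n + j)) \<xi>) \<le> ?M * (2 * ?a * ?b)" by simp
      also have "\<dots> \<le> ?M * (?a\<^sup>2 + ?b\<^sup>2)" by (rule mult_left_mono[OF sum_squares_bound M])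
      also have "?a\<^sup>2 + ?b\<^sup>2 = (vnorm K (n + n) \<xi>)\<^sup>2" unfolding K.vnorm_concat by simp
      also have "?M * \<dots> \<le> ?M * 1" using \<xi>(2) M by (intro mult_left_mono) (auto simp: power_le_one)
      finally show ?thesis by simp
    qed
    finally show "mat_norm H n x \<le> mat_norm K n ?P + r"
      using w(2) H.norm_le_numerical_max_corner[OF matsX[OF x] u1 u2] by linarith
  qed
qed

lemma Phi_ci: "completely_isometric H X K Phi"
  unfolding completely_isometric_def using Phi_linear mat_norm_Phi_le mat_norm_le_Phi by (auto intro: antisym)

end

sublocale dual_system \<subseteq> U: unital_cisom H K X Phi
  by unfold_locales (fact Xb Xs Xid Phi_bop Phi_ci Phi_unital)+

section \<open>Weak* topologies\<close>

lemma topspace_initial_topology: "F \<noteq> {} \<Longrightarrow> topspace (initial_topology A F) = A"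
  unfolding initial_topology_def topology_generated_by_topspace by auto

lemma openin_initial_topology: "f \<in> F \<Longrightarrow> open U \<Longrightarrow> openin (initial_topology A F) {x \<in> A. f x \<in> U}"
  unfolding initial_topology_def by (rule topology_generated_by_Basis) blast

lemma continuous_map_initial_topology:
  assumes F: "F \<noteq> {}" and h: "\<And>x. x \<in> topspace T \<Longrightarrow> h x \<in> A"
    and *: "\<And>f U. f \<in> F \<Longrightarrow> open U \<Longrightarrow> openin T {x \<in> topspace T. f (h x) \<in> U}"
  shows "continuous_map T (initial_topology A F) h"
  unfolding initial_topology_def
proof (rule continuous_on_generated_topo)
  fix W assume "W \<in> {{x \<in> A. f x \<in> U} | f U. f \<in> F \<and> open U}"
  then obtain f U where W: "W = {x \<in> A. f x \<in> U}" "f \<in> F" "open U" by blast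
  have "h -` W \<inter> topspace T = {x \<in> topspace T. f (h x) \<in> U}" using h by (auto simp: W)
  then show "openin T (h -` W \<inter> topspace T)" using *[OF W(2,3)] by simp
next
  have "\<Union> {{x \<in> A. f x \<in> U} | f U. f \<in> F \<and> open U} = A"
    using topspace_initial_topology[OF F, of A] unfolding initial_topology_def topology_generated_by_topspace .
  then show "h ` topspace T \<subseteq> \<Union> {{x \<in> A. f x \<in> U} | f U. f \<in> F \<and> open U}" using h by auto
qed

context dual_system
begin

definition normal_functional :: "(('h \<Rightarrow> 'h) \<Rightarrow> complex) \<Rightarrow> bool" where
  "normal_functional \<phi> \<longleftrightarrow> (\<exists>v\<in>V. \<forall>x\<in>X. \<phi> x = J x v)"

lemma normal_functional_zero: "normal_functional (\<lambda>_. 0)"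
  unfolding normal_functional_def using complex_vec.subspace_0[OF Vs] J_v_zero by force

lemma normal_functional_add: "normal_functional \<phi> \<Longrightarrow> normal_functional \<kappa> \<Longrightarrow> normal_functional (\<lambda>x. \<phi> x + \<kappa> x)"
  unfolding normal_functional_def using complex_vec.subspace_add[OF Vs] J_v_add by metis

lemma normal_functional_scale: "normal_functional \<phi> \<Longrightarrow> normal_functional (\<lambda>x. \<phi> x * c)"
  unfolding normal_functional_def using complex_vec.subspace_scale[OF Vs] J_v_scale by (metis mult.commute)

lemma normal_functional_sum: "(\<And>i. i \<in> I \<Longrightarrow> normal_functional (\<phi> i)) \<Longrightarrow> normal_functional (\<lambda>x. \<Sum>i\<in>I. \<phi> i x)"
  by (induction I rule: infinite_finite_induct) (auto simp: normal_functional_zero intro!: normal_functional_add)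

text \<open>Approximating elements of \<open>V\<close> are Cauchy, as the operator norm of \<open>V\<close> is determined by the unit
  ball of \<open>X\<close>; completeness of \<open>V\<close> supplies the limit.\<close>

lemma normal_functional_limit:
  assumes "\<And>e. 0 < e \<Longrightarrow> \<exists>\<kappa>. normal_functional \<kappa> \<and> (\<forall>x\<in>X. cmod (\<phi> x - \<kappa> x) \<le> e * op_norm H x)"
  shows "normal_functional \<phi>"
proof -
  have "\<exists>v\<in>V. \<forall>x\<in>X. cmod (\<phi> x - J x v) \<le> (1/2) * (1/2) ^ k * op_norm H x" for k :: nat
  proof -
    have "(0::real) < (1/2) * (1/2) ^ k" by simp
    from assms[OF this] show ?thesis unfolding normal_functional_def by (elim exE conjE bexE) (auto intro!: bexI)
  qed
  then obtain v where v: "\<And>k. v k \<in> V" "\<And>k x. x \<in> X \<Longrightarrow> cmod (\<phi> x - J x (v k)) \<le> (1/2) * (1/2) ^ k * op_norm H x" by metis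
  define w where "w k = (\<lambda>(_::nat) (_::nat). v k)" for k
  have wm: "w k \<in> mats 1 V" for k using v by (simp add: w_def mats_def)
  have "predual_norm 1 (w k - w (Suc k)) \<le> 1 / 2 ^ k" for k
  proof (rule predual_norm_leI)
    fix y assume y: "y \<in> mats 1 X" "mat_norm H 1 y \<le> 1"
    let ?x = "y 0 0"
    have x: "?x \<in> X" using y by (simp add: mats_def)
    have x1: "op_norm H ?x \<le> 1" using H.op_norm_le_mat_norm[OF matsX[OF y(1)], of 0 0] y(2) by simp
    have small: "c * op_norm H ?x \<le> c" if "0 \<le> c" for c using mult_left_mono[OF x1 that] by simp
    have "pairing 1 y (w k - w (Suc k)) = J ?x (v k) - J ?x (v (Suc k))"
      unfolding pairing_diff_right[OF y(1) wm wm] by (simp add: pairing_def w_def)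
    also have "\<dots> = (\<phi> ?x - J ?x (v (Suc k))) - (\<phi> ?x - J ?x (v k))" by simp
    also have "cmod \<dots> \<le> cmod (\<phi> ?x - J ?x (v (Suc k))) + cmod (\<phi> ?x - J ?x (v k))" by (rule norm_triangle_ineq4)
    also have "\<dots> \<le> (1/2) * (1/2) ^ Suc k + (1/2) * (1/2) ^ k"
      by (rule add_mono[OF order.trans[OF v(2)[OF x] small] order.trans[OF v(2)[OF x] small]]) simp_all
    also have "\<dots> = (3/4) * (1/2) ^ k" by simp
    also have "\<dots> \<le> 1 * (1/2) ^ k" by (rule mult_right_mono) auto
    also have "\<dots> = 1 / 2 ^ k" by (simp add: power_divide)
    finally show "cmod (pairing 1 y (w k - w (Suc k))) \<le> 1 / 2 ^ k" .
  qed
  from predual_norm_complete_geom[OF wm this] obtain u where u: "u \<in> mats 1 V" "\<forall>k. predual_norm 1 (w k - u) \<le> 2 * 1 / 2 ^ k" by blast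
  have uV: "u 0 0 \<in> V" using u(1) by (simp add: mats_def)
  have "\<phi> x = J x (u 0 0)" if x: "x \<in> X" for x
  proof -
    have xb: "x \<in> bounded_ops H" using x Xb by auto
    have "cmod (\<phi> x - J x (u 0 0)) \<le> 0"
    proof (rule LIMSEQ_le_const)
      have "(\<lambda>k. 3 * op_norm H x * (1/2) ^ k) \<longlonglongrightarrow> 3 * op_norm H x * 0" by (intro tendsto_intros) auto
      then show "(\<lambda>k. 3 * op_norm H x * (1/2) ^ k) \<longlonglongrightarrow> 0" by simp
      have "cmod (\<phi> x - J x (u 0 0)) \<le> 3 * op_norm H x * (1/2) ^ k" for k
      proof -
        have d: "w k - u \<in> mats 1 V" by (rule mats_V_diff[OF wm u(1)])
        have "op_norm L ((w k - u) 0 0) \<le> 2 * (1/2) ^ k"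
          using op_norm_le_predual_norm[OF d, of 0 0] u(2)[rule_format, of k] by (simp add: power_divide)
        then have "op_norm H x * op_norm L ((w k - u) 0 0) \<le> op_norm H x * (2 * (1/2) ^ k)"
          by (rule mult_left_mono[OF _ H.op_norm_ge_0[OF xb]])
        moreover have "(w k - u) 0 0 \<in> V" using d by (simp add: mats_def)
        ultimately have 1: "cmod (J x ((w k - u) 0 0)) \<le> op_norm H x * (2 * (1/2) ^ k)" using J_bound[OF x] by fastforce
        have "(w k - u) 0 0 = v k - u 0 0" by (simp add: w_def)
        then have "J x ((w k - u) 0 0) = J x (v k) - J x (u 0 0)"
          using linear_on_diff[OF J_lin[OF x] Vs v(1) uV] by (simp only:)
        then have "\<phi> x - J x (u 0 0) = (\<phi> x - J x (v k)) + J x ((w k - u) 0 0)" by simp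
        then have "cmod (\<phi> x - J x (u 0 0)) \<le> cmod (\<phi> x - J x (v k)) + cmod (J x ((w k - u) 0 0))"
          using norm_triangle_ineq by metis
        moreover have "(1/2) * (1/2) ^ k * op_norm H x \<le> op_norm H x * (1/2) ^ k"
          using H.op_norm_ge_0[OF xb] by simp
        ultimately show ?thesis using 1 v(2)[OF x, of k] by (simp add: algebra_simps)
      qed
      then show "\<exists>N. \<forall>k\<ge>N. cmod (\<phi> x - J x (u 0 0)) \<le> 3 * op_norm H x * (1/2) ^ k" by blast
    qed
    then show ?thesis by simp
  qed
  then show ?thesis unfolding normal_functional_def using uV by blast
qed

text \<open>Finitely many summands give a finite combination of entries of blocks, which are normal; the
  remaining summands contribute little, uniformly on the unit ball.\<close>

lemma Phi_normal:
  assumes f: "f \<in> hcarrier K" and g: "g \<in> hcarrier K"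
  shows "normal_functional (\<lambda>x. hinner K (Phi x f) g)"
proof (rule normal_functional_limit)
  fix e :: real assume e: "0 < e"
  define A where "A = (\<lambda>b. block_sq f b + block_sq g b)"
  have As: "A summable_on blocks" unfolding A_def by (rule summable_on_add[OF K_block_sq[OF f] K_block_sq[OF g]])
  have A0: "0 \<le> A b" for b by (simp add: A_def)
  have lim: "(sum A \<longlongrightarrow> infsum A blocks) (finite_subsets_at_top blocks)"
    using has_sum_infsum[OF As] by (simp add: has_sum_def)
  obtain F where F: "finite F" "F \<subseteq> blocks" and "dist (sum A F) (infsum A blocks) < e"
    using tendstoD[OF lim e] by (auto simp: eventually_finite_subsets_at_top)
  then have tailA: "infsum A blocks - sum A F < e" by (simp add: dist_real_def)
  have sA: "A summable_on (blocks - F)" by (rule summable_on_subset_banach[OF As]) auto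
  have Fblocks: "F \<union> (blocks - F) = blocks" using F by auto
  have "(A has_sum (sum A F + infsum A (blocks - F))) (F \<union> (blocks - F))"
    by (rule has_sum_Un_disjoint[OF has_sum_finite[OF F(1)] has_sum_infsum[OF sA]]) auto
  then have tail: "infsum A (blocks - F) < e" using tailA unfolding Fblocks by (simp add: infsumI)
  let ?\<kappa> = "\<lambda>x. \<Sum>b\<in>F. block_inner (Phi x f) g b"
  have "normal_functional ?\<kappa>"
  proof (rule normal_functional_sum)
    fix b assume "b \<in> F"
    then have b: "b \<in> blocks" using F by auto
    obtain m \<psi> where b': "b = (m, \<psi>)" by (cases b) auto
    have n: "normal_functional (\<lambda>x. \<psi> x i j)" if "i < m" "j < m" for i j
      unfolding normal_functional_def using block_normal[of m \<psi> i j] b that by (simp add: b')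
    have "normal_functional (\<lambda>x. \<Sum>i<m. \<Sum>j<m. \<psi> x i j * (f (m, \<psi>, j) * cnj (g (m, \<psi>, i))))"
      by (intro normal_functional_sum normal_functional_scale n) auto
    then show "normal_functional (\<lambda>x. block_inner (Phi x f) g b)"
      using block_inner_Phi[OF f, of m \<psi>] b by (simp add: b' mult.assoc)
  qed
  moreover have "cmod (hinner K (Phi x f) g - ?\<kappa> x) \<le> e * op_norm H x" if x: "x \<in> X" for x
  proof -
    let ?T = "block_inner (Phi x f) g"
    have xb: "x \<in> bounded_ops H" using x Xb by auto
    have x0: "0 \<le> op_norm H x" by (rule H.op_norm_ge_0[OF xb])
    have m: "(\<lambda>_ _. x) \<in> mats 1 X" using x by (simp add: mats_def)
    have v: "vec K 1 (\<lambda>_. f)" using f by (simp add: vec_def)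
    have Tb: "cmod (?T b) \<le> op_norm H x * A b" if b: "b \<in> blocks" for b
    proof -
      have "cmod (?T b) \<le> op_norm H x * (sqrt (block_sq f b) * sqrt (block_sq g b))"
        using block_inner_Phi_bound[OF m v b, of "\<lambda>_. g"] H.mat_norm_1[OF xb] by (simp add: mult.assoc)
      also have "\<dots> \<le> op_norm H x * A b"
      proof (rule mult_left_mono[OF _ x0])
        have "2 * sqrt (block_sq f b) * sqrt (block_sq g b) \<le> A b"
          using sum_squares_bound[of "sqrt (block_sq f b)" "sqrt (block_sq g b)"] by (simp add: A_def)
        moreover have "0 \<le> sqrt (block_sq f b) * sqrt (block_sq g b)" by simp
        ultimately show "sqrt (block_sq f b) * sqrt (block_sq g b) \<le> A b" by linarith
      qed
      finally show ?thesis .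
    qed
    have s: "(\<lambda>b. op_norm H x * A b) summable_on (blocks - F)" by (rule summable_on_cmult_right[OF sA])
    note T = summable_dominated[OF s, of ?T, OF Tb]
    have Ts: "?T summable_on (blocks - F)" by (rule T(1)) auto
    have "(?T has_sum (sum ?T F + infsum ?T (blocks - F))) (F \<union> (blocks - F))"
      by (rule has_sum_Un_disjoint[OF has_sum_finite[OF F(1)] has_sum_infsum[OF Ts]]) auto
    then have "hinner K (Phi x f) g - ?\<kappa> x = infsum ?T (blocks - F)"
      unfolding Fblocks K_inner by (simp add: infsumI)
    also have "cmod \<dots> \<le> infsum (\<lambda>b. op_norm H x * A b) (blocks - F)" by (rule T(3)) auto
    also have "\<dots> = op_norm H x * infsum A (blocks - F)" by (rule infsum_cmult_right')
    also have "\<dots> \<le> op_norm H x * e" using tail x0 by (intro mult_left_mono) auto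
    finally show ?thesis by (simp add: mult.commute)
  qed
  ultimately show "\<exists>\<kappa>. normal_functional \<kappa> \<and> (\<forall>x\<in>X. cmod (hinner K (Phi x f) g - \<kappa> x) \<le> e * op_norm H x)" by blast
qed

lemma op_norm_Phi_le: "x \<in> X \<Longrightarrow> op_norm K (Phi x) \<le> op_norm H x"
  by (rule K.op_norm_leI) (use H.op_norm_ge_0 Xb Phi_carrier(2) in auto)

lemma trace_normal:
  assumes S: "S \<in> trace_class K"
  shows "normal_functional (\<lambda>x. trace K (Phi x \<circ> S))"
proof (rule normal_functional_limit)
  fix e :: real assume e: "0 < e"
  obtain F where F: "finite F" "F \<subseteq> hcarrier K"
    "\<forall>T\<in>bounded_ops K. cmod (trace K (T \<circ> S) - (\<Sum>f\<in>F. hinner K (T (S f)) f)) \<le> e * op_norm K T"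
    using K.trace_class_approx[OF S e] by (elim exE conjE)
  have Sb: "S \<in> bounded_ops K" using S by (simp add: trace_class_def)
  have "normal_functional (\<lambda>x. \<Sum>f\<in>F. hinner K (Phi x (S f)) f)"
    using F(2) K.bopD(1)[OF Sb] by (intro normal_functional_sum Phi_normal) auto
  moreover have "cmod (trace K (Phi x \<circ> S) - (\<Sum>f\<in>F. hinner K (Phi x (S f)) f)) \<le> e * op_norm H x" if x: "x \<in> X" for x
    using F(3)[rule_format, OF Phi_bop[OF x]] mult_left_mono[OF op_norm_Phi_le[OF x], of e] e by linarith
  ultimately show "\<exists>\<kappa>. normal_functional \<kappa> \<and> (\<forall>x\<in>X. cmod (trace K (Phi x \<circ> S) - \<kappa> x) \<le> e * op_norm H x)" by blast
qed

text \<open>The functional \<open>v\<close> is a multiple of an off-diagonal corner of a normal state of \<open>M\<^sub>2(X)\<close>, hence a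
  form at the two components of the vector that represents the state. The bounds on \<open>\<xi>\<close> and \<open>\<eta>\<close> do
  not depend on \<open>v\<close>, which the proof of closedness relies on. If \<open>H\<close> is zero there are no states, but
  then \<open>J x v\<close> vanishes.\<close>

lemma vector_functional:
  assumes v: "v \<in> V" "op_norm L v \<le> 1"
  shows "\<exists>\<xi> \<eta>. \<xi> \<in> hcarrier K \<and> \<eta> \<in> hcarrier K \<and> hnorm K \<xi> \<le> 4 \<and> hnorm K \<eta> \<le> 1 \<and>
    (\<forall>x\<in>X. J x v = hinner K (Phi x \<xi>) \<eta>)"
proof (cases "\<exists>a\<in>hcarrier H. hnorm H a \<noteq> 0")
  case False
  have "J x v = 0" if x: "x \<in> X" for x
  proof -
    have xb: "x \<in> bounded_ops H" using x Xb by auto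
    have "op_norm H x \<le> 0" by (rule H.op_norm_leI) (use False H.bopD(1)[OF xb] in auto)
    then have "op_norm H x = 0" using H.op_norm_ge_0[OF xb] by simp
    then show ?thesis using J_bound[OF x v(1)] by simp
  qed
  moreover have "hinner K (Phi x 0) 0 = 0" if "x \<in> X" for x
    using K.ip_zero_right[OF Phi_carrier(1)[OF that K.mem_0]] .
  ultimately show ?thesis by (intro exI[of _ 0]) simp
next
  case True
  then obtain a where a: "a \<in> hcarrier H" "hnorm H a \<noteq> 0" by blast
  define a0 where "a0 = complex_of_real (1 / hnorm H a) *\<^sub>C a"
  have a0: "a0 \<in> hcarrier H" unfolding a0_def by (rule H.mem_scale[OF a(1)])
  have "hnorm H a0 = 1" unfolding a0_def using H.nm_scale[OF a(1)] a H.nm_ge_0[OF a(1)] by (simp add: norm_divide)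
  note a0 = a0 this
  obtain w where w: "nstate 2 w" "v = 4 *\<^sub>C w 0 1" using corner_exact[OF v a0] by blast
  define \<zeta>0 where "\<zeta>0 = (\<lambda>i::nat. if i = 0 then a0 else 0)"
  have u: "vec H 2 \<zeta>0" "vnorm H 2 \<zeta>0 = 1" 
    using a0 by (auto simp: vec_def \<zeta>0_def vnorm_def numeral_2_eq_2)
  obtain \<xi> where \<xi>: "vec K 2 \<xi>" "vnorm K 2 \<xi> \<le> 1"
    and rep: "\<forall>y\<in>mats 2 X. pairing 2 y w = mform K 2 (\<lambda>i j. Phi (y i j)) \<xi> \<xi>"
    using state_vectors[OF w(1) u] by blast
  have \<xi>C: "\<xi> 0 \<in> hcarrier K" "\<xi> 1 \<in> hcarrier K" using \<xi>(1) by (auto simp: vec_def)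
  have n: "hnorm K (\<xi> 0) \<le> 1" "hnorm K (\<xi> 1) \<le> 1"
    using K.nm_le_vnorm[of 0 2 \<xi>] K.nm_le_vnorm[of 1 2 \<xi>] \<xi> by auto
  have wV: "w 0 1 \<in> V" using w(1) by (simp add: nstate_def mats_def)
  have "J x v = hinner K (Phi x (4 *\<^sub>C \<xi> 1)) (\<xi> 0)" if x: "x \<in> X" for x
  proof -
    have P0: "Phi 0 f = 0" for f using linear_on_zero[OF Phi_linear Xs] by simp
    have "J x (w 0 1) = pairing 2 (single 0 1 x) w" using pairing_single_left[OF x, of 0 2 1 w] by simp
    also have "\<dots> = mform K 2 (\<lambda>i j. Phi (single 0 1 x i j)) \<xi> \<xi>"
      using rep single_mats[OF Xs x] by blast
    also have "\<dots> = hinner K (Phi x (\<xi> 1)) (\<xi> 0)"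
      unfolding mform_def by (subst sum_single[of 0 2 1]) (use K.ip_zero_left[OF vecD[OF \<xi>(1)]] in \<open>auto simp: single_def P0\<close>)
    finally have "J x v = 4 * hinner K (Phi x (\<xi> 1)) (\<xi> 0)" unfolding w(2) J_v_scale[OF x wV] by simp
    also have "\<dots> = hinner K (Phi x (4 *\<^sub>C \<xi> 1)) (\<xi> 0)"
      unfolding linear_onD(2)[OF K.bopD(3)[OF Phi_bop[OF x]] \<xi>C(2)]
      by (rule K.ip_scale_left[OF Phi_carrier(1)[OF x \<xi>C(2)] \<xi>C(1), symmetric])
    finally show ?thesis .
  qed
  moreover have "hnorm K (4 *\<^sub>C \<xi> 1) \<le> 4" using K.nm_scale[OF \<xi>C(2), of 4] n by simp
  ultimately show ?thesis using \<xi>C n K.mem_scale[OF \<xi>C(2)] by blast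
qed

lemma ex_onb: "\<exists>E. orthonormal_basis K E"
  unfolding K_def using ell2_onb by blast

lemma trace_functional:
  assumes "\<xi> \<in> hcarrier K" "\<eta> \<in> hcarrier K"
  shows "K.rank1 \<xi> \<eta> \<in> trace_class K" "T \<in> bounded_ops K \<Longrightarrow> trace K (T \<circ> K.rank1 \<xi> \<eta>) = hinner K (T \<xi>) \<eta>"
proof -
  obtain E where E: "orthonormal_basis K E" using ex_onb by blast
  show "K.rank1 \<xi> \<eta> \<in> trace_class K" by (rule K.rank1_trace_class[OF assms E])
  show "trace K (T \<circ> K.rank1 \<xi> \<eta>) = hinner K (T \<xi>) \<eta>" if "T \<in> bounded_ops K" by (rule K.trace_rank1[OF assms E that])
qed

lemma ex_trace_functional:
  assumes v: "v \<in> V"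
  shows "\<exists>S\<in>trace_class K. \<forall>x\<in>X. J x v = trace K (Phi x \<circ> S)"
proof -
  have vb: "v \<in> bounded_ops L" using v Vb by auto
  define r where "r = op_norm L v + 1"
  have r: "r > 0" "op_norm L v \<le> r" using op_norm_V_ge_0[OF v] by (auto simp: r_def)
  define v' where "v' = complex_of_real (1 / r) *\<^sub>C v"
  have v': "v' \<in> V" unfolding v'_def by (rule complex_vec.subspace_scale[OF Vs v])
  have "op_norm L v' \<le> 1" unfolding v'_def using L.op_norm_scale[OF vb] r by (simp add: norm_divide)
  from vector_functional[OF v' this] obtain \<xi> \<eta> where c: "\<xi> \<in> hcarrier K" "\<eta> \<in> hcarrier K"
    and e: "\<forall>x\<in>X. J x v' = hinner K (Phi x \<xi>) \<eta>" by (elim exE conjE)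
  define \<xi>' where "\<xi>' = complex_of_real r *\<^sub>C \<xi>"
  have c': "\<xi>' \<in> hcarrier K" unfolding \<xi>'_def by (rule K.mem_scale[OF c(1)])
  have "J x v = trace K (Phi x \<circ> K.rank1 \<xi>' \<eta>)" if x: "x \<in> X" for x
  proof -
    have "J x v = complex_of_real r * J x v'" unfolding v'_def J_v_scale[OF x v] using r by simp
    also have "\<dots> = complex_of_real r * hinner K (Phi x \<xi>) \<eta>" using e x by simp
    also have "\<dots> = hinner K (Phi x \<xi>') \<eta>"
      unfolding \<xi>'_def linear_onD(2)[OF K.bopD(3)[OF Phi_bop[OF x]] c(1)]
      by (rule K.ip_scale_left[OF Phi_carrier(1)[OF x c(1)] c(2), symmetric])
    finally show ?thesis using trace_functional(2)[OF c' c(2) Phi_bop[OF x]] by simp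
  qed
  then show ?thesis using trace_functional(1)[OF c' c(2)] by blast
qed

definition tfuns :: "(('h target \<Rightarrow> 'h target) \<Rightarrow> complex) set" where
  "tfuns = {\<lambda>T. trace K (T \<circ> S) | S. S \<in> trace_class K}"

lemma op_weak_star_eq: "op_weak_star K = initial_topology (bounded_ops K) tfuns"
  by (simp add: op_weak_star_def tfuns_def)

lemma tfuns_ne: "tfuns \<noteq> {}"
  using trace_functional(1)[OF K.mem_0 K.mem_0] by (auto simp: tfuns_def)

lemma topspace_ws: "topspace (op_weak_star K) = bounded_ops K"
  unfolding op_weak_star_eq by (rule topspace_initial_topology[OF tfuns_ne])

lemma openin_ws: "S \<in> trace_class K \<Longrightarrow> open U \<Longrightarrow> openin (op_weak_star K) {T \<in> bounded_ops K. trace K (T \<circ> S) \<in> U}"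
  unfolding op_weak_star_eq by (rule openin_initial_topology[of "\<lambda>T. trace K (T \<circ> S)"]) (auto simp: tfuns_def)

lemma vfuns_ne: "{\<lambda>x. J x v | v. v \<in> V} \<noteq> {}"
  using complex_vec.subspace_0[OF Vs] by auto

lemma topspace_dws: "topspace (dual_weak_star X V J) = X"
  unfolding dual_weak_star_def by (rule topspace_initial_topology[OF vfuns_ne])

lemma openin_dws: "v \<in> V \<Longrightarrow> open U \<Longrightarrow> openin (dual_weak_star X V J) {x \<in> X. J x v \<in> U}"
  unfolding dual_weak_star_def by (rule openin_initial_topology[of "\<lambda>x. J x v"]) auto

lemma Phi_inj: "inj_on Phi X"
  by (rule U.u_inj) (rule H.definite)

text \<open>Both topologies are initial, and under \<open>Phi\<close> the functionals that define them are the same: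
  trace functionals are normal, and every element of \<open>V\<close> is a trace functional.\<close>

theorem Phi_homeomorphic: "homeomorphic_map (dual_weak_star X V J) (subtopology (op_weak_star K) (Phi ` X)) Phi"
proof -
  let ?g = "inv_into X Phi"
  have ig: "?g (Phi x) = x" if "x \<in> X" for x by (rule inv_into_f_f[OF Phi_inj that])
  have sub: "topspace (subtopology (op_weak_star K) (Phi ` X)) = Phi ` X"
    using Phi_bop by (auto simp: topspace_ws)
  have "continuous_map (dual_weak_star X V J) (op_weak_star K) Phi"
    unfolding op_weak_star_eq
  proof (rule continuous_map_initial_topology[OF tfuns_ne])
    fix f and U :: "complex set" assume "f \<in> tfuns" and U: "open U"
    then obtain S where S: "f = (\<lambda>T. trace K (T \<circ> S))" "S \<in> trace_class K" by (auto simp: tfuns_def)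
    obtain v where v: "v \<in> V" "\<forall>x\<in>X. trace K (Phi x \<circ> S) = J x v"
      using trace_normal[OF S(2)] by (auto simp: normal_functional_def)
    have "{x \<in> topspace (dual_weak_star X V J). f (Phi x) \<in> U} = {x \<in> X. J x v \<in> U}"
      unfolding topspace_dws S(1) using v(2) by auto
    then show "openin (dual_weak_star X V J) {x \<in> topspace (dual_weak_star X V J). f (Phi x) \<in> U}"
      using openin_dws[OF v(1) U] by simp
  qed (simp add: topspace_dws Phi_bop)
  then have 1: "continuous_map (dual_weak_star X V J) (subtopology (op_weak_star K) (Phi ` X)) Phi"
    by (simp add: continuous_map_in_subtopology topspace_dws)
  have 2: "continuous_map (subtopology (op_weak_star K) (Phi ` X)) (dual_weak_star X V J) ?g"
    unfolding dual_weak_star_def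
  proof (rule continuous_map_initial_topology[OF vfuns_ne])
    fix f and U :: "complex set" assume "f \<in> {\<lambda>x. J x v | v. v \<in> V}" and U: "open U"
    then obtain v where v: "f = (\<lambda>x. J x v)" "v \<in> V" by blast
    obtain S where S: "S \<in> trace_class K" "\<forall>x\<in>X. J x v = trace K (Phi x \<circ> S)" using ex_trace_functional[OF v(2)] by blast
    have "{y \<in> Phi ` X. f (?g y) \<in> U} = {T \<in> bounded_ops K. trace K (T \<circ> S) \<in> U} \<inter> Phi ` X"
      unfolding v(1) using S(2) ig Phi_bop by auto
    then show "openin (subtopology (op_weak_star K) (Phi ` X)) {y \<in> topspace (subtopology (op_weak_star K) (Phi ` X)). f (?g y) \<in> U}"
      unfolding sub openin_subtopology using openin_ws[OF S(1) U] by blast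
  next
    fix y assume "y \<in> topspace (subtopology (op_weak_star K) (Phi ` X))"
    then show "?g y \<in> X" unfolding sub by (rule inv_into_into)
  qed
  show ?thesis unfolding homeomorphic_map_maps homeomorphic_maps_def
    by (rule exI[of _ ?g]) (use 1 2 ig in \<open>auto simp: sub topspace_dws simp del: topspace_subtopology\<close>)
qed

text \<open>Let \<open>T\<close> be in the closure. Linear relations between trace functionals that hold on the range of
  \<open>Phi\<close> hold at \<open>T\<close>, so \<open>v \<mapsto> tr (T S)\<close>, for any trace class \<open>S\<close> that represents \<open>v\<close>, is a well-defined
  linear functional on \<open>V\<close>; the uniform bounds on representing vectors make it bounded. It is
  therefore some \<open>J x\<close>, and comparing vector functionals shows \<open>T = Phi x\<close>.\<close>

theorem Phi_closed: "closedin (op_weak_star K) (Phi ` X)"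
proof -
  have "T \<in> Phi ` X" if "T \<in> op_weak_star K closure_of (Phi ` X)" for T
  proof -
    have T: "T \<in> bounded_ops K" and cl: "\<And>W. openin (op_weak_star K) W \<Longrightarrow> T \<in> W \<Longrightarrow> \<exists>x\<in>X. Phi x \<in> W"
      using that by (auto simp: in_closure_of topspace_ws)
    have approx: "\<exists>x\<in>X. cmod (trace K (T \<circ> S1) - trace K (Phi x \<circ> S1)) < e \<and> cmod (trace K (T \<circ> S2) - trace K (Phi x \<circ> S2)) < e
        \<and> cmod (trace K (T \<circ> S3) - trace K (Phi x \<circ> S3)) < e"
      if S: "S1 \<in> trace_class K" "S2 \<in> trace_class K" "S3 \<in> trace_class K" and e: "0 < e" for S1 S2 S3 e
    proof -
      let ?W = "\<lambda>S. {T' \<in> bounded_ops K. trace K (T' \<circ> S) \<in> ball (trace K (T \<circ> S)) e}"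
      have o: "openin (op_weak_star K) (?W S1 \<inter> ?W S2 \<inter> ?W S3)"
        by (intro openin_Int openin_ws S) auto
      have "T \<in> ?W S1 \<inter> ?W S2 \<inter> ?W S3" using T e by simp
      from cl[OF o this] obtain x where "x \<in> X" "Phi x \<in> ?W S1 \<inter> ?W S2 \<inter> ?W S3" by blast
      then show ?thesis by (intro bexI[of _ x]) (simp_all add: dist_norm)
    qed
    obtain R where R: "\<And>v. v \<in> V \<Longrightarrow> R v \<in> trace_class K" "\<And>v x. v \<in> V \<Longrightarrow> x \<in> X \<Longrightarrow> J x v = trace K (Phi x \<circ> R v)"
      using ex_trace_functional by metis
    define h where "h v = (if v \<in> V then trace K (T \<circ> R v) else 0)" for v
    have hV: "h v = trace K (T \<circ> R v)" if "v \<in> V" for v using that by (simp add: h_def)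
    \<comment> \<open>The value at \<open>T\<close> depends only on the functional on \<open>X\<close>, not on the operator that represents it.\<close>
    have indep: "trace K (T \<circ> S) = h v" if S: "S \<in> trace_class K" and v: "v \<in> V" and eq: "\<And>x. x \<in> X \<Longrightarrow> J x v = trace K (Phi x \<circ> S)" for S v
    proof -
      have "cmod (trace K (T \<circ> S) - h v) \<le> 0"
      proof (rule field_le_epsilon)
        fix e :: real assume e: "0 < e"
        then have "0 < e/2" by simp
        from approx[OF S R(1)[OF v] S this] obtain x where x: "x \<in> X" "cmod (trace K (T \<circ> S) - trace K (Phi x \<circ> S)) < e/2"
          "cmod (trace K (T \<circ> R v) - trace K (Phi x \<circ> R v)) < e/2" by blast
        define p q where "p = trace K (T \<circ> S) - trace K (Phi x \<circ> S)" and "q = trace K (T \<circ> R v) - trace K (Phi x \<circ> R v)"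
        have pq: "cmod p < e/2" "cmod q < e/2" unfolding p_def q_def by (rule x(2), rule x(3))
        have eqn: "trace K (T \<circ> S) - h v = p - q"
          unfolding p_def q_def eq[OF x(1), symmetric] R(2)[OF v x(1), symmetric] by (simp add: h_def v)
        show "cmod (trace K (T \<circ> S) - h v) \<le> 0 + e"
          unfolding eqn using norm_triangle_ineq4[of p q] pq by linarith
      qed
      then show ?thesis by simp
    qed
    have hadd: "h (v + w) = h v + h w" if v: "v \<in> V" and w: "w \<in> V" for v w
    proof -
      have vw: "v + w \<in> V" by (rule complex_vec.subspace_add[OF Vs v w])
      have "cmod (h (v + w) - (h v + h w)) \<le> 0"
      proof (rule field_le_epsilon)
        fix e :: real assume e: "0 < e"
        then have "0 < e/3" by simp
        from approx[OF R(1)[OF v] R(1)[OF w] R(1)[OF vw] this] obtain x where x0: "x \<in> X"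
          "cmod (trace K (T \<circ> R v) - trace K (Phi x \<circ> R v)) < e/3" "cmod (trace K (T \<circ> R w) - trace K (Phi x \<circ> R w)) < e/3"
          "cmod (trace K (T \<circ> R (v + w)) - trace K (Phi x \<circ> R (v + w))) < e/3" by blast
        note x = x0(1) x0(2)[folded R(2)[OF v x0(1)] hV[OF v]] x0(3)[folded R(2)[OF w x0(1)] hV[OF w]]
          x0(4)[folded R(2)[OF vw x0(1)] hV[OF vw]]
        define p q r where "p = h (v + w) - J x (v + w)" and "q = h v - J x v" and "r = h w - J x w"
        have pqr: "cmod p < e/3" "cmod q < e/3" "cmod r < e/3" unfolding p_def q_def r_def by (rule x(4), rule x(2), rule x(3))
        have eqn: "h (v + w) - (h v + h w) = p - (q + r)"
          unfolding p_def q_def r_def J_v_add[OF x(1) v w] by simp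
        show "cmod (h (v + w) - (h v + h w)) \<le> 0 + e"
          unfolding eqn using norm_triangle_ineq4[of p "q + r"] norm_triangle_ineq[of q r] pqr by linarith
      qed
      then show ?thesis by simp
    qed
    have hsc: "h (c *\<^sub>C v) = c * h v" if v: "v \<in> V" for c v
    proof -
      have cv: "c *\<^sub>C v \<in> V" by (rule complex_vec.subspace_scale[OF Vs v])
      have "cmod (h (c *\<^sub>C v) - c * h v) \<le> 0"
      proof (rule field_le_epsilon)
        fix e :: real assume e: "0 < e"
        define d where "d = e / (1 + cmod c)"
        have cp: "0 < 1 + cmod c" by (simp add: add_pos_nonneg)
        have "d + cmod c * d = (1 + cmod c) * d" by (simp add: distrib_right)
        then have d: "0 < d" "d + cmod c * d = e" using e cp by (simp_all add: d_def)
        from approx[OF R(1)[OF v] R(1)[OF cv] R(1)[OF cv] d(1)] obtain x where x0: "x \<in> X"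
          "cmod (trace K (T \<circ> R v) - trace K (Phi x \<circ> R v)) < d"
          "cmod (trace K (T \<circ> R (c *\<^sub>C v)) - trace K (Phi x \<circ> R (c *\<^sub>C v))) < d" by blast
        note x = x0(1) x0(2)[folded R(2)[OF v x0(1)] hV[OF v]] x0(3)[folded R(2)[OF cv x0(1)] hV[OF cv]]
        define p q where "p = h (c *\<^sub>C v) - J x (c *\<^sub>C v)" and "q = h v - J x v"
        have pq: "cmod p < d" "cmod q < d" unfolding p_def q_def by (rule x(3), rule x(2))
        have eqn: "h (c *\<^sub>C v) - c * h v = p - c * q"
          unfolding p_def q_def J_v_scale[OF x(1) v] by (simp add: algebra_simps)
        have "cmod (c * q) \<le> cmod c * d" unfolding norm_mult by (rule mult_left_mono[OF less_imp_le[OF pq(2)] norm_ge_zero])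
        then show "cmod (h (c *\<^sub>C v) - c * h v) \<le> 0 + e"
          unfolding eqn using norm_triangle_ineq4[of p "c * q"] pq(1) d(2) by linarith
      qed
      then show ?thesis by simp
    qed
    have T0: "0 \<le> op_norm K T" by (rule K.op_norm_ge_0[OF T])
    have h1: "cmod (h v) \<le> op_norm K T * 4" if v: "v \<in> V" "op_norm L v \<le> 1" for v
    proof -
      obtain \<xi> \<eta> where c: "\<xi> \<in> hcarrier K" "\<eta> \<in> hcarrier K" "hnorm K \<xi> \<le> 4" "hnorm K \<eta> \<le> 1"
        "\<forall>x\<in>X. J x v = hinner K (Phi x \<xi>) \<eta>" using vector_functional[OF v] by (elim exE conjE)
      have "h v = trace K (T \<circ> K.rank1 \<xi> \<eta>)"
        by (rule indep[symmetric, OF trace_functional(1)[OF c(1,2)] v(1)])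
          (use c(5) trace_functional(2)[OF c(1,2) Phi_bop] in simp)
      also have "\<dots> = hinner K (T \<xi>) \<eta>" by (rule trace_functional(2)[OF c(1,2) T])
      also have "cmod \<dots> \<le> op_norm K T * hnorm K \<xi> * hnorm K \<eta>" by (rule K.op_form_bound[OF T c(1,2)])
      also have "\<dots> \<le> op_norm K T * 4 * 1" using T0 c K.nm_ge_0 by (intro mult_mono mult_nonneg_nonneg) auto
      finally show ?thesis by simp
    qed
    have hb: "cmod (h v) \<le> (op_norm K T * 4) * op_norm L v" if v: "v \<in> V" for v
    proof (rule field_le_epsilon)
      fix e :: real assume e: "0 < e"
      have vb: "v \<in> bounded_ops L" using v Vb by auto
      define C where "C = op_norm K T * 4"
      have C: "0 \<le> C" using T0 by (simp add: C_def)
      define r where "r = op_norm L v + e / (C + 1)"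
      have ec: "0 < e / (C + 1)" using e C by simp
      have r: "r > 0" "op_norm L v \<le> r" using op_norm_V_ge_0[OF v] ec by (auto simp: r_def)
      let ?v = "complex_of_real (1 / r) *\<^sub>C v"
      have "op_norm L ?v \<le> 1" using L.op_norm_scale[OF vb] r by (simp add: norm_divide)
      from h1[OF complex_vec.subspace_scale[OF Vs v] this] have "cmod (h v) / r \<le> C"
        unfolding hsc[OF v] C_def using r by (simp add: norm_mult norm_divide)
      then have "cmod (h v) \<le> C * r" using r by (simp add: field_simps)
      also have "\<dots> = C * op_norm L v + e * (C / (C + 1))" by (simp add: r_def algebra_simps)
      also have "e * (C / (C + 1)) \<le> e * 1" using e C by (intro mult_left_mono) (auto simp: divide_le_eq_1)
      finally show "cmod (h v) \<le> (op_norm K T * 4) * op_norm L v + e" by (simp add: C_def)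
    qed
    have "h \<in> dual_space L V" unfolding dual_space_def mem_Collect_eq
    proof (intro conjI)
      show "linear_on V h" using hadd hsc by (simp add: linear_on_def scaleC_complex_def)
      show "\<exists>M. \<forall>v\<in>V. cmod (h v) \<le> M * op_norm L v" using hb by blast
      show "\<forall>v. v \<notin> V \<longrightarrow> h v = 0" by (simp add: h_def)
    qed
    from J_surj[OF this] obtain x0 where x0: "x0 \<in> X" "J x0 = h" by blast
    have Px: "Phi x0 \<in> bounded_ops K" by (rule Phi_bop[OF x0(1)])
    have "T = Phi x0"
    proof (rule K.bop_eqI[OF T Px])
      fix a assume a: "a \<in> hcarrier K"
      have m: "T a \<in> hcarrier K" "Phi x0 a \<in> hcarrier K" using K.bopD(1)[OF T a] K.bopD(1)[OF Px a] .
      have eq: "hinner K (T a) b = hinner K (Phi x0 a) b" if b: "b \<in> hcarrier K" for b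
      proof -
        obtain v where v: "v \<in> V" "\<forall>x\<in>X. hinner K (Phi x a) b = J x v"
          using Phi_normal[OF a b] unfolding normal_functional_def by blast
        have "hinner K (T a) b = trace K (T \<circ> K.rank1 a b)" by (rule trace_functional(2)[OF a b T, symmetric])
        also have "\<dots> = h v"
          by (rule indep[OF trace_functional(1)[OF a b] v(1)]) (use v(2) trace_functional(2)[OF a b Phi_bop] in simp)
        also have "\<dots> = hinner K (Phi x0 a) b" using v(2) x0 by simp
        finally show ?thesis .
      qed
      have "hinner K (T a - Phi x0 a) (T a - Phi x0 a) = 0"
        unfolding K.ip_diff_left[OF m K.mem_diff[OF m]] eq[OF K.mem_diff[OF m]] by simp
      from K.definite[OF K.mem_diff[OF m] this] show "T a = Phi x0 a" by simp
    qed
    then show ?thesis using x0(1) by blast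
  qed
  moreover have "Phi ` X \<subseteq> topspace (op_weak_star K)" using Phi_bop by (auto simp: topspace_ws)
  ultimately show ?thesis using closure_of_subset_eq[of "Phi ` X" "op_weak_star K"] by blast
qed

end

theorem theorem1p1:
  fixes H :: "'h::complex_vector hilb" and X :: "('h \<Rightarrow> 'h) set"
    and L :: "'l::complex_vector hilb" and V :: "('l \<Rightarrow> 'l) set"
    and J :: "('h \<Rightarrow> 'h) \<Rightarrow> ('l \<Rightarrow> 'l) \<Rightarrow> complex"
  assumes "hilbert_space H" and "operator_system H X"
    and "hilbert_space L" and "operator_space L V"
    and "dual_identification H X L V J"
  shows "\<exists>(K :: 'h target hilb) (\<Phi> :: ('h \<Rightarrow> 'h) \<Rightarrow> 'h target \<Rightarrow> 'h target).
    hilbert_space K \<and>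
    operator_system K (\<Phi> ` X) \<and>
    closedin (op_weak_star K) (\<Phi> ` X) \<and>
    completely_isometric H X K \<Phi> \<and>
    homeomorphic_map (dual_weak_star X V J) (subtopology (op_weak_star K) (\<Phi> ` X)) \<Phi> \<and>
    \<Phi> (id_op H) = id_op K \<and>
    complete_order_isomorphism H X K (\<Phi> ` X) \<Phi>"
proof -
  interpret D: dual_system H X L V J by (rule dual_system.intro[OF assms])
  have "hilbert_space D.K" unfolding D.K_def by (rule ell2_hilbert)
  moreover have "complete_order_isomorphism H X D.K (D.Phi ` X) D.Phi"
    by (rule D.U.u_order_iso) (rule D.H.definite)
  ultimately show ?thesis
    using D.U.u_operator_system[OF assms(2)] D.Phi_closed D.Phi_ci D.Phi_homeomorphic D.Phi_unital
    by (intro exI[of _ D.K] exI[of _ D.Phi] conjI)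
qed

end
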